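(* If $\alpha>0$, $1\le p\le\infty$, and $0<q\le\infty$, then $B^{\alpha q}_p=A^{\alpha/2,\,q}_p$ with equivalent norms, where $B^{\alpha q}_p=B^{\alpha q}_p(H)$ is the Hermite–Besov space and $A^{\alpha/2,\,q}_p$ is the approximation space generated by best $L^p$-approximation from linear combinations of Hermite functions.
   Context: Hermite functions and kernels: $H_n(t)=(-1)^n e^{t^2}(\frac{d}{dt})^n e^{-t^2}$, $h_n(t)=(2^n n!\sqrt\pi)^{-1/2}H_n(t)e^{-t^2/2}$, $\mathcal{H}_\beta(x)=h_{\beta_1}(x_1)\cdots h_{\beta_d}(x_d)$ for $\beta\in\mathbb{N}_0^d$, $x\in\mathbb{R}^d$, and $\mathcal{H}_\nu(x,y)=\sum_{|\beta|=\nu}\mathcal{H}_\beta(x)\mathcal{H}_\beta(y)$, with $|\beta|=\beta_1+\dots+\beta_d$. $V_n:=\operatorname{span}\{\mathcal{H}_\beta:|\beta|\le n\}$. Hermite–Besov space: for tempered distributions $f\in\mathcal{S}'$ put $\langle f,\phi\rangle:=f(\overline\phi)$, and for a kernel $\Phi$ with $\Phi(x,\cdot)\in\mathcal{S}$ put $\Phi*f(x):=\langle f,\overline{\Phi(x,\cdot)}\rangle$. Let $\widehat a\in C^\infty[0,\infty)$, $\operatorname{supp}\widehat a\subset[1/4,4]$, $|\widehat a(t)|>c>0$ for $t\in[1/3,3]$; set $\Phi_0:=\mathcal{H}_0(\cdot,\cdot)$ and $\Phi_j:=\sum_{\nu=0}^\infty\widehat a(\nu/4^{j-1})\mathcal{H}_\nu(\cdot,\cdot)$,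 $j\ge1$. $B^{\alpha q}_p(H)$ is the set of all $f\in\mathcal{S}'$ with $$\|f\|_{B^{\alpha q}_p}:=\Big(\sum_{j=0}^\infty\big(2^{\alpha j}\|\Phi_j*f\|_{L^p(\mathbb{R}^d)}\big)^q\Big)^{1/q}<\infty$$ (sup norm in place of the $\ell^q$-norm if $q=\infty$). Different choices of $\widehat a$ give equivalent quasi-norms. Approximation space: for $f\in L^p(\mathbb{R}^d)$, $E_n(f)_p:=\inf_{g\in V_n}\|f-g\|_{L^p(\mathbb{R}^d)}$, and $A^{\alpha q}_p$ is the space of all $f\in L^p(\mathbb{R}^d)$ for which $$\|f\|_{A^{\alpha q}_p}:=\|f\|_{L^p(\mathbb{R}^d)}+\Big(\sum_{j=0}^\infty(2^{\alpha j}E_{2^j}(f)_p)^q\Big)^{1/q}<\infty$$ with the usual modification when $q=\infty$. *)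

theory Defs
  imports "HOL-Analysis.Analysis" "HOL-Probability.Essential_Supremum"
begin

section \<open>Hermite functions and kernels\<close>

definition hermite_poly :: "nat \<Rightarrow> real \<Rightarrow> real" where
  "hermite_poly n t = (-1) ^ n * exp (t\<^sup>2) * (deriv ^^ n) (\<lambda>s. exp (- s\<^sup>2)) t"

definition hermite_fun1 :: "nat \<Rightarrow> real \<Rightarrow> real" where
  "hermite_fun1 n t =
     (2 ^ n * fact n * sqrt pi) powr (- 1 / 2) * hermite_poly n t * exp (- t\<^sup>2 / 2)"

definition hermite_fun :: "('d::finite \<Rightarrow> nat) \<Rightarrow> real ^ 'd \<Rightarrow> real" where
  "hermite_fun \<beta> x = (\<Prod>i\<in>UNIV. hermite_fun1 (\<beta> i) (x $ i))"

abbreviation multi_deg :: "('d::finite \<Rightarrow> nat) \<Rightarrow> nat" where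
  "multi_deg \<beta> \<equiv> \<Sum>i\<in>UNIV. \<beta> i"

definition hermite_kernel :: "nat \<Rightarrow> real ^ 'd::finite \<Rightarrow> real ^ 'd \<Rightarrow> real" where
  "hermite_kernel \<nu> x y = (\<Sum>\<beta> | multi_deg \<beta> = \<nu>. hermite_fun \<beta> x * hermite_fun \<beta> y)"

text \<open>The complex span of the Hermite functions of degree at most \<open>n\<close>.\<close>

definition hermite_space :: "nat \<Rightarrow> (real ^ 'd::finite \<Rightarrow> complex) set" where
  "hermite_space n =
     {\<lambda>x. \<Sum>\<beta> | multi_deg \<beta> \<le> n. c \<beta> * complex_of_real (hermite_fun \<beta> x) | c. True}"

section \<open>Schwartz functions and tempered distributions\<close>

definition partial_deriv :: "'d::finite \<Rightarrow> (real ^ 'd \<Rightarrow> complex) \<Rightarrow> real ^ 'd \<Rightarrow> complex" where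
  "partial_deriv i \<phi> x = vector_derivative (\<lambda>t. \<phi> (x + t *\<^sub>R axis i 1)) (at 0)"

text \<open>Higher partial derivatives are indexed by the list of the successive directions of
  differentiation; on smooth functions the order is immaterial, so this is the usual family of
  derivatives indexed by multi-indices.\<close>

definition partial_derivs :: "'d::finite list \<Rightarrow> (real ^ 'd \<Rightarrow> complex) \<Rightarrow> real ^ 'd \<Rightarrow> complex" where
  "partial_derivs w \<phi> = foldr partial_deriv w \<phi>"

definition schwartz_weight ::
  "('d::finite \<Rightarrow> nat) \<Rightarrow> 'd list \<Rightarrow> (real ^ 'd \<Rightarrow> complex) \<Rightarrow> real ^ 'd \<Rightarrow> real" where
  "schwartz_weight \<gamma> w \<phi> x = \<bar>\<Prod>i\<in>UNIV. (x $ i) ^ \<gamma> i\<bar> * norm (partial_derivs w \<phi> x)"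

definition schwartz :: "(real ^ 'd::finite \<Rightarrow> complex) set" where
  "schwartz =
     {\<phi>. (\<forall>w x. partial_derivs w \<phi> differentiable (at x)) \<and>
         (\<forall>\<gamma> w. bdd_above (range (schwartz_weight \<gamma> w \<phi>)))}"

definition schwartz_seminorm ::
  "('d::finite \<Rightarrow> nat) \<Rightarrow> 'd list \<Rightarrow> (real ^ 'd \<Rightarrow> complex) \<Rightarrow> real" where
  "schwartz_seminorm \<gamma> w \<phi> = (SUP x. schwartz_weight \<gamma> w \<phi> x)"

definition schwartz_topology :: "(real ^ 'd::finite \<Rightarrow> complex) topology" where
  "schwartz_topology = topology_generated_by
     {{\<psi> \<in> schwartz. schwartz_seminorm \<gamma> w (\<lambda>x. \<psi> x - \<phi> x) < \<epsilon>} | \<gamma> w \<phi> \<epsilon>. \<phi> \<in> schwartz \<and> 0 < \<epsilon>}"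

text \<open>Functionals are made extensional, so that two distributions are equal as HOL functions
  iff they agree on all Schwartz functions.\<close>

definition tempered :: "((real ^ 'd::finite \<Rightarrow> complex) \<Rightarrow> complex) set" where
  "tempered =
     {f \<in> extensional schwartz.
        (\<forall>\<phi>\<in>schwartz. \<forall>\<psi>\<in>schwartz. f (\<lambda>x. \<phi> x + \<psi> x) = f \<phi> + f \<psi>) \<and>
        (\<forall>c. \<forall>\<phi>\<in>schwartz. f (\<lambda>x. c * \<phi> x) = c * f \<phi>) \<and>
        continuous_map schwartz_topology euclidean f}"

definition dist_pair ::
  "((real ^ 'd::finite \<Rightarrow> complex) \<Rightarrow> complex) \<Rightarrow> (real ^ 'd \<Rightarrow> complex) \<Rightarrow> complex" where
  "dist_pair f \<phi> = f (\<lambda>y. cnj (\<phi> y))"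

definition kernel_apply ::
  "(real ^ 'd::finite \<Rightarrow> real ^ 'd \<Rightarrow> complex) \<Rightarrow> ((real ^ 'd \<Rightarrow> complex) \<Rightarrow> complex) \<Rightarrow>
   real ^ 'd \<Rightarrow> complex" where
  "kernel_apply \<Phi> f x = dist_pair f (\<lambda>y. cnj (\<Phi> x y))"

text \<open>The tempered distribution given by integration against an \<open>L\<^sup>p\<close> function.\<close>

definition dist_of_fun ::
  "(real ^ 'd::finite \<Rightarrow> complex) \<Rightarrow> (real ^ 'd \<Rightarrow> complex) \<Rightarrow> complex" where
  "dist_of_fun F = (\<lambda>\<phi>\<in>schwartz. \<integral>x. F x * \<phi> x \<partial>lborel)"

section \<open>Extended-valued \<open>L\<^sup>p\<close> and \<open>l\<^sup>q\<close> (quasi-)norms\<close>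

text \<open>The power is only used with a positive exponent \<open>r\<close>.\<close>

definition ennpowr :: "ennreal \<Rightarrow> real \<Rightarrow> ennreal" where
  "ennpowr x r = (if x = \<infinity> then \<infinity> else ennreal (enn2real x powr r))"

definition lp_norm :: "ennreal \<Rightarrow> (real ^ 'd::finite \<Rightarrow> complex) \<Rightarrow> ennreal" where
  "lp_norm p F =
     (if p = \<infinity> then esssup lborel (\<lambda>x. ennreal (norm (F x)))
      else ennpowr (\<integral>\<^sup>+x. ennreal (norm (F x) powr enn2real p) \<partial>lborel) (1 / enn2real p))"

definition lq_norm :: "ennreal \<Rightarrow> (nat \<Rightarrow> ennreal) \<Rightarrow> ennreal" where
  "lq_norm q s =
     (if q = \<infinity> then (SUP j. s j)
      else ennpowr (\<Sum>j. ennpowr (s j) (enn2real q)) (1 / enn2real q))"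

text \<open>Functions rather than classes modulo null sets; every class of Lebesgue measurable functions
  has a Borel measurable representative.\<close>

definition lp_space :: "ennreal \<Rightarrow> (real ^ 'd::finite \<Rightarrow> complex) set" where
  "lp_space p = {F \<in> borel_measurable lborel. lp_norm p F < \<infinity>}"

section \<open>Hermite--Besov spaces\<close>

text \<open>Only the values of \<open>a\<close> on \<open>[0,\<infinity>)\<close> matter; derivatives at \<open>0\<close> are one-sided.\<close>

definition admissible_cutoff :: "(real \<Rightarrow> complex) \<Rightarrow> bool" where
  "admissible_cutoff a \<longleftrightarrow>
     (\<exists>D. D 0 = a \<and>
        (\<forall>n::nat. \<forall>t\<ge>0. (D n has_vector_derivative D (Suc n) t) (at t within {0..}))) \<and>
     closure {t. 0 \<le> t \<and> a t \<noteq> 0} \<subseteq> {1/4..4} \<and>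
     (\<exists>c>0. \<forall>t\<in>{1/3..3}. norm (a t) > c)"

definition besov_kernel ::
  "(real \<Rightarrow> complex) \<Rightarrow> nat \<Rightarrow> real ^ 'd::finite \<Rightarrow> real ^ 'd \<Rightarrow> complex" where
  "besov_kernel a j x y =
     (if j = 0 then complex_of_real (hermite_kernel 0 x y)
      else (\<Sum>\<nu>. a (real \<nu> / 4 ^ (j - 1)) * complex_of_real (hermite_kernel \<nu> x y)))"

definition besov_norm ::
  "(real \<Rightarrow> complex) \<Rightarrow> real \<Rightarrow> ennreal \<Rightarrow> ennreal \<Rightarrow>
   ((real ^ 'd::finite \<Rightarrow> complex) \<Rightarrow> complex) \<Rightarrow> ennreal" where
  "besov_norm a \<alpha> p q f =
     lq_norm q (\<lambda>j. ennreal (2 powr (\<alpha> * real j)) * lp_norm p (kernel_apply (besov_kernel a j) f))"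

definition besov_space ::
  "(real \<Rightarrow> complex) \<Rightarrow> real \<Rightarrow> ennreal \<Rightarrow> ennreal \<Rightarrow>
   ((real ^ 'd::finite \<Rightarrow> complex) \<Rightarrow> complex) set" where
  "besov_space a \<alpha> p q = {f \<in> tempered. besov_norm a \<alpha> p q f < \<infinity>}"

section \<open>Approximation spaces\<close>

definition best_approx :: "ennreal \<Rightarrow> nat \<Rightarrow> (real ^ 'd::finite \<Rightarrow> complex) \<Rightarrow> ennreal" where
  "best_approx p n F = (INF G\<in>hermite_space n. lp_norm p (\<lambda>x. F x - G x))"

definition approx_norm ::
  "real \<Rightarrow> ennreal \<Rightarrow> ennreal \<Rightarrow> (real ^ 'd::finite \<Rightarrow> complex) \<Rightarrow> ennreal" where
  "approx_norm \<alpha> p q F =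
     lp_norm p F + lq_norm q (\<lambda>j. ennreal (2 powr (\<alpha> * real j)) * best_approx p (2 ^ j) F)"

definition approx_space ::
  "real \<Rightarrow> ennreal \<Rightarrow> ennreal \<Rightarrow> (real ^ 'd::finite \<Rightarrow> complex) set" where
  "approx_space \<alpha> p q = {F \<in> lp_space p. approx_norm \<alpha> p q F < \<infinity>}"

end

theory Submission
  imports Defs "HOL-Probability.Probability"
begin

text \<open>
  Mehler's formula, continued to complex parameters \<open>r\<close> with \<open>\<bar>r\<bar> < 1\<close>, gives Gaussian bounds for
  \<open>\<Sum>\<nu>. r ^ \<nu> * hermite_kernel \<nu> x y\<close>. A spectral multiplier \<open>m (\<nu> / n)\<close> with a smooth compactly
  supported symbol is recovered from this generating function by a Fourier integral over the circle
  \<open>\<bar>r\<bar> = exp (- 1 / n)\<close>, whose weight decays rapidly away from the positive axis by summation by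
  parts. Hence the kernels of these multipliers have uniformly bounded row and column integrals, and
  Schur's test bounds them on every \<open>L\<^sup>p\<close> uniformly in the dilation.

  The direct estimate follows because the \<open>j\<close>-th Littlewood--Paley piece annihilates
  \<open>hermite_space (4 ^ (j - 3))\<close>. For the inverse estimate, the cut-off has a smooth dual symbol with
  \<open>\<Sum>j. dual_symbol a (\<nu> / 4 ^ j) * a (\<nu> / 4 ^ j) = 1\<close> (Calderon's formula). Thus a distribution with
  finite Besov norm is the \<open>L\<^sup>p\<close>-convergent sum of elements of the Hermite spaces whose partial
  sums are competitors for the best approximation, and a discrete Hardy inequality sums the tails.
  A tempered distribution is determined by its Hermite coefficients, which identifies the sum with it.
\<close>

section \<open>Hermite functions on the line\<close>

text \<open>At the end points orthogonality gives nothing, and for \<open>p = \<infinity>\<close>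
  the Hermite functions are not dense; so all norm bounds go through absolute kernel estimates, and
  uniqueness of coefficients goes through positivity of the real Mehler kernel. The choice of radius
  is a balance. At \<open>r = \<rho> cis \<theta>\<close> the row integral of Mehler's kernel is at
  most a multiple of \<open>(|1 - r| / (1 - |r|)) ^ d\<close>, hence polynomial of degree
  \<open>d\<close> in \<open>1 + n |cis \<theta> - 1|\<close>. Therefore \<open>d + 2\<close>
  summations by parts suffice: \<open>d\<close> powers absorb this growth and two make the integral
  over \<open>\<theta>\<close> converge uniformly in \<open>n\<close>. Undoing
  \<open>\<rho> ^ \<nu>\<close> multiplies the symbol by \<open>exp t\<close>, harmless on a compact
  support. The smoothness index is halved because level \<open>j\<close> lives on degrees about
  \<open>4 ^ j\<close> while the approximation norm samples degrees \<open>2 ^ i\<close>, so that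
  \<open>j\<close> corresponds to \<open>i div 2\<close>. For \<open>q < 1\<close> there is only a
  quasi-norm; termwise bounds with geometric weights take the place of the triangle
  inequality.\<close>

fun herm :: "nat \<Rightarrow> real \<Rightarrow> real" where
  "herm 0 t = 1"
| "herm (Suc 0) t = 2 * t"
| "herm (Suc (Suc n)) t = 2 * t * herm (Suc n) t - 2 * real (Suc n) * herm n t"

text \<open>At \<open>n = 0\<close> the truncated \<open>n - 1\<close> is harmless since its
  coefficient is zero. The later ladder formulas, also those with
  \<open>\<beta>(i := \<beta> i - 1)\<close>, rely on the same convention.\<close>

lemma herm_Suc: "herm (Suc n) t = 2 * t * herm n t - 2 * real n * herm (n - 1) t"
  by (cases n) auto

lemma herm_deriv: "(herm n has_real_derivative 2 * real n * herm (n - 1) t) (at t)"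
proof (induction n t rule: herm.induct)
  case (1 t)
  have "herm 0 = (\<lambda>t. 1)" by auto
  then show ?case by (auto intro!: derivative_eq_intros)
next
  case (2 t)
  have "herm (Suc 0) = (\<lambda>t. 2 * t)" by auto
  then show ?case by (auto intro!: derivative_eq_intros)
next
  case (3 n t)
  have *: "herm (Suc (Suc n)) = (\<lambda>t. 2 * t * herm (Suc n) t - 2 * real (Suc n) * herm n t)" by auto
  show ?case unfolding *
    by (rule derivative_eq_intros 3 refl)+ (simp add: herm_Suc[of n] algebra_simps)
qed

text \<open>Differentiating \<open>herm n t * exp (- t\<^sup>2)\<close> produces the factor
  \<open>2 n herm (n - 1) t - 2 t herm n t\<close>, which is minus the recurrence for
  \<open>herm (Suc n) t\<close>.\<close>

lemma deriv_funpow_gaussian: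
  "(deriv ^^ n) (\<lambda>s. exp (- s\<^sup>2)) = (\<lambda>t::real. (-1) ^ n * herm n t * exp (- t\<^sup>2))"
proof (induction n)
  case (Suc n)
  have "((\<lambda>t. (-1) ^ n * herm n t * exp (- t\<^sup>2)) has_real_derivative
        ((-1) ^ Suc n * herm (Suc n) t * exp (- t\<^sup>2))) (at t)" for t :: real
    by (auto intro!: derivative_eq_intros herm_deriv simp: herm_Suc[of n] algebra_simps)
  then show ?case by (auto simp: Suc DERIV_imp_deriv)
qed auto

lemma hermite_poly_eq_herm: "hermite_poly n t = herm n t"
proof -
  have "(-1) ^ n * (-1) ^ n = (1::real)" by (simp flip: power_mult_distrib)
  moreover have "exp (t\<^sup>2) * exp (- t\<^sup>2) = 1" by (simp flip: exp_add)
  moreover have "(-1) ^ n * exp (t\<^sup>2) * ((-1) ^ n * herm n t * exp (- t\<^sup>2))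
      = ((-1) ^ n * (-1) ^ n) * (exp (t\<^sup>2) * exp (- t\<^sup>2)) * herm n t"
    by (simp only: mult_ac)
  ultimately have "(-1) ^ n * exp (t\<^sup>2) * ((-1) ^ n * herm n t * exp (- t\<^sup>2)) = herm n t"
    by simp
  then show ?thesis unfolding hermite_poly_def deriv_funpow_gaussian .
qed

definition hermite_const :: "nat \<Rightarrow> real" where
  "hermite_const n = (2 ^ n * fact n * sqrt pi) powr (- 1 / 2)"

lemma hermite_const_pos: "hermite_const n > 0"
  unfolding hermite_const_def by simp

lemma hermite_const_square: "hermite_const n ^ 2 = 1 / (2 ^ n * fact n * sqrt pi)"
proof -
  have "(x powr (-1/2))^2 = 1 / x" if "x > 0" for x :: real
  proof -
    have "(x powr (-1/2))^2 = x powr (-1/2 + -1/2)" unfolding power2_eq_square by (rule powr_add[symmetric])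
    then show ?thesis using that by (simp add: powr_minus_divide)
  qed
  then show ?thesis unfolding hermite_const_def by simp
qed

lemma hermite_const_Suc: "sqrt (2 * real (Suc n)) * hermite_const (Suc n) = hermite_const n"
proof (rule power2_eq_imp_eq)
  show "(sqrt (2 * real (Suc n)) * hermite_const (Suc n))\<^sup>2 = (hermite_const n)\<^sup>2"
    unfolding power_mult_distrib hermite_const_square
    by (simp add: field_simps del: of_nat_Suc)
qed (use hermite_const_pos[of n] hermite_const_pos[of "Suc n"] in auto)

lemma hermite_fun1_eq: "hermite_fun1 n t = hermite_const n * herm n t * exp (- t\<^sup>2 / 2)"
  by (simp add: hermite_fun1_def hermite_const_def hermite_poly_eq_herm)

lemma two_n_hermite_const:
  "2 * real n * hermite_const n = sqrt (2 * real n) * hermite_const (n - 1)"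
proof (cases n)
  case (Suc m)
  have "2 * real n * hermite_const n = sqrt (2 * real n) * (sqrt (2 * real n) * hermite_const n)"
    by (simp flip: mult.assoc)
  then show ?thesis using hermite_const_Suc[of m] Suc by (simp del: of_nat_Suc)
qed simp

lemma sqrt_two_half: "x \<ge> 0 \<Longrightarrow> sqrt (2 * x) = 2 * sqrt (x / 2)"
  by (simp add: real_sqrt_mult real_sqrt_divide field_simps)

text \<open>The three-term recurrence after normalisation: multiplication by \<open>t\<close> is the
  sum of a raising and a lowering term. \<open>hermite_fun1_deriv\<close> is the difference of the
  same two terms, so \<open>t\<close> plus the derivative is a pure lowering operator.\<close>

lemma hermite_fun1_mult:
  "t * hermite_fun1 n t = sqrt (real (Suc n) / 2) * hermite_fun1 (Suc n) t
     + sqrt (real n / 2) * hermite_fun1 (n - 1) t"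
proof -
  have 1: "hermite_const n = 2 * sqrt (real (Suc n) / 2) * hermite_const (Suc n)"
    using hermite_const_Suc[of n] sqrt_two_half[of "real (Suc n)"] by (simp del: of_nat_Suc)
  have 2: "real n * hermite_const n = sqrt (real n / 2) * hermite_const (n - 1)"
    using two_n_hermite_const[of n] sqrt_two_half[of "real n"] by simp
  have "2 * t * herm n t = herm (Suc n) t + 2 * real n * herm (n - 1) t"
    by (simp add: herm_Suc[of n])
  then have "t * (hermite_const n * herm n t)
      = hermite_const n * herm (Suc n) t / 2 + real n * hermite_const n * herm (n - 1) t"
    by algebra
  also have "\<dots> = sqrt (real (Suc n) / 2) * hermite_const (Suc n) * herm (Suc n) t
      + sqrt (real n / 2) * hermite_const (n - 1) * herm (n - 1) t"
    unfolding 2 by (subst 1) simp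
  finally have "t * (hermite_const n * herm n t) * exp (- t\<^sup>2 / 2)
      = (sqrt (real (Suc n) / 2) * hermite_const (Suc n) * herm (Suc n) t
      + sqrt (real n / 2) * hermite_const (n - 1) * herm (n - 1) t) * exp (- t\<^sup>2 / 2)" by simp
  then show ?thesis unfolding hermite_fun1_eq by (simp add: algebra_simps)
qed

lemma hermite_fun1_deriv:
  "(hermite_fun1 n has_real_derivative
     sqrt (real n / 2) * hermite_fun1 (n - 1) t - sqrt (real (Suc n) / 2) * hermite_fun1 (Suc n) t) (at t)"
proof -
  have "((\<lambda>t. hermite_const n * herm n t * exp (- t\<^sup>2 / 2)) has_real_derivative
        hermite_const n * (2 * real n * herm (n - 1) t) * exp (- t\<^sup>2 / 2)
        - t * (hermite_const n * herm n t * exp (- t\<^sup>2 / 2))) (at t)"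
    by (auto intro!: derivative_eq_intros herm_deriv simp: algebra_simps)
  also have "hermite_const n * (2 * real n * herm (n - 1) t) = 2 * (sqrt (real n / 2) * hermite_const (n - 1) * herm (n - 1) t)"
    using two_n_hermite_const[of n] sqrt_two_half[of "real n"] by (simp add: algebra_simps)
  finally show ?thesis
    using hermite_fun1_mult[of t n] unfolding hermite_fun1_eq[abs_def] by (simp add: algebra_simps)
qed

lemma hermite_fun1_0: "hermite_fun1 0 t = hermite_const 0 * exp (- t\<^sup>2 / 2)"
  by (simp add: hermite_fun1_eq)

section \<open>Mehler's formula\<close>

text \<open>After normalisation the recurrence becomes, in absolute values,
  \<open>u (n + 2) \<le> \<epsilon> u (n + 1) + u n\<close> with \<open>\<epsilon>\<close> tending
  to 0 for fixed \<open>x\<close>; such a sequence grows slower than every geometric one.\<close>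

lemma herm_growth:
  assumes "q > (1::real)"
  shows "\<exists>C>0. \<forall>n. \<bar>herm n x / sqrt (2 ^ n * fact n)\<bar> \<le> C * q ^ n"
proof -
  define u where "u n = \<bar>herm n x / sqrt (2 ^ n * fact n)\<bar>" for n
  have rec: "u (Suc (Suc n)) \<le> sqrt (2 / real (n + 2)) * \<bar>x\<bar> * u (Suc n) + u n" for n
  proof -
    let ?s = "\<lambda>n. sqrt (2 ^ n * fact n)"
    have s1: "?s (Suc n) = sqrt (2 * real (Suc n)) * ?s n" for n
      by (simp flip: real_sqrt_mult add: algebra_simps)
    have sp: "?s n > 0" for n by simp
    have "herm (Suc (Suc n)) x / ?s (Suc (Suc n))
       = 2 * x / sqrt (2 * real (n + 2)) * (herm (Suc n) x / ?s (Suc n))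
         - 2 * real (Suc n) / (sqrt (2 * real (n + 2)) * sqrt (2 * real (n + 1))) * (herm n x / ?s n)"
      using s1[of "Suc n"] s1[of n] sp[of n] sp[of "Suc n"]
      by (simp add: diff_divide_distrib del: of_nat_Suc power_Suc fact_Suc)
    also have "\<bar>\<dots>\<bar> \<le> \<bar>2 * x / sqrt (2 * real (n + 2))\<bar> * u (Suc n)
        + \<bar>2 * real (Suc n) / (sqrt (2 * real (n + 2)) * sqrt (2 * real (n + 1)))\<bar> * u n"
      unfolding u_def abs_mult[symmetric] by (rule abs_triangle_ineq4)
    also have "\<bar>2 * x / sqrt (2 * real (n + 2))\<bar> = sqrt (2 / real (n + 2)) * \<bar>x\<bar>"
    proof -
      have "2 / sqrt (2 * real (n + 2)) = sqrt (2 / real (n + 2))"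
        by (rule power2_eq_imp_eq) (auto simp: power_divide field_simps)
      then show ?thesis by (simp add: abs_mult abs_divide field_simps)
    qed
    also have "\<bar>2 * real (Suc n) / (sqrt (2 * real (n + 2)) * sqrt (2 * real (n + 1)))\<bar> * u n \<le> 1 * u n"
    proof (rule mult_right_mono)
      have "2 * real (Suc n) = sqrt (2 * real (n + 1)) * sqrt (2 * real (n + 1))" by simp
      also have "\<dots> \<le> sqrt (2 * real (n + 2)) * sqrt (2 * real (n + 1))"
        by (intro mult_right_mono) auto
      finally show "\<bar>2 * real (Suc n) / (sqrt (2 * real (n + 2)) * sqrt (2 * real (n + 1)))\<bar> \<le> 1"
        by (simp add: abs_divide divide_le_eq)
    qed (simp add: u_def)
    finally show ?thesis unfolding u_def by simp
  qed
  have "(\<lambda>n. sqrt (2 / real (n + 2)) * \<bar>x\<bar>) \<longlonglongrightarrow> sqrt 0 * \<bar>x\<bar>"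
    by (intro tendsto_intros) (real_asymp | simp)+
  \<comment> \<open>The threshold \<open>q - 1 / q\<close> is the coefficient for which
    \<open>q ^ n\<close> solves the majorising recurrence:
    \<open>(q - 1 / q) q ^ (n + 1) + q ^ n = q ^ (n + 2)\<close>.\<close>
  moreover have "q - 1 / q > 0" using assms by (smt (verit) divide_less_eq_1_pos)
  ultimately have "\<forall>\<^sub>F n in sequentially. sqrt (2 / real (n + 2)) * \<bar>x\<bar> < q - 1 / q"
    by (intro order_tendstoD(2)) auto
  then obtain N where N: "\<And>n. n \<ge> N \<Longrightarrow> sqrt (2 / real (n + 2)) * \<bar>x\<bar> < q - 1 / q"
    unfolding eventually_sequentially by auto
  define C where "C = (\<Sum>n\<le>N+1. u n) + 1"
  have u0: "u n \<ge> 0" for n unfolding u_def by simp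
  have C0: "C > 0" unfolding C_def using sum_nonneg[of "{..N+1}" u] u0 by (smt (verit))
  have small: "u n \<le> C * q ^ n" if "n \<le> N + 1" for n
  proof -
    have "u n \<le> (\<Sum>n\<le>N+1. u n)" using that u0 by (intro member_le_sum) auto
    then have "u n \<le> C * 1" unfolding C_def by simp
    also have "\<dots> \<le> C * q ^ n" using C0 assms by (intro mult_left_mono) auto
    finally show ?thesis .
  qed
  have "u n \<le> C * q ^ n" for n
  proof (induction n rule: less_induct)
    case (less n)
    show ?case
    proof (cases "n \<le> N + 1")
      case False
      define m where "m = n - 2"
      have m: "n = Suc (Suc m)" "m \<ge> N" using False unfolding m_def by auto
      have "1 / q \<le> q" using assms by (smt (verit) divide_less_eq_1_pos)
      have "u n \<le> sqrt (2 / real (m + 2)) * \<bar>x\<bar> * u (Suc m) + u m" using rec[of m] m by simp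
      also have "\<dots> \<le> (q - 1 / q) * (C * q ^ Suc m) + C * q ^ m"
        using \<open>1 / q \<le> q\<close> N[OF m(2)] less[of m] less[of "Suc m"] m u0
        by (intro add_mono mult_mono) auto
      also have "\<dots> = C * q ^ n" using assms m by (simp add: field_simps)
      finally show ?thesis .
    qed (use small in auto)
  qed
  then show ?thesis using C0 unfolding u_def by auto
qed

definition mehler_coeff :: "real \<Rightarrow> real \<Rightarrow> nat \<Rightarrow> complex" where
  "mehler_coeff x y n = complex_of_real (herm n x * herm n y / (2 ^ n * fact n))"

lemma mehler_conv_radius: "fps_conv_radius (Abs_fps (mehler_coeff x y)) \<ge> 1"
  unfolding fps_conv_radius_def fps_nth_Abs_fps
proof (rule conv_radius_geI_ex)
  fix r :: real assume r: "0 < r" "ereal r < 1"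
  \<comment> \<open>A fourth root, because two growth factors \<open>q ^ n\<close> occur: they cost
    \<open>q\<^sup>2 = (1 / r) powr (1 / 2)\<close> and leave the convergent ratio
    \<open>q\<^sup>2 * r = sqrt r\<close>.\<close>
  define q where "q = (1 / r) powr (1/4)"
  have r1: "r < 1" using r by simp
  have q: "q > 1" unfolding q_def using r(1) r1 by (intro gr_one_powr) auto
  have q2: "q\<^sup>2 = (1/r) powr (1/2)" unfolding q_def power2_eq_square powr_add[symmetric] by simp
  have qr: "q\<^sup>2 * r < 1"
  proof -
    have "(q\<^sup>2 * r)^2 = (1/r) powr 1 * r^2" unfolding power_mult_distrib q2
      by (simp only: power2_eq_square powr_add[symmetric]) simp
    also have "\<dots> = r" using r by (simp add: power2_eq_square)
    finally have "(q\<^sup>2 * r)^2 < 1^2" using r1 by simp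
    then show ?thesis by (rule power_less_imp_less_base) simp
  qed
  obtain C1 where C1: "C1 > 0" "\<And>n. \<bar>herm n x / sqrt (2 ^ n * fact n)\<bar> \<le> C1 * q ^ n"
    using herm_growth[OF q, of x] by auto
  obtain C2 where C2: "C2 > 0" "\<And>n. \<bar>herm n y / sqrt (2 ^ n * fact n)\<bar> \<le> C2 * q ^ n"
    using herm_growth[OF q, of y] by auto
  have bd: "norm (mehler_coeff x y n * of_real r ^ n) \<le> C1 * C2 * (q\<^sup>2 * r) ^ n" for n
  proof -
    have s: "2 ^ n * fact n = sqrt (2 ^ n * fact n) * sqrt (2 ^ n * fact n :: real)" by simp
    have "norm (mehler_coeff x y n) = \<bar>herm n x / sqrt (2 ^ n * fact n)\<bar> * \<bar>herm n y / sqrt (2 ^ n * fact n)\<bar>"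
      unfolding mehler_coeff_def norm_of_real
      by (subst s) (simp add: abs_mult abs_divide del: real_sqrt_mult_self)
    also have "\<dots> \<le> (C1 * q ^ n) * (C2 * q ^ n)"
      using C1(1) C2(1) q by (intro mult_mono C1(2) C2(2)) auto
    finally have "norm (mehler_coeff x y n) * r ^ n \<le> (C1 * q ^ n) * (C2 * q ^ n) * r ^ n"
      using r by (intro mult_right_mono) auto
    also have "\<dots> = C1 * C2 * (q\<^sup>2 * r) ^ n" by (simp add: power_mult_distrib power2_eq_square)
    finally show ?thesis using r by (simp add: norm_mult norm_power)
  qed
  have "summable (\<lambda>n. mehler_coeff x y n * of_real r ^ n)"
    by (rule summable_comparison_test'[OF summable_mult[OF summable_geometric], OF _ bd])
       (use qr r q in \<open>auto simp: abs_mult\<close>)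
  then show "\<exists>z. norm z = r \<and> summable (\<lambda>n. mehler_coeff x y n * z ^ n)"
    by (intro exI[of _ "of_real r"]) (use r in auto)
qed

text \<open>With \<open>A\<close>, \<open>B\<close> the series having one index shifted in \<open>x\<close>, \<open>y\<close> respectively, the three-term
  recurrence makes the system for \<open>F\<close>, \<open>A\<close>, \<open>B\<close> and \<open>F'\<close> linear, which yields a first-order
  differential equation for \<open>F\<close>.\<close>

lemma mehler_fps_ode:
  fixes x y :: real
  defines "F \<equiv> Abs_fps (mehler_coeff x y)"
  shows "(1 - fps_X^2)^2 * fps_deriv F
    = (fps_X * (1 - fps_X^2) + 2 * (fps_const (of_real x) - fps_const (of_real y) * fps_X)
        * (fps_const (of_real y) - fps_const (of_real x) * fps_X)) * F"
proof -
  define cx cy where "cx = fps_const (of_real x :: complex)" and "cy = fps_const (of_real y :: complex)"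
  define A where "A = Abs_fps (\<lambda>n. complex_of_real (herm (Suc n) x * herm n y / (2 ^ n * fact n)))"
  define B where "B = Abs_fps (\<lambda>n. complex_of_real (herm n x * herm (Suc n) y / (2 ^ n * fact n)))"
  \<comment> \<open>The recurrence in \<open>x\<close>. Since
    \<open>2 n / (2 ^ n n!) = 1 / (2 ^ (n - 1) (n - 1)!)\<close>, its second term is
    \<open>B\<close> shifted by one place.\<close>
  have A: "A = 2 * cx * F - fps_X * B"
  proof (rule fps_ext)
    fix n show "fps_nth A n = fps_nth (2 * cx * F - fps_X * B) n"
      by (cases n) (auto simp: A_def B_def F_def cx_def mehler_coeff_def numeral_fps_const mult.assoc field_simps
            simp del: of_nat_Suc)
  qed
  have B: "B = 2 * cy * F - fps_X * A"
  proof (rule fps_ext)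
    fix n show "fps_nth B n = fps_nth (2 * cy * F - fps_X * A) n"
      by (cases n) (auto simp: A_def B_def F_def cy_def mehler_coeff_def numeral_fps_const mult.assoc field_simps
            simp del: of_nat_Suc)
  qed
  \<comment> \<open>The recurrence in both variables applied to the coefficients of
    \<open>F'\<close>; the product of the two lowered terms brings back
    \<open>F + fps_X * fps_deriv F\<close>.\<close>
  have D: "2 * fps_deriv F = 2 * cx * B - 2 * cy * fps_X * B + 2 * fps_X * (F + fps_X * fps_deriv F)"
  proof (rule fps_ext)
    fix n show "fps_nth (2 * fps_deriv F) n = fps_nth (2 * cx * B - 2 * cy * fps_X * B + 2 * fps_X * (F + fps_X * fps_deriv F)) n"
    proof (cases n)
      case 0
      then show ?thesis by (simp add: B_def F_def cx_def cy_def mehler_coeff_def numeral_fps_const mult.assoc)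
    next
      case (Suc m)
      define k :: complex where "k = 2 ^ m * fact m"
      have k: "k \<noteq> 0" unfolding k_def by simp
      define p q u v X Y where "p = complex_of_real (herm m x)" and "q = complex_of_real (herm (Suc m) x)"
        and "u = complex_of_real (herm m y)" and "v = complex_of_real (herm (Suc m) y)"
        and "X = complex_of_real x" and "Y = complex_of_real y"
      define M :: complex where "M = of_nat (Suc m)"
      have M: "M \<noteq> 0" unfolding M_def using of_nat_neq_0 by blast
      have fm: "fact m * 2 ^ m = k" by (simp add: k_def)
      have h2: "complex_of_real (herm (Suc (Suc m)) x) = 2 * X * q - 2 * M * p"
        "complex_of_real (herm (Suc (Suc m)) y) = 2 * Y * v - 2 * M * u"
        unfolding p_def q_def u_def v_def X_def Y_def M_def by (simp_all del: of_nat_Suc)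
      have c1: "mehler_coeff x y m = p * u / k" "mehler_coeff x y (Suc m) = q * v / (2 * M * k)"
        unfolding mehler_coeff_def p_def q_def u_def v_def k_def M_def by (simp_all del: of_nat_Suc herm.simps add: mult_ac)
      have c2: "(M + 1) * mehler_coeff x y (Suc (Suc m)) = (2 * X * q - 2 * M * p) * (2 * Y * v - 2 * M * u) / (4 * M * k)"
      proof -
        have "M + 1 \<noteq> 0" unfolding M_def using of_nat_neq_0[of "Suc m", where 'a=complex] by (simp add: add_ac)
        moreover have "mehler_coeff x y (Suc (Suc m)) = (2 * X * q - 2 * M * p) * (2 * Y * v - 2 * M * u) / (4 * (M + 1) * M * k)"
          unfolding mehler_coeff_def of_real_divide of_real_mult h2
          by (simp add: M_def k_def mult_ac del: herm.simps)
        moreover have "N * (E / (4 * N * M * k)) = E / (4 * M * k)" if "N \<noteq> 0" for N E :: complex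
          using that by simp
        ultimately show ?thesis by metis
      qed
      have L: "fps_nth (2 * fps_deriv F) n = 2 * ((M + 1) * mehler_coeff x y (Suc (Suc m)))"
        unfolding F_def Suc M_def by (simp add: numeral_fps_const add_ac)
      have b1: "fps_nth B (Suc m) = q * (2 * Y * v - 2 * M * u) / (2 * M * k)"
        unfolding B_def fps_nth_Abs_fps of_real_divide of_real_mult h2 q_def[symmetric]
        by (simp add: M_def k_def mult_ac del: herm.simps)
      have b0: "fps_nth B m = p * v / k"
        unfolding B_def fps_nth_Abs_fps p_def v_def k_def by (simp del: herm.simps)
      have dm: "fps_nth F m + fps_nth (fps_X * fps_deriv F) m = M * (p * u / k)"
        unfolding F_def M_def c1(1)[symmetric] by (cases m) (simp_all add: algebra_simps)
      have "fps_nth (2 * cx * B - 2 * cy * fps_X * B + 2 * fps_X * (F + fps_X * fps_deriv F)) n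
          = 2 * X * fps_nth B (Suc m) - 2 * Y * fps_nth B m + 2 * (fps_nth F m + fps_nth (fps_X * fps_deriv F) m)"
        unfolding Suc cx_def cy_def X_def Y_def
        by (simp add: numeral_fps_const mult.assoc)
      also have "\<dots> = 2 * X * (q * (2 * Y * v - 2 * M * u) / (2 * M * k)) - 2 * Y * (p * v / k) + 2 * M * (p * u / k)"
        unfolding b1 b0 dm by (simp add: algebra_simps)
      also have "\<dots> = 2 * ((M + 1) * mehler_coeff x y (Suc (Suc m)))"
        unfolding c2 using k M by (simp add: field_simps)
      finally show ?thesis using L by simp
    qed
  qed
  \<comment> \<open>Elimination of \<open>A\<close> from the linear system, whose determinant is
    \<open>1 - fps_X^2\<close>.\<close>
  have B': "(1 - fps_X^2) * B = 2 * (cy - cx * fps_X) * F"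
    using A B by algebra
  have "2 * (fps_deriv F * (1 - fps_X^2)) = 2 * ((cx - cy * fps_X) * B + fps_X * F)"
    using D by algebra
  then have "fps_deriv F * (1 - fps_X^2) = (cx - cy * fps_X) * B + fps_X * F"
    by (subst (asm) mult_left_cancel) simp_all
  then show ?thesis unfolding cx_def[symmetric] cy_def[symmetric] using B' by algebra
qed

text \<open>Keeps \<open>1 - r\<^sup>2\<close> in the right half plane, where the principal root
  \<open>csqrt\<close> is holomorphic and nonzero.\<close>

lemma one_minus_square_Re_pos:
  fixes r :: complex
  assumes "norm r < 1"
  shows "Re (1 - r\<^sup>2) > 0" "1 - r\<^sup>2 \<noteq> 0" "1 - r\<^sup>2 \<notin> \<real>\<^sub>\<le>\<^sub>0"
proof -
  have "norm (r\<^sup>2) < 1" using assms by (simp add: norm_power power_less_one_iff)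
  then show R: "Re (1 - r\<^sup>2) > 0" using complex_Re_le_cmod[of "r\<^sup>2"] by simp
  then show "1 - r\<^sup>2 \<noteq> 0" by (metis less_irrefl zero_complex.simps(1))
  show "1 - r\<^sup>2 \<notin> \<real>\<^sub>\<le>\<^sub>0" using R by (auto simp: complex_nonpos_Reals_iff)
qed

text \<open>The closed form solves the differential equation of \<open>mehler_fps_ode\<close>. The
  quotient of the series by it therefore has derivative zero on the connected disc and keeps its
  value 1 at the origin.\<close>

lemma mehler_coeff_sums:
  assumes r: "norm (r::complex) < 1"
  shows "(\<lambda>n. mehler_coeff x y n * r ^ n) sums
     (exp ((2 * x * y * r - (x\<^sup>2 + y\<^sup>2) * r\<^sup>2) / (1 - r\<^sup>2)) / csqrt (1 - r\<^sup>2))"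
proof -
  define F where "F = Abs_fps (mehler_coeff x y)"
  define X Y where "X = complex_of_real x" and "Y = complex_of_real y"
  define P where "P = [:1, 0, -2, 0, 1::complex:]"
  define Q where "Q = [:2 * X * Y, 1 - 2 * X\<^sup>2 - 2 * Y\<^sup>2, 2 * X * Y, -1:]"
  have c: "fps_conv_radius F \<ge> 1" unfolding F_def by (rule mehler_conv_radius)
  have in_disc: "ereal (norm z) < fps_conv_radius F" if "norm z < 1" for z :: complex
    using that c by (metis ereal_less(3) order_less_le_trans one_ereal_def ereal_less_eq(3) less_ereal.simps(1))
  have in_disc': "ereal (norm z) < fps_conv_radius (fps_deriv F)" if "norm z < 1" for z :: complex
    using in_disc[OF that] fps_conv_radius_deriv[of F] by simp
  have "fps_of_poly P * fps_deriv F = fps_of_poly Q * F"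
  proof -
    have P: "fps_of_poly P = (1 - fps_X^2)^2"
      by (rule fps_ext) (simp add: P_def fps_of_poly_pCons power2_eq_square algebra_simps numeral_fps_const
          flip: fps_const_neg)
    have Q: "fps_of_poly Q = (fps_X * (1 - fps_X^2) + 2 * (fps_const X - fps_const Y * fps_X)
        * (fps_const Y - fps_const X * fps_X))"
      by (simp add: Q_def fps_of_poly_pCons power2_eq_square algebra_simps numeral_fps_const
          flip: fps_const_neg fps_const_add fps_const_mult fps_const_sub)
    show ?thesis unfolding P Q X_def Y_def F_def by (rule mehler_fps_ode)
  qed
  then have ev: "eval_fps (fps_of_poly P * fps_deriv F) z = eval_fps (fps_of_poly Q * F) z" for z by simp
  have ode: "poly P z * eval_fps (fps_deriv F) z = poly Q z * eval_fps F z" if "norm z < 1" for z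
    using ev[of z] in_disc[OF that] in_disc'[OF that]
    by (subst (asm) eval_fps_mult, simp, simp, subst (asm) eval_fps_mult, simp, simp, simp)
  define \<phi> where "\<phi> z = (2 * X * Y * z - (X\<^sup>2 + Y\<^sup>2) * z\<^sup>2) / (1 - z\<^sup>2)" for z
  \<comment> \<open>The series divided by the closed form; the root and
    \<open>exp (- \<phi> z)\<close> are factors, so no division occurs.\<close>
  define g where "g z = eval_fps F z * csqrt (1 - z\<^sup>2) * exp (- \<phi> z)" for z
  have "(g has_field_derivative 0) (at z within ball 0 1)" if z: "z \<in> ball 0 1" for z
  proof -
    have z1: "norm z < 1" using z by simp
    note nz = one_minus_square_Re_pos[OF z1]
    define s where "s = csqrt (1 - z\<^sup>2)"
    have s2: "s * s = 1 - z\<^sup>2" "s \<noteq> 0" unfolding s_def using nz(2) power2_csqrt[of "1 - z\<^sup>2"]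
      by (auto simp: power2_eq_square)
    define d where "d = ((2 * X * Y - (X\<^sup>2 + Y\<^sup>2) * (2 * z)) * (1 - z\<^sup>2) - (2 * X * Y * z - (X\<^sup>2 + Y\<^sup>2) * z\<^sup>2) * (- 2 * z)) / (1 - z\<^sup>2)^2"
    have d\<phi>: "(\<phi> has_field_derivative d) (at z within ball 0 1)"
      unfolding \<phi>_def[abs_def] d_def
      by (rule derivative_eq_intros refl | use nz in \<open>simp add: power2_eq_square\<close>)+
    have ds: "((\<lambda>z. csqrt (1 - z\<^sup>2)) has_field_derivative (- z / s)) (at z within ball 0 1)"
      by (rule derivative_eq_intros refl | use nz in \<open>simp add: s_def\<close>)+
    have "(g has_field_derivative ((eval_fps (fps_deriv F) z * s + eval_fps F z * (- z / s)) * exp (- \<phi> z)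
         + eval_fps F z * s * (exp (- \<phi> z) * (- d)))) (at z within ball 0 1)"
      unfolding g_def[abs_def]
      by (rule derivative_eq_intros refl d\<phi> ds has_field_derivative_eval_fps[OF in_disc[OF z1]] | simp add: s_def)+
    moreover have "(eval_fps (fps_deriv F) z * s + eval_fps F z * (- z / s)) * exp (- \<phi> z)
         + eval_fps F z * s * (exp (- \<phi> z) * (- d)) = 0"
    proof -
      define W where "W = 1 - z\<^sup>2"
      have W: "W \<noteq> 0" using nz unfolding W_def by simp
      have PW: "poly P z = W^2" unfolding P_def W_def by (simp add: power2_eq_square algebra_simps)
      have QW: "poly Q z = d * W^2 + z * W"
      proof -
        have "d * W^2 = ((2 * X * Y - (X\<^sup>2 + Y\<^sup>2) * (2 * z)) * (1 - z\<^sup>2) - (2 * X * Y * z - (X\<^sup>2 + Y\<^sup>2) * z\<^sup>2) * (- 2 * z))"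
          unfolding d_def W_def[symmetric] using W by simp
        then show ?thesis unfolding W_def Q_def by (simp add: power2_eq_square algebra_simps)
      qed
      have E: "W^2 * eval_fps (fps_deriv F) z = (d * W^2 + z * W) * eval_fps F z"
        using ode[OF z1] unfolding PW QW .
      have "W * (W * eval_fps (fps_deriv F) z - (d * W + z) * eval_fps F z) = 0"
        using E by (simp add: power2_eq_square algebra_simps)
      then have E: "W * eval_fps (fps_deriv F) z = (d * W + z) * eval_fps F z" using W by simp
      have "eval_fps (fps_deriv F) z * s + eval_fps F z * (- z / s) - eval_fps F z * s * d
         = (W * eval_fps (fps_deriv F) z - z * eval_fps F z - eval_fps F z * d * W) / s"
        using s2 unfolding W_def[symmetric] by (simp add: field_simps) (simp add: mult.assoc[symmetric])
      also have "\<dots> = 0" unfolding E by (simp add: algebra_simps)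
      finally show ?thesis by (simp add: algebra_simps)
    qed
    ultimately show ?thesis by simp
  qed
  then obtain k where k: "\<And>z. z \<in> ball 0 1 \<Longrightarrow> g z = k"
    using has_field_derivative_zero_constant[of "ball 0 1" g] by auto
  have "g 0 = 1" unfolding g_def \<phi>_def eval_fps_at_0 F_def by (simp add: mehler_coeff_def)
  then have "g r = 1" using k[of 0] k[of r] r by simp
  then have "eval_fps F r * csqrt (1 - r\<^sup>2) = exp (\<phi> r)"
    unfolding g_def by (simp add: exp_minus field_simps)
  then have "eval_fps F r = exp (\<phi> r) / csqrt (1 - r\<^sup>2)"
    using one_minus_square_Re_pos(2)[OF r] by (simp add: field_simps)
  moreover have "(\<lambda>n. fps_nth F n * r ^ n) sums eval_fps F r"
    by (rule sums_eval_fps[OF in_disc[OF r]])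
  ultimately show ?thesis unfolding F_def \<phi>_def X_def Y_def by simp
qed


text \<open>Mehler's generating function with the Gaussian factors included; for
  \<open>0 < r < 1\<close> it is, up to a factor, the heat kernel of the harmonic
  oscillator.\<close>

definition mehler1 :: "complex \<Rightarrow> real \<Rightarrow> real \<Rightarrow> complex" where
  "mehler1 r x y = exp ((4 * x * y * r - (x\<^sup>2 + y\<^sup>2) * (1 + r\<^sup>2)) / (2 * (1 - r\<^sup>2)))
     / (of_real (sqrt pi) * csqrt (1 - r\<^sup>2))"

lemma hermite_fun1_prod_eq:
  "complex_of_real (hermite_fun1 n x * hermite_fun1 n y)
    = mehler_coeff x y n * of_real (exp (- (x\<^sup>2 + y\<^sup>2) / 2) / sqrt pi)"
proof -
  have "hermite_fun1 n x * hermite_fun1 n y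
     = hermite_const n ^ 2 * herm n x * herm n y * (exp (- x\<^sup>2 / 2) * exp (- y\<^sup>2 / 2))"
    unfolding hermite_fun1_eq by (simp add: power2_eq_square)
  also have "exp (- x\<^sup>2 / 2) * exp (- y\<^sup>2 / 2) = exp (- (x\<^sup>2 + y\<^sup>2) / 2)"
    by (simp flip: exp_add add: field_simps)
  finally show ?thesis unfolding hermite_const_square mehler_coeff_def by simp
qed

lemma mehler1_sums:
  assumes r: "norm r < 1"
  shows "(\<lambda>n. complex_of_real (hermite_fun1 n x * hermite_fun1 n y) * r ^ n) sums mehler1 r x y"
proof -
  define W where "W = 1 - r\<^sup>2"
  have W: "W \<noteq> 0" using one_minus_square_Re_pos(2)[OF r] unfolding W_def .
  define e where "e = complex_of_real (exp (- (x\<^sup>2 + y\<^sup>2) / 2) / sqrt pi)"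
  have "(\<lambda>n. (mehler_coeff x y n * r ^ n) * e) sums
      (exp ((2 * x * y * r - (x\<^sup>2 + y\<^sup>2) * r\<^sup>2) / (1 - r\<^sup>2)) / csqrt (1 - r\<^sup>2) * e)"
    using mehler_coeff_sums[OF r, of x y] by (intro sums_mult2) simp
  also have "exp ((2 * x * y * r - (x\<^sup>2 + y\<^sup>2) * r\<^sup>2) / (1 - r\<^sup>2)) / csqrt (1 - r\<^sup>2) * e = mehler1 r x y"
  proof -
    have "e = exp (of_real (- (x\<^sup>2 + y\<^sup>2) / 2)) / of_real (sqrt pi)"
      unfolding e_def exp_of_real by simp
    moreover have "(2 * x * y * r - (x\<^sup>2 + y\<^sup>2) * r\<^sup>2) / W + of_real (- (x\<^sup>2 + y\<^sup>2) / 2)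
        = (4 * x * y * r - (x\<^sup>2 + y\<^sup>2) * (1 + r\<^sup>2)) / (2 * W)"
      using W by (simp add: field_simps) (simp add: W_def algebra_simps)
    ultimately show ?thesis unfolding mehler1_def W_def[symmetric]
      by (simp only: flip: exp_add) (simp add: exp_add[symmetric])
  qed
  finally show ?thesis
    unfolding hermite_fun1_prod_eq e_def by (simp only: mult_ac)
qed

text \<open>Absolute convergence is what later permits multiplying out the series of the separate
  coordinates.\<close>

lemma mehler1_abs_summable:
  assumes r: "norm (r::complex) < 1"
  shows "summable (\<lambda>n. norm (complex_of_real (hermite_fun1 n x * hermite_fun1 n y) * r ^ n))"
proof -
  have "ereal (norm r) < fps_conv_radius (Abs_fps (mehler_coeff x y))"
    using mehler_conv_radius[of x y] r
    by (metis order_less_le_trans one_ereal_def less_ereal.simps(1))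
  from norm_summable_fps[OF this] have "summable (\<lambda>n. norm (mehler_coeff x y n * r ^ n))" by simp
  from summable_mult2[OF this, of "norm (complex_of_real (exp (- (x\<^sup>2 + y\<^sup>2) / 2) / sqrt pi))"]
  show ?thesis unfolding hermite_fun1_prod_eq norm_mult by (simp only: mult_ac)
qed

lemma mehler1_of_real:
  assumes "\<bar>r\<bar> < 1"
  shows "mehler1 (of_real r) x y
    = of_real (exp ((4 * x * y * r - (x\<^sup>2 + y\<^sup>2) * (1 + r\<^sup>2)) / (2 * (1 - r\<^sup>2))) / (sqrt (pi * (1 - r\<^sup>2))))"
proof -
  have "r\<^sup>2 < 1" using assms by (simp add: abs_square_less_1)
  then have "csqrt (1 - (of_real r)\<^sup>2) = of_real (sqrt (1 - r\<^sup>2))"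
    using csqrt_of_real_nonneg[of "of_real (1 - r\<^sup>2)"] by simp
  moreover have "(4 * x * y * of_real r - (x\<^sup>2 + y\<^sup>2) * (1 + (of_real r)\<^sup>2)) / (2 * (1 - (of_real r)\<^sup>2))
     = complex_of_real ((4 * x * y * r - (x\<^sup>2 + y\<^sup>2) * (1 + r\<^sup>2)) / (2 * (1 - r\<^sup>2)))"
    by simp
  moreover have "exp \<dots> = complex_of_real (exp ((4 * x * y * r - (x\<^sup>2 + y\<^sup>2) * (1 + r\<^sup>2)) / (2 * (1 - r\<^sup>2))))"
    by (rule exp_of_real)
  ultimately show ?thesis unfolding mehler1_def
    by (simp add: real_sqrt_mult)
qed

lemma mehler1_real_sums:
  assumes "\<bar>r\<bar> < 1"
  shows "(\<lambda>n. hermite_fun1 n x * hermite_fun1 n y * r ^ n) sums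
     (exp ((4 * x * y * r - (x\<^sup>2 + y\<^sup>2) * (1 + r\<^sup>2)) / (2 * (1 - r\<^sup>2))) / (sqrt (pi * (1 - r\<^sup>2))))"
proof -
  have "(\<lambda>n. complex_of_real (hermite_fun1 n x * hermite_fun1 n y * r ^ n)) sums
     of_real (exp ((4 * x * y * r - (x\<^sup>2 + y\<^sup>2) * (1 + r\<^sup>2)) / (2 * (1 - r\<^sup>2))) / (sqrt (pi * (1 - r\<^sup>2))))"
    using mehler1_sums[of "of_real r" x y] assms mehler1_of_real[OF assms, of x y] by simp
  then show ?thesis by (simp only: sums_of_real_iff)
qed

text \<open>On the diagonal the Mehler series has nonnegative terms, so each term is at most the
  sum, and there the exponent of the closed form is nonpositive. Polynomial growth in
  \<open>n\<close>, uniform in \<open>x\<close>, is enough for everything that follows.\<close>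

lemma hermite_fun1_bound: "\<bar>hermite_fun1 n x\<bar> \<le> 3 * real (n + 1)"
proof -
  \<comment> \<open>Close enough to 1 that \<open>r ^ n \<ge> 1 / 3\<close>, while the bound
    \<open>1 / sqrt (pi * (1 - r\<^sup>2))\<close> of the sum is still at most
    \<open>n + 2\<close>.\<close>
  define r where "r = 1 - 1 / real (n + 2)"
  have r: "r \<ge> 0" "r < 1" unfolding r_def by auto
  then have r1: "\<bar>r\<bar> < 1" by simp
  have r2: "r\<^sup>2 < 1" using r1 by (simp add: abs_square_less_1)
  let ?E = "exp ((4 * x * x * r - (x\<^sup>2 + x\<^sup>2) * (1 + r\<^sup>2)) / (2 * (1 - r\<^sup>2)))"
  have "hermite_fun1 n x * hermite_fun1 n x * r ^ n \<le> ?E / sqrt (pi * (1 - r\<^sup>2))"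
  proof -
    have S: "(\<lambda>n. hermite_fun1 n x * hermite_fun1 n x * r ^ n) sums (?E / sqrt (pi * (1 - r\<^sup>2)))"
      by (rule mehler1_real_sums[OF r1])
    have "sum (\<lambda>n. hermite_fun1 n x * hermite_fun1 n x * r ^ n) {n} \<le> (\<Sum>n. hermite_fun1 n x * hermite_fun1 n x * r ^ n)"
      using S r by (intro sum_le_suminf) (auto simp: sums_iff)
    then show ?thesis using S by (simp add: sums_iff)
  qed
  also have "\<dots> \<le> 1 / sqrt (pi * (1 - r\<^sup>2))"
  proof (rule divide_right_mono)
    have "4 * x * x * r - (x\<^sup>2 + x\<^sup>2) * (1 + r\<^sup>2) = - 2 * (x * (1 - r))^2"
      by (simp add: power2_eq_square algebra_simps)
    also have "\<dots> \<le> 0" by simp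
    finally show "?E \<le> 1" using r2 by (simp add: divide_le_0_iff)
  qed (use r2 in auto)
  also have "\<dots> \<le> 1 / (1 / real (n + 2))"
  proof (rule divide_left_mono)
    have "1 / real (n + 2) = 1 - r" unfolding r_def by simp
    also have "\<dots> \<le> 1 - r\<^sup>2" using r by (simp add: power2_eq_square mult_left_le)
    also have "\<dots> \<le> pi * (1 - r\<^sup>2)" using pi_gt3 r2 mult_right_mono[of 1 pi "1 - r\<^sup>2"] by simp
    finally have "sqrt (1 / real (n + 2)) \<le> sqrt (pi * (1 - r\<^sup>2))" by simp
    moreover have "1 / real (n + 2) \<le> sqrt (1 / real (n + 2))"
      by (rule real_le_rsqrt) (simp add: power2_eq_square divide_le_eq)
    ultimately show "1 / real (n + 2) \<le> sqrt (pi * (1 - r\<^sup>2))" by linarith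
  qed (use r2 in auto)
  finally have "(hermite_fun1 n x)\<^sup>2 * r ^ n \<le> real (n + 2)" by (simp add: power2_eq_square)
  moreover have "1 / 3 \<le> r ^ n"
  proof -
    have "r = real (n + 1) / real (n + 2)" "1 + 1 / real (n + 1) = real (n + 2) / real (n + 1)"
      unfolding r_def by (simp_all add: divide_simps)
    then have "r * (1 + 1 / real (n + 1)) = 1" by simp
    then have "r ^ n * (1 + 1 / real (n + 1)) ^ n = 1" by (metis power_mult_distrib power_one)
    moreover have "(1 + 1 / real (n + 1)) ^ n \<le> 3"
    proof -
      have "(1 + 1 / real (n + 1)) ^ n \<le> exp (1 / real (n + 1)) ^ n"
        by (intro power_mono exp_ge_add_one_self) auto
      also have "\<dots> = exp (real n * (1 / real (n + 1)))" by (rule exp_of_nat_mult[symmetric])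
      also have "\<dots> \<le> exp 1" by simp
      also have "\<dots> \<le> 3" by (rule exp_le)
      finally show ?thesis .
    qed
    ultimately have "1 \<le> r ^ n * 3"
      using r mult_left_mono[of "(1 + 1 / real (n + 1)) ^ n" 3 "r ^ n"] by simp
    then show ?thesis by simp
  qed
  ultimately have "(hermite_fun1 n x)\<^sup>2 * (1 / 3) \<le> real (n + 2)"
    by (meson mult_left_mono order_trans zero_le_power2)
  then have "(hermite_fun1 n x)\<^sup>2 \<le> 3 * real (n + 2)" by simp
  also have "\<dots> \<le> (3 * real (n + 1))\<^sup>2" by (simp add: power2_eq_square algebra_simps)
  finally have "\<bar>hermite_fun1 n x\<bar> \<le> \<bar>3 * real (n + 1)\<bar>" unfolding abs_le_square_iff .
  then show ?thesis by simp
qed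

text \<open>The real part of the exponent is the quadratic form
  \<open>B x y - \<gamma> (x\<^sup>2 + y\<^sup>2)\<close>. Completing the square in \<open>y\<close>
  leaves \<open>- \<gamma> x\<^sup>2 (1 - c\<^sup>2)\<close>, which has the right sign because
  \<open>|B| \<le> 2 \<gamma>\<close>. Only the width of the Gaussian, not its centre
  \<open>c * x\<close>, enters the integral over \<open>y\<close>.\<close>

lemma norm_mehler1_le:
  assumes r: "norm r < 1"
  shows "\<exists>c. \<forall>x y. norm (mehler1 r x y) \<le> (1 / sqrt (pi * norm (1 - r\<^sup>2))) *
     exp (- ((1 - norm r ^ 4) / (2 * norm (1 - r\<^sup>2) ^ 2)) * (y - c * x)\<^sup>2)"
proof -
  define W where "W = 1 - r\<^sup>2"
  define \<gamma> where "\<gamma> = (1 - norm r ^ 4) / (2 * norm W ^ 2)"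
  define B where "B = Re (2 * r / W)"
  have W: "W \<noteq> 0" using one_minus_square_Re_pos(2)[OF r] unfolding W_def .
  have \<gamma>: "\<gamma> > 0" unfolding \<gamma>_def using W r by (simp add: power_less_one_iff)
  have Re\<gamma>: "Re ((1 + r\<^sup>2) / W) = 2 * \<gamma>"
  proof -
    have "Re ((1 + r\<^sup>2) / W) = Re ((1 + r\<^sup>2) * cnj W) / norm W ^ 2" by (simp add: complex_div_cnj[of _ W])
    also have "Re ((1 + r\<^sup>2) * cnj W) = 1 - norm r ^ 4"
    proof -
      have "norm r ^ 4 = (norm (r\<^sup>2))\<^sup>2" by (simp add: norm_power)
      also have "\<dots> = (Re (r\<^sup>2))\<^sup>2 + (Im (r\<^sup>2))\<^sup>2" by (rule cmod_power2)
      finally show ?thesis unfolding W_def by (simp add: power2_eq_square algebra_simps)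
    qed
    finally have "Re ((1 + r\<^sup>2) / W) = (1 - norm r ^ 4) / norm W ^ 2" .
    moreover have "a / b = 2 * (a / (2 * b))" for a b :: real by simp
    ultimately show ?thesis unfolding \<gamma>_def by metis
  qed
  \<comment> \<open>The map \<open>(1 + s) / (1 - s)\<close> sends the disc into the right half
    plane. At \<open>s = r\<close> and \<open>s = - r\<close> its real part is
    \<open>2 \<gamma> + B\<close> and \<open>2 \<gamma> - B\<close>, which gives the bound on
    \<open>B\<close>.\<close>
  have half: "Re ((1 + s) / (1 - s)) \<ge> 0" if "norm s < 1" for s :: complex
  proof -
    have "Re ((1 + s) / (1 - s)) = Re ((1 + s) * cnj (1 - s)) / norm (1 - s) ^ 2" by (simp add: complex_div_cnj[of _ "1 - s"])
    also have "Re ((1 + s) * cnj (1 - s)) = 1 - norm s ^ 2"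
      unfolding cmod_power2 by (simp add: power2_eq_square algebra_simps)
    finally show ?thesis using that by (simp add: power_le_one)
  qed
  have nz: "1 - r \<noteq> 0" "1 + r \<noteq> 0" using W unfolding W_def by (auto simp: power2_eq_square algebra_simps add_eq_0_iff)
  have W': "W = (1 - r) * (1 + r)" unfolding W_def by (simp add: power2_eq_square algebra_simps)
  have B1: "2 * \<gamma> + B = Re ((1 + r) / (1 - r))"
  proof -
    have "(1 + r\<^sup>2) / W + 2 * r / W = ((1 + r) * (1 + r)) / ((1 - r) * (1 + r))"
      unfolding W' add_divide_distrib[symmetric] by (simp add: algebra_simps power2_eq_square)
    then have "(1 + r\<^sup>2) / W + 2 * r / W = (1 + r) / (1 - r)" using nz by simp
    then show ?thesis using Re\<gamma> unfolding B_def by (metis plus_complex.sel(1))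
  qed
  have B2: "2 * \<gamma> - B = Re ((1 + (- r)) / (1 - (- r)))"
  proof -
    have "(1 + r\<^sup>2) / W - 2 * r / W = ((1 - r) * (1 - r)) / ((1 - r) * (1 + r))"
      unfolding W' diff_divide_distrib[symmetric] by (simp add: algebra_simps power2_eq_square)
    then have "(1 + r\<^sup>2) / W - 2 * r / W = (1 + (- r)) / (1 - (- r))" using nz by simp
    then show ?thesis using Re\<gamma> unfolding B_def by (metis minus_complex.sel(1))
  qed
  have Bb: "\<bar>B\<bar> \<le> 2 * \<gamma>" using half[OF r] half[of "- r"] r unfolding B1[symmetric] B2[symmetric] by simp
  define c where "c = B / (2 * \<gamma>)"
  have Bc: "B = 2 * \<gamma> * c" unfolding c_def using \<gamma> by simp
  have c: "\<bar>c\<bar> \<le> 1" unfolding c_def using Bb \<gamma> by (simp add: abs_divide)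
  have "norm (mehler1 r x y) \<le> (1 / sqrt (pi * norm W)) * exp (- \<gamma> * (y - c * x)\<^sup>2)" for x y
  proof -
    let ?z = "(4 * x * y * r - (x\<^sup>2 + y\<^sup>2) * (1 + r\<^sup>2)) / (2 * W)"
    have "?z = of_real (x * y) * (2 * r / W) - of_real ((x\<^sup>2 + y\<^sup>2) / 2) * ((1 + r\<^sup>2) / W)"
      using W by (simp add: field_simps)
    moreover have "Re (of_real a * w - of_real b * v) = a * Re w - b * Re v" for a b w v by simp
    ultimately have "Re ?z = x * y * B - (x\<^sup>2 + y\<^sup>2) / 2 * (2 * \<gamma>)"
      unfolding B_def Re\<gamma>[symmetric] by presburger
    also have "\<dots> = - \<gamma> * (y - c * x)\<^sup>2 - \<gamma> * x\<^sup>2 * (1 - c\<^sup>2)"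
      unfolding Bc by (simp add: power2_eq_square algebra_simps)
    also have "\<dots> \<le> - \<gamma> * (y - c * x)\<^sup>2"
      using c \<gamma> by (simp add: abs_square_le_1)
    finally have Re: "Re ?z \<le> - \<gamma> * (y - c * x)\<^sup>2" .
    have "norm (mehler1 r x y) = exp (Re ?z) / (sqrt pi * sqrt (norm W))"
      unfolding mehler1_def W_def[symmetric] by (simp add: norm_divide norm_mult)
    also have "\<dots> \<le> exp (- \<gamma> * (y - c * x)\<^sup>2) / (sqrt pi * sqrt (norm W))"
      using Re by (intro divide_right_mono) auto
    finally show ?thesis by (simp add: real_sqrt_mult)
  qed
  then show ?thesis unfolding W_def \<gamma>_def by blast
qed

section \<open>Hermite functions in several variables\<close>

lemma prod_split_one:
  fixes f :: "'d::finite \<Rightarrow> 'a::comm_monoid_mult"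
  shows "(\<Prod>j\<in>UNIV. f j) = f i * (\<Prod>j\<in>UNIV - {i}. f j)"
  by (simp add: prod.remove)

lemma hermite_fun_upd:
  "hermite_fun (\<beta>(i := n)) x = hermite_fun1 n (x $ i) * (\<Prod>j\<in>UNIV - {i}. hermite_fun1 (\<beta> j) (x $ j))"
  unfolding hermite_fun_def prod_split_one[where i = i] by (auto intro!: prod.cong)

lemma hermite_fun_split:
  "hermite_fun \<beta> x = hermite_fun1 (\<beta> i) (x $ i) * (\<Prod>j\<in>UNIV - {i}. hermite_fun1 (\<beta> j) (x $ j))"
  using hermite_fun_upd[of \<beta> i "\<beta> i" x] by simp

lemma hermite_fun_mult:
  "x $ i * hermite_fun \<beta> x = sqrt (real (Suc (\<beta> i)) / 2) * hermite_fun (\<beta>(i := Suc (\<beta> i))) x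
     + sqrt (real (\<beta> i) / 2) * hermite_fun (\<beta>(i := \<beta> i - 1)) x"
proof -
  have "x $ i * hermite_fun \<beta> x
      = (x $ i * hermite_fun1 (\<beta> i) (x $ i)) * (\<Prod>j\<in>UNIV - {i}. hermite_fun1 (\<beta> j) (x $ j))"
    by (subst hermite_fun_split[of _ _ i]) simp
  then show ?thesis unfolding hermite_fun1_mult hermite_fun_upd by (simp add: algebra_simps)
qed

lemma hermite_fun_deriv:
  "((\<lambda>t. hermite_fun \<beta> (x + t *\<^sub>R axis i 1)) has_real_derivative
     sqrt (real (\<beta> i) / 2) * hermite_fun (\<beta>(i := \<beta> i - 1)) x
     - sqrt (real (Suc (\<beta> i)) / 2) * hermite_fun (\<beta>(i := Suc (\<beta> i))) x) (at 0)"
proof -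
  define R where "R = (\<Prod>j\<in>UNIV - {i}. hermite_fun1 (\<beta> j) (x $ j))"
  have eq: "hermite_fun \<beta> (x + t *\<^sub>R axis i 1) = hermite_fun1 (\<beta> i) (x $ i + t) * R" for t
    unfolding R_def by (subst hermite_fun_split[of _ _ i]) (auto simp: axis_def intro!: prod.cong)
  have "((\<lambda>t. hermite_fun1 (\<beta> i) (x $ i + t)) has_real_derivative
      (sqrt (real (\<beta> i) / 2) * hermite_fun1 (\<beta> i - 1) (x $ i)
       - sqrt (real (Suc (\<beta> i)) / 2) * hermite_fun1 (Suc (\<beta> i)) (x $ i))) (at 0)"
    using hermite_fun1_deriv[of "\<beta> i" "x $ i"]
    by (simp add: DERIV_shift[of "hermite_fun1 (\<beta> i)" _ 0 "x $ i", simplified add.commute[of _ "x $ i"] add_0_right, symmetric])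
  from DERIV_cmult_right[OF this, of R] show ?thesis
    unfolding eq hermite_fun_upd R_def[symmetric] by (simp add: algebra_simps)
qed

lemma hermite_fun1_differentiable: "hermite_fun1 n differentiable (at t)"
  using hermite_fun1_deriv real_differentiable_def by blast

lemma hermite_fun_differentiable: "hermite_fun \<beta> differentiable (at x)"
proof -
  have *: "(\<lambda>x. hermite_fun1 (\<beta> i) (x $ i)) differentiable (at x)" for i
    using differentiable_compose[of "hermite_fun1 (\<beta> i)" "\<lambda>x. x $ i" x UNIV]
      hermite_fun1_differentiable bounded_linear_imp_differentiable[OF bounded_linear_vec_nth] by blast
  have "(\<lambda>x. \<Prod>i\<in>A. hermite_fun1 (\<beta> i) (x $ i)) differentiable (at x)" if "finite A" for A
    using that by (induction A rule: finite_induct) (auto intro!: differentiable_mult *)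
  then show ?thesis unfolding hermite_fun_def[abs_def] by simp
qed

lemma hermite_fun_continuous: "continuous_on UNIV (hermite_fun \<beta>)"
  using hermite_fun_differentiable differentiable_imp_continuous_within continuous_on_eq_continuous_within
  by blast

lemma hermite_fun_measurable [measurable]: "hermite_fun \<beta> \<in> borel_measurable borel"
  by (rule borel_measurable_continuous_onI[OF hermite_fun_continuous])

section \<open>Multi-indices of given total degree\<close>

lemma multi_deg_ge: "\<beta> i \<le> multi_deg (\<beta> :: 'd::finite \<Rightarrow> nat)"
  by (rule member_le_sum) auto

lemma hermite_fun_bound:
  fixes \<beta> :: "'d::finite \<Rightarrow> nat"
  shows "\<bar>hermite_fun \<beta> x\<bar> \<le> 3 ^ CARD('d) * (1 + real (multi_deg \<beta>)) ^ CARD('d)"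
proof -
  have "\<bar>hermite_fun \<beta> x\<bar> = (\<Prod>i\<in>UNIV. \<bar>hermite_fun1 (\<beta> i) (x $ i)\<bar>)"
    unfolding hermite_fun_def by (rule abs_prod)
  also have "\<dots> \<le> (\<Prod>i\<in>(UNIV::'d set). 3 * (1 + real (multi_deg \<beta>)))"
  proof (intro prod_mono conjI)
    fix i :: 'd
    have "\<bar>hermite_fun1 (\<beta> i) (x $ i)\<bar> \<le> 3 * real (\<beta> i + 1)" by (rule hermite_fun1_bound)
    also have "\<dots> \<le> 3 * real (multi_deg \<beta> + 1)"
      using multi_deg_ge[of \<beta> i] by (intro mult_left_mono of_nat_mono add_right_mono) auto
    finally show "\<bar>hermite_fun1 (\<beta> i) (x $ i)\<bar> \<le> 3 * (1 + real (multi_deg \<beta>))"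
      by (simp del: of_nat_sum)
  qed auto
  also have "\<dots> = 3 ^ CARD('d) * (1 + real (multi_deg \<beta>)) ^ CARD('d)"
    by (simp only: prod_constant power_mult_distrib)
  finally show ?thesis .
qed

lemma multi_deg_le_subset: "{\<beta> :: 'd::finite \<Rightarrow> nat. multi_deg \<beta> \<le> n} \<subseteq> PiE UNIV (\<lambda>_. {..n})"
  by (auto simp: PiE_UNIV_domain intro: order_trans[OF multi_deg_ge])

lemma finite_multi_deg_le [simp]: "finite {\<beta> :: 'd::finite \<Rightarrow> nat. multi_deg \<beta> \<le> n}"
  by (rule finite_subset[OF multi_deg_le_subset]) (auto intro: finite_PiE)

lemma finite_multi_deg [simp]: "finite {\<beta> :: 'd::finite \<Rightarrow> nat. multi_deg \<beta> = n}"
  by (rule finite_subset[OF _ finite_multi_deg_le[of n]]) auto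

lemma card_multi_deg: "card {\<beta> :: 'd::finite \<Rightarrow> nat. multi_deg \<beta> = n} \<le> (n + 1) ^ CARD('d)"
proof -
  have "card {\<beta> :: 'd::finite \<Rightarrow> nat. multi_deg \<beta> = n} \<le> card (PiE (UNIV :: 'd set) (\<lambda>_. {..n}))"
    using multi_deg_le_subset[of n] by (intro card_mono finite_PiE) auto
  then show ?thesis by (simp add: card_PiE)
qed

lemma multi_deg_0_iff: "multi_deg (\<beta> :: 'd::finite \<Rightarrow> nat) = 0 \<longleftrightarrow> \<beta> = (\<lambda>_. 0)"
  by auto

lemma multi_deg_inc: "multi_deg (\<beta>(i := Suc (\<beta> i))) = Suc (multi_deg (\<beta> :: 'd::finite \<Rightarrow> nat))"
  by (simp add: sum.remove[of UNIV i] sum.remove[of UNIV i "\<beta>"])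

lemma multi_deg_dec: "\<beta> i > 0 \<Longrightarrow> Suc (multi_deg (\<beta>(i := \<beta> i - 1))) = multi_deg (\<beta> :: 'd::finite \<Rightarrow> nat)"
  by (simp add: sum.remove[of UNIV i] sum.remove[of UNIV i "\<beta>"])

lemma multi_deg_dec_le: "multi_deg (\<beta>(i := \<beta> i - 1)) \<le> multi_deg (\<beta> :: 'd::finite \<Rightarrow> nat)"
  by (simp add: sum.remove[of UNIV i] sum.remove[of UNIV i "\<beta>"])

lemma sum_multi_deg_le:
  fixes g :: "('d::finite \<Rightarrow> nat) \<Rightarrow> 'a::comm_monoid_add"
  shows "(\<Sum>\<beta> | multi_deg \<beta> \<le> n. g \<beta>) = (\<Sum>\<nu>\<le>n. \<Sum>\<beta> | multi_deg \<beta> = \<nu>. g \<beta>)"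
proof -
  have "{\<beta> :: 'd \<Rightarrow> nat. multi_deg \<beta> \<le> n} = (\<Union>\<nu>\<in>{..n}. {\<beta>. multi_deg \<beta> = \<nu>})" by auto
  then show ?thesis by (simp only:) (rule sum.UNION_disjoint, auto)
qed

lemma sum_multi_deg_bound:
  fixes g :: "('d::finite \<Rightarrow> nat) \<Rightarrow> 'a::real_normed_vector"
  assumes "\<And>\<beta>. multi_deg \<beta> = n \<Longrightarrow> norm (g \<beta>) \<le> B"
  shows "norm (\<Sum>\<beta> | multi_deg \<beta> = n. g \<beta>) \<le> (1 + real n) ^ CARD('d) * B"
proof -
  have "B \<ge> 0"
  proof -
    \<comment> \<open>To see \<open>B \<ge> 0\<close> some multi-index of degree \<open>n\<close>
      must be exhibited: the whole degree is put on one coordinate.\<close>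
    have "multi_deg ((\<lambda>_. 0)(undefined := n) :: 'd \<Rightarrow> nat) = n" by (simp add: fun_upd_def)
    from assms[OF this] show ?thesis by (meson norm_ge_zero order_trans)
  qed
  have "norm (\<Sum>\<beta> | multi_deg \<beta> = n. g \<beta>) \<le> real (card {\<beta> :: 'd \<Rightarrow> nat. multi_deg \<beta> = n}) * B"
    using assms by (intro order_trans[OF norm_sum] sum_bounded_above) auto
  also have "\<dots> \<le> real ((n + 1) ^ CARD('d)) * B"
    using card_multi_deg[where 'd='d] \<open>B \<ge> 0\<close> by (intro mult_right_mono of_nat_mono) auto
  finally show ?thesis by (simp add: add.commute)
qed

text \<open>Unconditional summability over all multi-indices permits grouping into the finite shells
  of constant degree.\<close>

lemma sum_has_sum_by_degree:
  fixes g :: "('d::finite \<Rightarrow> nat) \<Rightarrow> complex"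
  assumes "(g has_sum S) UNIV"
  shows "(\<lambda>\<nu>. \<Sum>\<beta> | multi_deg \<beta> = \<nu>. g \<beta>) sums S"
proof -
  have "((\<lambda>(\<nu>, \<beta>). g \<beta>) has_sum S) (Sigma UNIV (\<lambda>\<nu>. {\<beta>. multi_deg \<beta> = \<nu>}))"
    by (rule has_sum_reindex_bij_witness[where i = "\<lambda>\<beta>. (multi_deg \<beta>, \<beta>)" and j = snd and h = g
          and T = UNIV, THEN iffD2]) (use assms in auto)
  then have "((\<lambda>\<nu>. \<Sum>\<beta> | multi_deg \<beta> = \<nu>. g \<beta>) has_sum S) UNIV"
    by (rule has_sum_SigmaD) (auto intro: has_sum_finite)
  then show ?thesis by (rule has_sum_imp_sums)
qed

section \<open>The Mehler kernel in several variables\<close>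

definition mehler :: "complex \<Rightarrow> real ^ 'd::finite \<Rightarrow> real ^ 'd \<Rightarrow> complex" where
  "mehler r x y = (\<Prod>i\<in>UNIV. mehler1 r (x $ i) (y $ i))"

text \<open>The finite product of absolutely convergent series is multiplied out over all
  multi-indices; on the shell of degree \<open>\<nu>\<close> the powers \<open>r ^ \<beta> i\<close>
  combine to \<open>r ^ \<nu>\<close>.\<close>

lemma mehler_sums:
  fixes x y :: "real ^ 'd::finite"
  assumes r: "norm r < 1"
  shows "(\<lambda>\<nu>. complex_of_real (hermite_kernel \<nu> x y) * r ^ \<nu>) sums mehler r x y"
proof -
  define f where "f i n = complex_of_real (hermite_fun1 n (x $ i) * hermite_fun1 n (y $ i)) * r ^ n" for i n
  have ab: "(\<lambda>n. norm (f i n)) summable_on UNIV" for i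
    using mehler1_abs_summable[OF r, of "x $ i" "y $ i"]
    by (auto simp: f_def[abs_def] intro!: norm_summable_imp_summable_on)
  have U: "PiE UNIV (\<lambda>_. UNIV) = (UNIV :: ('d \<Rightarrow> nat) set)"
    by (simp add: PiE_UNIV_domain)
  have "infsum (f i) UNIV = mehler1 r (x $ i) (y $ i)" for i
  proof -
    have "(f i has_sum mehler1 r (x $ i) (y $ i)) UNIV"
      unfolding f_def using mehler1_abs_summable[OF r] mehler1_sums[OF r]
      by (intro norm_summable_imp_has_sum) auto
    then show ?thesis by (rule infsumI)
  qed
  moreover have "(\<lambda>g. \<Prod>i\<in>UNIV. f i (g i)) summable_on (PiE UNIV (\<lambda>_. UNIV))"
  proof -
    have "(\<lambda>g. norm (\<Prod>i\<in>UNIV. f i (g i))) summable_on (PiE UNIV (\<lambda>_. UNIV))"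
      by (rule abs_summable_equivalent[THEN iffD2], rule abs_summable_on_prod_PiE)
         (use ab abs_summable_equivalent in \<open>auto\<close>)
    then show ?thesis by (rule abs_summable_summable)
  qed
  moreover have "infsum (\<lambda>g. \<Prod>i\<in>UNIV. f i (g i)) (PiE UNIV (\<lambda>_. UNIV)) = (\<Prod>i\<in>UNIV. infsum (f i) UNIV)"
    by (rule infsum_prod_PiE_abs) (use ab in auto)
  ultimately have "((\<lambda>g. \<Prod>i\<in>UNIV. f i (g i)) has_sum mehler r x y) UNIV"
    using U unfolding mehler_def has_sum_iff by simp
  then have "(\<lambda>\<nu>. \<Sum>\<beta> | multi_deg \<beta> = \<nu>. \<Prod>i\<in>UNIV. f i (\<beta> i)) sums mehler r x y"
    by (rule sum_has_sum_by_degree)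
  moreover have "(\<Sum>\<beta> | multi_deg \<beta> = \<nu>. \<Prod>i\<in>UNIV. f i (\<beta> i)) = complex_of_real (hermite_kernel \<nu> x y) * r ^ \<nu>" for \<nu>
    unfolding hermite_kernel_def hermite_fun_def f_def of_real_sum sum_distrib_right
    by (intro sum.cong) (auto simp: prod.distrib power_sum)
  ultimately show ?thesis by simp
qed

text \<open>In the exponent, one \<open>CARD('d)\<close> counts the multi-indices of degree
  \<open>\<nu>\<close>, and each of the two Hermite functions contributes another.\<close>

lemma hermite_kernel_bound:
  fixes x y :: "real ^ 'd::finite"
  shows "\<bar>hermite_kernel \<nu> x y\<bar> \<le> 9 ^ CARD('d) * (1 + real \<nu>) ^ (3 * CARD('d))"
proof -
  have "norm (hermite_fun \<beta> x * hermite_fun \<beta> y) \<le> 9 ^ CARD('d) * (1 + real \<nu>) ^ (2 * CARD('d))"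
    if "multi_deg \<beta> = \<nu>" for \<beta>
  proof -
    have "norm (hermite_fun \<beta> x * hermite_fun \<beta> y)
       \<le> (3 ^ CARD('d) * (1 + real \<nu>) ^ CARD('d)) * (3 ^ CARD('d) * (1 + real \<nu>) ^ CARD('d))"
      unfolding real_norm_def abs_mult using hermite_fun_bound[of \<beta> x] hermite_fun_bound[of \<beta> y] that
      by (intro mult_mono) auto
    also have "\<dots> = 9 ^ CARD('d) * (1 + real \<nu>) ^ (2 * CARD('d))"
    proof -
      have "(9::real) ^ CARD('d) = 3 ^ CARD('d) * 3 ^ CARD('d)" by (simp flip: power_mult_distrib)
      then show ?thesis unfolding mult_2 power_add by (simp only: mult_ac)
    qed
    finally show ?thesis .
  qed
  then have "norm (hermite_kernel \<nu> x y) \<le> (1 + real \<nu>) ^ CARD('d) * (9 ^ CARD('d) * (1 + real \<nu>) ^ (2 * CARD('d)))"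
    unfolding hermite_kernel_def by (rule sum_multi_deg_bound)
  also have "\<dots> = 9 ^ CARD('d) * (1 + real \<nu>) ^ (CARD('d) + 2 * CARD('d))"
    by (simp only: power_add mult_ac)
  finally show ?thesis by simp
qed

section \<open>Powers of extended non-negative reals\<close>

lemma ennpowr_ennreal: "t \<ge> 0 \<Longrightarrow> ennpowr (ennreal t) r = ennreal (t powr r)"
  by (simp add: ennpowr_def)

lemma ennpowr_top [simp]: "ennpowr \<infinity> r = \<infinity>" "ennpowr top r = top"
  by (simp_all add: ennpowr_def)

lemma ennpowr_0 [simp]: "ennpowr 0 r = 0"
  by (simp add: ennpowr_def)

lemma ennpowr_1_right [simp]: "ennpowr x 1 = x"
  by (cases x) (auto simp: ennpowr_ennreal)

lemma ennpowr_mono: "r \<ge> 0 \<Longrightarrow> x \<le> y \<Longrightarrow> ennpowr x r \<le> ennpowr y r"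
  by (cases x; cases y) (auto simp: ennpowr_ennreal top_unique intro!: powr_mono2)

lemma ennpowr_mult: "r > 0 \<Longrightarrow> ennpowr (x * y) r = ennpowr x r * ennpowr y r"
proof (cases x; cases y)
  fix s t assume "r > 0" "0 \<le> s" "x = ennreal s" "0 \<le> t" "y = ennreal t"
  then show ?thesis by (simp add: ennpowr_ennreal powr_mult flip: ennreal_mult)
next
  fix s assume *: "r > 0" "0 \<le> s" "x = ennreal s" "y = top"
  then show ?thesis by (cases "s = 0") (auto simp: ennpowr_ennreal ennreal_mult_top)
next
  fix s assume *: "r > 0" "0 \<le> s" "y = ennreal s" "x = top"
  then show ?thesis by (cases "s = 0") (auto simp: ennpowr_ennreal ennreal_top_mult)
qed (auto simp: ennreal_top_mult)

lemma ennpowr_ennpowr: "ennpowr (ennpowr x r) s = ennpowr x (r * s)"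
  by (cases x) (auto simp: ennpowr_ennreal powr_powr)

lemma ennpowr_inverse_cancel [simp]: "r \<noteq> 0 \<Longrightarrow> ennpowr (ennpowr x r) (1 / r) = x"
  "r \<noteq> 0 \<Longrightarrow> ennpowr (ennpowr x (1 / r)) r = x"
  unfolding ennpowr_ennpowr by simp_all

lemma ennpowr_le_iff: "r > 0 \<Longrightarrow> ennpowr x (1 / r) \<le> y \<longleftrightarrow> x \<le> ennpowr y r"
  using ennpowr_mono[of r "ennpowr x (1 / r)" y] ennpowr_mono[of "1 / r" x "ennpowr y r"] by auto

lemma ennpowr_eq_top_iff [simp]: "ennpowr x r = top \<longleftrightarrow> x = top"
  by (cases x) (auto simp: ennpowr_ennreal)

lemma ennpowr_eq_0_iff [simp]: "ennpowr x r = 0 \<longleftrightarrow> x = 0"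
  by (cases x) (auto simp: ennpowr_ennreal)

lemma ennpowr_measurable [measurable (raw)]:
  assumes f: "f \<in> borel_measurable M"
  shows "(\<lambda>x. ennpowr (f x) r) \<in> borel_measurable M"
proof -
  have "(\<lambda>x. ennpowr x r) \<in> borel_measurable borel"
    unfolding ennpowr_def by (intro measurable_If) auto
  from measurable_compose[OF f this] show ?thesis .
qed

text \<open>The convex power lies above its tangent at \<open>m\<close>, with equality at
  \<open>x = m\<close>. In this affine form the inequality can be integrated, infinite values
  included.\<close>

lemma young_ennreal:
  assumes "p \<ge> 1" "m > 0"
  shows "x \<le> ennreal (m powr (1 - p) / p) * ennpowr x p + ennreal ((1 - 1 / p) * m)"
proof (cases x)
  case (real t)
  have "t \<le> m powr (1 - p) / p * t powr p + (1 - 1 / p) * m"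
  proof (cases "p = 1")
    case False
    then have p: "p > 1" using assms by simp
    define q where "q = p / (p - 1)"
    have q: "q > 1" "1 / p + 1 / q = 1" unfolding q_def using p by (auto simp: field_simps)
    have "t / m * 1 \<le> (t / m) powr p / p + 1 powr q / q"
      using Youngs_inequality[of p q "t / m" 1] p q real assms by simp
    also have "1 powr q / q = 1 - 1 / p" using q by simp
    finally have "t \<le> ((t / m) powr p / p + (1 - 1 / p)) * m" using assms by (simp add: pos_divide_le_eq)
    also have "\<dots> = m powr (1 - p) / p * t powr p + (1 - 1 / p) * m"
      using assms real by (simp add: powr_divide powr_diff field_simps)
    finally show ?thesis .
  qed (use real assms in auto)
  then show ?thesis using real assms
    by (simp add: ennpowr_ennreal flip: ennreal_mult ennreal_plus)
next
  case top
  then show ?thesis using assms by (simp add: ennreal_mult_top)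
qed

lemma nn_integral_jensen:
  assumes [measurable]: "u \<in> borel_measurable M"
  assumes mass: "emeasure M (space M) \<le> 1" and p: "p \<ge> 1"
  shows "ennpowr (\<integral>\<^sup>+x. u x \<partial>M) p \<le> (\<integral>\<^sup>+x. ennpowr (u x) p \<partial>M)"
proof -
  define A where "A = (\<integral>\<^sup>+x. ennpowr (u x) p \<partial>M)"
  consider "A = top" | "A = 0" | a where "A = ennreal a" "a > 0"
    by (cases A) (auto simp: less_eq_real_def)
  then have "(\<integral>\<^sup>+x. u x \<partial>M) \<le> ennpowr A (1 / p)"
  proof cases
    case 2
    then have "AE x in M. ennpowr (u x) p = 0" unfolding A_def by (subst (asm) nn_integral_0_iff_AE) auto
    then have "(\<integral>\<^sup>+x. u x \<partial>M) = 0" by (subst nn_integral_0_iff_AE) auto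
    then show ?thesis by simp
  next
    case (3 a)
    \<comment> \<open>The tangent is taken at the \<open>p\<close>-mean, where Young's inequality is
      sharp. The constant term is nonnegative, so total mass at most 1 is enough.\<close>
    define m where "m = a powr (1 / p)"
    have m: "m > 0" unfolding m_def using 3 by simp
    have mp: "m powr p = a" unfolding m_def using 3 p by (simp add: powr_powr)
    have "(\<integral>\<^sup>+x. u x \<partial>M)
       \<le> (\<integral>\<^sup>+x. ennreal (m powr (1 - p) / p) * ennpowr (u x) p + ennreal ((1 - 1 / p) * m) \<partial>M)"
      by (intro nn_integral_mono young_ennreal p m)
    also have "\<dots> = ennreal (m powr (1 - p) / p) * A + ennreal ((1 - 1 / p) * m) * emeasure M (space M)"
      unfolding A_def by (subst nn_integral_add) (auto simp: nn_integral_cmult)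
    also have "\<dots> \<le> ennreal (m powr (1 - p) / p) * A + ennreal ((1 - 1 / p) * m) * 1"
      by (intro add_mono mult_left_mono mass) auto
    also have "\<dots> = ennreal m"
    proof -
      have "m powr (1 - p) / p * a + (1 - 1 / p) * m = m"
        unfolding mp[symmetric] using m p by (simp add: powr_diff field_simps)
      then show ?thesis unfolding 3 using m p 3 by (simp flip: ennreal_mult ennreal_plus)
    qed
    also have "\<dots> = ennpowr A (1 / p)" unfolding m_def 3 using 3 by (simp add: ennpowr_ennreal)
    finally show ?thesis .
  qed auto
  then have "ennpowr (\<integral>\<^sup>+x. u x \<partial>M) p \<le> ennpowr (ennpowr A (1 / p)) p"
    using p by (intro ennpowr_mono) auto
  also have "\<dots> = A" using p by simp
  finally show ?thesis unfolding A_def .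
qed

text \<open>Jensen for the sub-probability measure with density \<open>w\<close>: the common source
  of Minkowski's inequality, Schur's test and the pairing bound below.\<close>

lemma nn_integral_jensen_density:
  assumes [measurable]: "u \<in> borel_measurable M" "w \<in> borel_measurable M"
  assumes mass: "(\<integral>\<^sup>+x. w x \<partial>M) \<le> 1" and p: "p \<ge> 1"
  shows "ennpowr (\<integral>\<^sup>+x. w x * u x \<partial>M) p \<le> (\<integral>\<^sup>+x. w x * ennpowr (u x) p \<partial>M)"
  using nn_integral_jensen[of u "density M w" p] mass p
  by (simp add: nn_integral_density emeasure_density cong: nn_integral_cong)

lemma suminf_jensen:
  fixes u w :: "nat \<Rightarrow> ennreal"
  assumes "(\<Sum>j. w j) \<le> 1" "p \<ge> 1"
  shows "ennpowr (\<Sum>j. w j * u j) p \<le> (\<Sum>j. w j * ennpowr (u j) p)"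
  using nn_integral_jensen_density[of u "count_space UNIV" w p] assms
  by (simp add: nn_integral_count_space_nat)

section \<open>The \<open>L\<^sup>p\<close> norm of extended non-negative functions\<close>

text \<open>Extended values admit infinite series and kernel integrals as arguments before any
  convergence is known.\<close>

definition lpn :: "ennreal \<Rightarrow> (real ^ 'd::finite \<Rightarrow> ennreal) \<Rightarrow> ennreal" where
  "lpn p u = (if p = \<infinity> then esssup lborel u
     else ennpowr (\<integral>\<^sup>+x. ennpowr (u x) (enn2real p) \<partial>lborel) (1 / enn2real p))"

lemma lp_norm_eq_lpn: "lp_norm p F = lpn p (\<lambda>x. ennreal (norm (F x)))"
  by (simp add: lp_norm_def lpn_def ennpowr_ennreal)

lemma enn2real_ge_1: "1 \<le> p \<Longrightarrow> p \<noteq> \<infinity> \<Longrightarrow> enn2real p \<ge> 1"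
  by (cases p) (auto simp: ennreal_le_iff2 simp flip: ennreal_1)

lemma lpn_le_iff:
  assumes "1 \<le> p" "p \<noteq> \<infinity>"
  shows "lpn p u \<le> c \<longleftrightarrow> (\<integral>\<^sup>+x. ennpowr (u x) (enn2real p) \<partial>lborel) \<le> ennpowr c (enn2real p)"
  using enn2real_ge_1[OF assms] assms(2) by (simp add: lpn_def ennpowr_le_iff)

lemma lpn_powr:
  assumes "1 \<le> p" "p \<noteq> \<infinity>"
  shows "ennpowr (lpn p u) (enn2real p) = (\<integral>\<^sup>+x. ennpowr (u x) (enn2real p) \<partial>lborel)"
  using enn2real_ge_1[OF assms] assms(2) by (simp add: lpn_def)

lemma lpn_mono_AE:
  assumes [measurable]: "u \<in> borel_measurable lborel" "v \<in> borel_measurable lborel"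
  assumes p: "1 \<le> p" and le: "AE x in lborel. u x \<le> v x"
  shows "lpn p u \<le> lpn p v"
proof (cases "p = \<infinity>")
  case True
  then show ?thesis using le by (simp add: lpn_def esssup_AE_mono)
next
  case False
  have "(\<integral>\<^sup>+x. ennpowr (u x) (enn2real p) \<partial>lborel) \<le> (\<integral>\<^sup>+x. ennpowr (v x) (enn2real p) \<partial>lborel)"
    using le by (intro nn_integral_mono_AE) (auto elim!: eventually_mono intro: ennpowr_mono)
  then show ?thesis unfolding lpn_le_iff[OF p False] lpn_powr[OF p False] .
qed

lemma lpn_cong_AE:
  assumes "u \<in> borel_measurable lborel" "v \<in> borel_measurable lborel"
  assumes p: "1 \<le> p" and eq: "AE x in lborel. u x = v x"
  shows "lpn p u = lpn p v"
  using eq by (intro antisym lpn_mono_AE assms) auto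

lemma lpn_cmult_le:
  assumes [measurable]: "u \<in> borel_measurable lborel" and p: "1 \<le> p"
  shows "lpn p (\<lambda>x. c * u x) \<le> c * lpn p u"
proof (cases "p = \<infinity>")
  case True
  have "AE x in lborel. c * u x \<le> c * esssup lborel u"
    using esssup_AE[of u lborel] by eventually_elim (rule mult_left_mono, auto)
  then have "esssup lborel (\<lambda>x. c * u x) \<le> c * esssup lborel u" by (intro esssup_I) auto
  then show ?thesis using True by (simp add: lpn_def)
next
  case False
  then show ?thesis using enn2real_ge_1[OF p False]
    by (simp add: lpn_le_iff[OF p False] ennpowr_mult lpn_powr[OF p False] nn_integral_cmult)
qed

lemma lpn_0 [simp]: "1 \<le> p \<Longrightarrow> lpn p (\<lambda>x. 0) = 0"
  using lpn_cmult_le[of "\<lambda>x. 0" p 0] by simp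

text \<open>Minkowski's inequality from Jensen: with weights \<open>w j = c j / C\<close>
  proportional to the norms, the sum is \<open>C\<close> times the weighted mean of the
  \<open>u j / c j\<close>, and each of these has \<open>p\<close>-th moment at most 1.\<close>

lemma lpn_suminf_le:
  fixes u :: "nat \<Rightarrow> real ^ 'd::finite \<Rightarrow> ennreal"
  assumes [measurable]: "\<And>j. u j \<in> borel_measurable lborel" and p: "1 \<le> p"
  shows "lpn p (\<lambda>x. \<Sum>j. u j x) \<le> (\<Sum>j. lpn p (u j))"
proof (cases "p = \<infinity>")
  case True
  have "AE x in lborel. \<forall>j. u j x \<le> esssup lborel (u j)"
    unfolding AE_all_countable by (intro allI esssup_AE)
  then have "AE x in lborel. (\<Sum>j. u j x) \<le> (\<Sum>j. esssup lborel (u j))"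
    by eventually_elim (rule suminf_le, auto)
  then show ?thesis using True by (auto simp: lpn_def intro!: esssup_I)
next
  case False
  define P where "P = enn2real p"
  have P: "P \<ge> 1" unfolding P_def by (rule enn2real_ge_1[OF p False])
  define S where "S = (\<Sum>j. lpn p (u j))"
  show ?thesis unfolding S_def[symmetric]
  proof (rule ennreal_le_epsilon)
    fix e :: real assume S: "S < top" and e: "e > 0"
    \<comment> \<open>A positive summable perturbation keeps every weight nonzero even if some
      \<open>lpn p (u j)\<close> vanishes; its total \<open>e\<close> is arbitrary.\<close>
    define d where "d j = ennreal (e * (1 / 2) ^ Suc j)" for j
    define c where "c j = lpn p (u j) + d j" for j
    have sd: "(\<Sum>j. d j) = ennreal e"
      unfolding d_def using power_half_series e
      by (intro suminf_ennreal_eq) (auto dest: sums_mult[of _ _ e])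
    have sc: "(\<Sum>j. c j) = S + ennreal e"
      unfolding c_def S_def sd[symmetric] by (intro suminf_add[symmetric]) auto
    define C where "C = S + ennreal e"
    have C: "C \<noteq> 0" "C \<noteq> top" unfolding C_def using S e by auto
    have cj: "c j \<noteq> 0" "c j \<noteq> top" for j
    proof -
      show "c j \<noteq> 0" unfolding c_def d_def using e by (auto simp: ennreal_eq_0_iff not_le)
      have "sum c {j} \<le> (\<Sum>j. c j)" by (rule sum_le_suminf) auto
      then show "c j \<noteq> top" using C unfolding sc C_def by (auto simp: top_unique)
    qed
    define w where "w j = c j / C" for j
    have sw: "(\<Sum>j. w j) = 1" unfolding w_def using sc C by (simp add: C_def[symmetric] ennreal_suminf_divide ennreal_divide_self less_top)
    have pt: "ennpowr (\<Sum>j. u j x) P \<le> ennpowr C P * (\<Sum>j. w j * (ennpowr (u j x) P / ennpowr (c j) P))" for x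
    proof -
      have "u j x = C * (w j * (u j x / c j))" for j
      proof -
        have "C * (w j * (u j x / c j)) = (C / C) * (c j / c j) * u j x"
          unfolding w_def by (simp add: divide_ennreal_def mult_ac)
        then show ?thesis using C cj[of j] by (simp add: ennreal_divide_self less_top)
      qed
      then have "(\<Sum>j. u j x) = C * (\<Sum>j. w j * (u j x / c j))"
        by (simp only: ennreal_suminf_cmult[symmetric])
      then have "ennpowr (\<Sum>j. u j x) P = ennpowr C P * ennpowr (\<Sum>j. w j * (u j x / c j)) P"
        using P by (simp add: ennpowr_mult)
      also have "\<dots> \<le> ennpowr C P * (\<Sum>j. w j * ennpowr (u j x / c j) P)"
        using sw P by (intro mult_left_mono suminf_jensen) auto
      also have "(\<lambda>j. w j * ennpowr (u j x / c j) P) = (\<lambda>j. w j * (ennpowr (u j x) P / ennpowr (c j) P))"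
      proof
        fix j
        obtain r where r: "c j = ennreal r" "r > 0"
          using cj[of j] by (cases "c j") (auto simp: less_eq_real_def)
        then show "w j * ennpowr (u j x / c j) P = w j * (ennpowr (u j x) P / ennpowr (c j) P)"
          using P by (simp add: divide_ennreal_def ennpowr_mult inverse_ennreal ennpowr_ennreal inverse_powr)
      qed
      finally show ?thesis .
    qed
    have "(\<integral>\<^sup>+x. ennpowr (\<Sum>j. u j x) P \<partial>lborel)
        \<le> (\<integral>\<^sup>+x. ennpowr C P * (\<Sum>j. w j * (ennpowr (u j x) P / ennpowr (c j) P)) \<partial>lborel)"
      by (intro nn_integral_mono pt)
    also have "\<dots> = ennpowr C P * (\<Sum>j. w j * ((\<integral>\<^sup>+x. ennpowr (u j x) P \<partial>lborel) / ennpowr (c j) P))"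
      by (simp add: nn_integral_cmult nn_integral_suminf divide_ennreal_def nn_integral_multc)
    also have "\<dots> \<le> ennpowr C P * (\<Sum>j. w j * 1)"
    proof (intro mult_left_mono suminf_le)
      fix j
      have "(\<integral>\<^sup>+x. ennpowr (u j x) P \<partial>lborel) \<le> ennpowr (c j) P"
        unfolding P_def lpn_powr[OF p False, symmetric] c_def by (intro ennpowr_mono) auto
      then have "(\<integral>\<^sup>+x. ennpowr (u j x) P \<partial>lborel) / ennpowr (c j) P \<le> ennpowr (c j) P / ennpowr (c j) P"
        by (rule divide_right_mono_ennreal)
      also have "\<dots> = 1" using cj[of j] P by (intro ennreal_divide_self) (auto simp: less_top[symmetric])
      finally show "(\<integral>\<^sup>+x. ennpowr (u j x) P \<partial>lborel) / ennpowr (c j) P \<le> 1" .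
    qed auto
    also have "\<dots> = ennpowr C P" using sw by simp
    finally show "lpn p (\<lambda>x. \<Sum>j. u j x) \<le> S + ennreal e"
      unfolding lpn_le_iff[OF p False] P_def C_def .
  qed
qed

lemma lpn_add_le:
  assumes [measurable]: "u \<in> borel_measurable lborel" "v \<in> borel_measurable lborel" and p: "1 \<le> p"
  shows "lpn p (\<lambda>x. u x + v x) \<le> lpn p u + lpn p v"
proof -
  define w where "w j = (if j = 0 then u else if j = Suc 0 then v else (\<lambda>_. 0))" for j :: nat
  have [measurable]: "w j \<in> borel_measurable lborel" for j unfolding w_def by auto
  have "(\<Sum>j. f j) = f 0 + f 1" if "\<And>j. j \<ge> 2 \<Longrightarrow> f j = 0" for f :: "nat \<Rightarrow> ennreal"
    by (subst suminf_finite[of "{0, 1}"]) (use that in auto)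
  note two = this
  have "lpn p (\<lambda>x. \<Sum>j. w j x) \<le> (\<Sum>j. lpn p (w j))" by (rule lpn_suminf_le) (use p in auto)
  also have "\<dots> = lpn p u + lpn p v" by (subst two) (use p in \<open>auto simp: w_def\<close>)
  also have "(\<lambda>x. \<Sum>j. w j x) = (\<lambda>x. u x + v x)" by (subst two) (auto simp: w_def)
  finally show ?thesis .
qed

text \<open>Schur's test. After division by \<open>C\<close> each row is a sub-probability density,
  so Jensen moves the power inside the integral over \<open>y\<close>; Tonelli and the column bound
  then remove the kernel. For \<open>p = \<infinity>\<close> the row bound is integrated
  directly.\<close>

lemma lpn_schur:
  fixes k :: "real ^ 'd::finite \<Rightarrow> real ^ 'd \<Rightarrow> ennreal"
  assumes k [measurable]: "(\<lambda>(x, y). k x y) \<in> borel_measurable (lborel \<Otimes>\<^sub>M lborel)"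
    and u [measurable]: "u \<in> borel_measurable lborel"
  assumes C: "C > 0" and row: "\<And>x. (\<integral>\<^sup>+y. k x y \<partial>lborel) \<le> ennreal C"
    and col: "\<And>y. (\<integral>\<^sup>+x. k x y \<partial>lborel) \<le> ennreal C" and p: "1 \<le> p"
  shows "lpn p (\<lambda>x. \<integral>\<^sup>+y. k x y * u y \<partial>lborel) \<le> ennreal C * lpn p u"
proof (cases "p = \<infinity>")
  case True
  have "(\<integral>\<^sup>+y. k x y * u y \<partial>lborel) \<le> ennreal C * esssup lborel u" for x
  proof -
    have "(\<integral>\<^sup>+y. k x y * u y \<partial>lborel) \<le> (\<integral>\<^sup>+y. k x y * esssup lborel u \<partial>lborel)"
      using esssup_AE[of u lborel] by (intro nn_integral_mono_AE) (auto elim!: eventually_mono intro: mult_left_mono)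
    also have "\<dots> = (\<integral>\<^sup>+y. k x y \<partial>lborel) * esssup lborel u" by (rule nn_integral_multc) measurable
    also have "\<dots> \<le> ennreal C * esssup lborel u" by (intro mult_right_mono row) auto
    finally show ?thesis .
  qed
  then show ?thesis using True by (auto simp: lpn_def intro!: esssup_I)
next
  case False
  define P where "P = enn2real p"
  have P: "P \<ge> 1" unfolding P_def by (rule enn2real_ge_1[OF p False])
  have cancel: "ennreal C * ennreal (1 / C) = 1" using C by (simp flip: ennreal_mult)
  define w where "w x y = ennreal (1 / C) * k x y" for x y
  have [measurable]: "(\<lambda>(x, y). w x y) \<in> borel_measurable (lborel \<Otimes>\<^sub>M lborel)" unfolding w_def by measurable
  have kw: "k x y = ennreal C * w x y" for x y unfolding w_def mult.assoc[symmetric] cancel by simp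
  have w1: "(\<integral>\<^sup>+y. w x y \<partial>lborel) \<le> 1" "(\<integral>\<^sup>+x. w x y \<partial>lborel) \<le> 1" for x y
  proof -
    have "ennreal (1 / C) * I \<le> 1" if "I \<le> ennreal C" for I
      using mult_left_mono[OF that, of "ennreal (1 / C)"] cancel by (simp add: mult.commute)
    then show "(\<integral>\<^sup>+y. w x y \<partial>lborel) \<le> 1" "(\<integral>\<^sup>+x. w x y \<partial>lborel) \<le> 1"
      unfolding w_def using row[of x] col[of y] by (simp_all add: nn_integral_cmult)
  qed
  have pt: "ennpowr (\<integral>\<^sup>+y. k x y * u y \<partial>lborel) P \<le> ennpowr C P * (\<integral>\<^sup>+y. w x y * ennpowr (u y) P \<partial>lborel)" for x
  proof -
    have "ennpowr (\<integral>\<^sup>+y. k x y * u y \<partial>lborel) P = ennpowr (ennreal C * (\<integral>\<^sup>+y. w x y * u y \<partial>lborel)) P"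
      unfolding kw mult.assoc by (subst nn_integral_cmult) auto
    also have "\<dots> = ennpowr C P * ennpowr (\<integral>\<^sup>+y. w x y * u y \<partial>lborel) P" using P by (simp add: ennpowr_mult)
    also have "\<dots> \<le> ennpowr C P * (\<integral>\<^sup>+y. w x y * ennpowr (u y) P \<partial>lborel)"
      using P w1 by (intro mult_left_mono nn_integral_jensen_density) auto
    finally show ?thesis .
  qed
  have "(\<integral>\<^sup>+x. ennpowr (\<integral>\<^sup>+y. k x y * u y \<partial>lborel) P \<partial>lborel)
      \<le> (\<integral>\<^sup>+x. ennpowr C P * (\<integral>\<^sup>+y. w x y * ennpowr (u y) P \<partial>lborel) \<partial>lborel)"
    by (intro nn_integral_mono pt)
  also have "\<dots> = ennpowr C P * (\<integral>\<^sup>+x. \<integral>\<^sup>+y. w x y * ennpowr (u y) P \<partial>lborel \<partial>lborel)"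
    by (rule nn_integral_cmult) measurable
  also have "(\<integral>\<^sup>+x. \<integral>\<^sup>+y. w x y * ennpowr (u y) P \<partial>lborel \<partial>lborel)
     = (\<integral>\<^sup>+y. \<integral>\<^sup>+x. w x y * ennpowr (u y) P \<partial>lborel \<partial>lborel)"
    by (rule lborel_pair.Fubini') measurable
  also have "\<dots> = (\<integral>\<^sup>+y. (\<integral>\<^sup>+x. w x y \<partial>lborel) * ennpowr (u y) P \<partial>lborel)"
    by (intro nn_integral_cong nn_integral_multc) measurable
  also have "\<dots> \<le> (\<integral>\<^sup>+y. 1 * ennpowr (u y) P \<partial>lborel)"
    by (intro nn_integral_mono mult_right_mono w1) auto
  also have "\<dots> = ennpowr (lpn p u) P" unfolding P_def lpn_powr[OF p False] by simp
  finally have "(\<integral>\<^sup>+x. ennpowr (\<integral>\<^sup>+y. k x y * u y \<partial>lborel) P \<partial>lborel) \<le> ennpowr (ennreal C * lpn p u) P"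
    using P by (simp add: ennpowr_mult mult_left_mono)
  then show ?thesis unfolding lpn_le_iff[OF p False] P_def .
qed

text \<open>A bounded integrable weight pairs with \<open>L\<^sup>p\<close> with one constant for
  all \<open>p\<close>. Jensen uses the integral bound on \<open>w\<close>; afterwards the density
  \<open>w / B\<close> is estimated by 1. This takes the place of Hoelder's inequality.\<close>

lemma lpn_pairing:
  fixes u :: "real ^ 'd::finite \<Rightarrow> ennreal"
  assumes [measurable]: "u \<in> borel_measurable lborel" "w \<in> borel_measurable lborel"
  assumes B: "B > 0" and sup: "\<And>x. w x \<le> ennreal B" and int: "(\<integral>\<^sup>+x. w x \<partial>lborel) \<le> ennreal B"
    and p: "1 \<le> p"
  shows "(\<integral>\<^sup>+x. w x * u x \<partial>lborel) \<le> ennreal B * lpn p u"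
proof (cases "p = \<infinity>")
  case True
  have "(\<integral>\<^sup>+x. w x * u x \<partial>lborel) \<le> (\<integral>\<^sup>+x. w x * esssup lborel u \<partial>lborel)"
    using esssup_AE[of u lborel] by (intro nn_integral_mono_AE) (auto elim!: eventually_mono intro: mult_left_mono)
  also have "\<dots> = (\<integral>\<^sup>+y. w y \<partial>lborel) * esssup lborel u" by (rule nn_integral_multc) measurable
  also have "\<dots> \<le> ennreal B * esssup lborel u" by (intro mult_right_mono int) auto
  finally show ?thesis using True by (simp add: lpn_def)
next
  case False
  define P where "P = enn2real p"
  have P: "P \<ge> 1" unfolding P_def by (rule enn2real_ge_1[OF p False])
  have cancel: "ennreal B * ennreal (1 / B) = 1" using B by (simp flip: ennreal_mult)
  define v where "v x = ennreal (1 / B) * w x" for x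
  have [measurable]: "v \<in> borel_measurable lborel" unfolding v_def by measurable
  have wv: "w x = ennreal B * v x" for x unfolding v_def mult.assoc[symmetric] cancel by simp
  have small: "ennreal (1 / B) * I \<le> 1" if "I \<le> ennreal B" for I
    using mult_left_mono[OF that, of "ennreal (1 / B)"] cancel by (simp add: mult.commute)
  have v1: "(\<integral>\<^sup>+x. v x \<partial>lborel) \<le> 1" "v x \<le> 1" for x
    unfolding v_def using small int sup[of x] by (simp_all add: nn_integral_cmult)
  have "(\<integral>\<^sup>+x. w x * u x \<partial>lborel) = ennreal B * (\<integral>\<^sup>+x. v x * u x \<partial>lborel)"
    unfolding wv mult.assoc by (rule nn_integral_cmult) measurable
  moreover have "(\<integral>\<^sup>+x. v x * u x \<partial>lborel) \<le> lpn p u"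
  proof -
    have "ennpowr (\<integral>\<^sup>+x. v x * u x \<partial>lborel) P \<le> (\<integral>\<^sup>+x. v x * ennpowr (u x) P \<partial>lborel)"
      using P v1 by (intro nn_integral_jensen_density) auto
    also have "\<dots> \<le> (\<integral>\<^sup>+x. 1 * ennpowr (u x) P \<partial>lborel)"
      by (intro nn_integral_mono mult_right_mono v1) auto
    also have "\<dots> = ennpowr (lpn p u) P" unfolding P_def lpn_powr[OF p False] by simp
    finally have "ennpowr (ennpowr (\<integral>\<^sup>+x. v x * u x \<partial>lborel) P) (1 / P) \<le> ennpowr (ennpowr (lpn p u) P) (1 / P)"
      using P by (rule_tac ennpowr_mono) auto
    then show ?thesis using P by simp
  qed
  ultimately show ?thesis by (simp add: mult_left_mono)
qed


section \<open>The \<open>l\<^sup>q\<close> quasi-norm\<close>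

lemma enn2real_q_pos: "0 < q \<Longrightarrow> q \<noteq> \<infinity> \<Longrightarrow> enn2real q > 0"
  by (cases q) auto

lemma lq_le_iff:
  assumes "0 < q" "q \<noteq> \<infinity>"
  shows "lq_norm q s \<le> c \<longleftrightarrow> (\<Sum>j. ennpowr (s j) (enn2real q)) \<le> ennpowr c (enn2real q)"
  using enn2real_q_pos[OF assms] assms(2) by (simp add: lq_norm_def ennpowr_le_iff)

lemma lq_powr:
  assumes "0 < q" "q \<noteq> \<infinity>"
  shows "ennpowr (lq_norm q s) (enn2real q) = (\<Sum>j. ennpowr (s j) (enn2real q))"
  using enn2real_q_pos[OF assms] assms(2) by (simp add: lq_norm_def)

lemma lq_mono:
  assumes q: "0 < q" and "\<And>j. s j \<le> t j"
  shows "lq_norm q s \<le> lq_norm q t"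
proof (cases "q = \<infinity>")
  case True
  then show ?thesis using assms by (auto simp: lq_norm_def intro!: SUP_mono)
next
  case False
  show ?thesis unfolding lq_le_iff[OF q False] lq_powr[OF q False]
    using assms enn2real_q_pos[OF q False] by (intro suminf_le ennpowr_mono) auto
qed

lemma lq_cmult_le:
  assumes q: "0 < q"
  shows "lq_norm q (\<lambda>j. c * s j) \<le> c * lq_norm q s"
proof (cases "q = \<infinity>")
  case True
  then show ?thesis by (auto simp: lq_norm_def intro!: SUP_least mult_left_mono SUP_upper)
next
  case False
  then show ?thesis using enn2real_q_pos[OF q False]
    by (simp add: lq_le_iff[OF q False] ennpowr_mult lq_powr[OF q False])
qed

lemma lq_ge:
  assumes q: "0 < q"
  shows "s j \<le> lq_norm q s"
proof (cases "q = \<infinity>")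
  case True
  then show ?thesis by (auto simp: lq_norm_def intro!: SUP_upper)
next
  case False
  have "ennpowr (s j) (enn2real q) = (\<Sum>i\<in>{j}. ennpowr (s i) (enn2real q))" by simp
  also have "\<dots> \<le> (\<Sum>j. ennpowr (s j) (enn2real q))" by (rule sum_le_suminf) auto
  finally have "ennpowr (ennpowr (s j) (enn2real q)) (1 / enn2real q) \<le> lq_norm q s"
    using False enn2real_q_pos[OF q False] by (simp only: lq_norm_def if_False) (rule ennpowr_mono, auto)
  then show ?thesis using enn2real_q_pos[OF q False] by simp
qed

lemma lq_subseq:
  assumes q: "0 < q" and i: "inj i"
  shows "lq_norm q (\<lambda>j. s (i j)) \<le> lq_norm q s"
proof (cases "q = \<infinity>")
  case True
  then show ?thesis by (auto simp: lq_norm_def intro!: SUP_least SUP_upper)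
next
  case False
  let ?f = "\<lambda>j. ennpowr (s j) (enn2real q)"
  have "(\<Sum>j. ?f (i j)) \<le> (\<Sum>j. ?f j)"
  proof (rule suminf_le_const)
    fix n
    have "(\<Sum>j<n. ?f (i j)) = sum ?f (i ` {..<n})"
      using i by (subst sum.reindex) (auto intro: inj_on_subset)
    also have "\<dots> \<le> (\<Sum>j. ?f j)" by (rule sum_le_suminf) auto
    finally show "(\<Sum>j<n. ?f (i j)) \<le> (\<Sum>j. ?f j)" .
  qed simp
  then show ?thesis unfolding lq_le_iff[OF q False] lq_powr[OF q False] .
qed

text \<open>Splits off one entry for every \<open>q > 0\<close>. Both parts are bounded by their
  sum, whence the factor \<open>2 powr (1 / Q)\<close>.\<close>

lemma lq_Suc_le:
  assumes q: "0 < q"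
  shows "\<exists>K>0. \<forall>s. lq_norm q s \<le> ennreal K * (s 0 + lq_norm q (\<lambda>j. s (Suc j)))"
proof (cases "q = \<infinity>")
  case True
  have "lq_norm q s \<le> ennreal 1 * (s 0 + lq_norm q (\<lambda>j. s (Suc j)))" for s
  proof -
    have "s j \<le> s 0 + (SUP j. s (Suc j))" for j
      by (cases j) (auto intro!: add_increasing SUP_upper2[of _ UNIV])
    then show ?thesis using True by (auto simp: lq_norm_def intro!: SUP_least)
  qed
  then show ?thesis by (intro exI[of _ 1]) auto
next
  case False
  define Q where "Q = enn2real q"
  have Q: "Q > 0" unfolding Q_def by (rule enn2real_q_pos[OF q False])
  have "lq_norm q s \<le> ennreal (2 powr (1 / Q)) * (s 0 + lq_norm q (\<lambda>j. s (Suc j)))" for s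
  proof -
    define T where "T = lq_norm q (\<lambda>j. s (Suc j))"
    have "(\<Sum>j. ennpowr (s j) Q) = ennpowr (s 0) Q + (\<Sum>j. ennpowr (s (Suc j)) Q)"
      by (subst suminf_offset[where i = 1]) (auto simp: add.commute)
    also have "\<dots> = ennpowr (s 0) Q + ennpowr T Q" unfolding T_def Q_def lq_powr[OF q False] ..
    also have "\<dots> \<le> ennpowr (s 0 + T) Q + ennpowr (s 0 + T) Q"
      using Q by (intro add_mono ennpowr_mono) auto
    also have "\<dots> = ennpowr (ennreal (2 powr (1 / Q)) * (s 0 + T)) Q"
      using Q by (simp add: ennpowr_mult ennpowr_ennreal powr_powr mult_2)
    finally show ?thesis unfolding lq_le_iff[OF q False] Q_def T_def .
  qed
  then show ?thesis by (intro exI[of _ "2 powr (1 / Q)"]) auto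
qed

lemma suminf_swap_ennreal:
  fixes f :: "nat \<Rightarrow> nat \<Rightarrow> ennreal"
  shows "(\<Sum>i. \<Sum>k. f i k) = (\<Sum>k. \<Sum>i. f i k)"
  using nn_integral_suminf[of "\<lambda>k i. f i k" "count_space UNIV"]
  by (simp add: nn_integral_count_space_nat)

text \<open>Every value of \<open>i div 2\<close> is attained exactly twice.\<close>

lemma suminf_div2_le:
  fixes f :: "nat \<Rightarrow> ennreal"
  shows "(\<Sum>i. f (i div 2)) \<le> 2 * (\<Sum>i. f i)"
proof (rule suminf_le_const)
  fix n
  have e: "(\<Sum>i<2 * m. f (i div 2)) = 2 * (\<Sum>i<m. f i)" for m
    by (induction m) (simp_all add: distrib_left mult_2 mult_2_right add_ac)
  have "(\<Sum>i<n. f (i div 2)) \<le> (\<Sum>i<2 * n. f (i div 2))" by (intro sum_mono2) auto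
  also have "\<dots> \<le> 2 * (\<Sum>i. f i)" unfolding e by (intro mult_left_mono sum_le_suminf) auto
  finally show "(\<Sum>i<n. f (i div 2)) \<le> 2 * (\<Sum>i. f i)" .
qed simp

text \<open>A discrete Hardy inequality, uniform in \<open>0 < q \<le> \<infinity>\<close>: half of the geometric decay \<open>r\<^sup>2\<close>
  turns the inner sum into a weighted \<open>l\<^sup>q\<close> sum, the other half makes it summable.\<close>

lemma lq_hardy:
  assumes q: "0 < q" and r: "0 < r" "r < (1::real)"
  shows "\<exists>K>0. \<forall>s t. (\<forall>i. s i \<le> (\<Sum>k. ennreal (r ^ (2 * k)) * t (i div 2 + k))) \<longrightarrow>
    lq_norm q s \<le> ennreal K * lq_norm q t"
proof (cases "q = \<infinity>")
  case True
  have "lq_norm q s \<le> ennreal (1 / (1 - r\<^sup>2)) * lq_norm q t"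
    if s: "\<And>i. s i \<le> (\<Sum>k. ennreal (r ^ (2 * k)) * t (i div 2 + k))" for s t
  proof -
    have r2: "r\<^sup>2 < 1" using r by (simp add: power_less_one_iff)
    have "s i \<le> ennreal (1 / (1 - r\<^sup>2)) * (SUP j. t j)" for i
    proof -
      note s[of i]
      also have "(\<Sum>k. ennreal (r ^ (2 * k)) * t (i div 2 + k)) \<le> (\<Sum>k. ennreal (r ^ (2 * k)) * (SUP j. t j))"
        by (intro suminf_le mult_left_mono SUP_upper) auto
      also have "\<dots> = (\<Sum>k. ennreal ((r\<^sup>2) ^ k)) * (SUP j. t j)" by (simp add: power_mult)
      also have "(\<Sum>k. ennreal ((r\<^sup>2) ^ k)) = ennreal (1 / (1 - r\<^sup>2))"
        using r r2 by (intro suminf_ennreal_eq geometric_sums) auto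
      finally show ?thesis .
    qed
    then show ?thesis using True by (auto simp: lq_norm_def intro!: SUP_least)
  qed
  moreover have "1 / (1 - r\<^sup>2) > 0" using r by (simp add: power_less_one_iff)
  ultimately show ?thesis by blast
next
  case False
  define Q where "Q = enn2real q"
  have Q: "Q > 0" unfolding Q_def by (rule enn2real_q_pos[OF q False])
  define R where "R = 1 / (1 - r)"
  have R: "R > 0" unfolding R_def using r by simp
  define z where "z = r powr Q"
  have z: "0 < z" "z < 1" unfolding z_def using r Q powr_less_mono2[of Q r 1] by auto
  define Z where "Z = 1 / (1 - z)"
  have Z: "Z > 0" unfolding Z_def using z by simp
  have geo: "(\<Sum>k. ennreal (r ^ k)) = ennreal R" "(\<Sum>k. ennreal (z ^ k)) = ennreal Z"
    unfolding R_def Z_def using r z by (auto intro!: suminf_ennreal_eq geometric_sums)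
  have rk: "ennpowr (ennreal (r ^ k)) Q = ennreal (z ^ k)" for k
    using r unfolding z_def by (simp add: ennpowr_ennreal powr_realpow[symmetric] powr_powr mult.commute)
  have "lq_norm q s \<le> ennreal (R * (2 * Z) powr (1 / Q)) * lq_norm q t"
    if s: "\<And>i. s i \<le> (\<Sum>k. ennreal (r ^ (2 * k)) * t (i div 2 + k))" for s t
  proof -
    \<comment> \<open>\<open>B i\<close> holds the \<open>q\<close>-th powers after one half of the
      decay has been used. Each single term is at most the \<open>q\<close>-th root of
      \<open>B i\<close>, and the other half of the decay sums these bounds; no convexity in
      \<open>q\<close> enters.\<close>
    define B where "B i = (\<Sum>k. ennpowr (ennreal (r ^ k) * t (i div 2 + k)) Q)" for i
    have le: "ennreal (r ^ k) * t (i div 2 + k) \<le> ennpowr (B i) (1 / Q)" for i k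
    proof -
      have "ennpowr (ennreal (r ^ k) * t (i div 2 + k)) Q = (\<Sum>k\<in>{k}. ennpowr (ennreal (r ^ k) * t (i div 2 + k)) Q)" by simp
      also have "\<dots> \<le> B i" unfolding B_def by (rule sum_le_suminf) auto
      finally have "ennpowr (ennpowr (ennreal (r ^ k) * t (i div 2 + k)) Q) (1 / Q) \<le> ennpowr (B i) (1 / Q)"
        using Q by (rule_tac ennpowr_mono) auto
      then show ?thesis using Q by simp
    qed
    have sB: "ennpowr (s i) Q \<le> ennpowr R Q * B i" for i
    proof -
      note s[of i]
      also have "(\<Sum>k. ennreal (r ^ (2 * k)) * t (i div 2 + k)) \<le> (\<Sum>k. ennreal (r ^ k) * ennpowr (B i) (1 / Q))"
      proof (intro suminf_le)
        fix k
        have "ennreal (r ^ (2 * k)) * t (i div 2 + k) = ennreal (r ^ k) * (ennreal (r ^ k) * t (i div 2 + k))"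
          using r by (simp add: mult_2 power_add ennreal_mult mult.assoc)
        also have "\<dots> \<le> ennreal (r ^ k) * ennpowr (B i) (1 / Q)" by (intro mult_left_mono le) auto
        finally show "ennreal (r ^ (2 * k)) * t (i div 2 + k) \<le> ennreal (r ^ k) * ennpowr (B i) (1 / Q)" .
      qed auto
      also have "\<dots> = ennreal R * ennpowr (B i) (1 / Q)" by (simp add: geo)
      finally have "ennpowr (s i) Q \<le> ennpowr (ennreal R * ennpowr (B i) (1 / Q)) Q"
        using Q by (rule_tac ennpowr_mono) auto
      then show ?thesis using Q by (simp add: ennpowr_mult)
    qed
    have "(\<Sum>i. ennpowr (s i) Q) \<le> (\<Sum>i. ennpowr R Q * B i)" by (intro suminf_le sB) auto
    also have "\<dots> = ennpowr R Q * (\<Sum>i. \<Sum>k. ennreal (z ^ k) * ennpowr (t (i div 2 + k)) Q)"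
      unfolding B_def using Q by (simp add: ennpowr_mult rk)
    also have "(\<Sum>i. \<Sum>k. ennreal (z ^ k) * ennpowr (t (i div 2 + k)) Q)
        = (\<Sum>k. ennreal (z ^ k) * (\<Sum>i. ennpowr (t (i div 2 + k)) Q))"
      by (subst suminf_swap_ennreal) simp
    also have "\<dots> \<le> (\<Sum>k. ennreal (z ^ k) * (2 * (\<Sum>i. ennpowr (t i) Q)))"
    proof (intro suminf_le mult_left_mono)
      fix k
      have "(\<Sum>i. ennpowr (t (i div 2 + k)) Q) \<le> 2 * (\<Sum>i. ennpowr (t (i + k)) Q)"
        by (rule suminf_div2_le)
      also have "(\<Sum>i. ennpowr (t (i + k)) Q) \<le> (\<Sum>i. ennpowr (t i) Q)"
        by (subst (2) suminf_offset[where i = k]) (auto simp: add_increasing)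
      finally show "(\<Sum>i. ennpowr (t (i div 2 + k)) Q) \<le> 2 * (\<Sum>i. ennpowr (t i) Q)"
        by (simp add: mult_left_mono)
    qed auto
    also have "\<dots> = ennreal Z * (2 * ennpowr (lq_norm q t) Q)"
      unfolding Q_def lq_powr[OF q False] by (simp add: geo)
    also have "ennpowr R Q * \<dots> = ennpowr (ennreal (R * (2 * Z) powr (1 / Q)) * lq_norm q t) Q"
    proof -
      have "ennpowr (ennreal (R * (2 * Z) powr (1 / Q))) Q = ennpowr R Q * (ennreal Z * 2)"
        using Q R Z by (simp add: ennpowr_mult ennreal_mult ennpowr_ennreal powr_powr mult.commute)
      then show ?thesis using Q by (simp add: ennpowr_mult mult_ac)
    qed
    finally show ?thesis unfolding lq_le_iff[OF q False] Q_def by (simp add: mult_left_mono)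
  qed
  moreover have "R * (2 * Z) powr (1 / Q) > 0" using R Z by simp
  ultimately show ?thesis by blast
qed

section \<open>Integration on \<open>\<real>\<^sup>d\<close> coordinate by coordinate\<close>

lemma prod_Basis_vec:
  fixes x :: "real ^ 'd::finite" and g :: "'d \<Rightarrow> real \<Rightarrow> 'a::comm_monoid_mult"
  shows "(\<Prod>b\<in>Basis. g (axis_index b) (x \<bullet> b)) = (\<Prod>i\<in>UNIV. g i (x $ i))"
proof -
  have B: "(Basis :: (real ^ 'd) set) = (\<lambda>i. axis i 1) ` UNIV"
    by (auto simp: Basis_vec_def)
  have inj: "inj (\<lambda>i. axis i 1 :: real ^ 'd)" by (auto simp: inj_on_def axis_eq_axis)
  show ?thesis unfolding B by (subst prod.reindex[OF inj]) (simp add: inner_axis)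
qed

lemma nn_integral_prod_coord:
  fixes f :: "'d::finite \<Rightarrow> real \<Rightarrow> ennreal"
  assumes [measurable]: "\<And>i. f i \<in> borel_measurable borel"
  shows "(\<integral>\<^sup>+x. (\<Prod>i\<in>UNIV. f i (x $ i)) \<partial>(lborel :: (real ^ 'd) measure)) = (\<Prod>i\<in>UNIV. \<integral>\<^sup>+t. f i t \<partial>lborel)"
proof -
  have "(\<integral>\<^sup>+x. (\<Prod>i\<in>UNIV. f i (x $ i)) \<partial>(lborel :: (real ^ 'd) measure))
     = (\<integral>\<^sup>+x. (\<Prod>b\<in>Basis. f (axis_index b) (x \<bullet> b)) \<partial>(lborel :: (real ^ 'd) measure))"
    by (simp only: prod_Basis_vec)
  also have "\<dots> = (\<Prod>b\<in>(Basis :: (real ^ 'd) set). \<integral>\<^sup>+t. f (axis_index b) t \<partial>lborel)"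
    by (rule nn_integral_lborel_prod) auto
  also have "\<dots> = (\<Prod>i\<in>UNIV. \<integral>\<^sup>+t. f i t \<partial>lborel)"
    using prod_Basis_vec[of "\<lambda>i _. \<integral>\<^sup>+t. f i t \<partial>lborel" 0] by simp
  finally show ?thesis .
qed

lemma vec_nth_measurable [measurable]: "(\<lambda>x :: real ^ 'd::finite. x $ i) \<in> borel_measurable borel"
  by (intro borel_measurable_continuous_onI continuous_intros)

text \<open>The normal density with variance \<open>1 / (2 g)\<close> has integral 1.\<close>

lemma nn_integral_gaussian:
  assumes g: "g > 0"
  shows "(\<integral>\<^sup>+t. ennreal (exp (- g * (t - c)\<^sup>2)) \<partial>lborel) = ennreal (sqrt (pi / g))"
proof -
  define s where "s = sqrt (1 / (2 * g))"
  have s: "s > 0" "s\<^sup>2 = 1 / (2 * g)" unfolding s_def using g by auto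
  have nd: "normal_density c s t = sqrt (g / pi) * exp (- g * (t - c)\<^sup>2)" for t
    unfolding normal_density_def s(2) using g by (simp add: real_sqrt_divide)
  have "(\<integral>\<^sup>+t. ennreal (normal_density c s t) \<partial>lborel) = 1"
    using s by (subst nn_integral_eq_integral) (auto simp: normal_density_nonneg)
  then have "ennreal (sqrt (g / pi)) * (\<integral>\<^sup>+t. ennreal (exp (- g * (t - c)\<^sup>2)) \<partial>lborel) = 1"
    unfolding nd using g by (simp add: ennreal_mult nn_integral_cmult)
  then have "ennreal (sqrt (pi / g)) * (ennreal (sqrt (g / pi)) * (\<integral>\<^sup>+t. ennreal (exp (- g * (t - c)\<^sup>2)) \<partial>lborel))
     = ennreal (sqrt (pi / g))" by simp
  moreover have "ennreal (sqrt (pi / g)) * ennreal (sqrt (g / pi)) = 1"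
    using g by (simp flip: ennreal_mult real_sqrt_mult)
  ultimately show ?thesis by (simp add: mult.assoc[symmetric])
qed

text \<open>An integrable weight bounded by 1 whose inverse is a polynomial. The product form makes
  that polynomial a sum of monomials with exponents 0 and 2, so that finitely many Schwartz
  seminorms control it.\<close>

definition wt :: "real ^ 'd::finite \<Rightarrow> real" where
  "wt x = (\<Prod>i\<in>UNIV. inverse (1 + (x $ i)\<^sup>2))"

lemma one_plus_square_pos: "1 + t\<^sup>2 > (0::real)"
  by (rule add_pos_nonneg) auto

lemma wt_pos: "wt x > 0"
  unfolding wt_def by (intro prod_pos) (auto simp: one_plus_square_pos)

lemma wt_le_1: "wt x \<le> 1"
  unfolding wt_def by (intro prod_le_1) (auto simp: one_plus_square_pos less_imp_le intro!: inverse_le_1_iff[THEN iffD2])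

lemma wt_measurable [measurable]: "wt \<in> borel_measurable borel"
  unfolding wt_def[abs_def] by measurable

lemma wt_integrable: "integrable lborel (wt :: real ^ 'd::finite \<Rightarrow> real)"
proof -
  have fin: "(\<integral>\<^sup>+t. ennreal (inverse (1 + t\<^sup>2)) \<partial>lborel) < \<infinity>"
    using integrable_inverse_1_plus_square
    by (simp add: set_integrable_def integrable_iff_bounded one_plus_square_pos less_imp_le abs_of_pos)
  have "(\<integral>\<^sup>+x. ennreal (wt x) \<partial>(lborel :: (real ^ 'd) measure))
     = (\<integral>\<^sup>+x. (\<Prod>i\<in>UNIV. ennreal (inverse (1 + (x $ i)\<^sup>2))) \<partial>(lborel :: (real ^ 'd) measure))"
    unfolding wt_def by (intro nn_integral_cong, subst prod_ennreal) (auto simp: one_plus_square_pos less_imp_le)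
  also have "\<dots> = (\<Prod>i\<in>(UNIV :: 'd set). \<integral>\<^sup>+t. ennreal (inverse (1 + t\<^sup>2)) \<partial>lborel)"
    by (rule nn_integral_prod_coord[where f = "\<lambda>_ t. ennreal (inverse (1 + t\<^sup>2))"]) auto
  also have "\<dots> < \<infinity>" using fin by (simp add: ennreal_prod_eq_top power_less_top_ennreal less_top[symmetric] power_eq_top_ennreal)
  finally show ?thesis by (intro integrableI_nonneg) (auto simp: less_imp_le[OF wt_pos])
qed

text \<open>Translations of length at most 1 cost only a constant factor, which is what dominates
  the difference quotients in the integration by parts below.\<close>

lemma wt_shift: "\<bar>s\<bar> \<le> 1 \<Longrightarrow> wt (x + s *\<^sub>R axis i 1) \<le> 3 * wt x"
proof -
  assume s: "\<bar>s\<bar> \<le> 1"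
  define R where "R = (\<Prod>j\<in>UNIV - {i}. inverse (1 + (x $ j)\<^sup>2))"
  have R: "R \<ge> 0" unfolding R_def by (intro prod_nonneg) (auto simp: one_plus_square_pos less_imp_le)
  have 1: "wt (x + s *\<^sub>R axis i 1) = inverse (1 + (x $ i + s)\<^sup>2) * R"
    unfolding wt_def R_def prod_split_one[where i = i] by (auto simp: axis_def intro!: prod.cong)
  have 2: "wt x = inverse (1 + (x $ i)\<^sup>2) * R"
    unfolding wt_def R_def prod_split_one[where i = i] ..
  have "(x $ i)\<^sup>2 \<le> 2 * (x $ i + s)\<^sup>2 + 2 * s\<^sup>2"
    using zero_le_power2[of "x $ i + 2 * s"] by (simp add: power2_eq_square algebra_simps)
  moreover have "s\<^sup>2 \<le> 1" using s by (simp add: abs_square_le_1)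
  ultimately have "1 + (x $ i)\<^sup>2 \<le> 3 * (1 + (x $ i + s)\<^sup>2)" by (smt (verit) zero_le_power2)
  then have "inverse (1 + (x $ i + s)\<^sup>2) \<le> 3 * inverse (1 + (x $ i)\<^sup>2)"
    using one_plus_square_pos[of "x $ i"] one_plus_square_pos[of "x $ i + s"] by (simp add: divide_simps)
  then show ?thesis unfolding 1 2 using mult_right_mono[OF _ R] by fastforce
qed

lemma lborel_integral_shift:
  fixes f :: "real ^ 'd::finite \<Rightarrow> complex"
  assumes [measurable]: "f \<in> borel_measurable borel"
  shows "(\<integral>x. f (x + c) \<partial>lborel) = (\<integral>x. f x \<partial>lborel)"
proof -
  have "(\<integral>x. f x \<partial>lborel) = (\<integral>x. f x \<partial>distr lborel borel ((+) c))" by (simp add: lborel_distr_plus)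
  also have "\<dots> = (\<integral>x. f (c + x) \<partial>lborel)" by (rule integral_distr) auto
  finally show ?thesis by (simp add: add.commute)
qed

lemma wt_bound_integrable:
  fixes u :: "real ^ 'd::finite \<Rightarrow> complex"
  assumes [measurable]: "u \<in> borel_measurable borel" and "\<And>x. norm (u x) \<le> C * wt x"
  shows "integrable lborel u"
proof (rule Bochner_Integration.integrable_bound)
  show "integrable lborel (\<lambda>x. C * wt x)" using wt_integrable by auto
  show "AE x in lborel. norm (u x) \<le> norm (C * wt x)" using assms(2) by (intro AE_I2) (smt (verit) real_norm_def)
qed simp

text \<open>By translation invariance, the difference quotients have integral zero.\<close>

lemma integral_partial_deriv_eq_0:
  fixes u v :: "real ^ 'd::finite \<Rightarrow> complex"
  assumes [measurable]: "u \<in> borel_measurable borel" "v \<in> borel_measurable borel"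
    and deriv: "\<And>x. ((\<lambda>t. u (x + t *\<^sub>R axis i 1)) has_vector_derivative v x) (at 0)"
    and bu: "\<And>x. norm (u x) \<le> C * wt x" and bv: "\<And>x. norm (v x) \<le> C * wt x"
  shows "(\<integral>x. v x \<partial>lborel) = 0"
proof -
  define h where "h n = 1 / real (Suc n)" for n
  have h: "h n > 0" "h n \<le> 1" for n unfolding h_def by auto
  have h0: "h \<longlonglongrightarrow> 0" unfolding h_def by (rule lim_inverse_n'[THEN LIMSEQ_Suc])
  define e :: "real ^ 'd" where "e = axis i 1"
  define q where "q n x = (u (x + h n *\<^sub>R e) - u x) /\<^sub>R h n" for n x
  have C: "C \<ge> 0" using bu[of 0] wt_pos[of "0 :: real ^ 'd"] by (smt (verit) norm_ge_zero zero_le_mult_iff)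
  have iu: "integrable lborel u" by (rule wt_bound_integrable[OF _ bu]) simp
  have "integrable lborel (\<lambda>x. u (x + c))" for c
    using integrable_distr_eq[of "(+) c" lborel borel u] iu by (simp add: lborel_distr_plus add.commute)
  then have "(\<integral>x. q n x \<partial>lborel) = 0" for n
    unfolding q_def using iu by (simp add: lborel_integral_shift)
  moreover have "(\<lambda>n. \<integral>x. q n x \<partial>lborel) \<longlonglongrightarrow> (\<integral>x. v x \<partial>lborel)"
  proof (rule integral_dominated_convergence[where w = "\<lambda>x. 3 * C * wt x"])
    show "integrable lborel (\<lambda>x. 3 * C * wt (x :: real ^ 'd))" using wt_integrable by auto
    show "AE x in lborel. (\<lambda>n. q n x) \<longlonglongrightarrow> v x"
    proof (rule AE_I2)
      fix x
      have "((\<lambda>t. (u (x + t *\<^sub>R e) - u x) /\<^sub>R t) \<longlongrightarrow> v x) (at 0)"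
      proof (rule Lim_null[THEN iffD2], rule tendsto_norm_zero_cancel)
        have A: "((\<lambda>t. norm ((u (x + t *\<^sub>R e) - u (x + 0 *\<^sub>R e)) - (t - 0) *\<^sub>R v x) / norm (t - 0)) \<longlongrightarrow> 0) (at 0)"
          using deriv[of x] unfolding has_vector_derivative_def has_derivative_iff_norm e_def by blast
        have B: "norm ((u (x + t *\<^sub>R e) - u (x + 0 *\<^sub>R e)) - (t - 0) *\<^sub>R v x) / norm (t - 0)
           = norm ((u (x + t *\<^sub>R e) - u x) /\<^sub>R t - v x)" if "t \<noteq> 0" for t
        proof -
          have "(u (x + t *\<^sub>R e) - u x) /\<^sub>R t - v x = inverse t *\<^sub>R ((u (x + t *\<^sub>R e) - u x) - t *\<^sub>R v x)"
            using that by (simp add: scaleR_diff_right)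
          then show ?thesis by (simp add: divide_inverse mult.commute)
        qed
        show "((\<lambda>t. norm ((u (x + t *\<^sub>R e) - u x) /\<^sub>R t - v x)) \<longlongrightarrow> 0) (at 0)"
          by (rule Lim_transform_eventually[OF A]) (use B in \<open>simp add: eventually_at_filter\<close>)
      qed
      moreover have "filterlim h (at 0) sequentially"
        using h0 h(1) by (intro filterlim_atI always_eventually allI) (auto simp: less_imp_neq[symmetric])
      ultimately show "(\<lambda>n. q n x) \<longlonglongrightarrow> v x" unfolding q_def by (rule filterlim_compose)
    qed
    fix n
    show "AE x in lborel. norm (q n x) \<le> 3 * C * wt x"
    proof (rule AE_I2)
      fix x
      have d: "((\<lambda>t. u (x + t *\<^sub>R e)) has_vector_derivative v (x + s *\<^sub>R e)) (at s)" for s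
      proof -
        have "((\<lambda>t. u ((x + s *\<^sub>R e) + t *\<^sub>R e)) has_vector_derivative v (x + s *\<^sub>R e)) (at (s - s))"
          using deriv[of "x + s *\<^sub>R e"] unfolding e_def by simp
        moreover have "((\<lambda>t. t - s) has_vector_derivative 1) (at s)"
          by (auto intro!: derivative_eq_intros)
        ultimately have "((\<lambda>t. u ((x + s *\<^sub>R e) + t *\<^sub>R e)) \<circ> (\<lambda>t. t - s) has_vector_derivative 1 *\<^sub>R v (x + s *\<^sub>R e)) (at s)"
          by (intro vector_diff_chain_at)
        moreover have "(\<lambda>t. u ((x + s *\<^sub>R e) + t *\<^sub>R e)) \<circ> (\<lambda>t. t - s) = (\<lambda>t. u (x + t *\<^sub>R e))"
          by (auto simp: scaleR_diff_left)
        ultimately show ?thesis by simp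
      qed
      \<comment> \<open>Mean value inequality along the segment; \<open>wt_shift\<close> makes the
        bound independent of the intermediate point and of \<open>n\<close>.\<close>
      have "norm (u (x + h n *\<^sub>R e) - u (x + 0 *\<^sub>R e)) \<le> (3 * C * wt x) * norm (h n - 0)"
      proof (rule differentiable_bound[where S = "{0..h n}" and f' = "\<lambda>s t. t *\<^sub>R v (x + s *\<^sub>R e)"])
        fix s assume s: "s \<in> {0..h n}"
        show "((\<lambda>t. u (x + t *\<^sub>R e)) has_derivative (\<lambda>t. t *\<^sub>R v (x + s *\<^sub>R e))) (at s within {0..h n})"
          using d[of s] unfolding has_vector_derivative_def by (rule has_derivative_at_withinI)
        show "onorm (\<lambda>t. t *\<^sub>R v (x + s *\<^sub>R e)) \<le> 3 * C * wt x"
        proof (rule onorm_le)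
          fix t :: real
          have "norm (v (x + s *\<^sub>R e)) \<le> C * wt (x + s *\<^sub>R e)" by (rule bv)
          also have "\<dots> \<le> C * (3 * wt x)"
            using s h[of n] C unfolding e_def by (intro mult_left_mono wt_shift) auto
          finally have "\<bar>t\<bar> * norm (v (x + s *\<^sub>R e)) \<le> \<bar>t\<bar> * (C * (3 * wt x))"
            by (rule mult_left_mono) simp
          then show "norm (t *\<^sub>R v (x + s *\<^sub>R e)) \<le> 3 * C * wt x * norm t"
            by (simp add: mult_ac)
        qed
      qed (use h[of n] in auto)
      then show "norm (q n x) \<le> 3 * C * wt x"
        unfolding q_def using h(1)[of n] by (simp add: divide_simps mult.commute)
    qed
  qed (auto simp: q_def e_def)
  ultimately show ?thesis by (simp add: LIMSEQ_const_iff)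
qed

section \<open>Schwartz functions\<close>

lemma partial_deriv_eqI:
  "((\<lambda>t. \<phi> (x + t *\<^sub>R axis i 1)) has_vector_derivative v) (at 0) \<Longrightarrow> partial_deriv i \<phi> x = v"
  unfolding partial_deriv_def by (rule vector_derivative_at)

lemma partial_deriv_works:
  assumes "\<phi> differentiable (at x)"
  shows "((\<lambda>t. \<phi> (x + t *\<^sub>R axis i 1)) has_vector_derivative partial_deriv i \<phi> x) (at 0)"
proof -
  have "(\<lambda>t::real. x + t *\<^sub>R axis i 1) differentiable (at 0)"
    by (intro differentiable_add differentiable_const differentiable_scaleR differentiable_ident)
  then have "(\<lambda>t. \<phi> (x + t *\<^sub>R axis i 1)) differentiable (at 0)"
    using differentiable_chain_at[of "\<lambda>t. x + t *\<^sub>R axis i 1" 0 \<phi>] assms by (simp add: o_def)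
  then show ?thesis unfolding partial_deriv_def by (simp add: vector_derivative_works)
qed

lemma partial_derivs_Nil [simp]: "partial_derivs [] \<phi> = \<phi>"
  and partial_derivs_Cons [simp]: "partial_derivs (i # w) \<phi> = partial_deriv i (partial_derivs w \<phi>)"
  and partial_derivs_snoc: "partial_derivs (w @ [i]) \<phi> = partial_derivs w (partial_deriv i \<phi>)"
  by (simp_all add: partial_derivs_def)

lemma schwartz_differentiable: "\<phi> \<in> schwartz \<Longrightarrow> partial_derivs w \<phi> differentiable (at x)"
  by (simp add: schwartz_def)

lemma schwartz_bdd: "\<phi> \<in> schwartz \<Longrightarrow> bdd_above (range (schwartz_weight \<gamma> w \<phi>))"
  by (simp add: schwartz_def)

lemma schwartzI:
  assumes "\<And>w x. partial_derivs w \<phi> differentiable (at x)"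
    and "\<And>\<gamma> w. \<exists>B. \<forall>x. schwartz_weight \<gamma> w \<phi> x \<le> B"
  shows "\<phi> \<in> schwartz"
  using assms unfolding schwartz_def bdd_above_def by blast

lemma schwartz_weight_le_seminorm:
  "\<phi> \<in> schwartz \<Longrightarrow> schwartz_weight \<gamma> w \<phi> x \<le> schwartz_seminorm \<gamma> w \<phi>"
  unfolding schwartz_seminorm_def by (intro cSUP_upper schwartz_bdd) auto

lemma schwartz_seminorm_le:
  "(\<And>x. schwartz_weight \<gamma> w \<phi> x \<le> B) \<Longrightarrow> schwartz_seminorm \<gamma> w \<phi> \<le> B"
  unfolding schwartz_seminorm_def by (intro cSUP_least) auto

lemma schwartz_weight_nonneg: "schwartz_weight \<gamma> w \<phi> x \<ge> 0"
  unfolding schwartz_weight_def by simp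

lemma partial_derivs_add:
  assumes "\<phi> \<in> schwartz" "\<psi> \<in> schwartz"
  shows "partial_derivs w (\<lambda>x. \<phi> x + \<psi> x) = (\<lambda>x. partial_derivs w \<phi> x + partial_derivs w \<psi> x)"
proof (induction w)
  case (Cons i w)
  show ?case unfolding partial_derivs_Cons Cons
    by (intro ext partial_deriv_eqI has_vector_derivative_add partial_deriv_works schwartz_differentiable assms)
qed simp

lemma partial_derivs_cmult:
  assumes "\<phi> \<in> schwartz"
  shows "partial_derivs w (\<lambda>x. c * \<phi> x) = (\<lambda>x. c * partial_derivs w \<phi> x)"
proof (induction w)
  case (Cons i w)
  show ?case unfolding partial_derivs_Cons Cons
    by (intro ext partial_deriv_eqI has_vector_derivative_mult_right partial_deriv_works schwartz_differentiable assms)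
qed simp

lemma schwartz_weight_add:
  assumes "\<phi> \<in> schwartz" "\<psi> \<in> schwartz"
  shows "schwartz_weight \<gamma> w (\<lambda>x. \<phi> x + \<psi> x) x \<le> schwartz_weight \<gamma> w \<phi> x + schwartz_weight \<gamma> w \<psi> x"
  unfolding schwartz_weight_def partial_derivs_add[OF assms] distrib_left[symmetric]
  by (intro mult_left_mono norm_triangle_ineq) auto

lemma schwartz_weight_cmult:
  assumes "\<phi> \<in> schwartz"
  shows "schwartz_weight \<gamma> w (\<lambda>x. c * \<phi> x) x = norm c * schwartz_weight \<gamma> w \<phi> x"
  unfolding schwartz_weight_def partial_derivs_cmult[OF assms] by (simp add: norm_mult)

lemma schwartz_add:
  assumes "\<phi> \<in> schwartz" "\<psi> \<in> schwartz"
  shows "(\<lambda>x. \<phi> x + \<psi> x) \<in> schwartz"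
proof (rule schwartzI)
  show "partial_derivs w (\<lambda>x. \<phi> x + \<psi> x) differentiable (at x)" for w x
    unfolding partial_derivs_add[OF assms] by (intro differentiable_add schwartz_differentiable assms)
  show "\<exists>B. \<forall>x. schwartz_weight \<gamma> w (\<lambda>x. \<phi> x + \<psi> x) x \<le> B" for \<gamma> w
    using schwartz_weight_add[OF assms] schwartz_weight_le_seminorm[OF assms(1)] schwartz_weight_le_seminorm[OF assms(2)]
    by (intro exI[of _ "schwartz_seminorm \<gamma> w \<phi> + schwartz_seminorm \<gamma> w \<psi>"]) (meson add_mono order_trans)
qed

lemma schwartz_cmult:
  assumes "\<phi> \<in> schwartz"
  shows "(\<lambda>x. c * \<phi> x) \<in> schwartz"
proof (rule schwartzI)
  show "partial_derivs w (\<lambda>x. c * \<phi> x) differentiable (at x)" for w x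
    unfolding partial_derivs_cmult[OF assms] by (intro differentiable_mult schwartz_differentiable assms) auto
  show "\<exists>B. \<forall>x. schwartz_weight \<gamma> w (\<lambda>x. c * \<phi> x) x \<le> B" for \<gamma> w
    unfolding schwartz_weight_cmult[OF assms] using schwartz_weight_le_seminorm[OF assms]
    by (intro exI[of _ "norm c * schwartz_seminorm \<gamma> w \<phi>"]) (auto intro: mult_left_mono)
qed

lemma schwartz_diff:
  assumes "\<phi> \<in> schwartz" "\<psi> \<in> schwartz"
  shows "(\<lambda>x. \<phi> x - \<psi> x) \<in> schwartz"
  using schwartz_add[OF assms(1) schwartz_cmult[OF assms(2), of "-1"]] by simp

lemma schwartz_partial_deriv:
  assumes "\<phi> \<in> schwartz"
  shows "partial_deriv i \<phi> \<in> schwartz"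
proof (rule schwartzI)
  show "partial_derivs w (partial_deriv i \<phi>) differentiable (at x)" for w x
    unfolding partial_derivs_snoc[symmetric] by (rule schwartz_differentiable[OF assms])
  show "\<exists>B. \<forall>x. schwartz_weight \<gamma> w (partial_deriv i \<phi>) x \<le> B" for \<gamma> w
    using schwartz_weight_le_seminorm[OF assms, of \<gamma> "w @ [i]"]
    unfolding schwartz_weight_def partial_derivs_snoc by blast
qed

text \<open>Leibniz' rule with the correction terms kept as an unspecified list of derivatives; the
  seminorm estimate only uses that the list is finite.\<close>

lemma partial_derivs_mult_coord:
  assumes "\<phi> \<in> schwartz"
  shows "\<exists>V. partial_derivs w (\<lambda>x. of_real (x $ i) * \<phi> x)
     = (\<lambda>x. of_real (x $ i) * partial_derivs w \<phi> x + (\<Sum>v\<leftarrow>V. partial_derivs v \<phi> x))"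
proof (induction w)
  case Nil
  show ?case by (intro exI[of _ "[]"]) simp
next
  case (Cons j w)
  then obtain V where V: "partial_derivs w (\<lambda>x. of_real (x $ i) * \<phi> x)
     = (\<lambda>x. of_real (x $ i) * partial_derivs w \<phi> x + (\<Sum>v\<leftarrow>V. partial_derivs v \<phi> x))" by blast
  have coord: "((\<lambda>t. complex_of_real ((x + t *\<^sub>R axis j 1) $ i)) has_vector_derivative
      (if i = j then 1 else 0)) (at 0)" for x :: "real ^ 'a"
  proof -
    have "((\<lambda>t. of_real (x $ i) + t *\<^sub>R (if i = j then 1 else 0 :: complex)) has_vector_derivative (if i = j then 1 else 0)) (at 0)"
      by (auto intro!: derivative_eq_intros)
    moreover have "(\<lambda>t. complex_of_real ((x + t *\<^sub>R axis j 1) $ i)) = (\<lambda>t. of_real (x $ i) + t *\<^sub>R (if i = j then 1 else 0 :: complex))"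
    proof
      fix t
      have "(x + t *\<^sub>R axis j 1) $ i = x $ i + t * (if i = j then 1 else 0)" by (simp add: axis_def)
      then show "complex_of_real ((x + t *\<^sub>R axis j 1) $ i) = of_real (x $ i) + t *\<^sub>R (if i = j then 1 else 0 :: complex)"
        by (simp add: scaleR_conv_of_real)
    qed
    ultimately show ?thesis by (simp only:)
  qed
  have lst: "((\<lambda>t. \<Sum>v\<leftarrow>V. partial_derivs v \<phi> (x + t *\<^sub>R axis j 1)) has_vector_derivative
      (\<Sum>v\<leftarrow>map ((#) j) V. partial_derivs v \<phi> x)) (at 0)" for x
    by (induction V) (auto intro!: has_vector_derivative_add partial_deriv_works schwartz_differentiable assms)
  have "partial_derivs (j # w) (\<lambda>x. of_real (x $ i) * \<phi> x) x
     = of_real (x $ i) * partial_derivs (j # w) \<phi> x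
        + (\<Sum>v\<leftarrow>(if i = j then [w] else []) @ map ((#) j) V. partial_derivs v \<phi> x)" for x
    unfolding partial_derivs_Cons V
  proof (rule partial_deriv_eqI)
    have "((\<lambda>t. complex_of_real ((x + t *\<^sub>R axis j 1) $ i) * partial_derivs w \<phi> (x + t *\<^sub>R axis j 1)
         + (\<Sum>v\<leftarrow>V. partial_derivs v \<phi> (x + t *\<^sub>R axis j 1))) has_vector_derivative
       (complex_of_real ((x + 0 *\<^sub>R axis j 1) $ i) * partial_deriv j (partial_derivs w \<phi>) x
        + (if i = j then 1 else 0) * partial_derivs w \<phi> (x + 0 *\<^sub>R axis j 1)
        + (\<Sum>v\<leftarrow>map ((#) j) V. partial_derivs v \<phi> x))) (at 0)"
      by (intro has_vector_derivative_add has_vector_derivative_mult coord lst partial_deriv_works schwartz_differentiable assms)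
    then show "((\<lambda>t. complex_of_real ((x + t *\<^sub>R axis j 1) $ i) * partial_derivs w \<phi> (x + t *\<^sub>R axis j 1)
         + (\<Sum>v\<leftarrow>V. partial_derivs v \<phi> (x + t *\<^sub>R axis j 1))) has_vector_derivative
        (of_real (x $ i) * partial_deriv j (partial_derivs w \<phi>) x
        + (\<Sum>v\<leftarrow>(if i = j then [w] else []) @ map ((#) j) V. partial_derivs v \<phi> x))) (at 0)"
      by (rule has_vector_derivative_eq_rhs) (simp add: comp_def)
  qed
  then show ?case by blast
qed

lemma monomial_times_coord:
  fixes x :: "real ^ 'd::finite"
  shows "(\<Prod>j\<in>UNIV. (x $ j) ^ (\<gamma>(i := Suc (\<gamma> i))) j) = x $ i * (\<Prod>j\<in>UNIV. (x $ j) ^ \<gamma> j)"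
  unfolding prod_split_one[where i = i] by (auto intro!: prod.cong)

lemma schwartz_mult_coord:
  assumes \<phi>: "\<phi> \<in> schwartz"
  shows "(\<lambda>x. of_real (x $ i) * \<phi> x) \<in> schwartz"
proof (rule schwartzI)
  fix w
  obtain V where V: "partial_derivs w (\<lambda>x. of_real (x $ i) * \<phi> x)
     = (\<lambda>x. of_real (x $ i) * partial_derivs w \<phi> x + (\<Sum>v\<leftarrow>V. partial_derivs v \<phi> x))"
    using partial_derivs_mult_coord[OF \<phi>] by blast
  have "(\<lambda>x. complex_of_real (x $ i)) differentiable (at x)" for x :: "real ^ 'a"
    by (intro bounded_linear_imp_differentiable bounded_linear_compose[OF bounded_linear_of_real] bounded_linear_vec_nth)
  moreover have "(\<lambda>x. \<Sum>v\<leftarrow>V. partial_derivs v \<phi> x) differentiable (at x)" for x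
    by (induction V) (auto intro!: differentiable_add schwartz_differentiable \<phi>)
  ultimately show "partial_derivs w (\<lambda>x. of_real (x $ i) * \<phi> x) differentiable (at x)" for x
    unfolding V by (intro differentiable_add differentiable_mult schwartz_differentiable \<phi>) auto
  fix \<gamma>
  define B where "B = schwartz_seminorm (\<gamma>(i := Suc (\<gamma> i))) w \<phi> + (\<Sum>v\<leftarrow>V. schwartz_seminorm \<gamma> v \<phi>)"
  have "schwartz_weight \<gamma> w (\<lambda>x. of_real (x $ i) * \<phi> x) x \<le> B" for x
  proof -
    define m where "m = \<bar>\<Prod>j\<in>UNIV. (x $ j) ^ \<gamma> j\<bar>"
    have "m * norm (\<Sum>v\<leftarrow>V. partial_derivs v \<phi> x) \<le> (\<Sum>v\<leftarrow>V. m * norm (partial_derivs v \<phi> x))"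
    proof (induction V)
      case (Cons v V)
      have "m * norm (\<Sum>v\<leftarrow>v # V. partial_derivs v \<phi> x)
         \<le> m * (norm (partial_derivs v \<phi> x) + norm (\<Sum>v\<leftarrow>V. partial_derivs v \<phi> x))"
        by (intro mult_left_mono) (auto simp: m_def norm_triangle_ineq)
      then show ?case using Cons by (simp add: distrib_left)
    qed simp
    also have "\<dots> \<le> (\<Sum>v\<leftarrow>V. schwartz_seminorm \<gamma> v \<phi>)"
      using schwartz_weight_le_seminorm[OF \<phi>, of \<gamma>] unfolding schwartz_weight_def m_def by (intro sum_list_mono) auto
    finally have 1: "m * norm (\<Sum>v\<leftarrow>V. partial_derivs v \<phi> x) \<le> (\<Sum>v\<leftarrow>V. schwartz_seminorm \<gamma> v \<phi>)" .
    have 2: "m * norm (of_real (x $ i) * partial_derivs w \<phi> x) \<le> schwartz_seminorm (\<gamma>(i := Suc (\<gamma> i))) w \<phi>"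
      using schwartz_weight_le_seminorm[OF \<phi>, of "\<gamma>(i := Suc (\<gamma> i))" w x]
      unfolding schwartz_weight_def m_def monomial_times_coord by (simp add: norm_mult abs_mult mult_ac)
    have "schwartz_weight \<gamma> w (\<lambda>x. of_real (x $ i) * \<phi> x) x
       \<le> m * (norm (of_real (x $ i) * partial_derivs w \<phi> x) + norm (\<Sum>v\<leftarrow>V. partial_derivs v \<phi> x))"
      unfolding schwartz_weight_def V m_def by (intro mult_left_mono norm_triangle_ineq) auto
    then show ?thesis using 1 2 unfolding B_def distrib_left by linarith
  qed
  then show "\<exists>B. \<forall>x. schwartz_weight \<gamma> w (\<lambda>x. of_real (x $ i) * \<phi> x) x \<le> B" by blast
qed

lemma schwartz_0: "(\<lambda>x. 0) \<in> schwartz"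
proof -
  have "partial_derivs w (\<lambda>x. 0) = (\<lambda>x. 0)" for w :: "'a list"
    by (induction w) (auto intro!: ext partial_deriv_eqI)
  then show ?thesis by (intro schwartzI) (auto simp: schwartz_weight_def)
qed

lemma schwartz_sum:
  "finite A \<Longrightarrow> (\<And>a. a \<in> A \<Longrightarrow> \<phi> a \<in> schwartz) \<Longrightarrow> (\<lambda>x. \<Sum>a\<in>A. \<phi> a x) \<in> schwartz"
  by (induction A rule: finite_induct) (auto intro: schwartz_0 schwartz_add)

lemma schwartz_continuous: "\<phi> \<in> schwartz \<Longrightarrow> continuous_on UNIV \<phi>"
  using schwartz_differentiable[of \<phi> "[]"] differentiable_imp_continuous_within continuous_on_eq_continuous_within
  by fastforce

lemma schwartz_measurable: "\<phi> \<in> schwartz \<Longrightarrow> \<phi> \<in> borel_measurable borel"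
  by (rule borel_measurable_continuous_onI[OF schwartz_continuous])

text \<open>Expanding the product of \<open>1 + (x $ i)\<^sup>2\<close> over subsets
  \<open>A\<close> of the coordinates exhibits monomial weights of Schwartz seminorms.\<close>

lemma inverse_wt_eq:
  "inverse (wt (x :: real ^ 'd::finite)) = (\<Sum>A\<in>Pow UNIV. \<bar>\<Prod>i\<in>UNIV. (x $ i) ^ (if i \<in> A then 2 else 0)\<bar>)"
proof -
  have "inverse (wt x) = (\<Prod>i\<in>UNIV. (x $ i)\<^sup>2 + 1)"
    unfolding wt_def prod_inversef[symmetric] o_def by (simp add: add.commute)
  also have "\<dots> = (\<Sum>A\<in>Pow UNIV. (\<Prod>i\<in>A. (x $ i)\<^sup>2) * (\<Prod>i\<in>UNIV - A. 1))" by (rule prod_add) simp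
  also have "\<dots> = (\<Sum>A\<in>Pow UNIV. \<bar>\<Prod>i\<in>UNIV. (x $ i) ^ (if i \<in> A then 2 else 0)\<bar>)"
  proof (rule sum.cong)
    fix A :: "'d set"
    have "(\<Prod>i\<in>A. (x $ i)\<^sup>2) = (\<Prod>i\<in>UNIV. (x $ i) ^ (if i \<in> A then 2 else 0))"
      by (rule prod.mono_neutral_cong_left) auto
    moreover have "(\<Prod>i\<in>A. (x $ i)\<^sup>2) \<ge> 0" by (intro prod_nonneg) auto
    ultimately show "(\<Prod>i\<in>A. (x $ i)\<^sup>2) * (\<Prod>i\<in>UNIV - A. 1) = \<bar>\<Prod>i\<in>UNIV. (x $ i) ^ (if i \<in> A then 2 else 0)\<bar>" by simp
  qed simp
  finally show ?thesis .
qed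

text \<open>The sum of precisely the seminorms that occur through \<open>inverse_wt_eq\<close>. It
  controls the pairing with every \<open>L\<^sup>p\<close> function and can be made small on
  Schwartz neighbourhoods.\<close>

definition schwartz_decay :: "(real ^ 'd::finite \<Rightarrow> complex) \<Rightarrow> real" where
  "schwartz_decay \<phi> = (\<Sum>A\<in>Pow UNIV. schwartz_seminorm (\<lambda>i. if i \<in> A then 2 else 0) [] \<phi>)"

lemma schwartz_decay_bound:
  assumes "\<phi> \<in> schwartz"
  shows "norm (\<phi> x) \<le> schwartz_decay \<phi> * wt x"
proof -
  have "inverse (wt x) * norm (\<phi> x) = (\<Sum>A\<in>Pow UNIV. schwartz_weight (\<lambda>i. if i \<in> A then 2 else 0) [] \<phi> x)"
    unfolding inverse_wt_eq schwartz_weight_def by (simp add: sum_distrib_right)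
  also have "\<dots> \<le> schwartz_decay \<phi>"
    unfolding schwartz_decay_def by (intro sum_mono schwartz_weight_le_seminorm assms)
  finally show ?thesis using wt_pos[of x] by (simp add: field_simps)
qed

lemma schwartz_integrable: "\<phi> \<in> schwartz \<Longrightarrow> integrable lborel \<phi>"
  by (rule wt_bound_integrable[OF schwartz_measurable schwartz_decay_bound])

section \<open>Hermite coefficients\<close>

abbreviation Hc :: "('d::finite \<Rightarrow> nat) \<Rightarrow> real ^ 'd \<Rightarrow> complex" where
  "Hc \<beta> \<equiv> (\<lambda>x. complex_of_real (hermite_fun \<beta> x))"

text \<open>The ladder formulas make this class stable under differentiation and under
  multiplication by coordinates, so rapid decay of all derivatives reduces to boundedness of the
  members.\<close>

inductive hermite_comb :: "(real ^ 'd::finite \<Rightarrow> complex) \<Rightarrow> bool" where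
  base: "hermite_comb (Hc \<beta>)"
| add: "hermite_comb \<phi> \<Longrightarrow> hermite_comb \<psi> \<Longrightarrow> hermite_comb (\<lambda>x. \<phi> x + \<psi> x)"
| cmult: "hermite_comb \<phi> \<Longrightarrow> hermite_comb (\<lambda>x. c * \<phi> x)"

lemma bounded_linear_complex_of_real: "bounded_linear complex_of_real"
  by (rule bounded_linear_of_real)

lemma hermite_comb_differentiable: "hermite_comb \<phi> \<Longrightarrow> \<phi> differentiable (at x)"
proof (induction rule: hermite_comb.induct)
  case (base \<beta>)
  show ?case
    using differentiable_chain_at[OF hermite_fun_differentiable[of \<beta> x]
        bounded_linear_imp_differentiable[OF bounded_linear_complex_of_real]]
    by (simp add: o_def)
qed (auto intro!: differentiable_add differentiable_mult)

lemma Hc_deriv: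
  "((\<lambda>t. Hc \<beta> (x + t *\<^sub>R axis i 1)) has_vector_derivative
     (of_real (sqrt (real (\<beta> i) / 2)) * Hc (\<beta>(i := \<beta> i - 1)) x
     + of_real (- sqrt (real (Suc (\<beta> i)) / 2)) * Hc (\<beta>(i := Suc (\<beta> i))) x)) (at 0)"
  using bounded_linear.has_vector_derivative[OF bounded_linear_complex_of_real
      hermite_fun_deriv[of \<beta> x i, unfolded has_real_derivative_iff_has_vector_derivative]]
  by simp

lemma partial_deriv_Hc:
  "partial_deriv i (Hc \<beta>) = (\<lambda>x. of_real (sqrt (real (\<beta> i) / 2)) * Hc (\<beta>(i := \<beta> i - 1)) x
     + of_real (- sqrt (real (Suc (\<beta> i)) / 2)) * Hc (\<beta>(i := Suc (\<beta> i))) x)"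
  by (intro ext partial_deriv_eqI Hc_deriv)

lemma coord_mult_Hc:
  "of_real (x $ i) * Hc \<beta> x = of_real (sqrt (real (Suc (\<beta> i)) / 2)) * Hc (\<beta>(i := Suc (\<beta> i))) x
     + of_real (sqrt (real (\<beta> i) / 2)) * Hc (\<beta>(i := \<beta> i - 1)) x"
  using hermite_fun_mult[of x i \<beta>] by (metis of_real_add of_real_mult)

lemma hermite_comb_partial_deriv: "hermite_comb \<phi> \<Longrightarrow> hermite_comb (partial_deriv i \<phi>)"
proof (induction rule: hermite_comb.induct)
  case (base \<beta>)
  show ?case unfolding partial_deriv_Hc by (intro hermite_comb.intros)
next
  case (add \<phi> \<psi>)
  have "partial_deriv i (\<lambda>x. \<phi> x + \<psi> x) = (\<lambda>x. partial_deriv i \<phi> x + partial_deriv i \<psi> x)"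
    using add by (intro ext partial_deriv_eqI has_vector_derivative_add partial_deriv_works hermite_comb_differentiable)
  then show ?case using add by (auto intro: hermite_comb.intros)
next
  case (cmult \<phi> c)
  have "partial_deriv i (\<lambda>x. c * \<phi> x) = (\<lambda>x. c * partial_deriv i \<phi> x)"
    using cmult by (intro ext partial_deriv_eqI has_vector_derivative_mult_right partial_deriv_works hermite_comb_differentiable)
  then show ?case using cmult by (auto intro: hermite_comb.intros)
qed

lemma hermite_comb_mult_coord: "hermite_comb \<phi> \<Longrightarrow> hermite_comb (\<lambda>x. of_real (x $ i) * \<phi> x)"
proof (induction rule: hermite_comb.induct)
  case (base \<beta>)
  show ?case unfolding coord_mult_Hc by (intro hermite_comb.intros)
next
  case (add \<phi> \<psi>)
  then show ?case unfolding distrib_left by (intro hermite_comb.intros)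
next
  case (cmult \<phi> c)
  then show ?case using hermite_comb.cmult[of "\<lambda>x. of_real (x $ i) * \<phi> x" c] by (simp add: mult.left_commute)
qed

lemma hermite_comb_bounded: "hermite_comb \<phi> \<Longrightarrow> \<exists>B. \<forall>x. norm (\<phi> x) \<le> B"
proof (induction rule: hermite_comb.induct)
  case (base \<beta>)
  show ?case using hermite_fun_bound[of \<beta>] by (auto simp: norm_of_real)
next
  case (add \<phi> \<psi>)
  then obtain B C where "\<forall>x. norm (\<phi> x) \<le> B" "\<forall>x. norm (\<psi> x) \<le> C" by auto
  then show ?case by (intro exI[of _ "B + C"]) (auto intro: norm_triangle_le add_mono)
next
  case (cmult \<phi> c)
  then obtain B where "\<forall>x. norm (\<phi> x) \<le> B" by auto
  then show ?case by (intro exI[of _ "norm c * B"]) (auto simp: norm_mult intro: mult_left_mono)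
qed

text \<open>Monomials are built up from single coordinates, over a finite set of indices and, for
  each index, over its exponent.\<close>

lemma monomial_induct:
  fixes Q :: "(real ^ 'd::finite \<Rightarrow> complex) \<Rightarrow> bool"
  assumes "Q \<phi>" and step: "\<And>\<psi> i. Q \<psi> \<Longrightarrow> Q (\<lambda>x. of_real (x $ i) * \<psi> x)"
  shows "Q (\<lambda>x. of_real (\<Prod>i\<in>UNIV. (x $ i) ^ \<gamma> i) * \<phi> x)"
proof -
  have "Q (\<lambda>x. of_real (\<Prod>i\<in>S. (x $ i) ^ \<gamma> i) * \<phi> x)" if "finite S" for S
    using that
  proof (induction S rule: finite_induct)
    case empty
    then show ?case using assms(1) by simp
  next
    case (insert i S)
    have "Q (\<lambda>x. of_real ((x $ i) ^ n) * (of_real (\<Prod>i\<in>S. (x $ i) ^ \<gamma> i) * \<phi> x))" for n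
    proof (induction n)
      case 0
      then show ?case using insert by simp
    next
      case (Suc n)
      then show ?case using step[of _ i] by (simp add: mult.assoc)
    qed
    from this[of "\<gamma> i"] show ?case using insert by (simp add: mult.assoc)
  qed
  then show ?thesis by simp
qed

lemma hermite_comb_schwartz:
  assumes "hermite_comb \<phi>"
  shows "\<phi> \<in> schwartz"
proof (rule schwartzI)
  have comb: "hermite_comb (partial_derivs w \<phi>)" for w
    by (induction w) (auto intro: assms hermite_comb_partial_deriv)
  then show "partial_derivs w \<phi> differentiable (at x)" for w x by (rule hermite_comb_differentiable)
  fix \<gamma> :: "'a \<Rightarrow> nat" and w
  have "hermite_comb (\<lambda>x. of_real (\<Prod>i\<in>UNIV. (x $ i) ^ \<gamma> i) * partial_derivs w \<phi> x)"
    by (rule monomial_induct[OF comb hermite_comb_mult_coord])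
  from hermite_comb_bounded[OF this] show "\<exists>B. \<forall>x. schwartz_weight \<gamma> w \<phi> x \<le> B"
    by (simp only: schwartz_weight_def norm_mult norm_of_real)
qed

lemma Hc_schwartz: "Hc \<beta> \<in> schwartz"
  by (intro hermite_comb_schwartz hermite_comb.base)

text \<open>Bilinear, without conjugation: the Hermite functions are real, and this is the value of
  \<open>dist_of_fun\<close> at \<open>Hc \<beta>\<close>.\<close>

definition hcoeff :: "(real ^ 'd::finite \<Rightarrow> complex) \<Rightarrow> ('d \<Rightarrow> nat) \<Rightarrow> complex" where
  "hcoeff \<phi> \<beta> = (\<integral>x. \<phi> x * Hc \<beta> x \<partial>lborel)"

lemma integrable_mult_bounded:
  fixes u v :: "real ^ 'd::finite \<Rightarrow> complex"
  assumes "integrable lborel u" and [measurable]: "v \<in> borel_measurable borel" and b: "\<And>x. norm (v x) \<le> B"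
  shows "integrable lborel (\<lambda>x. u x * v x)"
proof (rule Bochner_Integration.integrable_bound)
  have [measurable]: "u \<in> borel_measurable borel" using assms(1) by auto
  show "integrable lborel (\<lambda>x. B * norm (u x))" using assms(1) by auto
  show "(\<lambda>x. u x * v x) \<in> borel_measurable lborel" by simp
  have "norm (u x) * norm (v x) \<le> norm (u x) * B" for x by (intro mult_left_mono b) auto
  then show "AE x in lborel. norm (u x * v x) \<le> norm (B * norm (u x))"
    by (intro AE_I2) (smt (verit) norm_mult real_norm_def mult.commute)
qed

lemma norm_Hc_bound:
  "norm (Hc \<beta> x) \<le> 3 ^ CARD('d) * (1 + real (multi_deg \<beta>)) ^ CARD('d)" for x :: "real ^ 'd::finite"
  using hermite_fun_bound[of \<beta> x] by (simp add: norm_of_real del: of_nat_sum)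

lemma integrable_times_Hc:
  "integrable lborel u \<Longrightarrow> integrable lborel (\<lambda>x. u x * Hc \<beta> x)"
  by (rule integrable_mult_bounded[OF _ _ norm_Hc_bound]) auto

lemma hcoeff_add:
  "integrable lborel u \<Longrightarrow> integrable lborel v \<Longrightarrow> hcoeff (\<lambda>x. u x + v x) \<beta> = hcoeff u \<beta> + hcoeff v \<beta>"
  unfolding hcoeff_def by (simp add: distrib_right integrable_times_Hc)

lemma hcoeff_diff:
  "integrable lborel u \<Longrightarrow> integrable lborel v \<Longrightarrow> hcoeff (\<lambda>x. u x - v x) \<beta> = hcoeff u \<beta> - hcoeff v \<beta>"
  unfolding hcoeff_def by (simp add: left_diff_distrib integrable_times_Hc)

lemma hcoeff_cmult: "hcoeff (\<lambda>x. c * u x) \<beta> = c * hcoeff u \<beta>"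
  unfolding hcoeff_def by (simp add: mult.assoc)

lemma hcoeff_sum:
  "(\<And>a. a \<in> A \<Longrightarrow> integrable lborel (u a)) \<Longrightarrow> hcoeff (\<lambda>x. \<Sum>a\<in>A. u a x) \<beta> = (\<Sum>a\<in>A. hcoeff (u a) \<beta>)"
  unfolding hcoeff_def by (simp add: sum_distrib_right integrable_times_Hc)

lemma hcoeff_bound:
  fixes u :: "real ^ 'd::finite \<Rightarrow> complex"
  assumes "integrable lborel u"
  shows "norm (hcoeff u \<beta>) \<le> (\<integral>x. norm (u x) \<partial>lborel) * (3 ^ CARD('d) * (1 + real (multi_deg \<beta>)) ^ CARD('d))"
proof -
  let ?B = "3 ^ CARD('d) * (1 + real (multi_deg \<beta>)) ^ CARD('d)"
  have "norm (hcoeff u \<beta>) \<le> (\<integral>x. norm (u x * Hc \<beta> x) \<partial>lborel)"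
    unfolding hcoeff_def by (rule integral_norm_bound)
  also have "\<dots> \<le> (\<integral>x. norm (u x) * ?B \<partial>lborel)"
  proof (rule integral_mono)
    show "integrable lborel (\<lambda>x. norm (u x * Hc \<beta> x))" by (intro integrable_norm integrable_times_Hc assms)
    show "integrable lborel (\<lambda>x. norm (u x) * ?B)" using assms by auto
    show "norm (u x * Hc \<beta> x) \<le> norm (u x) * ?B" for x
      unfolding norm_mult by (intro mult_left_mono norm_Hc_bound) auto
  qed
  finally show ?thesis using assms by simp
qed

lemma hcoeff_mult_coord:
  assumes "\<phi> \<in> schwartz"
  shows "hcoeff (\<lambda>x. of_real (x $ i) * \<phi> x) \<beta>
    = of_real (sqrt (real (Suc (\<beta> i)) / 2)) * hcoeff \<phi> (\<beta>(i := Suc (\<beta> i)))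
     + of_real (sqrt (real (\<beta> i) / 2)) * hcoeff \<phi> (\<beta>(i := \<beta> i - 1))"
proof -
  have "hcoeff (\<lambda>x. of_real (x $ i) * \<phi> x) \<beta> = (\<integral>x. \<phi> x * (of_real (x $ i) * Hc \<beta> x) \<partial>lborel)"
    unfolding hcoeff_def by (simp add: mult_ac)
  also have "\<dots> = (\<integral>x. of_real (sqrt (real (Suc (\<beta> i)) / 2)) * (\<phi> x * Hc (\<beta>(i := Suc (\<beta> i))) x)
     + of_real (sqrt (real (\<beta> i) / 2)) * (\<phi> x * Hc (\<beta>(i := \<beta> i - 1)) x) \<partial>lborel)"
    unfolding coord_mult_Hc by (simp add: algebra_simps)
  also have "\<dots> = of_real (sqrt (real (Suc (\<beta> i)) / 2)) * hcoeff \<phi> (\<beta>(i := Suc (\<beta> i)))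
     + of_real (sqrt (real (\<beta> i) / 2)) * hcoeff \<phi> (\<beta>(i := \<beta> i - 1))"
  proof -
    have i: "integrable lborel (\<lambda>x. c * (\<phi> x * Hc \<gamma> x))" for c \<gamma>
      by (intro integrable_mult_right integrable_times_Hc schwartz_integrable assms)
    show ?thesis unfolding hcoeff_def
      by (subst Bochner_Integration.integral_add, rule i, rule i, simp only: integral_mult_right_zero)
  qed
  finally show ?thesis .
qed

lemma schwartz_decay_nonneg:
  fixes \<phi> :: "real ^ 'd::finite \<Rightarrow> complex"
  assumes "\<phi> \<in> schwartz"
  shows "schwartz_decay \<phi> \<ge> 0"
proof -
  have "0 \<le> schwartz_decay \<phi> * wt (0 :: real ^ 'd)"
    by (rule order_trans[OF norm_ge_zero schwartz_decay_bound[OF assms]])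
  then show ?thesis using wt_pos[of "0 :: real ^ 'd"] by (simp add: zero_le_mult_iff)
qed

text \<open>Integration by parts, in the form that the derivative of
  \<open>\<phi> * Hc \<beta>\<close> has integral zero. Compared with
  \<open>hcoeff_mult_coord\<close>, the term of lower degree changes its sign.\<close>

lemma hcoeff_partial_deriv:
  fixes \<phi> :: "real ^ 'd::finite \<Rightarrow> complex"
  assumes \<phi>: "\<phi> \<in> schwartz"
  shows "hcoeff (partial_deriv i \<phi>) \<beta>
    = of_real (sqrt (real (Suc (\<beta> i)) / 2)) * hcoeff \<phi> (\<beta>(i := Suc (\<beta> i)))
     - of_real (sqrt (real (\<beta> i) / 2)) * hcoeff \<phi> (\<beta>(i := \<beta> i - 1))"
proof -
  note [measurable] = schwartz_measurable[OF \<phi>] schwartz_measurable[OF schwartz_partial_deriv[OF \<phi>, of i]]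
    schwartz_measurable[OF schwartz_partial_deriv[OF Hc_schwartz, of i \<beta>]]
  obtain B where B: "\<And>x. norm (Hc \<beta> x) \<le> B" using norm_Hc_bound by blast
  have B0: "B \<ge> 0" by (rule order_trans[OF norm_ge_zero B[of 0]])
  obtain B' where B': "\<And>x. norm (partial_deriv i (Hc \<beta>) x) \<le> B'"
    using hermite_comb_bounded[OF hermite_comb_partial_deriv[OF hermite_comb.base]] by blast
  have B0': "B' \<ge> 0" by (rule order_trans[OF norm_ge_zero B'[of 0]])
  define D where "D = schwartz_decay \<phi>"
  define D' where "D' = schwartz_decay (partial_deriv i \<phi>)"
  have D: "D \<ge> 0" "D' \<ge> 0" unfolding D_def D'_def by (intro schwartz_decay_nonneg schwartz_partial_deriv \<phi>)+
  have b: "norm (\<phi> x) \<le> D * wt x" "norm (partial_deriv i \<phi> x) \<le> D' * wt x" for x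
    unfolding D_def D'_def by (intro schwartz_decay_bound schwartz_partial_deriv \<phi>)+
  have pb: "norm (g x * h x) \<le> (E * F) * wt x" if "norm (g x) \<le> E * wt x" "norm (h x) \<le> F" "E \<ge> 0"
    for g h :: "real ^ 'd \<Rightarrow> complex" and E F x
  proof -
    have "norm (g x * h x) \<le> (E * wt x) * F"
      unfolding norm_mult using that wt_pos[of x] by (intro mult_mono) auto
    then show ?thesis by (simp add: mult_ac)
  qed
  have "(\<integral>x. \<phi> x * partial_deriv i (Hc \<beta>) x + partial_deriv i \<phi> x * Hc \<beta> x \<partial>lborel) = 0"
  proof (rule integral_partial_deriv_eq_0[where i = i and C = "D * B + D * B' + D' * B"])
    show "(\<lambda>x. \<phi> x * Hc \<beta> x) \<in> borel_measurable borel" by measurable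
    show "(\<lambda>x. \<phi> x * partial_deriv i (Hc \<beta>) x + partial_deriv i \<phi> x * Hc \<beta> x) \<in> borel_measurable borel"
      by measurable
    fix x
    have "((\<lambda>t. \<phi> (x + t *\<^sub>R axis i 1) * Hc \<beta> (x + t *\<^sub>R axis i 1)) has_vector_derivative
        \<phi> (x + 0 *\<^sub>R axis i 1) * partial_deriv i (Hc \<beta>) x + partial_deriv i \<phi> x * Hc \<beta> (x + 0 *\<^sub>R axis i 1)) (at 0)"
      by (intro has_vector_derivative_mult partial_deriv_works hermite_comb_differentiable hermite_comb.base
          schwartz_differentiable[of _ "[]", simplified] \<phi>)
    then show "((\<lambda>t. \<phi> (x + t *\<^sub>R axis i 1) * Hc \<beta> (x + t *\<^sub>R axis i 1)) has_vector_derivative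
        \<phi> x * partial_deriv i (Hc \<beta>) x + partial_deriv i \<phi> x * Hc \<beta> x) (at 0)" by simp
    have t1: "norm (\<phi> x * Hc \<beta> x) \<le> (D * B) * wt x" by (rule pb[OF b(1) B D(1)])
    have t2: "norm (\<phi> x * partial_deriv i (Hc \<beta>) x) \<le> (D * B') * wt x" by (rule pb[OF b(1) B' D(1)])
    have t3: "norm (partial_deriv i \<phi> x * Hc \<beta> x) \<le> (D' * B) * wt x" by (rule pb[OF b(2) B D(2)])
    have nn: "D * B * wt x \<ge> 0" "D * B' * wt x \<ge> 0" "D' * B * wt x \<ge> 0" using D B0 B0' wt_pos[of x] by auto
    show "norm (\<phi> x * Hc \<beta> x) \<le> (D * B + D * B' + D' * B) * wt x"
      using t1 nn unfolding distrib_right by linarith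
    show "norm (\<phi> x * partial_deriv i (Hc \<beta>) x + partial_deriv i \<phi> x * Hc \<beta> x) \<le> (D * B + D * B' + D' * B) * wt x"
      using t2 t3 nn norm_triangle_ineq[of "\<phi> x * partial_deriv i (Hc \<beta>) x" "partial_deriv i \<phi> x * Hc \<beta> x"]
      unfolding distrib_right by linarith
  qed
  moreover have "(\<integral>x. \<phi> x * partial_deriv i (Hc \<beta>) x + partial_deriv i \<phi> x * Hc \<beta> x \<partial>lborel)
    = (of_real (sqrt (real (\<beta> i) / 2)) * hcoeff \<phi> (\<beta>(i := \<beta> i - 1))
     + of_real (- sqrt (real (Suc (\<beta> i)) / 2)) * hcoeff \<phi> (\<beta>(i := Suc (\<beta> i)))) + hcoeff (partial_deriv i \<phi>) \<beta>"
  proof -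
    have i: "integrable lborel (\<lambda>x. c * (\<phi> x * Hc \<gamma> x))" "integrable lborel (\<lambda>x. partial_deriv i \<phi> x * Hc \<beta> x)" for c \<gamma>
      by (intro integrable_mult_right integrable_times_Hc schwartz_integrable schwartz_partial_deriv \<phi>)+
    have "(\<integral>x. \<phi> x * partial_deriv i (Hc \<beta>) x + partial_deriv i \<phi> x * Hc \<beta> x \<partial>lborel)
      = (\<integral>x. (of_real (sqrt (real (\<beta> i) / 2)) * (\<phi> x * Hc (\<beta>(i := \<beta> i - 1)) x)
     + of_real (- sqrt (real (Suc (\<beta> i)) / 2)) * (\<phi> x * Hc (\<beta>(i := Suc (\<beta> i))) x)) + partial_deriv i \<phi> x * Hc \<beta> x \<partial>lborel)"
      unfolding partial_deriv_Hc by (simp only: distrib_left mult.left_commute)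
    also have "\<dots> = (of_real (sqrt (real (\<beta> i) / 2)) * hcoeff \<phi> (\<beta>(i := \<beta> i - 1))
     + of_real (- sqrt (real (Suc (\<beta> i)) / 2)) * hcoeff \<phi> (\<beta>(i := Suc (\<beta> i)))) + hcoeff (partial_deriv i \<phi>) \<beta>"
      unfolding hcoeff_def
      by (subst Bochner_Integration.integral_add, intro Bochner_Integration.integrable_add i, rule i,
          subst Bochner_Integration.integral_add, rule i, rule i, simp only: integral_mult_right_zero)
    finally show ?thesis .
  qed
  ultimately show ?thesis by (simp add: algebra_simps add_eq_0_iff)
qed

text \<open>The annihilation operator. On coefficients it reads off the entry one degree higher,
  since the contributions of lower degree cancel.\<close>

definition lower :: "'d::finite \<Rightarrow> (real ^ 'd \<Rightarrow> complex) \<Rightarrow> real ^ 'd \<Rightarrow> complex" where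
  "lower i \<phi> = (\<lambda>x. of_real (x $ i) * \<phi> x + partial_deriv i \<phi> x)"

lemma lower_schwartz: "\<phi> \<in> schwartz \<Longrightarrow> lower i \<phi> \<in> schwartz"
  unfolding lower_def by (intro schwartz_add schwartz_mult_coord schwartz_partial_deriv)

lemma sqrt_half_double: "2 * sqrt (real n / 2) = sqrt (2 * real n)"
  using sqrt_two_half[of "real n"] by simp

lemma hcoeff_lower:
  assumes \<phi>: "\<phi> \<in> schwartz"
  shows "hcoeff (lower i \<phi>) \<beta> = of_real (sqrt (2 * real (Suc (\<beta> i)))) * hcoeff \<phi> (\<beta>(i := Suc (\<beta> i)))"
proof -
  have "hcoeff (lower i \<phi>) \<beta> = hcoeff (\<lambda>x. of_real (x $ i) * \<phi> x) \<beta> + hcoeff (partial_deriv i \<phi>) \<beta>"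
    unfolding lower_def by (intro hcoeff_add schwartz_integrable schwartz_mult_coord schwartz_partial_deriv \<phi>)
  also have "\<dots> = of_real (2 * sqrt (real (Suc (\<beta> i)) / 2)) * hcoeff \<phi> (\<beta>(i := Suc (\<beta> i)))"
    unfolding hcoeff_mult_coord[OF \<phi>] hcoeff_partial_deriv[OF \<phi>] by (simp add: algebra_simps)
  finally show ?thesis unfolding sqrt_half_double .
qed

lemma lower_Hc: "lower i (Hc \<beta>) = (\<lambda>x. of_real (sqrt (2 * real (\<beta> i))) * Hc (\<beta>(i := \<beta> i - 1)) x)"
proof
  fix x
  have "lower i (Hc \<beta>) x = of_real (2 * sqrt (real (\<beta> i) / 2)) * Hc (\<beta>(i := \<beta> i - 1)) x"
    unfolding lower_def partial_deriv_Hc coord_mult_Hc by (simp add: algebra_simps)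
  then show "lower i (Hc \<beta>) x = of_real (sqrt (2 * real (\<beta> i))) * Hc (\<beta>(i := \<beta> i - 1)) x"
    unfolding sqrt_half_double .
qed

lemma hermite_fun_0: "hermite_fun (\<lambda>_. 0) x = (\<Prod>i\<in>UNIV. hermite_const 0 * exp (- (x $ i)\<^sup>2 / 2))"
  unfolding hermite_fun_def hermite_fun1_0 ..

text \<open>The square of the ground state is a product of normalised Gaussians.\<close>

lemma hcoeff_Hc_0: "hcoeff (Hc (\<lambda>_ :: 'd::finite. 0)) (\<lambda>_. 0) = 1"
proof -
  have sq: "hermite_fun (\<lambda>_ :: 'd. 0) x * hermite_fun (\<lambda>_. 0) x = (\<Prod>i\<in>UNIV. (1 / sqrt pi) * exp (- 1 * (x $ i - 0)\<^sup>2))"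
    for x :: "real ^ 'd"
  proof -
    have "(hermite_const 0 * exp (- t\<^sup>2 / 2)) * (hermite_const 0 * exp (- t\<^sup>2 / 2))
        = (hermite_const 0)\<^sup>2 * (exp (- t\<^sup>2 / 2) * exp (- t\<^sup>2 / 2))" for t
      by (simp add: power2_eq_square)
    also have "(hermite_const 0)\<^sup>2 * (exp (- t\<^sup>2 / 2) * exp (- t\<^sup>2 / 2)) = (1 / sqrt pi) * exp (- 1 * (t - 0)\<^sup>2)" for t
      unfolding hermite_const_square by (simp flip: exp_add)
    finally show ?thesis unfolding hermite_fun_0 prod.distrib[symmetric] by simp
  qed
  have "(\<integral>\<^sup>+x. ennreal (hermite_fun (\<lambda>_ :: 'd. 0) x * hermite_fun (\<lambda>_. 0) x) \<partial>lborel)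
     = (\<integral>\<^sup>+x. (\<Prod>i\<in>UNIV. ennreal ((1 / sqrt pi) * exp (- 1 * (x $ i - 0)\<^sup>2))) \<partial>(lborel :: (real ^ 'd) measure))"
    unfolding sq by (intro nn_integral_cong prod_ennreal[symmetric]) auto
  also have "\<dots> = (\<Prod>i\<in>(UNIV :: 'd set). \<integral>\<^sup>+t. ennreal ((1 / sqrt pi) * exp (- 1 * (t - 0)\<^sup>2)) \<partial>lborel)"
    by (rule nn_integral_prod_coord[where f = "\<lambda>_ t. ennreal ((1 / sqrt pi) * exp (- 1 * (t - 0)\<^sup>2))"]) auto
  also have "(\<integral>\<^sup>+t. ennreal ((1 / sqrt pi) * exp (- 1 * (t - 0)\<^sup>2)) \<partial>lborel) = 1"
  proof -
    have "(\<integral>\<^sup>+t. ennreal ((1 / sqrt pi) * exp (- 1 * (t - 0)\<^sup>2)) \<partial>lborel)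
       = ennreal (1 / sqrt pi) * (\<integral>\<^sup>+t. ennreal (exp (- 1 * (t - 0)\<^sup>2)) \<partial>lborel)"
      by (subst nn_integral_cmult[symmetric]) (simp_all flip: ennreal_mult)
    also have "\<dots> = 1" unfolding nn_integral_gaussian[OF zero_less_one] by (simp flip: ennreal_mult)
    finally show ?thesis .
  qed
  finally have "(\<integral>\<^sup>+x. ennreal (hermite_fun (\<lambda>_ :: 'd. 0) x * hermite_fun (\<lambda>_. 0) x) \<partial>lborel) = 1" by simp
  then have "(\<integral>x. hermite_fun (\<lambda>_ :: 'd. 0) x * hermite_fun (\<lambda>_. 0) x \<partial>lborel) = 1"
    by (subst integral_eq_nn_integral) auto
  then have "(\<integral>x. complex_of_real (hermite_fun (\<lambda>_ :: 'd. 0) x * hermite_fun (\<lambda>_. 0) x) \<partial>lborel) = 1"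
    by (subst integral_complex_of_real) simp
  then show ?thesis unfolding hcoeff_def by simp
qed

text \<open>Orthonormality by induction on the degree of \<open>\<gamma>\<close>: a lowering
  operator replaces both \<open>\<beta>\<close> and \<open>\<gamma>\<close> by indices one step
  lower, so that everything reduces to pairings with the ground state.\<close>

lemma hcoeff_Hc: "hcoeff (Hc \<beta>) \<gamma> = (if \<beta> = \<gamma> then 1 else 0)"
proof (induction "multi_deg \<gamma>" arbitrary: \<beta> \<gamma>)
  case 0
  then have \<gamma>: "\<gamma> = (\<lambda>_. 0)" by auto
  show ?case
  proof (cases "\<beta> = \<gamma>")
    case False
    then obtain i where i: "\<beta> i > 0" unfolding \<gamma> by (auto simp: fun_eq_iff)
    define \<beta>' where "\<beta>' = \<beta>(i := \<beta> i - 1)"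
    have \<beta>: "\<beta> = \<beta>'(i := Suc (\<beta>' i))" unfolding \<beta>'_def using i by auto
    \<comment> \<open>By symmetry the lowering operator may act on the ground state, which it
      annihilates.\<close>
    have "hcoeff (Hc \<beta>) \<gamma> = hcoeff (Hc \<gamma>) \<beta>" unfolding hcoeff_def by (simp add: mult.commute)
    moreover have "hcoeff (lower i (Hc \<gamma>)) \<beta>' = of_real (sqrt (2 * real (Suc (\<beta>' i)))) * hcoeff (Hc \<gamma>) \<beta>"
      using hcoeff_lower[OF Hc_schwartz, of i \<gamma> \<beta>'] \<beta> by simp
    moreover have "hcoeff (lower i (Hc \<gamma>)) \<beta>' = 0" unfolding lower_Hc \<gamma> hcoeff_cmult by simp
    ultimately show ?thesis using False by auto
  qed (simp add: \<gamma> hcoeff_Hc_0)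
next
  case (Suc n)
  then obtain i where i: "\<gamma> i > 0" by (metis Zero_not_Suc multi_deg_0_iff not_gr_zero ext)
  define \<gamma>' where "\<gamma>' = \<gamma>(i := \<gamma> i - 1)"
  have \<gamma>: "\<gamma> = \<gamma>'(i := Suc (\<gamma>' i))" unfolding \<gamma>'_def using i by auto
  have n: "n = multi_deg \<gamma>'" using Suc(2) multi_deg_inc[of \<gamma>' i] unfolding \<gamma>[symmetric] by simp
  have "of_real (sqrt (2 * real (Suc (\<gamma>' i)))) * hcoeff (Hc \<beta>) \<gamma> = hcoeff (lower i (Hc \<beta>)) \<gamma>'"
    using hcoeff_lower[OF Hc_schwartz, of i \<beta> \<gamma>'] \<gamma> by simp
  also have "\<dots> = of_real (sqrt (2 * real (\<beta> i))) * hcoeff (Hc (\<beta>(i := \<beta> i - 1))) \<gamma>'"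
    unfolding lower_Hc hcoeff_cmult ..
  also have "\<dots> = of_real (sqrt (2 * real (\<beta> i))) * (if \<beta>(i := \<beta> i - 1) = \<gamma>' then 1 else 0)"
    using Suc(1)[OF n] by simp
  finally have eq: "of_real (sqrt (2 * real (Suc (\<gamma>' i)))) * hcoeff (Hc \<beta>) \<gamma>
     = of_real (sqrt (2 * real (\<beta> i))) * (if \<beta>(i := \<beta> i - 1) = \<gamma>' then 1 else 0)" .
  show ?case
  proof (cases "\<beta> = \<gamma>")
    case True
    then have "\<beta> i = Suc (\<gamma>' i)" "\<beta>(i := \<beta> i - 1) = \<gamma>'" using i unfolding \<gamma>'_def by auto
    then show ?thesis using eq True by (simp del: of_nat_Suc)
  next
    case False
    \<comment> \<open>Truncated subtraction matters here: for \<open>\<beta> i = 0\<close> the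
      lowered index can coincide with \<open>\<gamma>'\<close>, but then the factor
      \<open>sqrt (2 * real (\<beta> i))\<close> vanishes.\<close>
    have "\<beta> i = 0 \<or> \<beta>(i := \<beta> i - 1) \<noteq> \<gamma>'"
    proof (rule ccontr)
      assume "\<not> ?thesis"
      then have pos: "\<beta> i \<noteq> 0" and g: "\<gamma>' = \<beta>(i := \<beta> i - 1)" by simp_all
      have "\<gamma>'(i := Suc (\<gamma>' i)) = \<beta>" unfolding g using pos by auto
      then show False using False \<gamma> by metis
    qed
    then show ?thesis using eq False by auto
  qed
qed

text \<open>Each lowering step gains a factor of order \<open>\<surd>(\<beta> i)\<close>.\<close>

lemma hcoeff_decay_coord:
  fixes \<phi> :: "real ^ 'd::finite \<Rightarrow> complex"
  assumes "\<phi> \<in> schwartz"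
  shows "\<exists>C\<ge>0. \<forall>\<beta>. (1 + real (\<beta> i)) ^ k * norm (hcoeff \<phi> \<beta>) ^ 2 \<le> C * (1 + real (multi_deg \<beta>)) ^ (2 * CARD('d))"
  using assms
proof (induction k arbitrary: \<phi>)
  case 0
  define J where "J = (\<integral>x. norm (\<phi> x) \<partial>lborel) * 3 ^ CARD('d)"
  have J: "J \<ge> 0" unfolding J_def by (intro mult_nonneg_nonneg integral_nonneg) auto
  have "norm (hcoeff \<phi> \<beta>) ^ 2 \<le> J ^ 2 * (1 + real (multi_deg \<beta>)) ^ (2 * CARD('d))" for \<beta>
  proof -
    have "norm (hcoeff \<phi> \<beta>) \<le> J * (1 + real (multi_deg \<beta>)) ^ CARD('d)"
      using hcoeff_bound[OF schwartz_integrable[OF 0], of \<beta>] unfolding J_def by (simp only: mult.assoc)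
    then have "norm (hcoeff \<phi> \<beta>) ^ 2 \<le> (J * (1 + real (multi_deg \<beta>)) ^ CARD('d)) ^ 2" by (intro power_mono) auto
    also have "\<dots> = J ^ 2 * (1 + real (multi_deg \<beta>)) ^ (2 * CARD('d))"
      by (simp only: power_mult_distrib power_mult[symmetric] mult.commute)
    finally show ?thesis .
  qed
  then show ?case by (intro exI[of _ "J ^ 2"]) auto
next
  case (Suc k)
  obtain C1 where C1: "C1 \<ge> 0" "\<And>\<beta>. (1 + real (\<beta> i)) ^ k * norm (hcoeff (lower i \<phi>) \<beta>) ^ 2 \<le> C1 * (1 + real (multi_deg \<beta>)) ^ (2 * CARD('d))"
    using Suc.IH[OF lower_schwartz[OF Suc.prems]] by blast
  obtain C0 where C0: "C0 \<ge> 0" "\<And>\<beta>. (1 + real (\<beta> i)) ^ k * norm (hcoeff \<phi> \<beta>) ^ 2 \<le> C0 * (1 + real (multi_deg \<beta>)) ^ (2 * CARD('d))"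
    using Suc.IH[OF Suc.prems] by blast
  have "(1 + real (\<beta> i)) ^ Suc k * norm (hcoeff \<phi> \<beta>) ^ 2 \<le> (C0 + 2 ^ k * C1) * (1 + real (multi_deg \<beta>)) ^ (2 * CARD('d))" for \<beta>
  \<comment> \<open>Lowering gains nothing at \<open>\<beta> i = 0\<close>, but there the additional
    factor is 1 and the previous exponent suffices; this is why two constants are carried.\<close>
  proof (cases "\<beta> i = 0")
    case True
    then have "(1 + real (\<beta> i)) ^ Suc k * norm (hcoeff \<phi> \<beta>) ^ 2 \<le> C0 * (1 + real (multi_deg \<beta>)) ^ (2 * CARD('d))"
      using C0(2)[of \<beta>] by simp
    also have "\<dots> \<le> (C0 + 2 ^ k * C1) * (1 + real (multi_deg \<beta>)) ^ (2 * CARD('d))"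
      using C0 C1 by (intro mult_right_mono) auto
    finally show ?thesis .
  next
    case False
    define \<beta>' where "\<beta>' = \<beta>(i := \<beta> i - 1)"
    have \<beta>: "\<beta> = \<beta>'(i := Suc (\<beta>' i))" "\<beta> i = Suc (\<beta>' i)" unfolding \<beta>'_def using False by auto
    have "norm (hcoeff (lower i \<phi>) \<beta>') = sqrt (2 * real (\<beta> i)) * norm (hcoeff \<phi> \<beta>)"
      using hcoeff_lower[OF Suc.prems, of i \<beta>'] \<beta> by (simp add: norm_mult norm_of_real del: of_nat_Suc)
    then have "norm (hcoeff (lower i \<phi>) \<beta>') ^ 2 = 2 * real (\<beta> i) * norm (hcoeff \<phi> \<beta>) ^ 2"
      by (simp add: power_mult_distrib)
    moreover have "1 + real (\<beta> i) \<le> 2 * real (\<beta> i)" using \<beta>(2) by simp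
    ultimately have 1: "(1 + real (\<beta> i)) * norm (hcoeff \<phi> \<beta>) ^ 2 \<le> norm (hcoeff (lower i \<phi>) \<beta>') ^ 2"
      by (simp add: mult_right_mono)
    have "(1 + real (\<beta> i)) ^ Suc k * norm (hcoeff \<phi> \<beta>) ^ 2 = (1 + real (\<beta> i)) ^ k * ((1 + real (\<beta> i)) * norm (hcoeff \<phi> \<beta>) ^ 2)"
      by simp
    also have "\<dots> \<le> (2 * (1 + real (\<beta>' i))) ^ k * norm (hcoeff (lower i \<phi>) \<beta>') ^ 2"
      using 1 \<beta>(2) by (intro mult_mono power_mono) auto
    also have "\<dots> = 2 ^ k * ((1 + real (\<beta>' i)) ^ k * norm (hcoeff (lower i \<phi>) \<beta>') ^ 2)"
      by (simp only: power_mult_distrib mult.assoc)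
    also have "\<dots> \<le> 2 ^ k * (C1 * (1 + real (multi_deg \<beta>')) ^ (2 * CARD('d)))"
      by (intro mult_left_mono C1) auto
    also have "\<dots> \<le> 2 ^ k * (C1 * (1 + real (multi_deg \<beta>)) ^ (2 * CARD('d)))"
      using C1(1) multi_deg_dec_le[of \<beta> i] unfolding \<beta>'_def
      by (intro mult_left_mono power_mono add_left_mono of_nat_mono) (auto intro!: add_nonneg_nonneg sum_nonneg)
    also have "\<dots> \<le> (C0 + 2 ^ k * C1) * (1 + real (multi_deg \<beta>)) ^ (2 * CARD('d))"
      unfolding mult.assoc[symmetric] using C0 C1 by (intro mult_right_mono) auto
    finally show ?thesis .
  qed
  then show ?case using C0 C1 by (intro exI[of _ "C0 + 2 ^ k * C1"]) auto
qed

text \<open>A weighted supremum norm of the coefficients, phrased as a bound \<open>A\<close>, so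
  that no supremum has to be shown finite beforehand.\<close>

definition coeff_bdd :: "nat \<Rightarrow> real \<Rightarrow> (real ^ 'd::finite \<Rightarrow> complex) \<Rightarrow> bool" where
  "coeff_bdd k A \<phi> \<longleftrightarrow> (\<forall>\<beta>. (1 + real (multi_deg \<beta>)) ^ k * norm (hcoeff \<phi> \<beta>) \<le> A)"

text \<open>The largest coordinate carries at least the average degree; this turns decay in each
  coordinate into decay in the total degree.\<close>

lemma multi_deg_le_max:
  fixes \<beta> :: "'d::finite \<Rightarrow> nat"
  obtains i where "1 + real (multi_deg \<beta>) \<le> real CARD('d) * (1 + real (\<beta> i))"
proof -
  have "Max (range \<beta>) \<in> range \<beta>" by (rule Max_in) auto
  then obtain i where i: "Max (range \<beta>) = \<beta> i" by (rule rangeE)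
  have "\<beta> j \<le> \<beta> i" for j unfolding i[symmetric] by simp
  then have "multi_deg \<beta> \<le> CARD('d) * \<beta> i" using sum_bounded_above[of UNIV \<beta> "\<beta> i"] by simp
  from add_mono[OF _ this, of 1 "CARD('d)"] have "1 + multi_deg \<beta> \<le> CARD('d) * (1 + \<beta> i)"
    by (simp add: Suc_leI distrib_left)
  then have "real (1 + multi_deg \<beta>) \<le> real (CARD('d) * (1 + \<beta> i))" by (rule of_nat_mono)
  then show ?thesis by (intro that[of i]) (simp del: of_nat_sum add: distrib_left)
qed

lemma hcoeff_decay:
  fixes \<phi> :: "real ^ 'd::finite \<Rightarrow> complex"
  assumes "\<phi> \<in> schwartz"
  shows "\<exists>A. coeff_bdd k A \<phi>"
proof -
  \<comment> \<open>Twice \<open>k\<close> because squares are estimated; the extra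
    \<open>2 * CARD('d)\<close> cancels the growth that \<open>hcoeff_decay_coord\<close> leaves on
    its right-hand side.\<close>
  define m where "m = 2 * k + 2 * CARD('d)"
  have "\<forall>i. \<exists>C\<ge>0. \<forall>\<beta>. (1 + real (\<beta> i)) ^ m * norm (hcoeff \<phi> \<beta>) ^ 2 \<le> C * (1 + real (multi_deg \<beta>)) ^ (2 * CARD('d))"
    using hcoeff_decay_coord[OF assms] by blast
  then obtain C where C: "\<And>i. C i \<ge> 0"
    "\<And>i \<beta>. (1 + real (\<beta> i)) ^ m * norm (hcoeff \<phi> \<beta>) ^ 2 \<le> C i * (1 + real (multi_deg \<beta>)) ^ (2 * CARD('d))" by metis
  define S where "S = real CARD('d) ^ m * (\<Sum>i\<in>UNIV. C i)"
  have S: "S \<ge> 0" unfolding S_def using C(1) by (intro mult_nonneg_nonneg sum_nonneg) auto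
  have "(1 + real (multi_deg \<beta>)) ^ k * norm (hcoeff \<phi> \<beta>) \<le> sqrt S" for \<beta>
  proof -
    define M where "M = 1 + real (multi_deg \<beta>)"
    define c where "c = norm (hcoeff \<phi> \<beta>)"
    have M: "M > 0" unfolding M_def by (simp del: of_nat_sum add: add_pos_nonneg)
    obtain i where i: "M \<le> real CARD('d) * (1 + real (\<beta> i))" unfolding M_def by (rule multi_deg_le_max)
    have "(M ^ k * c) ^ 2 * M ^ (2 * CARD('d)) = M ^ m * c ^ 2"
      unfolding m_def power_add power_mult_distrib power_mult[symmetric] by (simp add: mult_ac)
    also have "\<dots> \<le> (real CARD('d) * (1 + real (\<beta> i))) ^ m * c ^ 2"
      using i M by (intro mult_right_mono power_mono) auto
    also have "\<dots> = real CARD('d) ^ m * ((1 + real (\<beta> i)) ^ m * c ^ 2)" by (simp only: power_mult_distrib mult.assoc)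
    also have "\<dots> \<le> real CARD('d) ^ m * (C i * M ^ (2 * CARD('d)))"
      unfolding c_def M_def by (intro mult_left_mono C) auto
    also have "\<dots> \<le> real CARD('d) ^ m * ((\<Sum>i\<in>UNIV. C i) * M ^ (2 * CARD('d)))"
      using C(1) M by (intro mult_left_mono mult_right_mono member_le_sum) auto
    also have "\<dots> = S * M ^ (2 * CARD('d))" unfolding S_def by simp
    finally have "(M ^ k * c) ^ 2 \<le> S" using M by simp
    then show ?thesis unfolding M_def[symmetric] c_def[symmetric] by (rule real_le_rsqrt)
  qed
  then show ?thesis unfolding coeff_bdd_def by blast
qed

section \<open>Mehler's kernel as an approximate identity\<close>

definition mehler_real :: "real \<Rightarrow> real ^ 'd::finite \<Rightarrow> real ^ 'd \<Rightarrow> real" where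
  "mehler_real r x y = (\<Prod>i\<in>UNIV. exp ((4 * (x $ i) * (y $ i) * r - ((x $ i)\<^sup>2 + (y $ i)\<^sup>2) * (1 + r\<^sup>2))
      / (2 * (1 - r\<^sup>2))) / sqrt (pi * (1 - r\<^sup>2)))"

lemma mehler_of_real: "\<bar>r\<bar> < 1 \<Longrightarrow> mehler (of_real r) x y = of_real (mehler_real r x y)"
  unfolding mehler_def mehler_real_def of_real_prod by (intro prod.cong mehler1_of_real) auto

lemma mehler_real_sums:
  assumes "\<bar>r\<bar> < 1"
  shows "(\<lambda>\<nu>. hermite_kernel \<nu> x y * r ^ \<nu>) sums mehler_real r x y"
proof -
  have "(\<lambda>\<nu>. complex_of_real (hermite_kernel \<nu> x y * r ^ \<nu>)) sums of_real (mehler_real r x y)"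
    using mehler_sums[of "of_real r" x y] mehler_of_real[OF assms, of x y] assms by simp
  then show ?thesis by (simp only: sums_of_real_iff)
qed

lemma mehler_real_measurable [measurable]:
  "mehler_real r x \<in> borel_measurable borel" "(\<lambda>y. mehler_real r y x) \<in> borel_measurable borel"
  unfolding mehler_real_def by measurable

lemma mehler_real_nonneg: "\<bar>r\<bar> < 1 \<Longrightarrow> mehler_real r x y \<ge> 0"
  unfolding mehler_real_def by (intro prod_nonneg) (auto simp: abs_square_le_1)

text \<open>With \<open>s\<^sup>2 = (1 - r) / (1 + r)\<close> the substitution \<open>y = x + 2 s z\<close> turns Mehler's kernel into a
  perturbation of the standard Gaussian.\<close>

definition mehler_scale :: "real \<Rightarrow> real" where
  "mehler_scale r = sqrt ((1 - r) / (1 + r))"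

lemma mehler_real_subst:
  fixes x z :: "real ^ 'd::finite"
  assumes r: "0 < r" "r < 1"
  shows "(2 * mehler_scale r) ^ CARD('d) * mehler_real r x (x + (2 * mehler_scale r) *\<^sub>R z)
    = (\<Prod>i\<in>UNIV. 2 / (1 + r) / sqrt pi * exp (- (mehler_scale r)\<^sup>2 * (x $ i + mehler_scale r * z $ i)\<^sup>2 - (z $ i)\<^sup>2))"
proof -
  define s where "s = mehler_scale r"
  have s: "s > 0" "s\<^sup>2 = (1 - r) / (1 + r)" unfolding s_def mehler_scale_def using r by auto
  have r2: "1 - r\<^sup>2 = s\<^sup>2 * (1 + r)\<^sup>2" "1 - r\<^sup>2 > 0"
  proof -
    show "1 - r\<^sup>2 = s\<^sup>2 * (1 + r)\<^sup>2" unfolding s(2) using r by (simp add: field_simps power2_eq_square)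
    then show "1 - r\<^sup>2 > 0" using s r by (metis add_pos_pos mult_pos_pos zero_less_one zero_less_power)
  qed
  have sq: "sqrt (pi * (1 - r\<^sup>2)) = sqrt pi * (s * (1 + r))"
    unfolding r2(1) real_sqrt_mult using s(1) r by simp
  have rs: "r = (1 - s\<^sup>2) / (1 + s\<^sup>2)" unfolding s(2) using r by (simp add: field_simps)
  have one: "2 * s * (exp ((4 * a * (a + 2 * s * t) * r - (a\<^sup>2 + (a + 2 * s * t)\<^sup>2) * (1 + r\<^sup>2))
      / (2 * (1 - r\<^sup>2))) / sqrt (pi * (1 - r\<^sup>2)))
     = 2 / (1 + r) / sqrt pi * exp (- s\<^sup>2 * (a + s * t)\<^sup>2 - t\<^sup>2)" for a t
  proof -
    define y w where "y = a + 2 * s * t" and "w = a + s * t"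
    have ay: "a + y = 2 * w" "y - a = 2 * s * t" unfolding y_def w_def by simp_all
    have r1: "1 - r = s\<^sup>2 * (1 + r)" unfolding s(2) using r by simp
    \<comment> \<open>The quadratic form is diagonal in \<open>a + y\<close> and
      \<open>y - a\<close>; by the substitution the second square becomes a multiple of
      \<open>t\<^sup>2\<close>.\<close>
    have "2 * (4 * a * y * r - (a\<^sup>2 + y\<^sup>2) * (1 + r\<^sup>2)) = - ((1 - r)\<^sup>2 * (a + y)\<^sup>2 + (1 + r)\<^sup>2 * (y - a)\<^sup>2)"
      by (simp add: power2_eq_square algebra_simps)
    also have "\<dots> = 4 * (s\<^sup>2 * (1 + r)\<^sup>2) * (- s\<^sup>2 * w\<^sup>2 - t\<^sup>2)"
      unfolding ay r1 by (simp add: power2_eq_square algebra_simps)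
    finally have "4 * a * y * r - (a\<^sup>2 + y\<^sup>2) * (1 + r\<^sup>2) = 2 * (1 - r\<^sup>2) * (- s\<^sup>2 * w\<^sup>2 - t\<^sup>2)"
      unfolding r2(1) by simp
    then have E: "(4 * a * (a + 2 * s * t) * r - (a\<^sup>2 + (a + 2 * s * t)\<^sup>2) * (1 + r\<^sup>2)) / (2 * (1 - r\<^sup>2))
        = - s\<^sup>2 * (a + s * t)\<^sup>2 - t\<^sup>2" using r2(2) unfolding y_def w_def by simp
    have gen: "2 * s * (e / (P * (s * D))) = 2 / D / P * e" if "P \<noteq> 0" "D \<noteq> 0" for e P D
      using that s(1) by (simp add: field_simps)
    show ?thesis unfolding E sq by (rule gen) (use r in auto)
  qed
  have "(2 * s) ^ CARD('d) * mehler_real r x (x + (2 * s) *\<^sub>R z)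
    = (\<Prod>i\<in>(UNIV :: 'd set). 2 * s) * mehler_real r x (x + (2 * s) *\<^sub>R z)" by simp
  also have "\<dots> = (\<Prod>i\<in>UNIV. 2 / (1 + r) / sqrt pi * exp (- s\<^sup>2 * (x $ i + s * z $ i)\<^sup>2 - (z $ i)\<^sup>2))"
    unfolding mehler_real_def prod.distrib[symmetric]
    by (intro prod.cong refl) (simp only: vector_add_component vector_scaleR_component real_scaleR_def one)
  finally show ?thesis unfolding s_def .
qed

lemma lborel_integral_affine:
  fixes f :: "real ^ 'd::finite \<Rightarrow> complex"
  assumes [measurable]: "f \<in> borel_measurable borel" and c: "c > 0"
  shows "(\<integral>x. f x \<partial>lborel) = (\<integral>z. of_real (c ^ CARD('d)) * f (t + c *\<^sub>R z) \<partial>lborel)"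
proof -
  have "(\<integral>x. f x \<partial>lborel) = (\<integral>x. f x \<partial>density (distr lborel borel (\<lambda>z. t + c *\<^sub>R z)) (\<lambda>_. ennreal (\<bar>c\<bar> ^ CARD('d))))"
    using lborel_affine[of c t] c by simp
  also have "\<dots> = (\<integral>x. \<bar>c\<bar> ^ CARD('d) *\<^sub>R f x \<partial>distr lborel borel (\<lambda>z. t + c *\<^sub>R z))"
    by (rule integral_density) auto
  also have "\<dots> = (\<integral>z. \<bar>c\<bar> ^ CARD('d) *\<^sub>R f (t + c *\<^sub>R z) \<partial>lborel)"
    by (rule integral_distr) auto
  finally show ?thesis using c by (simp add: scaleR_conv_of_real)
qed

definition gauss :: "real ^ 'd::finite \<Rightarrow> real" where
  "gauss z = (\<Prod>i\<in>UNIV. 1 / sqrt pi * exp (- (z $ i)\<^sup>2))"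

lemma gauss_measurable [measurable]: "gauss \<in> borel_measurable borel"
  unfolding gauss_def[abs_def] by measurable

lemma gauss_nonneg: "gauss z \<ge> 0"
  unfolding gauss_def by (intro prod_nonneg) auto

lemma gauss_integral: "integrable lborel (gauss :: real ^ 'd::finite \<Rightarrow> real)" "(\<integral>z. gauss (z :: real ^ 'd) \<partial>lborel) = 1"
proof -
  have "(\<integral>\<^sup>+z. ennreal (gauss (z :: real ^ 'd)) \<partial>lborel)
     = (\<integral>\<^sup>+z. (\<Prod>i\<in>UNIV. ennreal (1 / sqrt pi * exp (- (z $ i)\<^sup>2))) \<partial>(lborel :: (real ^ 'd) measure))"
    unfolding gauss_def by (intro nn_integral_cong prod_ennreal[symmetric]) auto
  also have "\<dots> = (\<Prod>i\<in>(UNIV :: 'd set). \<integral>\<^sup>+t. ennreal (1 / sqrt pi * exp (- t\<^sup>2)) \<partial>lborel)"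
    by (rule nn_integral_prod_coord[where f = "\<lambda>_ t. ennreal (1 / sqrt pi * exp (- t\<^sup>2))"]) auto
  also have "(\<integral>\<^sup>+t. ennreal (1 / sqrt pi * exp (- t\<^sup>2)) \<partial>lborel) = 1"
  proof -
    have "(\<integral>\<^sup>+t. ennreal (1 / sqrt pi * exp (- t\<^sup>2)) \<partial>lborel)
       = ennreal (1 / sqrt pi) * (\<integral>\<^sup>+t. ennreal (exp (- 1 * (t - 0)\<^sup>2)) \<partial>lborel)"
      by (subst nn_integral_cmult[symmetric]) (simp_all flip: ennreal_mult)
    also have "\<dots> = 1" unfolding nn_integral_gaussian[OF zero_less_one] by (simp flip: ennreal_mult)
    finally show ?thesis .
  qed
  finally have *: "(\<integral>\<^sup>+z. ennreal (gauss (z :: real ^ 'd)) \<partial>lborel) = 1" by simp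
  show "integrable lborel (gauss :: real ^ 'd \<Rightarrow> real)"
    by (rule integrableI_nonneg) (use * in \<open>auto simp: gauss_nonneg\<close>)
  show "(\<integral>z. gauss (z :: real ^ 'd) \<partial>lborel) = 1"
    by (subst integral_eq_nn_integral) (use * in \<open>auto simp: gauss_nonneg\<close>)
qed

text \<open>Parameters for Abel summation; any sequence in the open unit interval with limit 1 would
  serve.\<close>

definition abel :: "nat \<Rightarrow> real" where
  "abel n = 1 - 1 / real (n + 2)"

lemma abel: "0 < abel n" "abel n < 1" "\<bar>abel n\<bar> < 1"
  unfolding abel_def by auto

lemma abel_tendsto: "abel \<longlonglongrightarrow> 1"
  unfolding abel_def by real_asymp

text \<open>After the substitution the kernel tends pointwise to \<open>gauss\<close>, which has
  mass 1. It is dominated by \<open>2 ^ CARD('d)\<close> times \<open>gauss\<close>, since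
  \<open>2 / (1 + r) \<le> 2\<close> and the perturbing square enters the exponent with a minus
  sign.\<close>

lemma mehler_tendsto:
  fixes \<psi> :: "real ^ 'd::finite \<Rightarrow> complex"
  assumes cont: "continuous_on UNIV \<psi>" and bdd: "\<And>x. norm (\<psi> x) \<le> B"
  shows "(\<lambda>n. \<integral>y. of_real (mehler_real (abel n) x y) * \<psi> y \<partial>lborel) \<longlonglongrightarrow> \<psi> x"
proof -
  have [measurable]: "\<psi> \<in> borel_measurable borel" by (rule borel_measurable_continuous_onI[OF cont])
  define s where "s n = mehler_scale (abel n)" for n
  have s: "s n > 0" for n unfolding s_def mehler_scale_def using abel[of n] by simp
  have s0: "s \<longlonglongrightarrow> 0"
  proof -
    have "(\<lambda>n. sqrt ((1 - abel n) / (1 + abel n))) \<longlonglongrightarrow> sqrt ((1 - 1) / (1 + 1))"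
      by (intro tendsto_intros abel_tendsto) auto
    then show ?thesis unfolding s_def mehler_scale_def by simp
  qed
  define g where "g n z = (\<Prod>i\<in>UNIV. 2 / (1 + abel n) / sqrt pi * exp (- (s n)\<^sup>2 * (x $ i + s n * z $ i)\<^sup>2 - (z $ i)\<^sup>2))" for n and z :: "real ^ 'd"
  have "(\<integral>y. of_real (mehler_real (abel n) x y) * \<psi> y \<partial>lborel)
      = (\<integral>z. of_real (g n z) * \<psi> (x + (2 * s n) *\<^sub>R z) \<partial>lborel)" for n
  proof -
    have "(\<integral>y. of_real (mehler_real (abel n) x y) * \<psi> y \<partial>lborel)
       = (\<integral>z. of_real ((2 * s n) ^ CARD('d)) * (of_real (mehler_real (abel n) x (x + (2 * s n) *\<^sub>R z)) * \<psi> (x + (2 * s n) *\<^sub>R z)) \<partial>lborel)"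
      by (rule lborel_integral_affine) (use s[of n] in auto)
    also have "\<dots> = (\<integral>z. of_real (g n z) * \<psi> (x + (2 * s n) *\<^sub>R z) \<partial>lborel)"
      unfolding g_def s_def mehler_real_subst[OF abel(1,2), symmetric] by (simp add: mult.assoc)
    finally show ?thesis .
  qed
  moreover have "(\<lambda>n. \<integral>z. of_real (g n z) * \<psi> (x + (2 * s n) *\<^sub>R z) \<partial>lborel) \<longlonglongrightarrow> (\<integral>z. of_real (gauss (z :: real ^ 'd)) * \<psi> x \<partial>lborel)"
  proof (rule integral_dominated_convergence[where w = "\<lambda>z :: real ^ 'd. 2 ^ CARD('d) * B * gauss z"])
    show "integrable lborel (\<lambda>z. 2 ^ CARD('d) * B * gauss (z :: real ^ 'd))" using gauss_integral by auto
    show "(\<lambda>z. of_real (g n z) * \<psi> (x + (2 * s n) *\<^sub>R z)) \<in> borel_measurable lborel" for n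
      unfolding g_def by measurable
    show "AE z in lborel. (\<lambda>n. of_real (g n z) * \<psi> (x + (2 * s n) *\<^sub>R z)) \<longlonglongrightarrow> of_real (gauss z) * \<psi> x"
    proof (rule AE_I2, intro tendsto_mult tendsto_of_real)
      fix z :: "real ^ 'd"
      have "(\<lambda>n. g n z) \<longlonglongrightarrow> (\<Prod>i\<in>UNIV. 2 / (1 + 1) / sqrt pi * exp (- 0\<^sup>2 * (x $ i + 0 * z $ i)\<^sup>2 - (z $ i)\<^sup>2))"
        unfolding g_def by (intro tendsto_intros abel_tendsto s0) auto
      then show "(\<lambda>n. g n z) \<longlonglongrightarrow> gauss z" unfolding gauss_def by simp
      have "(\<lambda>n. x + (2 * s n) *\<^sub>R z) \<longlonglongrightarrow> x + (2 * 0) *\<^sub>R z" by (intro tendsto_intros s0)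
      then have "(\<lambda>n. x + (2 * s n) *\<^sub>R z) \<longlonglongrightarrow> x" by simp
      moreover have "isCont \<psi> x" using cont by (simp add: continuous_on_eq_continuous_at)
      ultimately show "(\<lambda>n. \<psi> (x + (2 * s n) *\<^sub>R z)) \<longlonglongrightarrow> \<psi> x" by (rule isCont_tendsto_compose[rotated])
    qed
    fix n
    show "AE z in lborel. norm (of_real (g n z) * \<psi> (x + (2 * s n) *\<^sub>R z)) \<le> 2 ^ CARD('d) * B * gauss z"
    proof (rule AE_I2)
      fix z :: "real ^ 'd"
      have "g n z \<ge> 0" unfolding g_def using abel[of n] by (intro prod_nonneg) auto
      moreover have "g n z \<le> 2 ^ CARD('d) * gauss z"
      proof -
        have "g n z \<le> (\<Prod>i\<in>UNIV. 2 * (1 / sqrt pi * exp (- (z $ i)\<^sup>2)))"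
          unfolding g_def
        proof (intro prod_mono conjI)
          fix i
          show "0 \<le> 2 / (1 + abel n) / sqrt pi * exp (- (s n)\<^sup>2 * (x $ i + s n * z $ i)\<^sup>2 - (z $ i)\<^sup>2)"
            using abel[of n] by auto
          have "2 / (1 + abel n) \<le> 2" using abel[of n] by (simp add: divide_le_eq)
          then have "2 / (1 + abel n) / sqrt pi \<le> 2 / sqrt pi" by (rule divide_right_mono) simp
          then have "2 / (1 + abel n) / sqrt pi * exp (- (s n)\<^sup>2 * (x $ i + s n * z $ i)\<^sup>2 - (z $ i)\<^sup>2)
              \<le> (2 / sqrt pi) * exp (- (z $ i)\<^sup>2)"
            using abel[of n] by (intro mult_mono) auto
          then show "2 / (1 + abel n) / sqrt pi * exp (- (s n)\<^sup>2 * (x $ i + s n * z $ i)\<^sup>2 - (z $ i)\<^sup>2)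
              \<le> 2 * (1 / sqrt pi * exp (- (z $ i)\<^sup>2))" by simp
        qed
        then show ?thesis unfolding prod.distrib gauss_def by simp
      qed
      ultimately have "\<bar>g n z\<bar> * norm (\<psi> (x + (2 * s n) *\<^sub>R z)) \<le> (2 ^ CARD('d) * gauss z) * B"
        using gauss_nonneg[of z] by (intro mult_mono bdd) auto
      then show "norm (of_real (g n z) * \<psi> (x + (2 * s n) *\<^sub>R z)) \<le> 2 ^ CARD('d) * B * gauss z"
        by (simp add: norm_mult mult_ac)
    qed
  qed simp
  moreover have "(\<integral>z. of_real (gauss z) * \<psi> x \<partial>(lborel :: (real ^ 'd) measure)) = \<psi> x"
    using gauss_integral(2)[where 'd='d] by simp
  ultimately show ?thesis by (simp add: gauss_integral(2))
qed

section \<open>Hermite expansions of Schwartz functions\<close>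

definition hcomp :: "nat \<Rightarrow> (('d::finite \<Rightarrow> nat) \<Rightarrow> complex) \<Rightarrow> real ^ 'd \<Rightarrow> complex" where
  "hcomp \<nu> c x = (\<Sum>\<beta> | multi_deg \<beta> = \<nu>. c \<beta> * Hc \<beta> x)"

lemma summable_power_poly:
  assumes "\<bar>r\<bar> < (1::real)"
  shows "summable (\<lambda>\<nu>. (1 + real \<nu>) ^ k * r ^ \<nu>)"
proof -
  obtain c where c: "\<bar>r\<bar> < c" "c < 1" using assms dense by blast
  have "(\<lambda>n. (2 + real n) / (1 + real n)) \<longlonglongrightarrow> 1" by real_asymp
  then have "(\<lambda>n. ((2 + real n) / (1 + real n)) ^ k * \<bar>r\<bar>) \<longlonglongrightarrow> 1 ^ k * \<bar>r\<bar>" by (intro tendsto_intros)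
  then have "\<forall>\<^sub>F n in sequentially. ((2 + real n) / (1 + real n)) ^ k * \<bar>r\<bar> < c"
    using c by (intro order_tendstoD(2)) auto
  then obtain N where N: "\<And>n. n \<ge> N \<Longrightarrow> ((2 + real n) / (1 + real n)) ^ k * \<bar>r\<bar> < c"
    unfolding eventually_sequentially by auto
  show ?thesis
  proof (rule summable_ratio_test[OF c(2)])
    fix n assume "n \<ge> N"
    have p: "(1 + real n) ^ k > 0" by simp
    have "norm ((1 + real (Suc n)) ^ k * r ^ Suc n) = (((2 + real n) / (1 + real n)) ^ k * \<bar>r\<bar>) * ((1 + real n) ^ k * \<bar>r ^ n\<bar>)"
      using p by (simp add: abs_mult power_divide)
    also have "\<dots> \<le> c * ((1 + real n) ^ k * \<bar>r ^ n\<bar>)"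
      using N[OF \<open>n \<ge> N\<close>] p by (intro mult_right_mono) auto
    finally show "norm ((1 + real (Suc n)) ^ k * r ^ Suc n) \<le> c * norm ((1 + real n) ^ k * r ^ n)"
      by (simp add: abs_mult)
  qed
qed

text \<open>The operator multiplies the component of degree \<open>\<nu>\<close> by
  \<open>r ^ \<nu>\<close>. The polynomial bound on the Hermite kernels, beaten by
  \<open>r ^ \<nu>\<close>, justifies exchanging sum and integral.\<close>

lemma mehler_integral_sums:
  fixes u :: "real ^ 'd::finite \<Rightarrow> complex"
  assumes u: "integrable lborel u" and r: "\<bar>r\<bar> < 1"
  shows "(\<lambda>\<nu>. of_real (r ^ \<nu>) * hcomp \<nu> (hcoeff u) x) sums (\<integral>y. of_real (mehler_real r x y) * u y \<partial>lborel)"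
proof -
  have [measurable]: "u \<in> borel_measurable borel" using u by auto
  define f where "f \<nu> y = of_real (r ^ \<nu>) * (of_real (hermite_kernel \<nu> x y) * u y)" for \<nu> y
  define J where "J = (\<integral>y. norm (u y) \<partial>lborel)"
  have kb: "norm (f \<nu> y) \<le> \<bar>r\<bar> ^ \<nu> * (9 ^ CARD('d) * (1 + real \<nu>) ^ (3 * CARD('d))) * norm (u y)" for \<nu> y
  proof -
    have "\<bar>r\<bar> ^ \<nu> * \<bar>hermite_kernel \<nu> x y\<bar> \<le> \<bar>r\<bar> ^ \<nu> * (9 ^ CARD('d) * (1 + real \<nu>) ^ (3 * CARD('d)))"
      by (intro mult_left_mono hermite_kernel_bound) auto
    from mult_right_mono[OF this norm_ge_zero[of "u y"]] show ?thesis
      unfolding f_def by (simp add: norm_mult norm_power power_abs mult.assoc)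
  qed
  have sb: "summable (\<lambda>\<nu>. \<bar>r\<bar> ^ \<nu> * (9 ^ CARD('d) * (1 + real \<nu>) ^ (3 * CARD('d))))"
    using summable_mult[OF summable_power_poly[of "\<bar>r\<bar>" "3 * CARD('d)"], of "9 ^ CARD('d)"] r by (simp add: mult_ac)
  have kernel: "f \<nu> y = (\<Sum>\<beta> | multi_deg \<beta> = \<nu>. of_real (r ^ \<nu>) * Hc \<beta> x * (u y * Hc \<beta> y))" for \<nu> y
    unfolding f_def hermite_kernel_def of_real_sum sum_distrib_left sum_distrib_right by (simp add: mult_ac)
  have fi: "integrable lborel (f \<nu>)" for \<nu>
    unfolding kernel[abs_def] by (intro Bochner_Integration.integrable_sum integrable_mult_right integrable_times_Hc u)
  have int: "(\<integral>y. f \<nu> y \<partial>lborel) = of_real (r ^ \<nu>) * hcomp \<nu> (hcoeff u) x" for \<nu>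
  proof -
    have "(\<integral>y. f \<nu> y \<partial>lborel) = (\<Sum>\<beta> | multi_deg \<beta> = \<nu>. \<integral>y. of_real (r ^ \<nu>) * Hc \<beta> x * (u y * Hc \<beta> y) \<partial>lborel)"
      unfolding kernel by (rule Bochner_Integration.integral_sum) (intro integrable_mult_right integrable_times_Hc u)
    also have "\<dots> = of_real (r ^ \<nu>) * hcomp \<nu> (hcoeff u) x"
      unfolding hcomp_def hcoeff_def sum_distrib_left integral_mult_right_zero
      by (intro sum.cong refl) (simp only: mult_ac)
    finally show ?thesis .
  qed
  have s1: "AE y in lborel. summable (\<lambda>\<nu>. norm (f \<nu> y))"
  proof (rule AE_I2)
    fix y show "summable (\<lambda>\<nu>. norm (f \<nu> y))"
      by (rule summable_comparison_test'[OF summable_mult2[OF sb, of "norm (u y)"], of 0]) (use kb in auto)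
  qed
  have s2: "summable (\<lambda>\<nu>. \<integral>y. norm (f \<nu> y) \<partial>lborel)"
  proof (rule summable_comparison_test'[OF summable_mult2[OF sb, of J], of 0])
    fix \<nu>
    have "(\<integral>y. norm (f \<nu> y) \<partial>lborel) \<le> (\<integral>y. \<bar>r\<bar> ^ \<nu> * (9 ^ CARD('d) * (1 + real \<nu>) ^ (3 * CARD('d))) * norm (u y) \<partial>lborel)"
      using u by (intro integral_mono kb integrable_norm fi) auto
    also have "\<dots> = \<bar>r\<bar> ^ \<nu> * (9 ^ CARD('d) * (1 + real \<nu>) ^ (3 * CARD('d))) * J" unfolding J_def by simp
    finally show "norm (\<integral>y. norm (f \<nu> y) \<partial>lborel) \<le> \<bar>r\<bar> ^ \<nu> * (9 ^ CARD('d) * (1 + real \<nu>) ^ (3 * CARD('d))) * J"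
      by simp
  qed
  have "(\<lambda>\<nu>. \<integral>y. f \<nu> y \<partial>lborel) sums (\<integral>y. (\<Sum>\<nu>. f \<nu> y) \<partial>lborel)"
    by (rule sums_integral[OF fi s1 s2])
  moreover have "(\<Sum>\<nu>. f \<nu> y) = of_real (mehler_real r x y) * u y" for y
  proof -
    have "(\<lambda>\<nu>. complex_of_real (hermite_kernel \<nu> x y * r ^ \<nu>) * u y) sums (of_real (mehler_real r x y) * u y)"
      by (intro sums_mult2 sums_of_real mehler_real_sums r)
    then show ?thesis unfolding f_def by (simp add: sums_iff mult_ac)
  qed
  ultimately show ?thesis unfolding int by simp
qed

text \<open>Of the exponent \<open>2 * CARD('d) + 2\<close>, one \<open>CARD('d)\<close> pays for
  the size of the Hermite functions, one for their number, and 2 remains for a convergent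
  series.\<close>

lemma hcomp_bound:
  fixes c :: "('d::finite \<Rightarrow> nat) \<Rightarrow> complex"
  assumes "\<And>\<beta>. (1 + real (multi_deg \<beta>)) ^ (2 * CARD('d) + 2) * norm (c \<beta>) \<le> A"
  shows "norm (hcomp \<nu> c x) \<le> 3 ^ CARD('d) * A * (1 / (1 + real \<nu>) ^ 2)"
proof -
  define M where "M = 1 + real \<nu>"
  have M: "M > 0" unfolding M_def by simp
  have b: "norm (c \<beta> * Hc \<beta> x) \<le> 3 ^ CARD('d) * A / (M ^ (CARD('d) + 2))" if "multi_deg \<beta> = \<nu>" for \<beta>
  proof -
    have 1: "norm (c \<beta>) \<le> A / M ^ (2 * CARD('d) + 2)"
    proof -
      have "M ^ (2 * CARD('d) + 2) * norm (c \<beta>) \<le> A" using assms[of \<beta>] that unfolding M_def by (simp only:)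
      then show ?thesis using M by (simp only: pos_le_divide_eq zero_less_power mult.commute)
    qed
    have 2: "norm (Hc \<beta> x) \<le> 3 ^ CARD('d) * M ^ CARD('d)"
      using norm_Hc_bound[of \<beta> x] that unfolding M_def by (simp del: of_nat_sum)
    have "norm (c \<beta> * Hc \<beta> x) \<le> (A / M ^ (2 * CARD('d) + 2)) * (3 ^ CARD('d) * M ^ CARD('d))"
      unfolding norm_mult by (rule mult_mono[OF 1 2]) (use 1 in \<open>auto intro: order_trans[OF norm_ge_zero]\<close>)
    also have "\<dots> = 3 ^ CARD('d) * A / (M ^ (CARD('d) + 2))"
    proof -
      have "M ^ (2 * CARD('d) + 2) = M ^ (CARD('d) + 2) * M ^ CARD('d)" by (simp only: power_add[symmetric] mult_2 add_ac)
      moreover have "(A / (X * Y)) * (3 ^ CARD('d) * Y) = 3 ^ CARD('d) * A / X" if "X \<noteq> 0" "Y \<noteq> 0" for X Y :: real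
        using that by simp
      ultimately show ?thesis using M by simp
    qed
    finally show ?thesis .
  qed
  have "norm (hcomp \<nu> c x) \<le> M ^ CARD('d) * (3 ^ CARD('d) * A / (M ^ (CARD('d) + 2)))"
    unfolding hcomp_def M_def by (rule sum_multi_deg_bound, rule b[unfolded M_def])
  also have "\<dots> = 3 ^ CARD('d) * A * (1 / M ^ 2)" using M by (simp add: power_add power2_eq_square)
  finally show ?thesis unfolding M_def .
qed

lemma summable_inverse_square: "summable (\<lambda>\<nu>. 1 / (1 + real \<nu>) ^ 2)"
  using inverse_squares_sums by (auto simp: sums_iff add.commute)

text \<open>The series converges absolutely by decay of the coefficients, and its Abel means
  converge to \<open>\<phi> x\<close> by \<open>mehler_tendsto\<close>; Tannery's theorem identifies
  the two limits.\<close>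

lemma hermite_expansion:
  fixes \<phi> :: "real ^ 'd::finite \<Rightarrow> complex"
  assumes \<phi>: "\<phi> \<in> schwartz"
  shows "(\<lambda>\<nu>. hcomp \<nu> (hcoeff \<phi>) x) sums \<phi> x"
proof -
  obtain A where "coeff_bdd (2 * CARD('d) + 2) A \<phi>" using hcoeff_decay[OF \<phi>] by blast
  then have A: "norm (hcomp \<nu> (hcoeff \<phi>) x) \<le> 3 ^ CARD('d) * A * (1 / (1 + real \<nu>) ^ 2)" for \<nu>
    unfolding coeff_bdd_def by (intro hcomp_bound) auto
  have sm: "summable (\<lambda>\<nu>. 3 ^ CARD('d) * A * (1 / (1 + real \<nu>) ^ 2))"
    by (intro summable_mult summable_inverse_square)
  have sn: "summable (\<lambda>\<nu>. hcomp \<nu> (hcoeff \<phi>) x)"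
    by (rule summable_comparison_test'[OF sm A])
  have "(\<lambda>n. \<integral>y. of_real (mehler_real (abel n) x y) * \<phi> y \<partial>lborel) \<longlonglongrightarrow> \<phi> x"
  proof (rule mehler_tendsto)
    show "continuous_on UNIV \<phi>" by (rule schwartz_continuous[OF \<phi>])
    show "norm (\<phi> x) \<le> schwartz_decay \<phi> * 1" for x
      by (rule order_trans[OF schwartz_decay_bound[OF \<phi>] mult_left_mono[OF wt_le_1 schwartz_decay_nonneg[OF \<phi>]]])
  qed
  moreover have "(\<integral>y. of_real (mehler_real (abel n) x y) * \<phi> y \<partial>lborel) = (\<Sum>\<nu>. of_real (abel n ^ \<nu>) * hcomp \<nu> (hcoeff \<phi>) x)" for n
    using mehler_integral_sums[OF schwartz_integrable[OF \<phi>] abel(3)] by (simp add: sums_iff)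
  moreover have "(\<lambda>n. \<Sum>\<nu>. of_real (abel n ^ \<nu>) * hcomp \<nu> (hcoeff \<phi>) x) \<longlonglongrightarrow> (\<Sum>\<nu>. of_real (1 ^ \<nu>) * hcomp \<nu> (hcoeff \<phi>) x)"
  proof (intro tannerys_theorem[THEN conjunct2, THEN conjunct2] always_eventually allI)
    show "(\<lambda>n. of_real (abel n ^ \<nu>) * hcomp \<nu> (hcoeff \<phi>) x) \<longlonglongrightarrow> of_real (1 ^ \<nu>) * hcomp \<nu> (hcoeff \<phi>) x" for \<nu>
      by (intro tendsto_intros abel_tendsto)
    show "summable (\<lambda>\<nu>. 3 ^ CARD('d) * A * (1 / (1 + real \<nu>) ^ 2))" by (rule sm)
    fix z :: "nat \<times> nat"
    obtain \<nu> n where z: "z = (\<nu>, n)" by force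
    have "abel n ^ \<nu> \<le> 1" using abel[of n] by (intro power_le_one) auto
    then have "norm (complex_of_real (abel n ^ \<nu>)) \<le> 1"
      unfolding norm_of_real using abel(1)[of n] by simp
    then have "norm (complex_of_real (abel n ^ \<nu>)) * norm (hcomp \<nu> (hcoeff \<phi>) x) \<le> 1 * (3 ^ CARD('d) * A * (1 / (1 + real \<nu>) ^ 2))"
      by (intro mult_mono A) auto
    then show "case z of (\<nu>, n) \<Rightarrow> norm (of_real (abel n ^ \<nu>) * hcomp \<nu> (hcoeff \<phi>) x) \<le> 3 ^ CARD('d) * A * (1 / (1 + real \<nu>) ^ 2)"
      unfolding z by (simp add: norm_mult)
  qed simp
  ultimately have "(\<Sum>\<nu>. hcomp \<nu> (hcoeff \<phi>) x) = \<phi> x" using LIMSEQ_unique by fastforce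
  then show ?thesis using sn by (simp add: sums_iff)
qed


lemma schwartz_sup_le:
  "\<exists>K\<ge>0. \<forall>\<phi>\<in>(schwartz :: (real ^ 'd::finite \<Rightarrow> complex) set). \<forall>A. coeff_bdd (2 * CARD('d) + 2) A \<phi> \<longrightarrow>
     (\<forall>x. norm (\<phi> x) \<le> K * A)"
proof -
  define S where "S = (\<Sum>\<nu>. 1 / (1 + real \<nu>) ^ 2)"
  have "norm (\<phi> x) \<le> (3 ^ CARD('d) * S) * A"
    if \<phi>: "\<phi> \<in> schwartz" and A: "coeff_bdd (2 * CARD('d) + 2) A \<phi>" for \<phi> :: "real ^ 'd \<Rightarrow> complex" and A x
  proof -
    have b: "norm (hcomp \<nu> (hcoeff \<phi>) x) \<le> 3 ^ CARD('d) * A * (1 / (1 + real \<nu>) ^ 2)" for \<nu>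
      using A unfolding coeff_bdd_def by (intro hcomp_bound) auto
    have "\<phi> x = (\<Sum>\<nu>. hcomp \<nu> (hcoeff \<phi>) x)" using hermite_expansion[OF \<phi>, of x] by (simp add: sums_iff)
    also have "norm \<dots> \<le> (\<Sum>\<nu>. 3 ^ CARD('d) * A * (1 / (1 + real \<nu>) ^ 2))"
      by (intro norm_suminf_le b summable_mult summable_inverse_square)
    also have "\<dots> = 3 ^ CARD('d) * A * S"
      unfolding S_def by (rule suminf_mult[OF summable_inverse_square])
    finally show ?thesis by (simp add: mult_ac)
  qed
  moreover have "S \<ge> 0" unfolding S_def by (intro suminf_nonneg summable_inverse_square) auto
  ultimately show ?thesis by (intro exI[of _ "3 ^ CARD('d) * S"]) auto
qed

section \<open>Coefficient norms control the Schwartz seminorms\<close>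

lemma sqrt_half_le: "sqrt (real n / 2) \<le> real n"
proof (rule real_le_lsqrt)
  show "real n / 2 \<le> (real n)\<^sup>2"
    using of_nat_mono[OF le_square[of n], where 'a=real] by (simp add: power2_eq_square)
qed simp_all

text \<open>A ladder step moves the degree by one and has a factor of at most \<open>1 + M\<close>,
  which is one power of the weight. The constant \<open>2 ^ Suc k\<close> compares the weights at
  degrees \<open>M\<close> and \<open>M - 1\<close>.\<close>

lemma coeff_shift_bound:
  fixes c :: "('d::finite \<Rightarrow> nat) \<Rightarrow> complex"
  assumes A: "\<And>\<beta>. (1 + real (multi_deg \<beta>)) ^ Suc k * norm (c \<beta>) \<le> A"
  shows "(1 + real (multi_deg \<beta>)) ^ k * (sqrt (real (Suc (\<beta> i)) / 2) * norm (c (\<beta>(i := Suc (\<beta> i))))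
     + sqrt (real (\<beta> i) / 2) * norm (c (\<beta>(i := \<beta> i - 1)))) \<le> (1 + 2 ^ Suc k) * A"
proof -
  define M where "M = real (multi_deg \<beta>)"
  have M: "M \<ge> real (\<beta> i)" unfolding M_def using multi_deg_ge by (rule of_nat_mono)
  have up: "(1 + M) ^ k * (sqrt (real (Suc (\<beta> i)) / 2) * norm (c (\<beta>(i := Suc (\<beta> i))))) \<le> A"
  proof -
    define \<gamma> where "\<gamma> = \<beta>(i := Suc (\<beta> i))"
    have deg: "real (multi_deg \<gamma>) = 1 + M" unfolding \<gamma>_def M_def multi_deg_inc by simp
    have "sqrt (real (Suc (\<beta> i)) / 2) \<le> 1 + M" using sqrt_half_le[of "Suc (\<beta> i)"] M by simp
    then have "(1 + M) ^ k * (sqrt (real (Suc (\<beta> i)) / 2) * norm (c \<gamma>)) \<le> (1 + M) ^ k * ((1 + M) * norm (c \<gamma>))"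
      using M by (intro mult_left_mono mult_right_mono) auto
    also have "\<dots> = (1 + M) ^ Suc k * norm (c \<gamma>)" by simp
    also have "\<dots> \<le> (1 + real (multi_deg \<gamma>)) ^ Suc k * norm (c \<gamma>)"
      unfolding deg using M by (intro mult_right_mono power_mono) auto
    also have "\<dots> \<le> A" by (rule A)
    finally show ?thesis unfolding \<gamma>_def .
  qed
  have A0: "A \<ge> 0" using A[of \<beta>] by (rule order_trans[rotated]) (intro mult_nonneg_nonneg zero_le_power add_nonneg_nonneg, auto intro!: sum_nonneg)
  have down: "(1 + M) ^ k * (sqrt (real (\<beta> i) / 2) * norm (c (\<beta>(i := \<beta> i - 1)))) \<le> 2 ^ Suc k * A"
  proof (cases "\<beta> i = 0")
    case False
    define \<gamma> where "\<gamma> = \<beta>(i := \<beta> i - 1)"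
    have "Suc (multi_deg \<gamma>) = multi_deg \<beta>" unfolding \<gamma>_def using False by (intro multi_deg_dec) auto
    then have "real (Suc (multi_deg \<gamma>)) = M" unfolding M_def by (simp only:)
    then have deg: "real (multi_deg \<gamma>) = M - 1" by (simp del: of_nat_sum)
    have M1: "M \<ge> 1" using M False by linarith
    have "sqrt (real (\<beta> i) / 2) \<le> 1 + M" using sqrt_half_le[of "\<beta> i"] M by linarith
    then have "(1 + M) ^ k * (sqrt (real (\<beta> i) / 2) * norm (c \<gamma>)) \<le> (1 + M) ^ k * ((1 + M) * norm (c \<gamma>))"
      using M by (intro mult_left_mono mult_right_mono) auto
    also have "\<dots> = (1 + M) ^ Suc k * norm (c \<gamma>)" by simp
    also have "\<dots> \<le> (2 * (1 + real (multi_deg \<gamma>))) ^ Suc k * norm (c \<gamma>)"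
      unfolding deg using M1 by (intro mult_right_mono power_mono) auto
    also have "\<dots> = 2 ^ Suc k * ((1 + real (multi_deg \<gamma>)) ^ Suc k * norm (c \<gamma>))" by (simp only: power_mult_distrib mult.assoc)
    also have "\<dots> \<le> 2 ^ Suc k * A" by (intro mult_left_mono A) auto
    finally show ?thesis unfolding \<gamma>_def .
  qed (use A0 in simp)
  show ?thesis using up down unfolding M_def[symmetric] distrib_left distrib_right by simp
qed

lemma coeff_bdd_mult_coord:
  assumes \<phi>: "\<phi> \<in> schwartz" and A: "coeff_bdd (Suc k) A \<phi>"
  shows "coeff_bdd k ((1 + 2 ^ Suc k) * A) (\<lambda>x. of_real (x $ i) * \<phi> x)"
  unfolding coeff_bdd_def
proof
  fix \<beta>
  have "norm (hcoeff (\<lambda>x. of_real (x $ i) * \<phi> x) \<beta>) \<le> sqrt (real (Suc (\<beta> i)) / 2) * norm (hcoeff \<phi> (\<beta>(i := Suc (\<beta> i))))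
     + sqrt (real (\<beta> i) / 2) * norm (hcoeff \<phi> (\<beta>(i := \<beta> i - 1)))"
    unfolding hcoeff_mult_coord[OF \<phi>] by (rule order_trans[OF norm_triangle_ineq]) (simp add: norm_mult)
  then have "(1 + real (multi_deg \<beta>)) ^ k * norm (hcoeff (\<lambda>x. of_real (x $ i) * \<phi> x) \<beta>)
      \<le> (1 + real (multi_deg \<beta>)) ^ k * (sqrt (real (Suc (\<beta> i)) / 2) * norm (hcoeff \<phi> (\<beta>(i := Suc (\<beta> i))))
     + sqrt (real (\<beta> i) / 2) * norm (hcoeff \<phi> (\<beta>(i := \<beta> i - 1))))"
    by (rule mult_left_mono) (intro zero_le_power add_nonneg_nonneg, auto intro!: sum_nonneg)
  also have "\<dots> \<le> (1 + 2 ^ Suc k) * A"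
    using A unfolding coeff_bdd_def by (intro coeff_shift_bound) blast
  finally show "(1 + real (multi_deg \<beta>)) ^ k * norm (hcoeff (\<lambda>x. of_real (x $ i) * \<phi> x) \<beta>) \<le> (1 + 2 ^ Suc k) * A" .
qed

lemma coeff_bdd_partial_deriv:
  assumes \<phi>: "\<phi> \<in> schwartz" and A: "coeff_bdd (Suc k) A \<phi>"
  shows "coeff_bdd k ((1 + 2 ^ Suc k) * A) (partial_deriv i \<phi>)"
  unfolding coeff_bdd_def
proof
  fix \<beta>
  have "norm (hcoeff (partial_deriv i \<phi>) \<beta>) \<le> sqrt (real (Suc (\<beta> i)) / 2) * norm (hcoeff \<phi> (\<beta>(i := Suc (\<beta> i))))
     + sqrt (real (\<beta> i) / 2) * norm (hcoeff \<phi> (\<beta>(i := \<beta> i - 1)))"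
    unfolding hcoeff_partial_deriv[OF \<phi>] by (rule order_trans[OF norm_triangle_ineq4]) (simp add: norm_mult)
  then have "(1 + real (multi_deg \<beta>)) ^ k * norm (hcoeff (partial_deriv i \<phi>) \<beta>)
      \<le> (1 + real (multi_deg \<beta>)) ^ k * (sqrt (real (Suc (\<beta> i)) / 2) * norm (hcoeff \<phi> (\<beta>(i := Suc (\<beta> i))))
     + sqrt (real (\<beta> i) / 2) * norm (hcoeff \<phi> (\<beta>(i := \<beta> i - 1))))"
    by (rule mult_left_mono) (intro zero_le_power add_nonneg_nonneg, auto intro!: sum_nonneg)
  also have "\<dots> \<le> (1 + 2 ^ Suc k) * A"
    using A unfolding coeff_bdd_def by (intro coeff_shift_bound) blast
  finally show "(1 + real (multi_deg \<beta>)) ^ k * norm (hcoeff (partial_deriv i \<phi>) \<beta>) \<le> (1 + 2 ^ Suc k) * A" .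
qed

text \<open>Continuity for the coefficient norms with an unspecified loss of order; closure under
  composition reduces arbitrary weighted derivatives to single ladder steps.\<close>

definition coeff_bounded_op :: "((real ^ 'd::finite \<Rightarrow> complex) \<Rightarrow> real ^ 'd \<Rightarrow> complex) \<Rightarrow> bool" where
  "coeff_bounded_op T \<longleftrightarrow> (\<forall>\<phi>\<in>schwartz. T \<phi> \<in> schwartz) \<and>
     (\<forall>k. \<exists>k' K. \<forall>\<phi>\<in>schwartz. \<forall>A. coeff_bdd k' A \<phi> \<longrightarrow> coeff_bdd k (K * A) (T \<phi>))"

lemma coeff_bounded_op_id: "coeff_bounded_op (\<lambda>\<phi>. \<phi>)"
  unfolding coeff_bounded_op_def by (metis mult_1)

lemma coeff_bounded_op_comp:
  assumes S: "coeff_bounded_op S" and T: "coeff_bounded_op T"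
  shows "coeff_bounded_op (\<lambda>\<phi>. S (T \<phi>))"
  unfolding coeff_bounded_op_def
proof (intro conjI allI)
  show "\<forall>\<phi>\<in>schwartz. S (T \<phi>) \<in> schwartz" using S T unfolding coeff_bounded_op_def by blast
  fix k
  obtain k1 K1 where 1: "\<And>\<phi> A. \<phi> \<in> schwartz \<Longrightarrow> coeff_bdd k1 A \<phi> \<Longrightarrow> coeff_bdd k (K1 * A) (S \<phi>)"
    using S unfolding coeff_bounded_op_def by meson
  obtain k2 K2 where 2: "\<And>\<phi> A. \<phi> \<in> schwartz \<Longrightarrow> coeff_bdd k2 A \<phi> \<Longrightarrow> coeff_bdd k1 (K2 * A) (T \<phi>)"
    using T unfolding coeff_bounded_op_def by meson
  have "coeff_bdd k ((K1 * K2) * A) (S (T \<phi>))" if "\<phi> \<in> schwartz" "coeff_bdd k2 A \<phi>" for \<phi> A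
    using 1[OF _ 2[OF that]] that T unfolding coeff_bounded_op_def by (simp add: mult.assoc)
  then show "\<exists>k' K. \<forall>\<phi>\<in>schwartz. \<forall>A. coeff_bdd k' A \<phi> \<longrightarrow> coeff_bdd k (K * A) (S (T \<phi>))" by blast
qed

lemma coeff_bounded_op_mult_coord: "coeff_bounded_op (\<lambda>\<phi> x. of_real (x $ i) * \<phi> x)"
  unfolding coeff_bounded_op_def using coeff_bdd_mult_coord schwartz_mult_coord by blast

lemma coeff_bounded_op_partial_deriv: "coeff_bounded_op (partial_deriv i)"
  unfolding coeff_bounded_op_def using coeff_bdd_partial_deriv schwartz_partial_deriv by blast

lemma coeff_bounded_op_partial_derivs: "coeff_bounded_op (partial_derivs w)"
proof (induction w)
  case Nil
  then show ?case using coeff_bounded_op_id by (simp add: partial_derivs_def id_def)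
next
  case (Cons i w)
  have "partial_derivs (i # w) = (\<lambda>\<phi>. partial_deriv i (partial_derivs w \<phi>))" by (rule ext) simp
  then show ?case using coeff_bounded_op_comp[OF coeff_bounded_op_partial_deriv Cons] by simp
qed

lemma coeff_bounded_op_monomial: "coeff_bounded_op (\<lambda>\<phi> x. of_real (\<Prod>i\<in>UNIV. (x $ i) ^ \<gamma> i) * \<phi> x)"
proof -
  have "coeff_bounded_op (\<lambda>\<phi> x. of_real (\<Prod>i\<in>S. (x $ i) ^ \<gamma> i) * \<phi> x)" if "finite S" for S
    using that
  proof (induction S rule: finite_induct)
    case empty
    then show ?case using coeff_bounded_op_id by simp
  next
    case (insert i S)
    have "coeff_bounded_op (\<lambda>\<phi> x. of_real ((x $ i) ^ n) * (of_real (\<Prod>i\<in>S. (x $ i) ^ \<gamma> i) * \<phi> x))" for n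
    proof (induction n)
      case 0
      then show ?case using insert by simp
    next
      case (Suc n)
      from coeff_bounded_op_comp[OF coeff_bounded_op_mult_coord[of i] this] show ?case by (simp add: mult.assoc)
    qed
    from this[of "\<gamma> i"] show ?case using insert by (simp add: mult.assoc)
  qed
  then show ?thesis by simp
qed

text \<open>The converse direction to \<open>hcoeff_decay\<close>: a weighted derivative is the
  modulus of \<open>T \<phi>\<close>, whose coefficients lose only finitely many orders, and a
  supremum is controlled by coefficients.\<close>

lemma schwartz_weight_coeff_bound:
  fixes \<gamma> :: "'d::finite \<Rightarrow> nat"
  shows "\<exists>k K. \<forall>\<phi>\<in>(schwartz :: (real ^ 'd \<Rightarrow> complex) set). \<forall>A. coeff_bdd k A \<phi> \<longrightarrow> (\<forall>x. schwartz_weight \<gamma> w \<phi> x \<le> K * A)"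
proof -
  define T where "T = (\<lambda>\<phi> :: real ^ 'd \<Rightarrow> complex. \<lambda>x. of_real (\<Prod>i\<in>UNIV. (x $ i) ^ \<gamma> i) * partial_derivs w \<phi> x)"
  have T: "coeff_bounded_op T" unfolding T_def
    by (rule coeff_bounded_op_comp[OF coeff_bounded_op_monomial coeff_bounded_op_partial_derivs])
  obtain k K where 1: "\<And>\<phi> A. \<phi> \<in> schwartz \<Longrightarrow> coeff_bdd k A \<phi> \<Longrightarrow> coeff_bdd (2 * CARD('d) + 2) (K * A) (T \<phi>)"
    using T unfolding coeff_bounded_op_def by meson
  obtain K' where 2: "\<And>\<phi> A x. \<phi> \<in> (schwartz :: (real ^ 'd \<Rightarrow> complex) set) \<Longrightarrow> coeff_bdd (2 * CARD('d) + 2) A \<phi> \<Longrightarrow> norm (\<phi> x) \<le> K' * A"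
    using schwartz_sup_le by blast
  have "schwartz_weight \<gamma> w \<phi> x \<le> (K' * K) * A" if "\<phi> \<in> schwartz" "coeff_bdd k A \<phi>" for \<phi> A x
  proof -
    have "T \<phi> \<in> schwartz" using T that unfolding coeff_bounded_op_def by blast
    from 2[OF this 1[OF that]] have "norm (T \<phi> x) \<le> (K' * K) * A" by (simp add: mult.assoc)
    then show ?thesis unfolding T_def schwartz_weight_def by (simp only: norm_mult norm_of_real)
  qed
  then show ?thesis by blast
qed

section \<open>Density of the Hermite functions and tempered distributions\<close>

definition hsum :: "nat \<Rightarrow> (('d::finite \<Rightarrow> nat) \<Rightarrow> complex) \<Rightarrow> real ^ 'd \<Rightarrow> complex" where
  "hsum n c x = (\<Sum>\<beta> | multi_deg \<beta> \<le> n. c \<beta> * Hc \<beta> x)"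

lemma hsum_schwartz: "hsum n c \<in> schwartz"
proof -
  have "(\<lambda>x. \<Sum>\<beta> | multi_deg \<beta> \<le> n. c \<beta> * Hc \<beta> x) \<in> schwartz"
    by (intro schwartz_sum schwartz_cmult Hc_schwartz) auto
  then show ?thesis unfolding hsum_def[abs_def] .
qed

lemma hcoeff_hsum: "hcoeff (hsum n c) \<gamma> = (if multi_deg \<gamma> \<le> n then c \<gamma> else 0)"
proof -
  have "hcoeff (hsum n c) \<gamma> = (\<Sum>\<beta> | multi_deg \<beta> \<le> n. c \<beta> * hcoeff (Hc \<beta>) \<gamma>)"
    unfolding hsum_def[abs_def]
    by (subst hcoeff_sum) (intro schwartz_integrable schwartz_cmult Hc_schwartz, simp only: hcoeff_cmult)
  also have "\<dots> = (if multi_deg \<gamma> \<le> n then c \<gamma> else 0)"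
    unfolding hcoeff_Hc by (simp add: if_distrib cong: if_cong)
  finally show ?thesis .
qed

text \<open>One power of decay, spent on the degrees above \<open>n\<close>, buys the factor
  \<open>1 / (1 + n)\<close>.\<close>

lemma hsum_tail_coeff_bdd:
  assumes \<phi>: "\<phi> \<in> schwartz" and A: "coeff_bdd (Suc k) A \<phi>"
  shows "coeff_bdd k (A / (1 + real n)) (\<lambda>x. hsum n (hcoeff \<phi>) x - \<phi> x)"
  unfolding coeff_bdd_def
proof
  fix \<beta>
  have c: "hcoeff (\<lambda>x. hsum n (hcoeff \<phi>) x - \<phi> x) \<beta> = (if multi_deg \<beta> \<le> n then 0 else - hcoeff \<phi> \<beta>)"
    by (subst hcoeff_diff) (auto intro: schwartz_integrable hsum_schwartz \<phi> simp: hcoeff_hsum)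
  define M where "M = 1 + real (multi_deg \<beta>)"
  have M: "M > 0" unfolding M_def by (intro add_pos_nonneg) (auto intro!: sum_nonneg)
  have A': "M ^ Suc k * norm (hcoeff \<phi> \<beta>) \<le> A" using A unfolding coeff_bdd_def M_def by blast
  then have A0: "A \<ge> 0" by (rule order_trans[rotated]) (use M in auto)
  show "(1 + real (multi_deg \<beta>)) ^ k * norm (hcoeff (\<lambda>x. hsum n (hcoeff \<phi>) x - \<phi> x) \<beta>) \<le> A / (1 + real n)"
  proof (cases "multi_deg \<beta> \<le> n")
    case False
    then have "1 + real n \<le> M" unfolding M_def by (simp del: of_nat_sum)
    then have "(1 + real n) * (M ^ k * norm (hcoeff \<phi> \<beta>)) \<le> M * (M ^ k * norm (hcoeff \<phi> \<beta>))"
      using M by (intro mult_right_mono) auto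
    also have "\<dots> \<le> A" using A' by (simp add: mult.assoc)
    finally show ?thesis using False unfolding c M_def[symmetric] by (simp add: field_simps)
  qed (use A0 in \<open>simp add: c\<close>)
qed

lemma hsum_tendsto_seminorm:
  assumes \<phi>: "\<phi> \<in> schwartz"
  shows "(\<lambda>n. schwartz_seminorm \<gamma> w (\<lambda>x. hsum n (hcoeff \<phi>) x - \<phi> x)) \<longlonglongrightarrow> 0"
proof -
  obtain k K where kK: "\<And>\<psi> A x. \<psi> \<in> schwartz \<Longrightarrow> coeff_bdd k A \<psi> \<Longrightarrow> schwartz_weight \<gamma> w \<psi> x \<le> K * A"
    using schwartz_weight_coeff_bound[of \<gamma> w] by blast
  obtain A where A: "coeff_bdd (Suc k) A \<phi>" using hcoeff_decay[OF \<phi>] by blast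
  have sch: "(\<lambda>x. hsum n (hcoeff \<phi>) x - \<phi> x) \<in> schwartz" for n
    by (intro schwartz_diff hsum_schwartz \<phi>)
  have up: "schwartz_seminorm \<gamma> w (\<lambda>x. hsum n (hcoeff \<phi>) x - \<phi> x) \<le> K * (A / (1 + real n))" for n
    by (intro schwartz_seminorm_le kK sch hsum_tail_coeff_bdd \<phi> A)
  have low: "0 \<le> schwartz_seminorm \<gamma> w (\<lambda>x. hsum n (hcoeff \<phi>) x - \<phi> x)" for n
    by (rule order_trans[OF schwartz_weight_nonneg schwartz_weight_le_seminorm[OF sch, where x = 0]])
  have "(\<lambda>n. K * (A / (1 + real n))) \<longlonglongrightarrow> 0" by real_asymp
  then show ?thesis
    by (rule tendsto_sandwich[OF _ _ tendsto_const, rotated 2]) (use low up in auto)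
qed

lemma schwartz_seminorm_triangle:
  assumes "\<phi> \<in> schwartz" "\<psi> \<in> schwartz"
  shows "schwartz_seminorm \<gamma> w (\<lambda>x. \<phi> x + \<psi> x) \<le> schwartz_seminorm \<gamma> w \<phi> + schwartz_seminorm \<gamma> w \<psi>"
  by (intro schwartz_seminorm_le order_trans[OF schwartz_weight_add] add_mono schwartz_weight_le_seminorm assms)

text \<open>The space is the union of the subbase, and each \<open>\<psi>\<close> lies in a ball
  around itself because the zero function has seminorm 0.\<close>

lemma topspace_schwartz_topology: "topspace schwartz_topology = schwartz"
proof -
  have "schwartz_seminorm \<gamma> w (\<lambda>x. \<psi> x - \<psi> x) = 0" for \<gamma> w and \<psi> :: "real ^ 'a \<Rightarrow> complex"
  proof -
    have "schwartz_weight \<gamma> w (\<lambda>x. 0) x = 0" for x :: "real ^ 'a"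
    proof -
      have "partial_derivs w (\<lambda>x. 0) = (\<lambda>x. 0)"
        by (induction w) (auto intro!: ext partial_deriv_eqI)
      then show ?thesis by (simp add: schwartz_weight_def)
    qed
    then show ?thesis unfolding schwartz_seminorm_def by simp
  qed
  note z = this
  have "\<psi> \<in> {\<psi>' \<in> schwartz. schwartz_seminorm (\<lambda>_. 0) [] (\<lambda>x. \<psi>' x - \<psi> x) < 1}" if "\<psi> \<in> schwartz" for \<psi> :: "real ^ 'a \<Rightarrow> complex"
    using that z[of "\<lambda>_. 0" "[]" \<psi>] by simp
  then have "\<psi> \<in> topspace schwartz_topology" if "\<psi> \<in> schwartz" for \<psi> :: "real ^ 'a \<Rightarrow> complex"
    unfolding schwartz_topology_def topology_generated_by_topspace using that zero_less_one by blast
  then show ?thesis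
    unfolding schwartz_topology_def topology_generated_by_topspace by blast
qed

text \<open>The topology is given by a subbase only, so convergence is propagated through the
  inductive generation of open sets. At a subbasic ball, whose centre \<open>\<phi>0\<close> is
  arbitrary, the triangle inequality decides.\<close>

lemma schwartz_topology_limit:
  assumes "openin schwartz_topology U" and s: "\<And>n. s n \<in> schwartz" and \<phi>: "\<phi> \<in> schwartz"
    and lim: "\<And>\<gamma> w. (\<lambda>n. schwartz_seminorm \<gamma> w (\<lambda>x. s n x - \<phi> x)) \<longlonglongrightarrow> 0"
    and U: "\<phi> \<in> U"
  shows "\<forall>\<^sub>F n in sequentially. s n \<in> U"
proof -
  have "generate_topology_on {{\<psi> \<in> schwartz. schwartz_seminorm \<gamma> w (\<lambda>x. \<psi> x - \<phi> x) < \<epsilon>} | \<gamma> w \<phi> \<epsilon>. \<phi> \<in> schwartz \<and> 0 < \<epsilon>} U"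
    using assms(1) unfolding schwartz_topology_def openin_topology_generated_by_iff .
  then show ?thesis using U
  proof (induction rule: generate_topology_on.induct)
    case (Int a b)
    then show ?case using eventually_conj by fastforce
  next
    case (UN K)
    then obtain k where k: "k \<in> K" "\<phi> \<in> k" by blast
    then have "\<forall>\<^sub>F n in sequentially. s n \<in> k" using UN.IH by blast
    then show ?case by (rule eventually_mono) (use k in blast)
  next
    case (Basis V)
    then obtain \<gamma> w \<phi>0 \<epsilon> where V: "V = {\<psi> \<in> schwartz. schwartz_seminorm \<gamma> w (\<lambda>x. \<psi> x - \<phi>0 x) < \<epsilon>}"
      and \<phi>0: "\<phi>0 \<in> schwartz" by blast
    have "schwartz_seminorm \<gamma> w (\<lambda>x. \<phi> x - \<phi>0 x) < \<epsilon>" using Basis.prems V by blast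
    then have "\<forall>\<^sub>F n in sequentially. schwartz_seminorm \<gamma> w (\<lambda>x. s n x - \<phi> x) < \<epsilon> - schwartz_seminorm \<gamma> w (\<lambda>x. \<phi> x - \<phi>0 x)"
      by (intro order_tendstoD(2)[OF lim]) simp
    then show ?case
    proof (rule eventually_mono)
      fix n assume n: "schwartz_seminorm \<gamma> w (\<lambda>x. s n x - \<phi> x) < \<epsilon> - schwartz_seminorm \<gamma> w (\<lambda>x. \<phi> x - \<phi>0 x)"
      have "schwartz_seminorm \<gamma> w (\<lambda>x. (s n x - \<phi> x) + (\<phi> x - \<phi>0 x))
         \<le> schwartz_seminorm \<gamma> w (\<lambda>x. s n x - \<phi> x) + schwartz_seminorm \<gamma> w (\<lambda>x. \<phi> x - \<phi>0 x)"
        by (intro schwartz_seminorm_triangle schwartz_diff s \<phi> \<phi>0)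
      then show "s n \<in> V" unfolding V using n s by simp
    qed
  qed simp
qed

lemma tempered_add:
  assumes "f \<in> tempered" "\<phi> \<in> schwartz" "\<psi> \<in> schwartz"
  shows "f (\<lambda>x. \<phi> x + \<psi> x) = f \<phi> + f \<psi>"
proof -
  have "\<forall>\<phi>\<in>schwartz. \<forall>\<psi>\<in>schwartz. f (\<lambda>x. \<phi> x + \<psi> x) = f \<phi> + f \<psi>"
    using assms(1) unfolding tempered_def by simp
  from this[rule_format, OF assms(2,3)] show ?thesis .
qed

lemma tempered_cmult:
  assumes "f \<in> tempered" "\<phi> \<in> schwartz"
  shows "f (\<lambda>x. c * \<phi> x) = c * f \<phi>"
proof -
  have "\<forall>c. \<forall>\<phi>\<in>schwartz. f (\<lambda>x. c * \<phi> x) = c * f \<phi>"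
    using assms(1) unfolding tempered_def by simp
  from this[rule_format, OF assms(2)] show ?thesis .
qed

lemma tempered_sum:
  assumes f: "f \<in> tempered" and "finite B" and "\<And>b. b \<in> B \<Longrightarrow> \<phi> b \<in> schwartz"
  shows "f (\<lambda>x. \<Sum>b\<in>B. c b * \<phi> b x) = (\<Sum>b\<in>B. c b * f (\<phi> b))"
  using assms(2,3)
proof (induction B rule: finite_induct)
  case empty
  show ?case using tempered_cmult[OF f schwartz_0, of 0] by simp
next
  case (insert b B)
  have B: "(\<lambda>x. \<Sum>b\<in>B. c b * \<phi> b x) \<in> schwartz"
    using insert by (intro schwartz_sum schwartz_cmult) auto
  have "f (\<lambda>x. c b * \<phi> b x + (\<Sum>b\<in>B. c b * \<phi> b x)) = f (\<lambda>x. c b * \<phi> b x) + f (\<lambda>x. \<Sum>b\<in>B. c b * \<phi> b x)"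
    by (rule tempered_add[OF f schwartz_cmult B]) (use insert in simp)
  moreover have "f (\<lambda>x. c b * \<phi> b x) = c b * f (\<phi> b)" by (rule tempered_cmult[OF f]) (use insert in simp)
  ultimately show ?case using insert by simp
qed

text \<open>Continuity is applied along the partial Hermite sums of \<open>\<phi>\<close>, which
  converge in every seminorm.\<close>

lemma tempered_expansion:
  assumes f: "f \<in> tempered" and \<phi>: "\<phi> \<in> schwartz"
  shows "(\<lambda>n. \<Sum>\<beta> | multi_deg \<beta> \<le> n. hcoeff \<phi> \<beta> * f (Hc \<beta>)) \<longlonglongrightarrow> f \<phi>"
proof -
  have "(\<lambda>n. f (hsum n (hcoeff \<phi>))) \<longlonglongrightarrow> f \<phi>"
  proof (rule topological_tendstoI)
    fix S assume S: "open S" "f \<phi> \<in> S"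
    have "continuous_map schwartz_topology euclidean f" using f unfolding tempered_def by blast
    then have "openin schwartz_topology {\<psi> \<in> topspace schwartz_topology. f \<psi> \<in> S}"
      using S(1) by (auto simp: continuous_map_def)
    then have "\<forall>\<^sub>F n in sequentially. hsum n (hcoeff \<phi>) \<in> {\<psi> \<in> topspace schwartz_topology. f \<psi> \<in> S}"
      by (rule schwartz_topology_limit[OF _ hsum_schwartz \<phi> hsum_tendsto_seminorm[OF \<phi>]])
         (use S \<phi> in \<open>simp add: topspace_schwartz_topology\<close>)
    then show "\<forall>\<^sub>F n in sequentially. f (hsum n (hcoeff \<phi>)) \<in> S" by (rule eventually_mono) simp
  qed
  moreover have "f (hsum n (hcoeff \<phi>)) = (\<Sum>\<beta> | multi_deg \<beta> \<le> n. hcoeff \<phi> \<beta> * f (Hc \<beta>))" for n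
    unfolding hsum_def[abs_def] by (rule tempered_sum[OF f]) (auto intro: Hc_schwartz)
  ultimately show ?thesis by simp
qed

lemma tempered_eqI:
  assumes f: "f \<in> tempered" and g: "g \<in> tempered" and eq: "\<And>\<beta>. f (Hc \<beta>) = g (Hc \<beta>)"
  shows "f = g"
proof (rule extensionalityI[of _ schwartz])
  show "f \<in> extensional schwartz" "g \<in> extensional schwartz" using f g unfolding tempered_def by auto
  fix \<phi> assume "\<phi> \<in> (schwartz :: (real ^ 'a \<Rightarrow> complex) set)"
  from tempered_expansion[OF f this] tempered_expansion[OF g this] show "f \<phi> = g \<phi>"
    unfolding eq by (rule LIMSEQ_unique)
qed

section \<open>\<open>L\<^sup>p\<close> functions as tempered distributions\<close>

lemma lp_space_measurable: "F \<in> lp_space p \<Longrightarrow> F \<in> borel_measurable lborel"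
  and lp_space_finite: "F \<in> lp_space p \<Longrightarrow> lp_norm p F < \<infinity>"
  by (auto simp: lp_space_def)

lemma lp_wt_pairing:
  "\<exists>K>0. \<forall>p u. 1 \<le> p \<longrightarrow> u \<in> borel_measurable lborel \<longrightarrow>
     (\<integral>\<^sup>+x. ennreal (wt (x :: real ^ 'd::finite)) * u x \<partial>lborel) \<le> ennreal K * lpn p u"
proof -
  define K where "K = 1 + (\<integral>x. wt (x :: real ^ 'd) \<partial>lborel)"
  have pos: "wt x \<ge> 0" for x :: "real ^ 'd" using wt_pos[of x] by simp
  have I: "(\<integral>x. wt (x :: real ^ 'd) \<partial>lborel) \<ge> 0" by (intro Bochner_Integration.integral_nonneg pos)
  have "(\<integral>\<^sup>+x. ennreal (wt (x :: real ^ 'd)) * u x \<partial>lborel) \<le> ennreal K * lpn p u"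
    if "1 \<le> p" "u \<in> borel_measurable lborel" for p u
  proof (rule lpn_pairing)
    show "K > 0" unfolding K_def using I by simp
    show "ennreal (wt x) \<le> ennreal K" for x :: "real ^ 'd"
      unfolding K_def using I wt_le_1[of x] by (intro ennreal_leI) simp
    have "(\<integral>\<^sup>+x. ennreal (wt (x :: real ^ 'd)) \<partial>lborel) = ennreal (\<integral>x. wt (x :: real ^ 'd) \<partial>lborel)"
      by (rule nn_integral_eq_integral[OF wt_integrable]) (use pos in auto)
    then show "(\<integral>\<^sup>+x. ennreal (wt (x :: real ^ 'd)) \<partial>lborel) \<le> ennreal K"
      unfolding K_def by (simp add: ennreal_leI)
  qed (use that in auto)
  moreover have "K > 0" unfolding K_def using I by simp
  ultimately show ?thesis by blast
qed

text \<open>The test function is dominated by a multiple of \<open>wt\<close>, so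
  \<open>lpn_pairing\<close> yields a constant common to all \<open>p\<close>, \<open>F\<close> and
  \<open>\<phi>\<close>.\<close>

lemma lp_schwartz_pairing:
  "\<exists>K>0. \<forall>p F. 1 \<le> p \<longrightarrow> F \<in> borel_measurable lborel \<longrightarrow> (\<forall>\<phi> \<in> (schwartz :: (real ^ 'd::finite \<Rightarrow> complex) set).
     (\<integral>\<^sup>+x. ennreal (norm (F x * \<phi> x)) \<partial>lborel) \<le> ennreal (K * schwartz_decay \<phi>) * lp_norm p F)"
proof -
  obtain K where K: "K > 0" "\<And>p u. 1 \<le> p \<Longrightarrow> u \<in> borel_measurable lborel \<Longrightarrow>
     (\<integral>\<^sup>+x. ennreal (wt (x :: real ^ 'd)) * u x \<partial>lborel) \<le> ennreal K * lpn p u"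
    using lp_wt_pairing by blast
  have "(\<integral>\<^sup>+x. ennreal (norm (F x * \<phi> x)) \<partial>lborel) \<le> ennreal (K * schwartz_decay \<phi>) * lp_norm p F"
    if p: "1 \<le> p" and [measurable]: "F \<in> borel_measurable lborel" and \<phi>: "\<phi> \<in> schwartz"
    for p F and \<phi> :: "real ^ 'd \<Rightarrow> complex"
  proof -
    define D where "D = schwartz_decay \<phi>"
    have D: "D \<ge> 0" unfolding D_def by (rule schwartz_decay_nonneg[OF \<phi>])
    have "(\<integral>\<^sup>+x. ennreal (norm (F x * \<phi> x)) \<partial>lborel) \<le> (\<integral>\<^sup>+x. ennreal D * (ennreal (wt x) * ennreal (norm (F x))) \<partial>lborel)"
    proof (rule nn_integral_mono)
      fix x
      have "norm (F x * \<phi> x) \<le> norm (F x) * (D * wt x)"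
        unfolding norm_mult D_def by (intro mult_left_mono schwartz_decay_bound \<phi>) auto
      then have "ennreal (norm (F x * \<phi> x)) \<le> ennreal (D * (wt x * norm (F x)))" by (intro ennreal_leI) (simp add: mult_ac)
      then show "ennreal (norm (F x * \<phi> x)) \<le> ennreal D * (ennreal (wt x) * ennreal (norm (F x)))"
        using D wt_pos[of x] by (simp add: ennreal_mult)
    qed
    also have "\<dots> = ennreal D * (\<integral>\<^sup>+x. ennreal (wt x) * ennreal (norm (F x)) \<partial>lborel)" by (rule nn_integral_cmult) measurable
    also have "\<dots> \<le> ennreal D * (ennreal K * lp_norm p F)"
      unfolding lp_norm_eq_lpn by (intro mult_left_mono K p) auto
    also have "\<dots> = ennreal (K * D) * lp_norm p F" using D K by (simp add: ennreal_mult mult_ac)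
    finally show ?thesis unfolding D_def .
  qed
  then show ?thesis using K(1) by blast
qed

lemma lp_times_schwartz_integrable:
  assumes F: "F \<in> lp_space p" and p: "1 \<le> p" and \<phi>: "\<phi> \<in> schwartz"
  shows "integrable lborel (\<lambda>x. F x * \<phi> x)"
proof -
  note [measurable] = lp_space_measurable[OF F] schwartz_measurable[OF \<phi>]
  obtain K where K: "(\<integral>\<^sup>+x. ennreal (norm (F x * \<phi> x)) \<partial>lborel) \<le> ennreal (K * schwartz_decay \<phi>) * lp_norm p F"
    using lp_schwartz_pairing p lp_space_measurable[OF F] \<phi> by blast
  also have "\<dots> < \<infinity>" using lp_space_finite[OF F] by (simp add: ennreal_mult_less_top)
  finally show ?thesis by (intro integrableI_bounded) measurable
qed

lemma dist_of_fun_apply: "\<phi> \<in> schwartz \<Longrightarrow> dist_of_fun F \<phi> = (\<integral>x. F x * \<phi> x \<partial>lborel)"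
  by (simp add: dist_of_fun_def)

lemma dist_of_fun_Hc: "dist_of_fun F (Hc \<beta>) = hcoeff F \<beta>"
  unfolding dist_of_fun_apply[OF Hc_schwartz] hcoeff_def ..

text \<open>A finite intersection of subbasic balls, one for each of the \<open>N\<close> seminorms
  in \<open>schwartz_decay\<close>, with \<open>e\<close> shared equally among them.\<close>

lemma schwartz_nbhd:
  assumes \<phi>: "\<phi> \<in> schwartz" and e: "0 < e"
  shows "\<exists>V. openin schwartz_topology V \<and> \<phi> \<in> V \<and> V \<subseteq> schwartz \<and> (\<forall>\<psi>\<in>V. schwartz_decay (\<lambda>x. \<psi> x - \<phi> x) < e)"
proof -
  define N where "N = real (card (Pow (UNIV :: 'a set)))"
  have N: "N > 0" unfolding N_def by (simp add: card_Pow)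
  define V where "V A = {\<psi> \<in> schwartz. schwartz_seminorm (\<lambda>i. if i \<in> A then 2 else 0) [] (\<lambda>x. \<psi> x - \<phi> x) < e / N}" for A :: "'a set"
  have op: "openin schwartz_topology (V A)" for A
    unfolding schwartz_topology_def V_def
  proof (rule topology_generated_by_Basis)
    have "0 < e / N" using e N by simp
    then show "{\<psi> \<in> schwartz. schwartz_seminorm (\<lambda>i. if i \<in> A then 2 else 0) [] (\<lambda>x. \<psi> x - \<phi> x) < e / N}
        \<in> {{\<psi> \<in> schwartz. schwartz_seminorm \<gamma> w (\<lambda>x. \<psi> x - \<phi> x) < \<epsilon>} | \<gamma> w \<phi> \<epsilon>. \<phi> \<in> schwartz \<and> 0 < \<epsilon>}"
      using \<phi> by blast
  qed
  have z: "schwartz_seminorm \<gamma> w (\<lambda>x. \<phi> x - \<phi> x) = 0" for \<gamma> w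
  proof -
    have "partial_derivs w (\<lambda>x :: real ^ 'a. 0) = (\<lambda>x. 0)"
      by (induction w) (auto intro!: ext partial_deriv_eqI)
    then show ?thesis by (simp add: schwartz_seminorm_def schwartz_weight_def)
  qed
  define W where "W = (\<Inter>A\<in>Pow UNIV. V A)"
  have "openin schwartz_topology W" unfolding W_def by (rule openin_INT2) (auto intro: op)
  moreover have "\<phi> \<in> W" unfolding W_def V_def using z \<phi> e N by simp
  moreover have "W \<subseteq> schwartz" unfolding W_def V_def by auto
  moreover have "schwartz_decay (\<lambda>x. \<psi> x - \<phi> x) < e" if "\<psi> \<in> W" for \<psi>
  proof -
    have "schwartz_decay (\<lambda>x. \<psi> x - \<phi> x) < (\<Sum>A\<in>Pow (UNIV :: 'a set). e / N)"
      unfolding schwartz_decay_def using that unfolding W_def V_def by (intro sum_strict_mono) auto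
    also have "\<dots> = e" using N unfolding N_def by simp
    finally show ?thesis .
  qed
  ultimately show ?thesis by blast
qed

lemma dist_of_fun_tempered:
  fixes F :: "real ^ 'd::finite \<Rightarrow> complex"
  assumes F: "F \<in> lp_space p" and p: "1 \<le> p"
  shows "dist_of_fun F \<in> tempered"
proof -
  note [measurable] = lp_space_measurable[OF F]
  note int = lp_times_schwartz_integrable[OF F p]
  obtain K where K: "K > 0" "\<And>\<phi>. \<phi> \<in> schwartz \<Longrightarrow>
     (\<integral>\<^sup>+x. ennreal (norm (F x * \<phi> x)) \<partial>lborel) \<le> ennreal (K * schwartz_decay \<phi>) * lp_norm p F"
    using lp_schwartz_pairing[where 'd='d] p lp_space_measurable[OF F] by blast
  obtain L where L: "lp_norm p F = ennreal L" "L \<ge> 0"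
    using lp_space_finite[OF F] by (cases "lp_norm p F") auto
  have bound: "norm (dist_of_fun F \<phi>) \<le> K * L * schwartz_decay \<phi>" if "\<phi> \<in> schwartz" for \<phi>
  proof -
    have d: "schwartz_decay \<phi> \<ge> 0" by (rule schwartz_decay_nonneg[OF that])
    have "ennreal (norm (dist_of_fun F \<phi>)) \<le> (\<integral>\<^sup>+x. ennreal (norm (F x * \<phi> x)) \<partial>lborel)"
      unfolding dist_of_fun_apply[OF that] by (rule integral_norm_bound_ennreal[OF int[OF that]])
    also have "\<dots> \<le> ennreal (K * schwartz_decay \<phi>) * ennreal L" using K(2)[OF that] L by simp
    also have "\<dots> = ennreal (K * L * schwartz_decay \<phi>)" using L K d by (simp add: mult_ac flip: ennreal_mult)
    finally show ?thesis using L K d by (simp add: ennreal_le_iff)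
  qed
  have diff: "dist_of_fun F \<psi> - dist_of_fun F \<phi> = dist_of_fun F (\<lambda>x. \<psi> x - \<phi> x)" if "\<phi> \<in> schwartz" "\<psi> \<in> schwartz" for \<phi> \<psi>
    using that by (simp add: dist_of_fun_apply schwartz_diff right_diff_distrib Bochner_Integration.integral_diff[OF int int])
  have "continuous_map schwartz_topology euclidean (dist_of_fun F)"
    unfolding continuous_map_def topspace_schwartz_topology
  proof (intro conjI allI impI)
    fix U :: "complex set" assume "openin euclidean U"
    then have U: "open U" by simp
    show "openin schwartz_topology {\<phi> \<in> schwartz. dist_of_fun F \<phi> \<in> U}"
    proof (subst openin_subopen, intro ballI)
      fix \<phi> assume \<phi>: "\<phi> \<in> {\<phi> \<in> schwartz. dist_of_fun F \<phi> \<in> U}"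
      then obtain e where e: "e > 0" "ball (dist_of_fun F \<phi>) e \<subseteq> U" using U openE by blast
      \<comment> \<open>The summand 1 keeps the radius meaningful when the norm \<open>L\<close> of
        \<open>F\<close> is 0.\<close>
      have pos: "e / (K * L + 1) > 0" using e K L by (simp add: add_nonneg_pos)
      obtain V where V: "openin schwartz_topology V" "\<phi> \<in> V" "V \<subseteq> schwartz"
          "\<And>\<psi>. \<psi> \<in> V \<Longrightarrow> schwartz_decay (\<lambda>x. \<psi> x - \<phi> x) < e / (K * L + 1)"
        using schwartz_nbhd[OF _ pos, of \<phi>] \<phi> by blast
      have "dist_of_fun F \<psi> \<in> U" if "\<psi> \<in> V" for \<psi>
      proof -
        have \<psi>: "\<psi> \<in> schwartz" using V that by blast
        have d: "schwartz_decay (\<lambda>x. \<psi> x - \<phi> x) \<ge> 0" using \<psi> \<phi> by (intro schwartz_decay_nonneg schwartz_diff) auto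
        have "norm (dist_of_fun F \<psi> - dist_of_fun F \<phi>) \<le> K * L * schwartz_decay (\<lambda>x. \<psi> x - \<phi> x)"
          using \<phi> \<psi> by (subst diff) (auto intro!: bound schwartz_diff)
        also have "\<dots> \<le> (K * L + 1) * schwartz_decay (\<lambda>x. \<psi> x - \<phi> x)" using d by (intro mult_right_mono) auto
        also have "\<dots> < e" using V(4)[OF that] K L by (simp add: pos_less_divide_eq add_nonneg_pos mult.commute)
        finally show ?thesis using e(2) by (auto simp: dist_norm norm_minus_commute subset_iff)
      qed
      then show "\<exists>T. openin schwartz_topology T \<and> \<phi> \<in> T \<and> T \<subseteq> {\<phi> \<in> schwartz. dist_of_fun F \<phi> \<in> U}"
        using V by (intro exI[of _ V]) auto
    qed
  qed auto
  moreover have "dist_of_fun F (\<lambda>x. \<phi> x + \<psi> x) = dist_of_fun F \<phi> + dist_of_fun F \<psi>" if "\<phi> \<in> schwartz" "\<psi> \<in> schwartz" for \<phi> \<psi>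
    using that by (simp add: dist_of_fun_apply schwartz_add distrib_left Bochner_Integration.integral_add[OF int int])
  moreover have "dist_of_fun F (\<lambda>x. c * \<phi> x) = c * dist_of_fun F \<phi>" if "\<phi> \<in> schwartz" for c \<phi>
    using that by (simp add: dist_of_fun_apply schwartz_cmult mult.left_commute)
  moreover have "dist_of_fun F \<in> extensional schwartz" unfolding dist_of_fun_def by simp
  ultimately show ?thesis unfolding tempered_def by blast
qed

text \<open>\<open>Hc \<beta>\<close> has a single nonzero coefficient, equal to 1, so its
  coefficient norms are powers of \<open>1 + multi_deg \<beta>\<close>, and these bound its Schwartz
  seminorms.\<close>

lemma schwartz_decay_Hc:
  "\<exists>K m. K \<ge> 0 \<and> (\<forall>\<beta> :: 'd::finite \<Rightarrow> nat. schwartz_decay (Hc \<beta>) \<le> K * (1 + real (multi_deg \<beta>)) ^ m)"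
proof -
  have "\<forall>A :: 'd set. \<exists>k K. \<forall>\<phi>\<in>(schwartz :: (real ^ 'd \<Rightarrow> complex) set). \<forall>a. coeff_bdd k a \<phi> \<longrightarrow>
      (\<forall>x. schwartz_weight (\<lambda>i. if i \<in> A then 2 else 0) [] \<phi> x \<le> K * a)"
    by (intro allI schwartz_weight_coeff_bound)
  then obtain k K where kK: "\<And>A \<phi> a x. \<phi> \<in> (schwartz :: (real ^ 'd \<Rightarrow> complex) set) \<Longrightarrow> coeff_bdd (k A) a \<phi> \<Longrightarrow>
      schwartz_weight (\<lambda>i. if i \<in> A then 2 else 0) [] \<phi> x \<le> K A * a" by metis
  define m where "m = (\<Sum>A\<in>Pow UNIV. k A)"
  have "schwartz_decay (Hc \<beta>) \<le> (\<Sum>A\<in>Pow UNIV. \<bar>K A\<bar>) * (1 + real (multi_deg \<beta>)) ^ m" for \<beta> :: "'d \<Rightarrow> nat"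
  proof -
    define M where "M = 1 + real (multi_deg \<beta>)"
    have M: "M \<ge> 1" unfolding M_def by (simp add: sum_nonneg)
    have bd: "coeff_bdd n (M ^ n) (Hc \<beta>)" for n
      unfolding coeff_bdd_def hcoeff_Hc M_def by (auto simp: sum_nonneg)
    have "schwartz_seminorm (\<lambda>i. if i \<in> A then 2 else 0) [] (Hc \<beta>) \<le> \<bar>K A\<bar> * M ^ m" for A
    proof (rule schwartz_seminorm_le)
      fix x
      have "schwartz_weight (\<lambda>i. if i \<in> A then 2 else 0) [] (Hc \<beta>) x \<le> K A * M ^ k A"
        by (rule kK[OF Hc_schwartz bd])
      also have "\<dots> \<le> \<bar>K A\<bar> * M ^ k A" using M by (intro mult_right_mono) auto
      also have "\<dots> \<le> \<bar>K A\<bar> * M ^ m"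
        using M member_le_sum[of A "Pow UNIV" k] unfolding m_def by (intro mult_left_mono power_increasing) auto
      finally show "schwartz_weight (\<lambda>i. if i \<in> A then 2 else 0) [] (Hc \<beta>) x \<le> \<bar>K A\<bar> * M ^ m" .
    qed
    then show ?thesis unfolding schwartz_decay_def sum_distrib_right M_def[symmetric] by (intro sum_mono)
  qed
  moreover have "(\<Sum>A\<in>Pow UNIV. \<bar>K A\<bar>) \<ge> 0" by (intro sum_nonneg) auto
  ultimately show ?thesis by blast
qed

section \<open>Uniqueness of Hermite coefficients in \<open>L\<^sup>p\<close>\<close>

text \<open>Vanishing against continuous functions gives vanishing over closed sets. The positive
  and negative parts of \<open>G\<close> are then finite measures that agree on an
  intersection-stable generator.\<close>

lemma AE_eq_0_if_integral_continuous_eq_0: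
  fixes G :: "real ^ 'd::finite \<Rightarrow> real"
  assumes G: "integrable lborel G"
    and zero: "\<And>\<psi>. continuous_on UNIV \<psi> \<Longrightarrow> (\<And>x. 0 \<le> \<psi> x \<and> \<psi> x \<le> 1) \<Longrightarrow> (\<integral>x. G x * \<psi> x \<partial>lborel) = 0"
  shows "AE x in lborel. G x = 0"
proof -
  have [measurable]: "G \<in> borel_measurable borel" using G by auto
  have closed0: "(\<integral>x. G x * indicator C x \<partial>lborel) = 0" if C: "closed C" for C
  proof (cases "C = {}")
    case False
    have [measurable]: "C \<in> sets borel" using C by auto
    \<comment> \<open>Continuous functions decreasing to the indicator of \<open>C\<close>.\<close>
    define \<psi> where "\<psi> n x = max 0 (1 - real n * infdist x C)" for n x
    have "(\<lambda>n. \<integral>x. G x * \<psi> n x \<partial>lborel) \<longlonglongrightarrow> (\<integral>x. G x * indicator C x \<partial>lborel)"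
    proof (rule integral_dominated_convergence[where w = "\<lambda>x. \<bar>G x\<bar>"])
      show "integrable lborel (\<lambda>x. \<bar>G x\<bar>)" using G by auto
      have cont: "continuous_on UNIV (\<psi> n)" for n unfolding \<psi>_def by (intro continuous_intros)
      then have [measurable]: "\<psi> n \<in> borel_measurable borel" for n by (rule borel_measurable_continuous_onI)
      show "(\<lambda>x. G x * \<psi> n x) \<in> borel_measurable lborel" for n by measurable
      show "(\<lambda>x. G x * indicator C x) \<in> borel_measurable lborel" by measurable
      show "AE x in lborel. (\<lambda>n. G x * \<psi> n x) \<longlonglongrightarrow> G x * indicator C x"
      proof (rule AE_I2, intro tendsto_mult tendsto_const)
        fix x
        show "(\<lambda>n. \<psi> n x) \<longlonglongrightarrow> indicator C x"
        proof (cases "x \<in> C")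
          case True
          then show ?thesis unfolding \<psi>_def by simp
        next
          case False
          then have d: "infdist x C > 0"
            using C \<open>C \<noteq> {}\<close> in_closed_iff_infdist_zero[OF C \<open>C \<noteq> {}\<close>] infdist_nonneg[of x C] by (simp add: less_le)
          obtain N where N: "1 / infdist x C < real N" using reals_Archimedean2 by blast
          have "\<psi> n x = 0" if "n \<ge> N" for n
          proof -
            have "1 < real N * infdist x C" using N d by (simp add: pos_divide_less_eq)
            also have "\<dots> \<le> real n * infdist x C" using that d by (intro mult_right_mono) auto
            finally show ?thesis unfolding \<psi>_def by simp
          qed
          then have "\<forall>\<^sub>F n in sequentially. \<psi> n x = 0" unfolding eventually_sequentially by blast
          then show ?thesis using False by (simp add: tendsto_eventually)
        qed
      qed
      fix n
      show "AE x in lborel. norm (G x * \<psi> n x) \<le> \<bar>G x\<bar>"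
      proof (rule AE_I2)
        fix x
        have "\<bar>\<psi> n x\<bar> \<le> 1" unfolding \<psi>_def using infdist_nonneg[of x C] by auto
        from mult_left_mono[OF this, of "\<bar>G x\<bar>"] show "norm (G x * \<psi> n x) \<le> \<bar>G x\<bar>" by (simp add: abs_mult)
      qed
    qed
    moreover have "(\<integral>x. G x * \<psi> n x \<partial>lborel) = 0" for n
    proof (rule zero)
      show "continuous_on UNIV (\<psi> n)" unfolding \<psi>_def by (intro continuous_intros)
      show "0 \<le> \<psi> n x \<and> \<psi> n x \<le> 1" for x unfolding \<psi>_def using infdist_nonneg[of x C] by auto
    qed
    ultimately show ?thesis by (simp add: LIMSEQ_const_iff)
  qed simp
  \<comment> \<open>\<open>ennreal\<close> cuts off negative values, so the two densities are the
    positive and the negative part of \<open>G\<close>.\<close>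
  define P N where "P = density lborel (\<lambda>x. ennreal (G x))" and "N = density lborel (\<lambda>x. ennreal (- G x))"
  have fin: "(\<integral>\<^sup>+x. ennreal (G x) \<partial>lborel) \<noteq> \<infinity>" "(\<integral>\<^sup>+x. ennreal (- G x) \<partial>lborel) \<noteq> \<infinity>"
    using G unfolding real_integrable_def by auto
  have eqC: "emeasure P C = emeasure N C" if C: "closed C" for C
  proof -
    have [measurable]: "C \<in> sets borel" using C by auto
    have Gi: "integrable lborel (\<lambda>x. G x * indicator C x)" using G by (rule integrable_real_mult_indicator[rotated]) auto
    have ind: "ennreal (G x) * indicator C x = ennreal (G x * indicator C x)"
      "ennreal (- G x) * indicator C x = ennreal (- (G x * indicator C x))" for x
      by (auto split: split_indicator)
    have fin': "(\<integral>\<^sup>+x. ennreal (G x * indicator C x) \<partial>lborel) \<noteq> \<infinity>" "(\<integral>\<^sup>+x. ennreal (- (G x * indicator C x)) \<partial>lborel) \<noteq> \<infinity>"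
      using Gi unfolding real_integrable_def by auto
    have "enn2real (\<integral>\<^sup>+x. ennreal (G x * indicator C x) \<partial>lborel) = enn2real (\<integral>\<^sup>+x. ennreal (- (G x * indicator C x)) \<partial>lborel)"
      using closed0[OF C] real_lebesgue_integral_def[OF Gi] by simp
    then have "(\<integral>\<^sup>+x. ennreal (G x * indicator C x) \<partial>lborel) = (\<integral>\<^sup>+x. ennreal (- (G x * indicator C x)) \<partial>lborel)"
    proof -
      have "a = b" if "a \<noteq> \<infinity>" "b \<noteq> \<infinity>" "enn2real a = enn2real b" for a b :: ennreal
        using that by (cases a; cases b) auto
      then show "enn2real (\<integral>\<^sup>+x. ennreal (G x * indicator C x) \<partial>lborel) = enn2real (\<integral>\<^sup>+x. ennreal (- (G x * indicator C x)) \<partial>lborel) \<Longrightarrow> ?thesis"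
        using fin' by blast
    qed
    then show ?thesis unfolding P_def N_def by (simp add: emeasure_density ind)
  qed
  have "P = N"
  proof (rule measure_eqI_generator_eq[where E = "Collect closed" and \<Omega> = UNIV and A = "\<lambda>_. UNIV"])
    show "Int_stable (Collect closed :: (real ^ 'd) set set)" by (auto simp: Int_stable_def)
    show "sets P = sigma_sets UNIV (Collect closed)" "sets N = sigma_sets UNIV (Collect closed)"
      unfolding P_def N_def by (simp_all add: borel_eq_closed)
    show "emeasure P UNIV \<noteq> \<infinity>" for i :: nat
      unfolding P_def using fin by (simp add: emeasure_density)
  qed (use eqC in auto)
  then have "AE x in lborel. ennreal (G x) = ennreal (- G x)"
    unfolding P_def N_def by (subst (asm) finite_density_unique) (use fin in auto)
  then show ?thesis
  proof (rule AE_mp, intro AE_I2 impI)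
    fix x assume "ennreal (G x) = ennreal (- G x)"
    then show "G x = 0" by (cases "G x \<ge> 0") (auto simp: ennreal_neg ennreal_eq_0_iff dest: sym)
  qed
qed

lemma lp_norm_Hc_pairing:
  fixes F :: "real ^ 'd::finite \<Rightarrow> complex"
  assumes F: "F \<in> lp_space p" and p: "1 \<le> p"
  shows "\<exists>K m. K \<ge> 0 \<and> (\<forall>\<beta>. (\<integral>x. norm (F x * Hc \<beta> x) \<partial>lborel) \<le> K * (1 + real (multi_deg \<beta>)) ^ m)"
proof -
  obtain K where K: "K > 0" "\<And>\<phi>. \<phi> \<in> schwartz \<Longrightarrow>
     (\<integral>\<^sup>+x. ennreal (norm (F x * \<phi> x)) \<partial>lborel) \<le> ennreal (K * schwartz_decay \<phi>) * lp_norm p F"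
    using lp_schwartz_pairing[where 'd='d] p lp_space_measurable[OF F] by blast
  obtain L where L: "lp_norm p F = ennreal L" "L \<ge> 0"
    using lp_space_finite[OF F] by (cases "lp_norm p F") auto
  obtain K' m where K': "K' \<ge> 0" "\<And>\<beta> :: 'd \<Rightarrow> nat. schwartz_decay (Hc \<beta>) \<le> K' * (1 + real (multi_deg \<beta>)) ^ m"
    using schwartz_decay_Hc[where 'd='d] by blast
  have "(\<integral>x. norm (F x * Hc \<beta> x) \<partial>lborel) \<le> (K * L * K') * (1 + real (multi_deg \<beta>)) ^ m" for \<beta>
  proof -
    have d: "schwartz_decay (Hc \<beta>) \<ge> 0" by (rule schwartz_decay_nonneg[OF Hc_schwartz])
    have "ennreal (\<integral>x. norm (F x * Hc \<beta> x) \<partial>lborel) = (\<integral>\<^sup>+x. ennreal (norm (F x * Hc \<beta> x)) \<partial>lborel)"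
      by (rule nn_integral_eq_integral[symmetric]) (auto intro: integrable_norm lp_times_schwartz_integrable[OF F p Hc_schwartz])
    also have "\<dots> \<le> ennreal (K * schwartz_decay (Hc \<beta>)) * ennreal L" using K(2)[OF Hc_schwartz] L by simp
    also have "\<dots> = ennreal (K * L * schwartz_decay (Hc \<beta>))" using L K d by (simp add: mult_ac flip: ennreal_mult)
    finally have "(\<integral>x. norm (F x * Hc \<beta> x) \<partial>lborel) \<le> K * L * schwartz_decay (Hc \<beta>)"
      using L K d by (simp add: ennreal_le_iff)
    also have "\<dots> \<le> K * L * (K' * (1 + real (multi_deg \<beta>)) ^ m)" using L K by (intro mult_left_mono K') auto
    finally show ?thesis by (simp add: mult.assoc)
  qed
  then show ?thesis using L K K' by (intro exI[of _ "K * L * K'"] exI[of _ m]) auto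
qed

text \<open>The ground state is an eigenfunction of the Mehler operator with eigenvalue
  \<open>r ^ 0 = 1\<close>.\<close>

lemma hermite_kernel_mass:
  assumes "\<bar>r\<bar> < 1"
  shows "(\<integral>y. of_real (mehler_real r x y) * Hc (\<lambda>_ :: 'd::finite. 0) y \<partial>lborel) = Hc (\<lambda>_. 0) x"
proof -
  have "of_real (r ^ \<nu>) * hcomp \<nu> (hcoeff (Hc (\<lambda>_ :: 'd. 0))) x = (if \<nu> = 0 then Hc (\<lambda>_. 0) x else 0)" for \<nu>
  proof -
    have "hcomp \<nu> (hcoeff (Hc (\<lambda>_ :: 'd. 0))) x = (\<Sum>\<beta> | multi_deg \<beta> = \<nu>. if \<beta> = (\<lambda>_ :: 'd. 0) then Hc (\<lambda>_ :: 'd. 0) x else 0)"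
      unfolding hcomp_def hcoeff_Hc by (intro sum.cong) auto
    also have "\<dots> = (if \<nu> = 0 then Hc (\<lambda>_ :: 'd. 0) x else 0)" by (subst sum.delta) auto
    finally show ?thesis by simp
  qed
  then have "(\<lambda>\<nu>. if \<nu> = 0 then Hc (\<lambda>_ :: 'd. 0) x else 0) sums (\<integral>y. of_real (mehler_real r x y) * Hc (\<lambda>_ :: 'd. 0) y \<partial>lborel)"
    using mehler_integral_sums[OF schwartz_integrable[OF Hc_schwartz] assms, of "\<lambda>_ :: 'd. 0" x] by simp
  moreover have "(\<lambda>\<nu>. if \<nu> = 0 then Hc (\<lambda>_ :: 'd. 0) x else 0) sums Hc (\<lambda>_. 0) x" by (rule sums_single)
  ultimately show ?thesis using sums_unique2 by blast
qed

lemma hermite_fun_0_pos: "hermite_fun (\<lambda>_. 0) x > 0"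
  unfolding hermite_fun_0 using hermite_const_pos by (intro prod_pos) auto

text \<open>\<open>F\<close> is tested against \<open>W * \<psi>\<close> with the Gaussian ground
  state \<open>W\<close>. The Abel means of the Hermite expansion of \<open>W * \<psi>\<close> are
  annihilated by \<open>F\<close>, and they stay below \<open>W\<close> because the Mehler kernel is
  positive and preserves \<open>W\<close>. Hence the integrable function \<open>F * W\<close>
  dominates the passage to the limit, for every \<open>p\<close>.\<close>

lemma lp_eq_0_if_hcoeff_eq_0:
  fixes F :: "real ^ 'd::finite \<Rightarrow> complex"
  assumes F: "F \<in> lp_space p" and p: "1 \<le> p" and zero: "\<And>\<beta>. hcoeff F \<beta> = 0"
  shows "AE x in lborel. F x = 0"
proof -
  note [measurable] = lp_space_measurable[OF F]
  define W :: "real ^ 'd \<Rightarrow> real" where "W = hermite_fun (\<lambda>_. 0)"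
  have W0: "W x > 0" for x unfolding W_def by (rule hermite_fun_0_pos)
  have [measurable]: "W \<in> borel_measurable borel" unfolding W_def by measurable
  have Wi: "integrable lborel W"
    using integrable_Re[OF schwartz_integrable[OF Hc_schwartz[of "\<lambda>_ :: 'd. 0"]]] unfolding W_def by simp
  have FW: "integrable lborel (\<lambda>x. F x * of_real (W x))"
    using lp_times_schwartz_integrable[OF F p Hc_schwartz[of "\<lambda>_. 0"]] unfolding W_def[symmetric] .
  obtain K m where Km: "K \<ge> 0" "\<And>\<beta>. (\<integral>x. norm (F x * Hc \<beta> x) \<partial>lborel) \<le> K * (1 + real (multi_deg \<beta>)) ^ m"
    using lp_norm_Hc_pairing[OF F p] by blast
  have test: "(\<integral>x. F x * of_real (W x) * of_real (\<psi> x) \<partial>lborel) = 0"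
    if \<psi>: "continuous_on UNIV \<psi>" and \<psi>01: "\<And>x. 0 \<le> \<psi> x \<and> \<psi> x \<le> (1::real)" for \<psi>
  proof -
    have [measurable]: "\<psi> \<in> borel_measurable borel" by (rule borel_measurable_continuous_onI[OF \<psi>])
    define u where "u x = complex_of_real (W x * \<psi> x)" for x
    have un: "norm (u x) \<le> W x" for x
      unfolding u_def norm_of_real using W0[of x] \<psi>01[of x] by (simp add: abs_mult mult_left_le)
    have [measurable]: "u \<in> borel_measurable borel" unfolding u_def by measurable
    have u: "integrable lborel u"
      by (rule Bochner_Integration.integrable_bound[OF Wi]) (use un W0 in \<open>auto simp: less_imp_le abs_of_pos\<close>)
    define S where "S n y = (\<integral>x. of_real (mehler_real (abel n) y x) * u x \<partial>lborel)" for n y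
    have Ssums: "(\<lambda>\<nu>. of_real (abel n ^ \<nu>) * hcomp \<nu> (hcoeff u) y) sums S n y" for n y
      unfolding S_def by (rule mehler_integral_sums[OF u abel(3)])
    have [measurable]: "hcomp \<nu> c \<in> borel_measurable borel" for \<nu> and c :: "('d \<Rightarrow> nat) \<Rightarrow> complex"
      unfolding hcomp_def[abs_def] by measurable
    have Smeas [measurable]: "S n \<in> borel_measurable borel" for n
    proof -
      have "S n = (\<lambda>y. \<Sum>\<nu>. of_real (abel n ^ \<nu>) * hcomp \<nu> (hcoeff u) y)"
        using Ssums by (auto simp: sums_iff)
      then show ?thesis by simp
    qed
    have Slim: "(\<lambda>n. S n y) \<longlonglongrightarrow> u y" for y
      unfolding S_def
    proof (rule mehler_tendsto)
      show "continuous_on UNIV u"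
        unfolding u_def W_def by (intro continuous_intros hermite_fun_continuous \<psi>)
      show "norm (u x) \<le> 3 ^ CARD('d) * (1 + real (multi_deg (\<lambda>_ :: 'd. 0))) ^ CARD('d)" for x
        using un[of x] hermite_fun_bound[of "\<lambda>_. 0" x] unfolding W_def by linarith
    qed
    have Sbound: "norm (S n y) \<le> W y" for n y
    proof -
      \<comment> \<open>Integrability is read off from the value of the integral: a non-integrable
        function has integral 0 by convention, but the value here is \<open>W y > 0\<close>.\<close>
      have "integrable lborel (\<lambda>x. complex_of_real (mehler_real (abel n) y x) * of_real (W x))"
      proof (rule ccontr)
        assume "\<not> ?thesis"
        then have "(\<integral>x. complex_of_real (mehler_real (abel n) y x) * of_real (W x) \<partial>lborel) = 0"
          by (rule not_integrable_integral_eq)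
        then show False using hermite_kernel_mass[OF abel(3), of n y] W0[of y] unfolding W_def[symmetric] by simp
      qed
      from integrable_Re[OF this] have ki: "integrable lborel (\<lambda>x. mehler_real (abel n) y x * W x)" by simp
      have "norm (S n y) \<le> (\<integral>x. norm (of_real (mehler_real (abel n) y x) * u x) \<partial>lborel)"
        unfolding S_def by (rule integral_norm_bound)
      also have "\<dots> \<le> (\<integral>x. mehler_real (abel n) y x * W x \<partial>lborel)"
      proof (rule integral_mono')
        show "norm (of_real (mehler_real (abel n) y x) * u x) \<le> mehler_real (abel n) y x * W x" for x
          unfolding norm_mult norm_of_real using mehler_real_nonneg[OF abel(3), of n y x] un[of x] by (simp add: mult_left_mono)
        show "0 \<le> mehler_real (abel n) y x * W x" for x
          using mehler_real_nonneg[OF abel(3), of n y x] W0[of x] by simp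
      qed (rule ki)
      also have "\<dots> = W y"
      proof -
        have "complex_of_real (\<integral>x. mehler_real (abel n) y x * W x \<partial>lborel) = of_real (W y)"
          using hermite_kernel_mass[OF abel(3), of n y] unfolding W_def[symmetric]
          by (simp add: integral_complex_of_real[symmetric] del: integral_complex_of_real)
        then show ?thesis by (simp only: of_real_eq_iff)
      qed
      finally show ?thesis .
    qed
    \<comment> \<open>Integration term by term: the pairings of \<open>F\<close> with Hermite
      functions grow polynomially in the degree and are beaten by \<open>abel n ^ \<nu>\<close>, and
      each term contains a vanishing coefficient of \<open>F\<close>.\<close>
    have FS: "(\<integral>y. F y * S n y \<partial>lborel) = 0" for n
    proof -
      define J where "J = (\<integral>x. norm (u x) \<partial>lborel) * 3 ^ CARD('d)"
      have J: "J \<ge> 0" unfolding J_def by (intro mult_nonneg_nonneg integral_nonneg) auto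
      have cb: "norm (hcoeff u \<beta>) \<le> J * (1 + real (multi_deg \<beta>)) ^ CARD('d)" for \<beta>
        using hcoeff_bound[OF u, of \<beta>] unfolding J_def by (simp only: mult.assoc)
      define f where "f \<nu> y = of_real (abel n ^ \<nu>) * (F y * hcomp \<nu> (hcoeff u) y)" for \<nu> y
      have f_eq: "f \<nu> y = (\<Sum>\<beta> | multi_deg \<beta> = \<nu>. of_real (abel n ^ \<nu>) * hcoeff u \<beta> * (F y * Hc \<beta> y))" for \<nu> y
        unfolding f_def hcomp_def sum_distrib_left by (simp add: mult_ac)
      have FH: "integrable lborel (\<lambda>y. F y * Hc \<beta> y)" for \<beta>
        by (rule lp_times_schwartz_integrable[OF F p Hc_schwartz])
      have fi: "integrable lborel (f \<nu>)" for \<nu>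
        unfolding f_eq[abs_def] by (intro Bochner_Integration.integrable_sum integrable_mult_right FH)
      have f0: "(\<integral>y. f \<nu> y \<partial>lborel) = 0" for \<nu>
      proof -
        have "(\<integral>y. f \<nu> y \<partial>lborel) = (\<Sum>\<beta> | multi_deg \<beta> = \<nu>. \<integral>y. of_real (abel n ^ \<nu>) * hcoeff u \<beta> * (F y * Hc \<beta> y) \<partial>lborel)"
          unfolding f_eq by (rule Bochner_Integration.integral_sum) (intro integrable_mult_right FH)
        also have "\<dots> = 0" using zero unfolding hcoeff_def[of F] by simp
        finally show ?thesis .
      qed
      have s1: "AE y in lborel. summable (\<lambda>\<nu>. norm (f \<nu> y))"
      proof (rule AE_I2)
        fix y
        have "norm (f \<nu> y) \<le> norm (F y) * (J * 3 ^ CARD('d)) * ((1 + real \<nu>) ^ (3 * CARD('d)) * abel n ^ \<nu>)" for \<nu>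
        proof -
          have "norm (hcoeff u \<beta> * Hc \<beta> y) \<le> (J * 3 ^ CARD('d)) * (1 + real \<nu>) ^ (2 * CARD('d))" if "multi_deg \<beta> = \<nu>" for \<beta>
          proof -
            have "norm (hcoeff u \<beta> * Hc \<beta> y) \<le> (J * (1 + real \<nu>) ^ CARD('d)) * (3 ^ CARD('d) * (1 + real \<nu>) ^ CARD('d))"
              unfolding norm_mult using cb[of \<beta>] norm_Hc_bound[of \<beta> y] J that by (intro mult_mono) auto
            then show ?thesis unfolding mult_2 power_add by (simp only: mult_ac)
          qed
          from sum_multi_deg_bound[where g = "\<lambda>\<beta>. hcoeff u \<beta> * Hc \<beta> y", OF this]
          have "norm (hcomp \<nu> (hcoeff u) y) \<le> (1 + real \<nu>) ^ CARD('d) * ((J * 3 ^ CARD('d)) * (1 + real \<nu>) ^ (2 * CARD('d)))"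
            unfolding hcomp_def .
          also have "\<dots> = (J * 3 ^ CARD('d)) * (1 + real \<nu>) ^ (CARD('d) + 2 * CARD('d))" by (simp only: power_add mult_ac)
          finally have "norm (F y) * norm (hcomp \<nu> (hcoeff u) y) * abel n ^ \<nu> \<le> norm (F y) * ((J * 3 ^ CARD('d)) * (1 + real \<nu>) ^ (3 * CARD('d))) * abel n ^ \<nu>"
            using abel[of n] by (intro mult_right_mono mult_left_mono) auto
          then show ?thesis unfolding f_def using abel[of n] by (simp add: norm_mult norm_power mult_ac)
        qed
        then show "summable (\<lambda>\<nu>. norm (f \<nu> y))"
          by (intro summable_comparison_test'[OF summable_mult[OF summable_power_poly[OF abel(3)]], of 0]) auto
      qed
      have s2: "summable (\<lambda>\<nu>. \<integral>y. norm (f \<nu> y) \<partial>lborel)"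
      proof (rule summable_comparison_test'[OF summable_mult[OF summable_power_poly[OF abel(3)]], of 0])
        fix \<nu>
        have b: "(\<integral>y. norm (of_real (abel n ^ \<nu>) * hcoeff u \<beta> * (F y * Hc \<beta> y)) \<partial>lborel) \<le> abel n ^ \<nu> * (J * K * (1 + real \<nu>) ^ (CARD('d) + m))"
          if "multi_deg \<beta> = \<nu>" for \<beta>
        proof -
          have "(\<integral>y. norm (of_real (abel n ^ \<nu>) * hcoeff u \<beta> * (F y * Hc \<beta> y)) \<partial>lborel)
             = abel n ^ \<nu> * (norm (hcoeff u \<beta>) * (\<integral>y. norm (F y * Hc \<beta> y) \<partial>lborel))"
            using abel[of n] by (subst norm_mult) (simp add: norm_mult norm_power)
          also have "\<dots> \<le> abel n ^ \<nu> * ((J * (1 + real \<nu>) ^ CARD('d)) * (K * (1 + real \<nu>) ^ m))"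
            using cb[of \<beta>] Km(2)[of \<beta>] Km(1) J abel[of n] that by (intro mult_left_mono mult_mono) auto
          finally show ?thesis by (simp only: power_add mult_ac)
        qed
        have "(\<integral>y. norm (f \<nu> y) \<partial>lborel) \<le> (\<integral>y. (\<Sum>\<beta> | multi_deg \<beta> = \<nu>. norm (of_real (abel n ^ \<nu>) * hcoeff u \<beta> * (F y * Hc \<beta> y))) \<partial>lborel)"
        proof (rule integral_mono)
          show "integrable lborel (\<lambda>y. norm (f \<nu> y))" by (intro integrable_norm fi)
          show "integrable lborel (\<lambda>y. \<Sum>\<beta> | multi_deg \<beta> = \<nu>. norm (of_real (abel n ^ \<nu>) * hcoeff u \<beta> * (F y * Hc \<beta> y)))"
            by (intro Bochner_Integration.integrable_sum integrable_norm integrable_mult_right FH)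
          show "norm (f \<nu> y) \<le> (\<Sum>\<beta> | multi_deg \<beta> = \<nu>. norm (of_real (abel n ^ \<nu>) * hcoeff u \<beta> * (F y * Hc \<beta> y)))" for y
            unfolding f_eq by (rule norm_sum)
        qed
        also have "\<dots> = (\<Sum>\<beta> | multi_deg \<beta> = \<nu>. \<integral>y. norm (of_real (abel n ^ \<nu>) * hcoeff u \<beta> * (F y * Hc \<beta> y)) \<partial>lborel)"
          by (rule Bochner_Integration.integral_sum) (intro integrable_norm integrable_mult_right FH)
        also have "\<dots> \<le> norm \<dots>" by simp
        also have "\<dots> \<le> (1 + real \<nu>) ^ CARD('d) * (abel n ^ \<nu> * (J * K * (1 + real \<nu>) ^ (CARD('d) + m)))"
          by (rule sum_multi_deg_bound) (use b in simp)
        also have "\<dots> = J * K * ((1 + real \<nu>) ^ (CARD('d) + (CARD('d) + m)) * abel n ^ \<nu>)"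
          by (simp only: power_add mult_ac)
        finally show "norm (\<integral>y. norm (f \<nu> y) \<partial>lborel) \<le> J * K * ((1 + real \<nu>) ^ (CARD('d) + (CARD('d) + m)) * abel n ^ \<nu>)"
          by simp
      qed
      have "(\<lambda>\<nu>. \<integral>y. f \<nu> y \<partial>lborel) sums (\<integral>y. (\<Sum>\<nu>. f \<nu> y) \<partial>lborel)"
        by (rule sums_integral[OF fi s1 s2])
      moreover have "(\<Sum>\<nu>. f \<nu> y) = F y * S n y" for y
        using sums_mult[OF Ssums[of n y], of "F y"] unfolding f_def by (simp add: sums_iff mult_ac)
      ultimately show ?thesis unfolding f0 by (simp add: sums_iff)
    qed
    have "(\<lambda>n. \<integral>y. F y * S n y \<partial>lborel) \<longlonglongrightarrow> (\<integral>y. F y * u y \<partial>lborel)"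
    proof (rule integral_dominated_convergence[where w = "\<lambda>y. norm (F y * of_real (W y))"])
      show "integrable lborel (\<lambda>y. norm (F y * of_real (W y)))" by (intro integrable_norm FW)
      show "AE y in lborel. (\<lambda>n. F y * S n y) \<longlonglongrightarrow> F y * u y" by (intro AE_I2 tendsto_intros Slim)
      show "AE y in lborel. norm (F y * S n y) \<le> norm (F y * of_real (W y))" for n
        using Sbound W0 by (intro AE_I2) (simp add: norm_mult mult_left_mono abs_of_pos)
    qed measurable
    then have "(\<integral>y. F y * u y \<partial>lborel) = 0" unfolding FS by (simp add: LIMSEQ_const_iff)
    then show ?thesis unfolding u_def by (simp add: mult.assoc)
  qed
  have re: "AE x in lborel. Re (F x * of_real (W x)) = 0"
  proof (rule AE_eq_0_if_integral_continuous_eq_0)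
    show "integrable lborel (\<lambda>x. Re (F x * of_real (W x)))" by (rule integrable_Re[OF FW])
    fix \<psi> :: "real ^ 'd \<Rightarrow> real" assume \<psi>: "continuous_on UNIV \<psi>" "\<And>x. 0 \<le> \<psi> x \<and> \<psi> x \<le> 1"
    have [measurable]: "\<psi> \<in> borel_measurable borel" by (rule borel_measurable_continuous_onI[OF \<psi>(1)])
    have i: "integrable lborel (\<lambda>x. F x * of_real (W x) * of_real (\<psi> x))"
      by (rule integrable_mult_bounded[OF FW, of _ 1]) (use \<psi>(2) in auto)
    have "(\<integral>x. Re (F x * of_real (W x)) * \<psi> x \<partial>lborel) = Re (\<integral>x. F x * of_real (W x) * of_real (\<psi> x) \<partial>lborel)"
      by (subst integral_Re[OF i, symmetric]) simp
    then show "(\<integral>x. Re (F x * of_real (W x)) * \<psi> x \<partial>lborel) = 0" unfolding test[OF \<psi>] by simp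
  qed
  have im: "AE x in lborel. Im (F x * of_real (W x)) = 0"
  proof (rule AE_eq_0_if_integral_continuous_eq_0)
    show "integrable lborel (\<lambda>x. Im (F x * of_real (W x)))" by (rule integrable_Im[OF FW])
    fix \<psi> :: "real ^ 'd \<Rightarrow> real" assume \<psi>: "continuous_on UNIV \<psi>" "\<And>x. 0 \<le> \<psi> x \<and> \<psi> x \<le> 1"
    have [measurable]: "\<psi> \<in> borel_measurable borel" by (rule borel_measurable_continuous_onI[OF \<psi>(1)])
    have i: "integrable lborel (\<lambda>x. F x * of_real (W x) * of_real (\<psi> x))"
      by (rule integrable_mult_bounded[OF FW, of _ 1]) (use \<psi>(2) in auto)
    have "(\<integral>x. Im (F x * of_real (W x)) * \<psi> x \<partial>lborel) = Im (\<integral>x. F x * of_real (W x) * of_real (\<psi> x) \<partial>lborel)"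
      by (subst integral_Im[OF i, symmetric]) simp
    then show "(\<integral>x. Im (F x * of_real (W x)) * \<psi> x \<partial>lborel) = 0" unfolding test[OF \<psi>] by simp
  qed
  from re im show ?thesis
  proof eventually_elim
    case (elim x)
    then show ?case using W0[of x] by (auto simp: complex_eq_iff)
  qed
qed

section \<open>Size of Mehler's kernel for complex parameters\<close>

lemma norm_mehler1:
  assumes "norm r < 1"
  shows "norm (mehler1 r x y) = exp (Re ((4 * x * y * r - (x\<^sup>2 + y\<^sup>2) * (1 + r\<^sup>2)) / (2 * (1 - r\<^sup>2))))
     / (sqrt pi * sqrt (norm (1 - r\<^sup>2)))"
  unfolding mehler1_def by (simp add: norm_divide norm_mult)

text \<open>Integrating the Gaussian bound gives the square root of
  \<open>2 |1 - r\<^sup>2| / (1 - |r| ^ 4)\<close>. The factors \<open>|1 + r| \<le> 2\<close> and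
  \<open>1 + |r|\<^sup>2 \<ge> 1\<close> are then estimated away, which leaves the distance to 1
  against the distance to the circle.\<close>

lemma nn_integral_mehler1_le:
  assumes r: "norm r < 1"
  shows "(\<integral>\<^sup>+y. ennreal (norm (mehler1 r x y)) \<partial>lborel) \<le> ennreal (sqrt (4 * norm (1 - r) / (1 - (norm r)\<^sup>2)))"
proof -
  define W where "W = norm (1 - r\<^sup>2)"
  define g where "g = (1 - norm r ^ 4) / (2 * W ^ 2)"
  have W: "W > 0" using one_minus_square_Re_pos(2)[OF r] unfolding W_def by simp
  have r4: "norm r ^ 4 < 1" using r by (simp add: power_less_one_iff)
  have r2: "(norm r)\<^sup>2 < 1" using r by (simp add: power_less_one_iff)
  have g: "g > 0" unfolding g_def using W r4 by simp
  obtain c where c: "\<And>x y. norm (mehler1 r x y) \<le> (1 / sqrt (pi * W)) * exp (- g * (y - c * x)\<^sup>2)"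
    using norm_mehler1_le[OF r] unfolding W_def g_def by auto
  have "(\<integral>\<^sup>+y. ennreal (norm (mehler1 r x y)) \<partial>lborel)
     \<le> (\<integral>\<^sup>+y. ennreal (1 / sqrt (pi * W)) * ennreal (exp (- g * (y - c * x)\<^sup>2)) \<partial>lborel)"
  proof (rule nn_integral_mono)
    fix y
    have "ennreal (norm (mehler1 r x y)) \<le> ennreal ((1 / sqrt (pi * W)) * exp (- g * (y - c * x)\<^sup>2))"
      by (intro ennreal_leI c)
    also have "\<dots> = ennreal (1 / sqrt (pi * W)) * ennreal (exp (- g * (y - c * x)\<^sup>2))"
      by (rule ennreal_mult) (use W in auto)
    finally show "ennreal (norm (mehler1 r x y)) \<le> ennreal (1 / sqrt (pi * W)) * ennreal (exp (- g * (y - c * x)\<^sup>2))" .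
  qed
  also have "\<dots> = ennreal (1 / sqrt (pi * W)) * ennreal (sqrt (pi / g))"
    by (subst nn_integral_cmult) (simp_all only: nn_integral_gaussian[OF g], measurable)
  also have "\<dots> = ennreal (sqrt ((pi / g) / (pi * W)))"
    using W g by (simp add: real_sqrt_divide real_sqrt_mult flip: ennreal_mult)
  also have "\<dots> \<le> ennreal (sqrt (4 * norm (1 - r) / (1 - (norm r)\<^sup>2)))"
  proof (intro ennreal_leI real_sqrt_le_mono)
    have fac: "1 - norm r ^ 4 = (1 - (norm r)\<^sup>2) * (1 + (norm r)\<^sup>2)" by (simp add: power4_eq_xxxx power2_eq_square algebra_simps)
    have "(pi / g) / (pi * W) = 2 * W / (1 - norm r ^ 4)"
      unfolding g_def using W r4 by (simp add: field_simps power2_eq_square)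
    also have "\<dots> \<le> 2 * (norm (1 - r) * 2) / (1 - (norm r)\<^sup>2)"
    proof (rule frac_le)
      have "W = norm (1 - r) * norm (1 + r)"
        unfolding W_def norm_mult[symmetric] by (simp add: power2_eq_square algebra_simps)
      also have "\<dots> \<le> norm (1 - r) * 2"
        using norm_triangle_ineq[of 1 r] r by (intro mult_left_mono) auto
      finally show "2 * W \<le> 2 * (norm (1 - r) * 2)" by simp
      show "1 - (norm r)\<^sup>2 \<le> 1 - norm r ^ 4"
        unfolding fac using r2 mult_left_mono[of 1 "1 + (norm r)\<^sup>2" "1 - (norm r)\<^sup>2"] by simp
    qed (use r2 in auto)
    finally show "(pi / g) / (pi * W) \<le> 4 * norm (1 - r) / (1 - (norm r)\<^sup>2)" by simp
  qed
  finally show ?thesis .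
qed

lemma cis_measurable [measurable]: "cis \<in> borel_measurable borel"
  by (intro borel_measurable_continuous_onI continuous_intros)

text \<open>The modulus of the complex root is the real root of the modulus, so measurability in the
  angle can be checked on an explicit real formula.\<close>

lemma mehler1_norm_measurable:
  assumes \<rho>: "0 \<le> \<rho>" "\<rho> < 1" and [measurable]: "f \<in> borel_measurable M" "g \<in> borel_measurable M"
  shows "(\<lambda>z. norm (mehler1 (of_real \<rho> * cis (f z)) x (g z))) \<in> borel_measurable M"
proof -
  have "norm (of_real \<rho> * cis t) < 1" for t using \<rho> by (simp add: norm_mult)
  note * = norm_mehler1[OF this]
  have [measurable]: "(\<lambda>z. cis (f z)) \<in> borel_measurable M" by (rule measurable_compose[OF _ cis_measurable]) measurable
  show ?thesis unfolding * by measurable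
qed

lemma prod_mono_ennreal:
  fixes f g :: "'a \<Rightarrow> ennreal"
  shows "(\<And>i. i \<in> A \<Longrightarrow> f i \<le> g i) \<Longrightarrow> prod f A \<le> prod g A"
  by (induction A rule: infinite_finite_induct) (auto intro: mult_mono)

text \<open>\<open>X \<ge> 1\<close> allows \<open>sqrt X\<close> to be replaced by
  \<open>X\<close>. The loss of half the exponent only raises the number of summations by parts and
  keeps all powers integral.\<close>

lemma nn_integral_mehler_le:
  fixes x :: "real ^ 'd::finite"
  assumes r: "norm r < 1" and X: "4 * norm (1 - r) / (1 - (norm r)\<^sup>2) \<le> X"  "1 \<le> X"
  shows "(\<integral>\<^sup>+y. ennreal (norm (mehler r x y)) \<partial>lborel) \<le> ennreal (X ^ CARD('d))"
proof -
  have [measurable]: "(\<lambda>y. norm (mehler1 r x y)) \<in> borel_measurable borel" for x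
    unfolding norm_mehler1[OF r] by measurable
  have "(\<integral>\<^sup>+y. ennreal (norm (mehler r x y)) \<partial>lborel) = (\<integral>\<^sup>+y. (\<Prod>i\<in>UNIV. ennreal (norm (mehler1 r (x $ i) (y $ i)))) \<partial>lborel)"
    unfolding mehler_def prod_norm[symmetric] by (intro nn_integral_cong prod_ennreal[symmetric]) auto
  also have "\<dots> = (\<Prod>i\<in>UNIV. \<integral>\<^sup>+t. ennreal (norm (mehler1 r (x $ i) t)) \<partial>lborel)"
    by (rule nn_integral_prod_coord) auto
  also have "\<dots> \<le> (\<Prod>i\<in>(UNIV :: 'd set). ennreal X)"
  proof (rule prod_mono_ennreal)
    fix i :: 'd
    have "sqrt (4 * norm (1 - r) / (1 - (norm r)\<^sup>2)) \<le> sqrt X" using X by simp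
    also have "\<dots> \<le> X" using X(2) by (intro real_le_lsqrt) (auto simp: power2_eq_square)
    finally show "(\<integral>\<^sup>+t. ennreal (norm (mehler1 r (x $ i) t)) \<partial>lborel) \<le> ennreal X"
      by (intro order_trans[OF nn_integral_mehler1_le[OF r]] ennreal_leI)
  qed
  also have "\<dots> = ennreal (X ^ CARD('d))" using X(2) by (simp add: ennreal_power)
  finally show ?thesis .
qed

section \<open>Summation by parts\<close>

definition fdiff :: "real \<Rightarrow> (real \<Rightarrow> complex) \<Rightarrow> real \<Rightarrow> complex" where
  "fdiff h f = (\<lambda>t. f (t + h) - f t)"

text \<open>Each difference gains a factor \<open>h\<close> by the mean value inequality; the
  induction passes from the chain \<open>D\<close> to the chain of its differences.\<close>

lemma fdiff_bound:
  assumes "\<And>m t. m < k \<Longrightarrow> (D m has_vector_derivative D (Suc m) t) (at t)"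
    and "\<And>t. norm (D k t) \<le> B" and h: "h \<ge> 0"
  shows "norm ((fdiff h ^^ k) (D 0) t) \<le> h ^ k * B"
  using assms(1,2)
proof (induction k arbitrary: D B t)
  case 0
  then show ?case by simp
next
  case (Suc k)
  define E where "E m = fdiff h (D m)" for m
  have "norm ((fdiff h ^^ k) (E 0) t) \<le> h ^ k * (h * B)"
  proof (rule Suc.IH)
    fix m t assume "m < k"
    then have d: "(D m has_vector_derivative D (Suc m) t) (at t)" for t by (intro Suc.prems) simp
    have "((\<lambda>t. D m (t + h)) has_vector_derivative D (Suc m) (t + h)) (at t)"
    proof -
      have "((\<lambda>t. t + h) has_vector_derivative 1) (at t)" by (auto intro!: derivative_eq_intros)
      from vector_diff_chain_at[OF this d[of "t + h"]] show ?thesis by (simp add: o_def)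
    qed
    then show "(E m has_vector_derivative E (Suc m) t) (at t)"
      unfolding E_def fdiff_def using d by (rule has_vector_derivative_diff)
  next
    fix t
    have "norm (D k (t + h) - D k t) \<le> B * norm ((t + h) - t)"
    proof (rule differentiable_bound[where S = UNIV and f' = "\<lambda>s u. u *\<^sub>R D (Suc k) s"])
      fix s
      show "(D k has_derivative (\<lambda>u. u *\<^sub>R D (Suc k) s)) (at s within UNIV)"
        using Suc.prems(1)[of k s] by (simp add: has_vector_derivative_def)
      show "onorm (\<lambda>u. u *\<^sub>R D (Suc k) s) \<le> B"
      proof (rule onorm_le)
        fix u :: real
        show "norm (u *\<^sub>R D (Suc k) s) \<le> B * norm u"
          using mult_left_mono[OF Suc.prems(2)[of s], of "\<bar>u\<bar>"] by (simp add: mult.commute)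
      qed
    qed auto
    then show "norm (E k t) \<le> h * B" unfolding E_def fdiff_def using h by (simp add: mult.commute)
  qed
  then show ?case unfolding E_def by (simp add: funpow_swap1 mult_ac)
qed

text \<open>A symmetric range of integers: the shift caused by a difference stays within a slightly
  longer range of the same shape.\<close>

definition trig_sum :: "(real \<Rightarrow> complex) \<Rightarrow> real \<Rightarrow> int \<Rightarrow> real \<Rightarrow> complex" where
  "trig_sum f h L \<theta> = (\<Sum>\<nu>\<in>{-L..L}. f (of_int \<nu> * h) * cis (- of_int \<nu> * \<theta>))"

text \<open>Shifting the index of summation by one multiplies the sum by
  \<open>cis \<theta>\<close>, and the support grows by one step.\<close>

lemma trig_sum_fdiff:
  assumes f: "\<And>\<nu>. \<bar>\<nu>\<bar> > L \<Longrightarrow> f (of_int \<nu> * h) = 0"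
  shows "trig_sum (fdiff h f) h (L + 1) \<theta> = (cis \<theta> - 1) * trig_sum f h L \<theta>"
proof -
  have eq: "fdiff h f (of_int \<nu> * h) * cis (- of_int \<nu> * \<theta>)
     = cis \<theta> * (f (of_int (\<nu> + 1) * h) * cis (- of_int (\<nu> + 1) * \<theta>)) - f (of_int \<nu> * h) * cis (- of_int \<nu> * \<theta>)" for \<nu> :: int
  proof -
    have "cis (- of_int \<nu> * \<theta>) = cis \<theta> * cis (- of_int (\<nu> + 1) * \<theta>)" by (simp add: cis_mult algebra_simps)
    then show ?thesis unfolding fdiff_def by (simp add: algebra_simps)
  qed
  have "trig_sum (fdiff h f) h (L + 1) \<theta>
     = cis \<theta> * (\<Sum>\<nu>\<in>{-(L+1)..L+1}. f (of_int (\<nu> + 1) * h) * cis (- of_int (\<nu> + 1) * \<theta>))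
       - (\<Sum>\<nu>\<in>{-(L+1)..L+1}. f (of_int \<nu> * h) * cis (- of_int \<nu> * \<theta>))"
    unfolding trig_sum_def eq sum_subtractf sum_distrib_left ..
  also have "(\<Sum>\<nu>\<in>{-(L+1)..L+1}. f (of_int (\<nu> + 1) * h) * cis (- of_int (\<nu> + 1) * \<theta>))
      = (\<Sum>\<nu>\<in>{-L..L+2}. f (of_int \<nu> * h) * cis (- of_int \<nu> * \<theta>))"
    by (rule sum.reindex_bij_witness[of _ "\<lambda>\<nu>. \<nu> - 1" "\<lambda>\<nu>. \<nu> + 1"]) auto
  also have "\<dots> = trig_sum f h L \<theta>"
    unfolding trig_sum_def by (rule sum.mono_neutral_right) (use f in auto)
  also have "(\<Sum>\<nu>\<in>{-(L+1)..L+1}. f (of_int \<nu> * h) * cis (- of_int \<nu> * \<theta>)) = trig_sum f h L \<theta>"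
    unfolding trig_sum_def by (rule sum.mono_neutral_right) (use f in auto)
  finally show ?thesis by (simp add: left_diff_distrib)
qed

lemma trig_sum_fdiff_funpow:
  assumes f: "\<And>\<nu>. \<bar>\<nu>\<bar> > L \<Longrightarrow> f (of_int \<nu> * h) = 0"
  shows "trig_sum ((fdiff h ^^ k) f) h (L + int k) \<theta> = (cis \<theta> - 1) ^ k * trig_sum f h L \<theta>
    \<and> (\<forall>\<nu>. \<bar>\<nu>\<bar> > L + int k \<longrightarrow> (fdiff h ^^ k) f (of_int \<nu> * h) = 0)"
proof (induction k)
  case 0
  then show ?case using f by simp
next
  case (Suc k)
  define g where "g = (fdiff h ^^ k) f"
  have g: "\<And>\<nu>. \<bar>\<nu>\<bar> > L + int k \<Longrightarrow> g (of_int \<nu> * h) = 0" using Suc unfolding g_def by blast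
  have "trig_sum (fdiff h g) h (L + int k + 1) \<theta> = (cis \<theta> - 1) * trig_sum g h (L + int k) \<theta>"
    by (rule trig_sum_fdiff) (rule g)
  moreover have "fdiff h g (of_int \<nu> * h) = 0" if "\<bar>\<nu>\<bar> > L + int (Suc k)" for \<nu>
  proof -
    have "fdiff h g (of_int \<nu> * h) = g (of_int (\<nu> + 1) * h) - g (of_int \<nu> * h)"
      unfolding fdiff_def by (simp add: algebra_simps)
    then show ?thesis using g[of "\<nu> + 1"] g[of \<nu>] that by simp
  qed
  ultimately show ?case using Suc unfolding g_def by (simp add: add_ac)
qed

lemma norm_trig_sum_le:
  assumes "\<And>t. norm (f t) \<le> B" and "L \<ge> 0"
  shows "norm (trig_sum f h L \<theta>) \<le> (2 * of_int L + 1) * B"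
proof -
  have "norm (trig_sum f h L \<theta>) \<le> (\<Sum>\<nu>\<in>{-L..L}. B)"
    unfolding trig_sum_def by (intro sum_norm_le) (simp add: norm_mult assms)
  also have "\<dots> = (2 * of_int L + 1) * B" using assms(2) by simp
  finally show ?thesis .
qed

text \<open>\<open>k\<close>-fold summation by parts concentrates the sum on \<open>\<bar>\<theta>\<bar> \<lesssim> 1 / n\<close>.\<close>

lemma trig_sum_decay:
  assumes D: "\<And>m t. m < k \<Longrightarrow> (D m has_vector_derivative D (Suc m) t) (at t)"
    and B0: "\<And>t. norm (D 0 t) \<le> B" and Bk: "\<And>t. norm (D k t) \<le> B"
    and supp: "\<And>t. t \<notin> {0..4} \<Longrightarrow> D 0 t = 0" and n: "n \<ge> (1::nat)"
  shows "norm (trig_sum (D 0) (1 / real n) (4 * int n) \<theta>) * (1 + real n * norm (cis \<theta> - 1)) ^ k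
     \<le> 2 ^ k * (2 * (9 + 2 * real k) * B) * real n"
proof -
  define h where "h = 1 / real n"
  have h: "h > 0" unfolding h_def using n by simp
  have B: "B \<ge> 0" by (rule order_trans[OF norm_ge_zero B0[of 0]])
  define S where "S = trig_sum (D 0) h (4 * int n) \<theta>"
  define w where "w = norm (cis \<theta> - 1)"
  have v: "D 0 (of_int \<nu> * h) = 0" if "\<bar>\<nu>\<bar> > 4 * int n" for \<nu>
  proof (rule supp)
    have "real_of_int \<bar>\<nu>\<bar> > real_of_int (4 * int n)" using that by (simp only: of_int_less_iff)
    then have "\<bar>real_of_int \<nu>\<bar> * h > 4" unfolding h_def using n by (simp add: pos_less_divide_eq)
    then have "\<bar>real_of_int \<nu> * h\<bar> > 4" using h by (simp add: abs_mult)
    then show "real_of_int \<nu> * h \<notin> {0..4}" by auto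
  qed
  have S0: "norm S \<le> (9 + 2 * real k) * B * real n"
  proof -
    have "norm S \<le> (2 * of_int (4 * int n) + 1) * B" unfolding S_def by (rule norm_trig_sum_le[OF B0]) simp
    also have "\<dots> \<le> ((9 + 2 * real k) * real n) * B"
    proof (rule mult_right_mono)
      have "0 \<le> real k * (real n * 2)" by simp
      moreover have "(9 + 2 * real k) * real n = 9 * real n + real k * (real n * 2)" by (simp add: algebra_simps)
      moreover have "real n \<ge> 1" using n by simp
      moreover have "2 * of_int (4 * int n) + 1 = 8 * real n + 1" by simp
      ultimately show "2 * of_int (4 * int n) + 1 \<le> (9 + 2 * real k) * real n" by linarith
    qed (rule B)
    finally show ?thesis by (simp add: mult_ac)
  qed
  have Sk: "(real n * w) ^ k * norm S \<le> (9 + 2 * real k) * B * real n"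
  proof -
    have "w ^ k * norm S = norm (trig_sum ((fdiff h ^^ k) (D 0)) h (4 * int n + int k) \<theta>)"
      using trig_sum_fdiff_funpow[of "4 * int n" "D 0" h k \<theta>, OF v] unfolding S_def w_def
      by (simp add: norm_mult norm_power)
    also have "\<dots> \<le> (2 * of_int (4 * int n + int k) + 1) * (h ^ k * B)"
      by (rule norm_trig_sum_le, rule fdiff_bound[OF D Bk]) (use h in auto)
    also have "\<dots> \<le> ((9 + 2 * real k) * real n) * (h ^ k * B)"
    proof (rule mult_right_mono)
      have "1 * real k \<le> real n * real k" using n by (intro mult_right_mono) auto
      then show "2 * of_int (4 * int n + int k) + 1 \<le> (9 + 2 * real k) * real n" using n by (simp add: algebra_simps)
    qed (use h B in auto)
    finally have "real n ^ k * (w ^ k * norm S) \<le> real n ^ k * (((9 + 2 * real k) * real n) * (h ^ k * B))"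
      by (rule mult_left_mono) simp
    moreover have "real n ^ k * h ^ k = 1" unfolding h_def using n by (simp flip: power_mult_distrib)
    moreover have "real n ^ k * (((9 + 2 * real k) * real n) * (h ^ k * B)) = (real n ^ k * h ^ k) * ((9 + 2 * real k) * B * real n)"
      by (simp only: mult_ac)
    ultimately have "real n ^ k * (w ^ k * norm S) \<le> (9 + 2 * real k) * B * real n" by (simp only: mult_1)
    then show ?thesis by (simp only: power_mult_distrib mult.assoc)
  qed
  \<comment> \<open>The maximum merges the two estimates, without and with \<open>k\<close>
    differences, into one bound for \<open>(1 + n w) ^ k\<close>.\<close>
  have "(1 + real n * w) ^ k \<le> (2 * max 1 (real n * w)) ^ k"
    unfolding w_def by (intro power_mono) auto
  also have "\<dots> = 2 ^ k * (max 1 (real n * w)) ^ k" by (rule power_mult_distrib)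
  also have "(max 1 (real n * w)) ^ k \<le> 1 + (real n * w) ^ k"
    unfolding w_def by (cases "real n * norm (cis \<theta> - 1) \<le> 1") (auto simp: max_def)
  finally have "norm S * (1 + real n * w) ^ k \<le> norm S * (2 ^ k * (1 + (real n * w) ^ k))"
    by (auto intro: mult_left_mono)
  also have "\<dots> = 2 ^ k * (norm S + (real n * w) ^ k * norm S)" by (simp add: algebra_simps)
  also have "\<dots> \<le> 2 ^ k * ((9 + 2 * real k) * B * real n + (9 + 2 * real k) * B * real n)"
    by (intro mult_left_mono add_mono S0 Sk) auto
  finally show ?thesis unfolding S_def w_def h_def by (simp add: algebra_simps)
qed

text \<open>The chord has length \<open>2 |sin (\<theta> / 2)|\<close>; Jordan's inequality follows
  from concavity of the sine.\<close>

lemma norm_cis_minus_1_ge: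
  assumes "\<bar>\<theta>\<bar> \<le> pi"
  shows "norm (cis \<theta> - 1) \<ge> \<bar>\<theta>\<bar> / pi"
proof -
  have conc: "concave_on {0..pi} sin"
    by (rule f''_le0_imp_concave[where f' = cos and f'' = "\<lambda>x. - sin x"])
       (auto intro!: derivative_eq_intros sin_ge_zero)
  define x where "x = \<bar>\<theta>\<bar> / 2"
  define t where "t = x / (pi / 2)"
  have x: "0 \<le> x" "x \<le> pi / 2" unfolding x_def using assms by auto
  have t: "0 \<le> t" "t \<le> 1" unfolding t_def using x pi_gt_zero by (auto simp: divide_le_eq)
  have "(1 - t) * sin 0 + t * sin (pi / 2) \<le> sin ((1 - t) *\<^sub>R 0 + t *\<^sub>R (pi / 2))"
    by (rule concave_onD[OF conc t]) auto
  then have s: "t \<le> sin x" unfolding t_def by simp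
  have "(norm (cis \<theta> - 1))\<^sup>2 = (cos \<theta> - 1)\<^sup>2 + (sin \<theta>)\<^sup>2" by (simp add: cmod_power2)
  also have "\<dots> = 2 - 2 * cos \<theta>" using sin_cos_squared_add[of \<theta>] by (simp add: power2_eq_square algebra_simps)
  also have "cos \<theta> = cos (2 * x)" unfolding x_def by simp
  also have "2 - 2 * cos (2 * x) = (2 * sin x)\<^sup>2" unfolding cos_double_sin by (simp add: power2_eq_square)
  finally have "norm (cis \<theta> - 1) = \<bar>2 * sin x\<bar>" by (metis norm_ge_zero power2_abs power2_eq_iff_nonneg abs_ge_zero)
  moreover have "\<bar>\<theta>\<bar> / pi = t" unfolding t_def x_def by simp
  ultimately show ?thesis using s t by simp
qed

section \<open>Spectral multipliers\<close>

definition mult_kernel :: "nat \<Rightarrow> (nat \<Rightarrow> complex) \<Rightarrow> real ^ 'd::finite \<Rightarrow> real ^ 'd \<Rightarrow> complex" where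
  "mult_kernel N m x y = (\<Sum>\<nu>\<le>N. m \<nu> * of_real (hermite_kernel \<nu> x y))"

lemma hermite_kernel_sym: "hermite_kernel \<nu> x y = hermite_kernel \<nu> y x"
  unfolding hermite_kernel_def by (simp add: mult.commute)

lemma mult_kernel_sym: "mult_kernel N m x y = mult_kernel N m y x"
  unfolding mult_kernel_def hermite_kernel_sym[of _ x y] ..

lemma integral_cis_int:
  "(\<integral>\<theta>. indicator {-pi..pi} \<theta> *\<^sub>R cis (of_int k * \<theta>) \<partial>lborel) = (if k = 0 then of_real (2 * pi) else 0)"
  and integrable_cis_int: "integrable lborel (\<lambda>\<theta>. indicator {-pi..pi} \<theta> *\<^sub>R cis (of_int k * \<theta>))"
proof -
  define F where "F \<theta> = (if k = 0 then of_real \<theta> else cis (of_int k * \<theta>) / (\<i> * of_int k))" for \<theta> :: real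
  have F: "(F has_vector_derivative cis (of_int k * \<theta>)) (at \<theta> within {-pi..pi})" for \<theta>
  proof (cases "k = 0")
    case True
    have "(complex_of_real has_vector_derivative 1) (at \<theta> within {-pi..pi})"
      by (rule has_vector_derivative_at_within) (auto intro!: derivative_eq_intros)
    then show ?thesis using True unfolding F_def[abs_def] by simp
  next
    case False
    have "((\<lambda>\<theta>. cis (of_int k * \<theta>)) has_derivative (\<lambda>t. (of_int k * t) *\<^sub>R (\<i> * cis (of_int k * \<theta>)))) (at \<theta> within {-pi..pi})"
      by (auto intro!: derivative_eq_intros)
    then have "((\<lambda>\<theta>. cis (of_int k * \<theta>)) has_vector_derivative of_int k * (\<i> * cis (of_int k * \<theta>))) (at \<theta> within {-pi..pi})"
      unfolding has_vector_derivative_def by (rule has_derivative_eq_rhs) (auto simp: scaleR_conv_of_real)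
    from has_vector_derivative_divide[OF this, of "\<i> * of_int k"] show ?thesis
      using False unfolding F_def[abs_def] by simp
  qed
  have "cis (of_int k * pi) = cis (of_int k * (- pi))"
  proof -
    have "cis (of_int k * pi) = cis (of_int k * (- pi)) * cis (2 * pi * of_int k)"
      by (simp add: cis_mult algebra_simps)
    then show ?thesis by (simp add: cis_multiple_2pi)
  qed
  then have "F pi - F (- pi) = (if k = 0 then of_real (2 * pi) else 0)" unfolding F_def by simp
  then show "(\<integral>\<theta>. indicator {-pi..pi} \<theta> *\<^sub>R cis (of_int k * \<theta>) \<partial>lborel) = (if k = 0 then of_real (2 * pi) else 0)"
    using integral_FTC_Icc[of "-pi" pi F "\<lambda>\<theta>. cis (of_int k * \<theta>)"] F pi_ge_zero
    by (simp add: continuous_intros)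
  show "integrable lborel (\<lambda>\<theta>. indicator {-pi..pi} \<theta> *\<^sub>R cis (of_int k * \<theta>))"
    using has_bochner_integral_FTC_Icc[of "-pi" pi F "\<lambda>\<theta>. cis (of_int k * \<theta>)"] F pi_ge_zero
    by (auto simp: continuous_intros has_bochner_integral_iff)
qed

text \<open>Fourier inversion on the circle of radius \<open>\<rho>\<close>: the factors
  \<open>inverse \<rho> ^ \<mu>\<close> in \<open>G\<close> undo \<open>\<rho> ^ \<nu>\<close>, and
  orthogonality of the characters keeps only the diagonal \<open>\<mu> = \<nu>\<close>.\<close>

lemma mult_kernel_integral:
  fixes x y :: "real ^ 'd::finite" and m :: "nat \<Rightarrow> complex" and N :: nat
  assumes \<rho>: "0 < \<rho>" "\<rho> < 1"
  defines "G \<equiv> \<lambda>\<theta>. \<Sum>\<mu>\<le>N. m \<mu> * of_real (inverse \<rho> ^ \<mu>) * cis (- real \<mu> * \<theta>)"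
  shows "of_real (2 * pi) * mult_kernel N m x y
    = (\<integral>\<theta>. indicator {-pi..pi} \<theta> *\<^sub>R (mehler (of_real \<rho> * cis \<theta>) x y * G \<theta>) \<partial>lborel)"
proof -
  define H where "H \<nu> = complex_of_real (hermite_kernel \<nu> x y)" for \<nu>
  define f where "f \<nu> \<theta> = indicator {-pi..pi} \<theta> *\<^sub>R (H \<nu> * (of_real \<rho> * cis \<theta>) ^ \<nu> * G \<theta>)" for \<nu> \<theta>
  define c where "c \<nu> \<mu> = H \<nu> * of_real (\<rho> ^ \<nu>) * (m \<mu> * of_real (inverse \<rho> ^ \<mu>))" for \<nu> \<mu>
  have f_eq: "f \<nu> \<theta> = (\<Sum>\<mu>\<le>N. c \<nu> \<mu> * (indicator {-pi..pi} \<theta> *\<^sub>R cis (of_int (int \<nu> - int \<mu>) * \<theta>)))" for \<nu> \<theta>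
  proof -
    have "(of_real \<rho> * cis \<theta>) ^ \<nu> * cis (- real \<mu> * \<theta>) = of_real (\<rho> ^ \<nu>) * cis (of_int (int \<nu> - int \<mu>) * \<theta>)" for \<mu>
    proof -
      have "cis \<theta> ^ \<nu> * cis (- real \<mu> * \<theta>) = cis (of_int (int \<nu> - int \<mu>) * \<theta>)"
        unfolding Complex.DeMoivre cis_mult by (rule arg_cong[where f = cis]) (simp add: algebra_simps)
      then show ?thesis unfolding power_mult_distrib by simp
    qed
    then have "H \<nu> * (of_real \<rho> * cis \<theta>) ^ \<nu> * G \<theta> = (\<Sum>\<mu>\<le>N. c \<nu> \<mu> * cis (of_int (int \<nu> - int \<mu>) * \<theta>))"
      unfolding G_def c_def sum_distrib_left by (intro sum.cong refl) (metis (no_types, lifting) mult.assoc mult.left_commute)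
    then show ?thesis unfolding f_def by (simp add: scaleR_sum_right)
  qed
  have fi: "integrable lborel (f \<nu>)" for \<nu>
    unfolding f_eq[abs_def] by (intro Bochner_Integration.integrable_sum integrable_mult_right integrable_cis_int)
  have int: "(\<integral>\<theta>. f \<nu> \<theta> \<partial>lborel) = of_real (2 * pi) * (if \<nu> \<le> N then m \<nu> * H \<nu> else 0)" for \<nu>
  proof -
    have "(\<integral>\<theta>. f \<nu> \<theta> \<partial>lborel) = (\<Sum>\<mu>\<le>N. \<integral>\<theta>. c \<nu> \<mu> * (indicator {-pi..pi} \<theta> *\<^sub>R cis (of_int (int \<nu> - int \<mu>) * \<theta>)) \<partial>lborel)"
      unfolding f_eq by (rule Bochner_Integration.integral_sum) (intro integrable_mult_right integrable_cis_int)
    also have "\<dots> = (\<Sum>\<mu>\<le>N. if \<mu> = \<nu> then c \<nu> \<nu> * of_real (2 * pi) else 0)"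
      unfolding integral_mult_right_zero integral_cis_int by (intro sum.cong) auto
    also have "\<dots> = (if \<nu> \<le> N then c \<nu> \<nu> * of_real (2 * pi) else 0)" by simp
    also have "c \<nu> \<nu> = m \<nu> * H \<nu>"
    proof -
      have "\<rho> ^ \<nu> * inverse \<rho> ^ \<nu> = 1" using \<rho> by (simp flip: power_mult_distrib)
      then have "complex_of_real (\<rho> ^ \<nu>) * of_real (inverse \<rho> ^ \<nu>) = 1" by (metis of_real_1 of_real_mult)
      then show ?thesis unfolding c_def by (metis (no_types, lifting) mult.assoc mult.commute mult.right_neutral)
    qed
    finally show ?thesis by simp
  qed
  obtain A where A: "\<And>\<theta>. norm (G \<theta>) \<le> A"
  proof
    show "norm (G \<theta>) \<le> (\<Sum>\<mu>\<le>N. norm (m \<mu> * of_real (inverse \<rho> ^ \<mu>)))" for \<theta>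
      unfolding G_def by (intro sum_norm_le) (simp add: norm_mult)
  qed
  have A0: "A \<ge> 0" by (rule order_trans[OF norm_ge_zero A[of 0]])
  define b where "b \<nu> = (9 ^ CARD('d) * A) * ((1 + real \<nu>) ^ (3 * CARD('d)) * \<rho> ^ \<nu>)" for \<nu>
  have sb: "summable b" unfolding b_def using \<rho> by (intro summable_mult summable_power_poly) auto
  have fb: "norm (f \<nu> \<theta>) \<le> b \<nu> * indicator {-pi..pi} \<theta>" for \<nu> \<theta>
  proof -
    have "norm (H \<nu> * (of_real \<rho> * cis \<theta>) ^ \<nu> * G \<theta>) = \<bar>hermite_kernel \<nu> x y\<bar> * \<rho> ^ \<nu> * norm (G \<theta>)"
      unfolding H_def using \<rho> by (simp add: norm_mult norm_power)
    also have "\<dots> \<le> (9 ^ CARD('d) * (1 + real \<nu>) ^ (3 * CARD('d))) * \<rho> ^ \<nu> * A"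
      using \<rho> by (intro mult_mono hermite_kernel_bound A) auto
    finally show ?thesis unfolding f_def b_def by (auto simp: mult_ac split: split_indicator)
  qed
  have "(\<lambda>\<nu>. \<integral>\<theta>. f \<nu> \<theta> \<partial>lborel) sums (\<integral>\<theta>. (\<Sum>\<nu>. f \<nu> \<theta>) \<partial>lborel)"
  proof (rule sums_integral[OF fi])
    show "AE \<theta> in lborel. summable (\<lambda>\<nu>. norm (f \<nu> \<theta>))"
      by (intro AE_I2 summable_comparison_test'[OF summable_mult2[OF sb], of 0]) (use fb in auto)
    show "summable (\<lambda>\<nu>. \<integral>\<theta>. norm (f \<nu> \<theta>) \<partial>lborel)"
    proof (rule summable_comparison_test'[OF summable_mult2[OF sb, of "2 * pi"], of 0])
      fix \<nu>
      have "(\<integral>\<theta>. norm (f \<nu> \<theta>) \<partial>lborel) \<le> (\<integral>\<theta>. b \<nu> * indicator {-pi..pi} \<theta> \<partial>lborel)"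
        by (intro integral_mono integrable_norm fi fb) (auto intro!: integrable_real_indicator simp: less_top[symmetric])
      then show "norm (\<integral>\<theta>. norm (f \<nu> \<theta>) \<partial>lborel) \<le> b \<nu> * (2 * pi)" by simp
    qed
  qed
  moreover have "(\<lambda>\<nu>. \<integral>\<theta>. f \<nu> \<theta> \<partial>lborel) sums (of_real (2 * pi) * mult_kernel N m x y)"
  proof -
    have "(\<lambda>\<nu>. if \<nu> \<in> {..N} then m \<nu> * H \<nu> else 0) sums (\<Sum>\<nu>\<le>N. m \<nu> * H \<nu>)" by (rule sums_If_finite_set) simp
    from sums_mult[OF this, of "of_real (2 * pi)"] show ?thesis
      unfolding int mult_kernel_def H_def by simp
  qed
  moreover have "(\<Sum>\<nu>. f \<nu> \<theta>) = indicator {-pi..pi} \<theta> *\<^sub>R (mehler (of_real \<rho> * cis \<theta>) x y * G \<theta>)" for \<theta>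
  proof -
    have "(\<lambda>\<nu>. H \<nu> * (of_real \<rho> * cis \<theta>) ^ \<nu>) sums mehler (of_real \<rho> * cis \<theta>) x y"
      unfolding H_def by (rule mehler_sums) (use \<rho> in \<open>simp add: norm_mult\<close>)
    from sums_scaleR_right[OF sums_mult2[OF this, of "G \<theta>"], of "indicator {-pi..pi} \<theta>"] show ?thesis
      unfolding f_def by (simp add: sums_iff)
  qed
  ultimately show ?thesis using sums_unique2 by simp
qed


text \<open>Comparison with the derivative of \<open>pi * arctan (n \<theta> / pi)\<close>, whose
  total increase stays below \<open>pi ^ 2\<close> for every \<open>n\<close>.\<close>

lemma nn_integral_peak:
  assumes n: "n \<ge> (1::nat)"
  shows "(\<integral>\<^sup>+\<theta>. ennreal (real n / (1 + real n * norm (cis \<theta> - 1)) ^ 2) * indicator {-pi..pi} \<theta> \<partial>lborel) \<le> ennreal (pi ^ 2)"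
proof -
  define F where "F \<theta> = pi * arctan (real n * \<theta> / pi)" for \<theta>
  define f where "f \<theta> = real n / (1 + (real n * \<theta> / pi)\<^sup>2)" for \<theta>
  have dF: "DERIV F \<theta> :> f \<theta>" for \<theta>
  proof -
    have "((\<lambda>\<theta>. real n * \<theta> / pi) has_real_derivative real n / pi) (at \<theta>)"
      by (auto intro!: derivative_eq_intros)
    note d = DERIV_cmult[OF DERIV_chain2[OF DERIV_arctan this], of pi]
    have "pi * (I * (real n / pi)) = real n * I" for I by simp
    then show ?thesis using d unfolding F_def[abs_def] f_def divide_inverse[of "real n" "1 + (real n * \<theta> / pi)\<^sup>2"] by metis
  qed
  have "(\<integral>\<^sup>+\<theta>. ennreal (real n / (1 + real n * norm (cis \<theta> - 1)) ^ 2) * indicator {-pi..pi} \<theta> \<partial>lborel)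
     \<le> (\<integral>\<^sup>+\<theta>. ennreal (f \<theta>) * indicator {-pi..pi} \<theta> \<partial>lborel)"
  proof (rule nn_integral_mono)
    fix \<theta>
    show "ennreal (real n / (1 + real n * norm (cis \<theta> - 1)) ^ 2) * indicator {-pi..pi} \<theta> \<le> ennreal (f \<theta>) * indicator {-pi..pi} \<theta>"
    proof (cases "\<theta> \<in> {-pi..pi}")
      case True
      then have "\<bar>\<theta>\<bar> \<le> pi" by auto
      from norm_cis_minus_1_ge[OF this] have w: "norm (cis \<theta> - 1) \<ge> \<bar>\<theta>\<bar> / pi" .
      have "(real n * \<theta> / pi)\<^sup>2 = (real n * (\<bar>\<theta>\<bar> / pi))\<^sup>2" by (simp add: power_mult_distrib power_divide)
      also have "\<dots> \<le> (real n * norm (cis \<theta> - 1))\<^sup>2" using w by (intro power_mono mult_left_mono) auto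
      finally have le: "(real n * \<theta> / pi)\<^sup>2 \<le> (real n * norm (cis \<theta> - 1))\<^sup>2" .
      have "0 \<le> real n * norm (cis \<theta> - 1)" by simp
      with le have "1 + (real n * \<theta> / pi)\<^sup>2 \<le> (1 + real n * norm (cis \<theta> - 1)) ^ 2"
        unfolding power2_sum one_power2 by linarith
      then have "real n / (1 + real n * norm (cis \<theta> - 1)) ^ 2 \<le> f \<theta>"
        unfolding f_def by (intro divide_left_mono) (auto intro!: mult_pos_pos add_pos_nonneg zero_less_power)
      then show ?thesis by (intro mult_right_mono ennreal_leI) auto
    qed simp
  qed
  also have "\<dots> = ennreal (F pi - F (- pi))"
    by (rule nn_integral_FTC_Icc) (use dF in \<open>auto simp: f_def[abs_def]\<close>)
  also have "\<dots> \<le> ennreal (pi ^ 2)"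
  proof (rule ennreal_leI)
    have "F pi - F (- pi) = pi * (2 * arctan (real n))" unfolding F_def by (simp add: arctan_minus)
    also have "\<dots> \<le> pi * pi" using arctan_ubound[of "real n"] by (intro mult_left_mono) auto
    finally show "F pi - F (- pi) \<le> pi ^ 2" by (simp add: power2_eq_square)
  qed
  finally show ?thesis .
qed

text \<open>With \<open>z = 1 + n |cis \<theta> - 1|\<close>, the row integral of Mehler's kernel is
  at most a multiple of \<open>z ^ d\<close>, and \<open>G \<theta>\<close> at most a multiple of
  \<open>n / z ^ (d + 2)\<close>, where \<open>d = CARD('d)\<close>. What remains after
  multiplication is the peak \<open>n / z\<^sup>2\<close>, whose integral over
  \<open>\<theta>\<close> is bounded independently of \<open>n\<close>.\<close>

lemma mult_kernel_row_bound:
  fixes D :: "nat \<Rightarrow> real \<Rightarrow> complex"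
  assumes D: "\<And>m t. m < CARD('d::finite) + 2 \<Longrightarrow> (D m has_vector_derivative D (Suc m) t) (at t)"
    and B0: "\<And>t. norm (D 0 t) \<le> B" and Bk: "\<And>t. norm (D (CARD('d) + 2) t) \<le> B"
    and supp: "\<And>t. t \<notin> {0..4} \<Longrightarrow> D 0 t = 0"
  shows "\<exists>C>0. \<forall>n\<ge>1. \<forall>x :: real ^ 'd.
    (\<integral>\<^sup>+y. ennreal (norm (mult_kernel (4 * n) (\<lambda>\<nu>. D 0 (real \<nu> / real n) * of_real (exp (- real \<nu> / real n))) x y)) \<partial>lborel) \<le> ennreal C"
proof -
  define k where "k = CARD('d) + 2"
  define A where "A = 2 ^ k * (2 * (9 + 2 * real k) * B)"
  have B: "B \<ge> 0" by (rule order_trans[OF norm_ge_zero B0[of 0]])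
  have A: "A \<ge> 0" unfolding A_def using B by simp
  \<comment> \<open>\<open>6 ^ CARD('d)\<close> comes from the bound \<open>X\<close>,
    \<open>A\<close> from summation by parts, \<open>pi ^ 2\<close> from the peak and
    \<open>2 * pi\<close> from Fourier inversion; the summand 1 ensures positivity when
    \<open>B = 0\<close>.\<close>
  define C where "C = 6 ^ CARD('d) * A * pi ^ 2 / (2 * pi) + 1"
  have "(\<integral>\<^sup>+y. ennreal (norm (mult_kernel (4 * n) (\<lambda>\<nu>. D 0 (real \<nu> / real n) * of_real (exp (- real \<nu> / real n))) x y)) \<partial>lborel) \<le> ennreal C"
    if n: "n \<ge> 1" for n and x :: "real ^ 'd"
  proof -
    define \<rho> where "\<rho> = exp (- 1 / real n)"
    have \<rho>: "0 < \<rho>" "\<rho> < 1" unfolding \<rho>_def using n by auto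
    define M where "M = mult_kernel (4 * n) (\<lambda>\<nu>. D 0 (real \<nu> / real n) * of_real (exp (- real \<nu> / real n))) x"
    define G where "G \<theta> = trig_sum (D 0) (1 / real n) (4 * int n) \<theta>" for \<theta>
    define w where "w \<theta> = norm (cis \<theta> - 1)" for \<theta>
    have Gm [measurable]: "G \<in> borel_measurable borel"
      unfolding G_def trig_sum_def by measurable
    have Gsum: "(\<Sum>\<mu>\<le>4 * n. (D 0 (real \<mu> / real n) * of_real (exp (- real \<mu> / real n))) * of_real (inverse \<rho> ^ \<mu>) * cis (- real \<mu> * \<theta>)) = G \<theta>" for \<theta>
    proof -
      \<comment> \<open>The damping \<open>exp (- \<mu> / n)\<close> in the multiplier is
        \<open>\<rho> ^ \<mu>\<close>, so \<open>G\<close> is a plain trigonometric sum of samples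
        of \<open>D 0\<close>.\<close>
      have e: "complex_of_real (exp (- real \<mu> / real n)) * of_real (inverse \<rho> ^ \<mu>) = 1" for \<mu>
      proof -
        have "exp (- real \<mu> / real n) = \<rho> ^ \<mu>" unfolding \<rho>_def exp_of_nat_mult[symmetric] by simp
        then have "exp (- real \<mu> / real n) * inverse \<rho> ^ \<mu> = 1" using \<rho> by (simp flip: power_mult_distrib)
        then show ?thesis by (metis of_real_1 of_real_mult)
      qed
      have "(\<Sum>\<mu>\<le>4 * n. (D 0 (real \<mu> / real n) * of_real (exp (- real \<mu> / real n))) * of_real (inverse \<rho> ^ \<mu>) * cis (- real \<mu> * \<theta>))
         = (\<Sum>\<mu>\<le>4 * n. D 0 (of_int (int \<mu>) * (1 / real n)) * cis (- of_int (int \<mu>) * \<theta>))"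
      proof (rule sum.cong[OF refl])
        fix \<mu>
        have "(D 0 (real \<mu> / real n) * of_real (exp (- real \<mu> / real n))) * of_real (inverse \<rho> ^ \<mu>)
          = D 0 (real \<mu> / real n) * (of_real (exp (- real \<mu> / real n)) * of_real (inverse \<rho> ^ \<mu>))" by (rule mult.assoc)
        then show "(D 0 (real \<mu> / real n) * of_real (exp (- real \<mu> / real n))) * of_real (inverse \<rho> ^ \<mu>) * cis (- real \<mu> * \<theta>)
          = D 0 (of_int (int \<mu>) * (1 / real n)) * cis (- of_int (int \<mu>) * \<theta>)" unfolding e by simp
      qed
      also have "\<dots> = (\<Sum>\<nu>\<in>int ` {..4 * n}. D 0 (of_int \<nu> * (1 / real n)) * cis (- of_int \<nu> * \<theta>))"
        by (subst sum.reindex) (auto simp: o_def)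
      also have "\<dots> = G \<theta>"
        unfolding G_def trig_sum_def
      proof (rule sum.mono_neutral_left)
        show "int ` {..4 * n} \<subseteq> {- (4 * int n)..4 * int n}" by auto
        show "\<forall>\<nu>\<in>{- (4 * int n)..4 * int n} - int ` {..4 * n}. D 0 (of_int \<nu> * (1 / real n)) * cis (- of_int \<nu> * \<theta>) = 0"
        proof
          fix \<nu> assume \<nu>: "\<nu> \<in> {- (4 * int n)..4 * int n} - int ` {..4 * n}"
          have "\<nu> < 0"
          proof (rule ccontr)
            assume "\<not> \<nu> < 0"
            then have "\<nu> = int (nat \<nu>)" "nat \<nu> \<le> 4 * n" using \<nu> by auto
            then show False using \<nu> by (metis DiffE atMost_iff image_eqI)
          qed
          then have "real_of_int \<nu> * (1 / real n) < 0" using n by (simp add: divide_neg_pos)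
          then show "D 0 (of_int \<nu> * (1 / real n)) * cis (- of_int \<nu> * \<theta>) = 0" by (subst supp) auto
        qed
      qed simp
      finally show ?thesis .
    qed
    have Gb: "norm (G \<theta>) * (1 + real n * w \<theta>) ^ k \<le> A * real n" for \<theta>
      unfolding G_def w_def A_def
      by (rule trig_sum_decay) (use D B0 Bk supp n in \<open>auto simp: k_def\<close>)
    have w0: "w \<theta> \<ge> 0" for \<theta> unfolding w_def by simp
    \<comment> \<open>Numerator:
      \<open>|1 - r| \<le> (1 - \<rho>) + \<rho> w \<le> 1 / n + w\<close>. Denominator:
      \<open>1 - \<rho>\<^sup>2 \<ge> 2 / (n + 2) \<ge> 2 / (3 n)\<close>. The quotient produces the
      constant 6.\<close>
    have X: "4 * norm (1 - of_real \<rho> * cis \<theta>) / (1 - (norm (of_real \<rho> * cis \<theta>))\<^sup>2) \<le> 6 * (1 + real n * w \<theta>)" for \<theta>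
    proof -
      have nr: "norm (of_real \<rho> * cis \<theta>) = \<rho>" using \<rho> by (simp add: norm_mult)
      have "1 - of_real \<rho> * cis \<theta> = of_real (1 - \<rho>) - of_real \<rho> * (cis \<theta> - 1)" by (simp add: algebra_simps)
      then have "norm (1 - of_real \<rho> * cis \<theta>) \<le> norm (complex_of_real (1 - \<rho>)) + norm (of_real \<rho> * (cis \<theta> - 1))"
        by (simp only: norm_triangle_ineq4)
      also have "\<dots> = (1 - \<rho>) + \<rho> * w \<theta>" unfolding w_def norm_mult norm_of_real using \<rho> by simp
      also have "1 - \<rho> \<le> 1 / real n" unfolding \<rho>_def using exp_ge_add_one_self[of "- 1 / real n"] by simp
      also have "\<rho> * w \<theta> \<le> 1 * w \<theta>" using \<rho> w0 by (intro mult_right_mono) auto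
      finally have top: "4 * norm (1 - of_real \<rho> * cis \<theta>) \<le> 4 * (1 / real n + w \<theta>)" by simp
      have bot: "1 - \<rho>\<^sup>2 \<ge> 2 / (3 * real n)"
      proof -
        have "\<rho>\<^sup>2 * (1 + 2 / real n) \<le> \<rho>\<^sup>2 * exp (2 / real n)" by (intro mult_left_mono exp_ge_add_one_self) auto
        also have "\<dots> = 1" unfolding \<rho>_def power2_eq_square exp_add[symmetric] by simp
        finally have "\<rho>\<^sup>2 \<le> 1 / (1 + 2 / real n)" using n by (simp add: pos_le_divide_eq add_pos_nonneg)
        also have "\<dots> = real n / (real n + 2)" using n by (simp add: field_simps)
        finally have "1 - \<rho>\<^sup>2 \<ge> 1 - real n / (real n + 2)" by simp
        also have "1 - real n / (real n + 2) = 2 / (real n + 2)" by (simp add: field_simps)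
        finally have "2 / (real n + 2) \<le> 1 - \<rho>\<^sup>2" .
        moreover have "2 / (3 * real n) \<le> 2 / (real n + 2)" using n by (intro divide_left_mono) auto
        ultimately show ?thesis by linarith
      qed
      have "4 * norm (1 - of_real \<rho> * cis \<theta>) / (1 - \<rho>\<^sup>2) \<le> 4 * (1 / real n + w \<theta>) / (2 / (3 * real n))"
        by (rule frac_le) (use top bot n w0[of \<theta>] in auto)
      also have "\<dots> = 6 * (1 + real n * w \<theta>)" using n by (simp add: field_simps)
      finally show ?thesis unfolding nr .
    qed
    have row: "(\<integral>\<^sup>+y. ennreal (norm (mehler (of_real \<rho> * cis \<theta>) x y)) \<partial>lborel) \<le> ennreal ((6 * (1 + real n * w \<theta>)) ^ CARD('d))" for \<theta>
      by (rule nn_integral_mehler_le[OF _ X]) (use \<rho> w0[of \<theta>] in \<open>auto simp: norm_mult algebra_simps intro!: add_increasing2 mult_nonneg_nonneg\<close>)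
    have meas [measurable]: "(\<lambda>(y, \<theta>). norm (mehler (of_real \<rho> * cis \<theta>) x y)) \<in> borel_measurable (lborel \<Otimes>\<^sub>M lborel)"
    proof -
      have "(\<lambda>z. norm (mehler1 (of_real \<rho> * cis (snd z)) (x $ i) (fst z $ i))) \<in> borel_measurable (lborel \<Otimes>\<^sub>M lborel)" for i
        by (rule mehler1_norm_measurable) (use \<rho> in auto)
      then show ?thesis unfolding mehler_def prod_norm[symmetric] case_prod_unfold by (intro borel_measurable_prod)
    qed
    \<comment> \<open>For a non-integrable \<open>u\<close> the left side is 0 by convention, so the
      bound holds for every \<open>u\<close>.\<close>
    have norm_bound: "ennreal (norm (\<integral>\<theta>. u \<theta> \<partial>lborel)) \<le> (\<integral>\<^sup>+\<theta>. ennreal (norm (u \<theta>)) \<partial>lborel)" for u :: "real \<Rightarrow> complex"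
      by (cases "integrable lborel u") (simp_all add: integral_norm_bound_ennreal not_integrable_integral_eq)
    have pt: "ennreal (2 * pi) * ennreal (norm (M y))
       \<le> (\<integral>\<^sup>+\<theta>. ennreal (norm (mehler (of_real \<rho> * cis \<theta>) x y)) * (ennreal (norm (G \<theta>)) * indicator {-pi..pi} \<theta>) \<partial>lborel)" for y
    proof -
      have "of_real (2 * pi) * M y = (\<integral>\<theta>. indicator {-pi..pi} \<theta> *\<^sub>R (mehler (of_real \<rho> * cis \<theta>) x y * G \<theta>) \<partial>lborel)"
        unfolding M_def mult_kernel_integral[OF \<rho>] Gsum ..
      then have "ennreal (norm (complex_of_real (2 * pi) * M y)) \<le> (\<integral>\<^sup>+\<theta>. ennreal (norm (indicator {-pi..pi} \<theta> *\<^sub>R (mehler (of_real \<rho> * cis \<theta>) x y * G \<theta>))) \<partial>lborel)"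
        using norm_bound[of "\<lambda>\<theta>. indicator {-pi..pi} \<theta> *\<^sub>R (mehler (of_real \<rho> * cis \<theta>) x y * G \<theta>)"] by simp
      also have "\<dots> = (\<integral>\<^sup>+\<theta>. ennreal (norm (mehler (of_real \<rho> * cis \<theta>) x y)) * (ennreal (norm (G \<theta>)) * indicator {-pi..pi} \<theta>) \<partial>lborel)"
        by (intro nn_integral_cong) (auto simp: norm_mult ennreal_mult split: split_indicator)
      finally show ?thesis by (simp add: norm_mult ennreal_mult)
    qed
    have "ennreal (2 * pi) * (\<integral>\<^sup>+y. ennreal (norm (M y)) \<partial>lborel) = (\<integral>\<^sup>+y. ennreal (2 * pi) * ennreal (norm (M y)) \<partial>lborel)"
      unfolding M_def mult_kernel_def hermite_kernel_def by (subst nn_integral_cmult) auto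
    also have "\<dots> \<le> (\<integral>\<^sup>+y. \<integral>\<^sup>+\<theta>. ennreal (norm (mehler (of_real \<rho> * cis \<theta>) x y)) * (ennreal (norm (G \<theta>)) * indicator {-pi..pi} \<theta>) \<partial>lborel \<partial>lborel)"
      by (intro nn_integral_mono pt)
    also have "\<dots> = (\<integral>\<^sup>+\<theta>. \<integral>\<^sup>+y. ennreal (norm (mehler (of_real \<rho> * cis \<theta>) x y)) * (ennreal (norm (G \<theta>)) * indicator {-pi..pi} \<theta>) \<partial>lborel \<partial>lborel)"
      by (rule lborel_pair.Fubini') measurable
    also have "\<dots> = (\<integral>\<^sup>+\<theta>. (\<integral>\<^sup>+y. ennreal (norm (mehler (of_real \<rho> * cis \<theta>) x y)) \<partial>lborel) * (ennreal (norm (G \<theta>)) * indicator {-pi..pi} \<theta>) \<partial>lborel)"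
      by (intro nn_integral_cong nn_integral_multc) measurable
    also have "\<dots> \<le> (\<integral>\<^sup>+\<theta>. ennreal (6 ^ CARD('d) * A) * (ennreal (real n / (1 + real n * norm (cis \<theta> - 1)) ^ 2) * indicator {-pi..pi} \<theta>) \<partial>lborel)"
    proof (rule nn_integral_mono)
      fix \<theta>
      define z where "z = 1 + real n * w \<theta>"
      have z: "z > 0" unfolding z_def using w0[of \<theta>] by (intro add_pos_nonneg) auto
      have "(6 * z) ^ CARD('d) * norm (G \<theta>) \<le> (6 * z) ^ CARD('d) * (A * real n / z ^ k)"
        using Gb[of \<theta>] z unfolding z_def[symmetric] by (intro mult_left_mono) (simp_all add: pos_le_divide_eq)
      also have "\<dots> = (6 ^ CARD('d) * A) * (real n / z ^ 2)"
        unfolding k_def power_add power_mult_distrib using z by simp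
      finally have le: "(6 * z) ^ CARD('d) * norm (G \<theta>) \<le> (6 ^ CARD('d) * A) * (real n / z ^ 2)" .
      have "(\<integral>\<^sup>+y. ennreal (norm (mehler (of_real \<rho> * cis \<theta>) x y)) \<partial>lborel) * ennreal (norm (G \<theta>))
          \<le> ennreal ((6 * z) ^ CARD('d)) * ennreal (norm (G \<theta>))"
        unfolding z_def by (intro mult_right_mono row) auto
      also have "\<dots> = ennreal ((6 * z) ^ CARD('d) * norm (G \<theta>))" using z by (intro ennreal_mult[symmetric]) auto
      also have "\<dots> \<le> ennreal ((6 ^ CARD('d) * A) * (real n / z ^ 2))" by (rule ennreal_leI[OF le])
      also have "\<dots> = ennreal (6 ^ CARD('d) * A) * ennreal (real n / z ^ 2)" using A by (intro ennreal_mult) auto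
      finally show "(\<integral>\<^sup>+y. ennreal (norm (mehler (of_real \<rho> * cis \<theta>) x y)) \<partial>lborel) * (ennreal (norm (G \<theta>)) * indicator {-pi..pi} \<theta>)
        \<le> ennreal (6 ^ CARD('d) * A) * (ennreal (real n / (1 + real n * norm (cis \<theta> - 1)) ^ 2) * indicator {-pi..pi} \<theta>)"
        unfolding z_def w_def mult.assoc[symmetric] by (rule mult_right_mono) simp
    qed
    also have "\<dots> = ennreal (6 ^ CARD('d) * A) * (\<integral>\<^sup>+\<theta>. ennreal (real n / (1 + real n * norm (cis \<theta> - 1)) ^ 2) * indicator {-pi..pi} \<theta> \<partial>lborel)"
      by (rule nn_integral_cmult) measurable
    also have "\<dots> \<le> ennreal (6 ^ CARD('d) * A) * ennreal (pi ^ 2)"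
      by (intro mult_left_mono nn_integral_peak n) auto
    finally have "ennreal (2 * pi) * (\<integral>\<^sup>+y. ennreal (norm (M y)) \<partial>lborel) \<le> ennreal (6 ^ CARD('d) * A * pi ^ 2)"
      using A by (simp add: ennreal_mult)
    then have "ennreal (1 / (2 * pi)) * (ennreal (2 * pi) * (\<integral>\<^sup>+y. ennreal (norm (M y)) \<partial>lborel)) \<le> ennreal (1 / (2 * pi)) * ennreal (6 ^ CARD('d) * A * pi ^ 2)"
      by (rule mult_left_mono) simp
    also have "ennreal (1 / (2 * pi)) * ennreal (6 ^ CARD('d) * A * pi ^ 2) \<le> ennreal C"
      unfolding C_def using A by (subst ennreal_mult[symmetric]) (auto intro!: ennreal_leI)
    also have "ennreal (1 / (2 * pi)) * (ennreal (2 * pi) * (\<integral>\<^sup>+y. ennreal (norm (M y)) \<partial>lborel)) = (\<integral>\<^sup>+y. ennreal (norm (M y)) \<partial>lborel)"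
      unfolding mult.assoc[symmetric] by (subst ennreal_mult[symmetric]) auto
    finally show ?thesis unfolding M_def .
  qed
  moreover have "C > 0" unfolding C_def using A by (intro add_nonneg_pos) auto
  ultimately show ?thesis by blast
qed

lemma hsum_eq_kernel_integral:
  assumes F: "F \<in> lp_space p" and p: "1 \<le> p"
  shows "hsum N (\<lambda>\<beta>. m (multi_deg \<beta>) * hcoeff F \<beta>) x = (\<integral>y. F y * mult_kernel N m x y \<partial>lborel)"
    and "integrable lborel (\<lambda>y. F y * mult_kernel N m x y)"
proof -
  have k: "F y * mult_kernel N m x y = (\<Sum>\<beta> | multi_deg \<beta> \<le> N. (m (multi_deg \<beta>) * Hc \<beta> x) * (F y * Hc \<beta> y))" for y
    unfolding mult_kernel_def hermite_kernel_def sum_multi_deg_le sum_distrib_left of_real_sum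
    by (intro sum.cong refl) (simp add: mult_ac)
  have i: "integrable lborel (\<lambda>y. c * (F y * Hc \<beta> y))" for c \<beta>
    by (intro integrable_mult_right lp_times_schwartz_integrable[OF F p Hc_schwartz])
  show "integrable lborel (\<lambda>y. F y * mult_kernel N m x y)"
    unfolding k by (intro Bochner_Integration.integrable_sum i)
  have "(\<integral>y. F y * mult_kernel N m x y \<partial>lborel) = (\<Sum>\<beta> | multi_deg \<beta> \<le> N. (m (multi_deg \<beta>) * Hc \<beta> x) * hcoeff F \<beta>)"
    unfolding k hcoeff_def by (subst Bochner_Integration.integral_sum) (rule i, simp only: integral_mult_right_zero)
  then show "hsum N (\<lambda>\<beta>. m (multi_deg \<beta>) * hcoeff F \<beta>) x = (\<integral>y. F y * mult_kernel N m x y \<partial>lborel)"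
    unfolding hsum_def by (simp add: mult_ac)
qed

lemma hsum_measurable [measurable]: "hsum N c \<in> borel_measurable borel"
  by (rule schwartz_measurable[OF hsum_schwartz])

text \<open>The kernel is symmetric, so the row bound is also the column bound that Schur's test
  asks for.\<close>

lemma lp_norm_multiplier_le:
  fixes F :: "real ^ 'd::finite \<Rightarrow> complex"
  assumes F: "F \<in> lp_space p" and p: "1 \<le> p" and C: "C > 0"
    and row: "\<And>x :: real ^ 'd. (\<integral>\<^sup>+y. ennreal (norm (mult_kernel N m x y)) \<partial>lborel) \<le> ennreal C"
  shows "lp_norm p (hsum N (\<lambda>\<beta>. m (multi_deg \<beta>) * hcoeff F \<beta>)) \<le> ennreal C * lp_norm p F"
proof -
  note [measurable] = lp_space_measurable[OF F]
  have km [measurable]: "(\<lambda>(x, y). ennreal (norm (mult_kernel N m x y))) \<in> borel_measurable (lborel \<Otimes>\<^sub>M lborel)"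
    unfolding mult_kernel_def hermite_kernel_def by measurable
  have "lp_norm p (hsum N (\<lambda>\<beta>. m (multi_deg \<beta>) * hcoeff F \<beta>))
     \<le> lpn p (\<lambda>x. \<integral>\<^sup>+y. ennreal (norm (mult_kernel N m x y)) * ennreal (norm (F y)) \<partial>lborel)"
    unfolding lp_norm_eq_lpn
  proof (rule lpn_mono_AE[OF _ _ p], simp, measurable, rule AE_I2)
    fix x
    have "ennreal (norm (hsum N (\<lambda>\<beta>. m (multi_deg \<beta>) * hcoeff F \<beta>) x)) \<le> (\<integral>\<^sup>+y. ennreal (norm (F y * mult_kernel N m x y)) \<partial>lborel)"
      unfolding hsum_eq_kernel_integral(1)[OF F p]
      by (rule integral_norm_bound_ennreal[OF hsum_eq_kernel_integral(2)[OF F p]])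
    also have "\<dots> = (\<integral>\<^sup>+y. ennreal (norm (mult_kernel N m x y)) * ennreal (norm (F y)) \<partial>lborel)"
      by (intro nn_integral_cong) (simp add: norm_mult ennreal_mult mult.commute)
    finally show "ennreal (norm (hsum N (\<lambda>\<beta>. m (multi_deg \<beta>) * hcoeff F \<beta>) x))
       \<le> (\<integral>\<^sup>+y. ennreal (norm (mult_kernel N m x y)) * ennreal (norm (F y)) \<partial>lborel)" .
  qed
  also have "\<dots> \<le> ennreal C * lpn p (\<lambda>y. ennreal (norm (F y)))"
  proof (rule lpn_schur[OF km _ C row _ p])
    show "(\<integral>\<^sup>+x. ennreal (norm (mult_kernel N m x y)) \<partial>lborel) \<le> ennreal C" for y :: "real ^ 'd"
      using row[of y] by (subst mult_kernel_sym)
  qed measurable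
  finally show ?thesis unfolding lp_norm_eq_lpn .
qed

section \<open>Smooth symbols\<close>

text \<open>The existential form is closed under algebraic operations by induction on
  \<open>k\<close>, including the reciprocal that the dual symbol requires; \<open>Ck_chain\<close>
  recovers an explicit chain of derivatives.\<close>

primrec Ck :: "nat \<Rightarrow> real set \<Rightarrow> (real \<Rightarrow> complex) \<Rightarrow> bool" where
  "Ck 0 U f \<longleftrightarrow> continuous_on U f"
| "Ck (Suc k) U f \<longleftrightarrow> (\<exists>f'. (\<forall>t\<in>U. (f has_vector_derivative f' t) (at t)) \<and> Ck k U f')"

lemma Ck_SucI:
  "\<forall>t\<in>U. (f has_vector_derivative f' t) (at t) \<Longrightarrow> Ck k U f' \<Longrightarrow> Ck (Suc k) U f"
  by auto

lemma Ck_Suc_imp: "Ck (Suc k) U f \<Longrightarrow> Ck k U f"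
proof (induction k arbitrary: f)
  case 0
  then have "\<And>t. t \<in> U \<Longrightarrow> isCont f t"
    by (auto intro: has_vector_derivative_continuous)
  then show ?case by (simp add: continuous_at_imp_continuous_on)
next
  case (Suc k)
  then show ?case by (metis Ck.simps(2))
qed

lemma Ck_imp_continuous: "Ck k U f \<Longrightarrow> continuous_on U f"
proof (induction k)
  case (Suc k)
  show ?case by (rule Suc.IH[OF Ck_Suc_imp[OF Suc.prems]])
qed simp

lemma Ck_add: "Ck k U f \<Longrightarrow> Ck k U g \<Longrightarrow> Ck k U (\<lambda>t. f t + g t)"
proof (induction k arbitrary: f g)
  case (Suc k)
  obtain f' g' where f': "\<forall>t\<in>U. (f has_vector_derivative f' t) (at t)" "Ck k U f'"
    and g': "\<forall>t\<in>U. (g has_vector_derivative g' t) (at t)" "Ck k U g'"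
    using Suc.prems unfolding Ck.simps by blast
  have "\<forall>t\<in>U. ((\<lambda>t. f t + g t) has_vector_derivative f' t + g' t) (at t)"
    using f'(1) g'(1) by (intro ballI has_vector_derivative_add) simp_all
  then show ?case using Suc.IH[OF f'(2) g'(2)] by (rule Ck_SucI)
qed (auto intro: continuous_intros)

lemma Ck_mult: "Ck k U f \<Longrightarrow> Ck k U g \<Longrightarrow> Ck k U (\<lambda>t. f t * g t)"
proof (induction k arbitrary: f g)
  case (Suc k)
  obtain f' g' where f': "\<forall>t\<in>U. (f has_vector_derivative f' t) (at t)" "Ck k U f'"
    and g': "\<forall>t\<in>U. (g has_vector_derivative g' t) (at t)" "Ck k U g'"
    using Suc.prems unfolding Ck.simps by blast
  have "\<forall>t\<in>U. ((\<lambda>t. f t * g t) has_vector_derivative f t * g' t + f' t * g t) (at t)"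
    using f'(1) g'(1) by (intro ballI has_vector_derivative_mult) simp_all
  moreover have "Ck k U (\<lambda>t. f t * g' t + f' t * g t)"
    by (rule Ck_add[OF Suc.IH[OF Ck_Suc_imp[OF Suc.prems(1)] g'(2)] Suc.IH[OF f'(2) Ck_Suc_imp[OF Suc.prems(2)]]])
  ultimately show ?case by (rule Ck_SucI)
qed (auto intro: continuous_intros)

lemma Ck_cnj: "Ck k U f \<Longrightarrow> Ck k U (\<lambda>t. cnj (f t))"
proof (induction k arbitrary: f)
  case (Suc k)
  obtain f' where f': "\<forall>t\<in>U. (f has_vector_derivative f' t) (at t)" "Ck k U f'"
    using Suc.prems unfolding Ck.simps by blast
  have "\<forall>t\<in>U. ((\<lambda>t. cnj (f t)) has_vector_derivative cnj (f' t)) (at t)"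
    using f'(1) by (intro ballI bounded_linear.has_vector_derivative[OF bounded_linear_cnj]) simp_all
  then show ?case using Suc.IH[OF f'(2)] by (rule Ck_SucI)
qed (auto intro: continuous_intros)

lemma Ck_const: "Ck k U (\<lambda>t. c)"
proof (induction k arbitrary: c)
  case (Suc k)
  have "\<forall>t\<in>U. ((\<lambda>t. c) has_vector_derivative 0) (at t)" by simp
  then show ?case using Suc.IH[of 0] by (rule Ck_SucI)
qed simp

lemma Ck_inverse: "Ck k U f \<Longrightarrow> (\<And>t. t \<in> U \<Longrightarrow> f t \<noteq> 0) \<Longrightarrow> Ck k U (\<lambda>t. inverse (f t))"
proof (induction k arbitrary: f)
  case (Suc k)
  obtain f' where f': "\<forall>t\<in>U. (f has_vector_derivative f' t) (at t)" "Ck k U f'"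
    using Suc.prems unfolding Ck.simps by blast
  have "\<forall>t\<in>U. ((\<lambda>t. inverse (f t)) has_vector_derivative (- 1 * f' t) * (inverse (f t) * inverse (f t))) (at t)"
  proof
    fix t assume t: "t \<in> U"
    have "(inverse has_field_derivative - (inverse (f t) * inverse (f t))) (at (f t))"
      using DERIV_inverse[OF Suc.prems(2)[OF t]] by (simp add: power2_eq_square eval_nat_numeral)
    from field_vector_diff_chain_at[OF bspec[OF f'(1) t] this]
    show "((\<lambda>t. inverse (f t)) has_vector_derivative (- 1 * f' t) * (inverse (f t) * inverse (f t))) (at t)"
      by (simp add: o_def mult_ac)
  qed
  moreover have "Ck k U (\<lambda>t. (- 1 * f' t) * (inverse (f t) * inverse (f t)))"
  proof -
    have i: "Ck k U (\<lambda>t. inverse (f t))"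
      by (rule Suc.IH[OF Ck_Suc_imp[OF Suc.prems(1)] Suc.prems(2)])
    show ?thesis
      by (rule Ck_mult[OF Ck_mult[OF Ck_const f'(2)] Ck_mult[OF i i]])
  qed
  ultimately show ?case by (rule Ck_SucI)
qed (auto intro: continuous_intros)

lemma Ck_scale: "Ck k UNIV f \<Longrightarrow> Ck k UNIV (\<lambda>t. f (c * t))"
proof (induction k arbitrary: f)
  case (Suc k)
  obtain f' where f': "\<forall>t\<in>UNIV. (f has_vector_derivative f' t) (at t)" "Ck k UNIV f'"
    using Suc.prems unfolding Ck.simps by blast
  have "\<forall>t\<in>UNIV. ((\<lambda>t. f (c * t)) has_vector_derivative of_real c * f' (c * t)) (at t)"
  proof
    fix t
    have "((\<lambda>t. c * t) has_vector_derivative c) (at t)"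
      by (auto intro!: derivative_eq_intros)
    from vector_diff_chain_at[OF this, of f "f' (c * t)"] f'
    show "((\<lambda>t. f (c * t)) has_vector_derivative of_real c * f' (c * t)) (at t)"
      by (simp add: o_def scaleR_conv_of_real)
  qed
  moreover have "Ck k UNIV (\<lambda>t. of_real c * f' (c * t))" by (rule Ck_mult[OF Ck_const Suc.IH[OF f'(2)]])
  ultimately show ?case by (rule Ck_SucI)
next
  case 0
  then have "continuous_on UNIV f" by simp
  then have "continuous_on UNIV (\<lambda>t. f (c * t))"
    by (rule continuous_on_compose2) (auto intro: continuous_intros)
  then show ?case by simp
qed

lemma Ck_subset: "Ck k U f \<Longrightarrow> V \<subseteq> U \<Longrightarrow> Ck k V f"
proof (induction k arbitrary: f)
  case (Suc k)
  then show ?case unfolding Ck.simps by blast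
qed (auto intro: continuous_on_subset)

lemma Ck_of_chain:
  assumes "\<And>n t. t \<in> U \<Longrightarrow> (D n has_vector_derivative D (Suc n) t) (at t)"
  shows "Ck k U (D n)"
proof (induction k arbitrary: n)
  case 0
  have "\<And>t. t \<in> U \<Longrightarrow> isCont (D n) t" using assms by (auto intro: has_vector_derivative_continuous)
  then show ?case by (simp add: continuous_at_imp_continuous_on)
next
  case (Suc k)
  have "\<forall>t\<in>U. (D n has_vector_derivative D (Suc n) t) (at t)" using assms by blast
  then show ?case using Suc.IH[of "Suc n"] by (rule Ck_SucI)
qed

lemma Ck_exp: "Ck k U (\<lambda>t. of_real (exp t))"
proof (rule Ck_of_chain[of U "\<lambda>_ t. of_real (exp t)"])
  fix t :: real
  have "(exp has_vector_derivative exp t) (at t)"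
    using DERIV_exp[of t] by (simp add: has_real_derivative_iff_has_vector_derivative)
  from bounded_linear.has_vector_derivative[OF bounded_linear_complex_of_real this]
  show "((\<lambda>t. complex_of_real (exp t)) has_vector_derivative of_real (exp t)) (at t)" .
qed

lemma Ck_chain:
  "Ck k U f \<Longrightarrow> \<exists>D. D 0 = f \<and> (\<forall>m<k. \<forall>t\<in>U. (D m has_vector_derivative D (Suc m) t) (at t)) \<and> continuous_on U (D k)"
proof (induction k arbitrary: f)
  case 0
  then show ?case by (intro exI[of _ "\<lambda>_. f"]) auto
next
  case (Suc k)
  obtain f' where f': "\<forall>t\<in>U. (f has_vector_derivative f' t) (at t)" "Ck k U f'"
    using Suc.prems unfolding Ck.simps by blast
  obtain D where D: "D 0 = f'" "\<forall>m<k. \<forall>t\<in>U. (D m has_vector_derivative D (Suc m) t) (at t)" "continuous_on U (D k)"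
    using Suc.IH[OF f'(2)] by blast
  define E where "E m = (case m of 0 \<Rightarrow> f | Suc m \<Rightarrow> D m)" for m
  have "(E m has_vector_derivative E (Suc m) t) (at t)" if "m < Suc k" "t \<in> U" for m t
    using that f'(1) D unfolding E_def by (cases m) auto
  then show ?case using D(3) by (intro exI[of _ E]) (auto simp: E_def)
qed

text \<open>All derivatives vanish on \<open>U\<close> outside the compact interval, so the chain
  extends by zero to the whole line and compactness bounds it. Smoothness is assumed on a
  neighbourhood \<open>U\<close> because the denominator of the dual symbol is controlled only near
  the interval.\<close>

lemma Ck_extend:
  assumes Ck: "Ck k U g" and U: "open U" "{1/4..4} \<subseteq> U" and g0: "\<And>t. t \<notin> {1/4..4} \<Longrightarrow> g t = 0"
  shows "\<exists>D B. D 0 = g \<and> (\<forall>m<k. \<forall>t. (D m has_vector_derivative D (Suc m) t) (at t)) \<and>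
    (\<forall>t. norm (D 0 t) \<le> B) \<and> (\<forall>t. norm (D k t) \<le> B)"
proof -
  obtain D where D: "D 0 = g" "\<forall>m<k. \<forall>t\<in>U. (D m has_vector_derivative D (Suc m) t) (at t)" "continuous_on U (D k)"
    using Ck_chain[OF Ck] by blast
  have opc: "open (U - {1/4..4})" using U by (intro open_Diff) auto
  have z: "D m t = 0" if "m \<le> k" "t \<in> U - {1/4..4}" for m t
    using that
  proof (induction m arbitrary: t)
    case 0
    then show ?case using D(1) g0 by auto
  next
    case (Suc m)
    have "(D m has_vector_derivative D (Suc m) t) (at t)" using D(2) Suc.prems by simp
    moreover have "(D m has_vector_derivative 0) (at t)"
    proof (rule has_vector_derivative_transform_within_open[OF _ opc])
      show "((\<lambda>_. 0) has_vector_derivative 0) (at t)" by simp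
      show "t \<in> U - {1/4..4}" by (rule Suc.prems)
      show "0 = D m s" if "s \<in> U - {1/4..4}" for s using Suc.IH[OF _ that] Suc.prems by simp
    qed
    ultimately show ?case by (rule vector_derivative_unique_at)
  qed
  define E where "E m t = (if t \<in> U then D m t else 0)" for m t
  have Ez: "E m t = 0" if "m \<le> k" "t \<notin> {1/4..4}" for m t using z[of m t] that unfolding E_def by auto
  have E0: "E 0 = g"
  proof
    fix t
    have "t \<notin> U \<Longrightarrow> t \<notin> {1/4..4}" using U(2) by blast
    then show "E 0 t = g t" unfolding E_def using D(1) g0[of t] by simp
  qed
  have dE: "(E m has_vector_derivative E (Suc m) t) (at t)" if m: "m < k" for m t
  proof (cases "t \<in> U")
    case True
    then have "(D m has_vector_derivative D (Suc m) t) (at t)" using D(2) m by blast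
    then have "(E m has_vector_derivative D (Suc m) t) (at t)"
      by (rule has_vector_derivative_transform_within_open[OF _ U(1) True]) (simp add: E_def)
    then show ?thesis using True by (simp add: E_def)
  next
    case False
    then have t: "t \<in> - {1/4..4}" using U by auto
    have "(E m has_vector_derivative 0) (at t)"
    proof (rule has_vector_derivative_transform_within_open[OF _ _ t])
      show "((\<lambda>_. 0) has_vector_derivative 0) (at t)" by simp
      show "open (- {1/4..4::real})" by auto
      show "0 = E m s" if "s \<in> - {1/4..4}" for s using Ez[of m s] m that by simp
    qed
    then show ?thesis using False by (simp add: E_def)
  qed
  have bd: "\<exists>B. \<forall>t. norm (h t) \<le> B" if "continuous_on {1/4..4} h" "\<And>t. t \<notin> {1/4..4} \<Longrightarrow> h t = 0" for h :: "real \<Rightarrow> complex"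
  proof -
    have "bounded (h ` {1/4..4})" by (intro compact_imp_bounded compact_continuous_image that) auto
    then obtain B where B: "\<forall>t\<in>{1/4..4}. norm (h t) \<le> B" unfolding bounded_iff by auto
    have "norm (h t) \<le> max B 0" for t using B that(2)[of t] by (cases "t \<in> {1/4..4}") (auto simp: le_max_iff_disj)
    then show ?thesis by blast
  qed
  have "continuous_on {1/4..4} (E k)"
    by (rule continuous_on_eq[OF continuous_on_subset[OF D(3) U(2)]]) (use U in \<open>auto simp: E_def\<close>)
  then obtain B1 where B1: "\<And>t. norm (E k t) \<le> B1" using bd[of "E k"] Ez[of k] by blast
  have "continuous_on {1/4..4} g" by (rule continuous_on_subset[OF Ck_imp_continuous[OF Ck] U(2)])
  then obtain B2 where B2: "\<And>t. norm (g t) \<le> B2" using bd[of g] g0 by blast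
  show ?thesis
    by (intro exI[of _ E] exI[of _ "max B1 B2"]) (use E0 dE B1 B2 in \<open>auto simp: le_max_iff_disj\<close>)
qed

text \<open>The cut-off vanishes on \<open>[0, 1/4)\<close>, so extension by zero is smooth and
  two-sided derivatives replace the one-sided ones at 0.\<close>

definition ext0 :: "(real \<Rightarrow> complex) \<Rightarrow> real \<Rightarrow> complex" where
  "ext0 a t = (if 0 \<le> t then a t else 0)"

lemma ext0_support:
  assumes "admissible_cutoff a" "t \<notin> {1/4..4}"
  shows "ext0 a t = 0"
proof -
  have "closure {t. 0 \<le> t \<and> a t \<noteq> 0} \<subseteq> {1/4..4}"
    using assms(1) unfolding admissible_cutoff_def by (elim conjE)
  then have "{t. 0 \<le> t \<and> a t \<noteq> 0} \<subseteq> {1/4..4}" by (rule subset_trans[OF closure_subset])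
  then show ?thesis using assms(2) unfolding ext0_def by auto
qed

lemma ext0_Ck:
  assumes a: "admissible_cutoff a"
  shows "Ck k UNIV (ext0 a)"
proof -
  obtain D where D0: "D 0 = a \<and>
      (\<forall>n::nat. \<forall>t\<ge>0. (D n has_vector_derivative D (Suc n) t) (at t within {0..}))"
    using conjunct1[OF a[unfolded admissible_cutoff_def]] by (elim exE) (rule that)
  have D: "D 0 = a" "t \<ge> 0 \<Longrightarrow> (D n has_vector_derivative D (Suc n) t) (at t within {0..})" for n t
    by (rule conjunct1[OF D0]) (rule conjunct2[OF D0, rule_format])
  define E where "E n = ext0 (D n)" for n
  have at: "(D n has_vector_derivative D (Suc n) t) (at t)" if "t > 0" for n t
  proof -
    have "at t within {0..} = at t" by (rule at_within_interior) (use that in auto)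
    then show ?thesis using D(2)[of t n] that by simp
  qed
  have z: "E n t = 0" if "t < 1/4" for n t
  proof (cases "t < 0")
    case False
    then show ?thesis using that
    proof (induction n arbitrary: t)
      case 0
      then show ?case using ext0_support[OF a, of t] unfolding E_def D(1) by auto
    next
      case (Suc n)
      have z: "D n s = 0" if "s \<in> {0..<1/4}" for s using Suc.IH[of s] that unfolding E_def ext0_def by auto
      have "(D n has_vector_derivative D (Suc n) t) (at t within {0..})" using D(2)[of t n] Suc.prems by simp
      then have 1: "(D n has_vector_derivative D (Suc n) t) (at t within {0..<1/4})"
        by (rule has_vector_derivative_within_subset) auto
      have 2: "(D n has_vector_derivative 0) (at t within {0..<1/4})"
        by (rule has_vector_derivative_transform[of _ _ _ "\<lambda>_. 0"]) (use z Suc.prems in auto)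
      \<comment> \<open>Uniqueness of the derivative requires a limit point; at \<open>t = 0\<close>
        the approach is from the right only.\<close>
      have "at t within {0..<1/4} \<noteq> bot"
      proof (cases "t = 0")
        case True
        have "at (0::real) within {0..<1/4} = at_right 0"
          by (rule at_within_nhd[of _ "{..<1/4}"]) auto
        then show ?thesis using True by simp
      next
        case False
        have "at t within {0..<1/4} = at t" by (rule at_within_interior) (use Suc.prems False in auto)
        then show ?thesis by simp
      qed
      then have "D (Suc n) t = 0" using vector_derivative_unique_within[OF _ 1 2] by simp
      then show ?case unfolding E_def ext0_def by simp
    qed
  qed (simp add: E_def ext0_def)
  have "(E n has_vector_derivative E (Suc n) t) (at t)" for n t
  proof (cases "t < 1/4")
    case True
    then have t: "t \<in> {..<1/4}" by simp
    have "(E n has_vector_derivative 0) (at t)"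
      by (rule has_vector_derivative_transform_within_open[OF _ _ t, of "\<lambda>_. 0"]) (use z in auto)
    then show ?thesis using z[OF True] by simp
  next
    case False
    then have t: "t \<in> {0<..}" by simp
    have "(E n has_vector_derivative D (Suc n) t) (at t)"
      by (rule has_vector_derivative_transform_within_open[OF at _ t]) (use False in \<open>auto simp: E_def ext0_def\<close>)
    then show ?thesis using False by (simp add: E_def ext0_def)
  qed
  from Ck_of_chain[of UNIV E k 0, OF this] show ?thesis unfolding E_def D(1) .
qed

text \<open>The support condition allows the end point 4, where continuity excludes a nonzero value.
  In \<open>calderon_sum\<close> the degree \<open>\<nu> = 1\<close> meets exactly this
  argument.\<close>

lemma ext0_at_4:
  assumes a: "admissible_cutoff a"
  shows "ext0 a 4 = 0"
proof -
  have "isCont (ext0 a) 4" using Ck_imp_continuous[OF ext0_Ck[OF a, of 0]] by (simp add: continuous_on_eq_continuous_at)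
  moreover have "(\<lambda>n. 4 + 1 / real (Suc n)) \<longlonglongrightarrow> 4" by real_asymp
  ultimately have "(\<lambda>n. ext0 a (4 + 1 / real (Suc n))) \<longlonglongrightarrow> ext0 a 4" by (rule isCont_tendsto_compose)
  moreover have "ext0 a (4 + 1 / real (Suc n)) = 0" for n by (rule ext0_support[OF a]) auto
  ultimately show ?thesis by (simp add: LIMSEQ_const_iff)
qed

text \<open>For \<open>t \<in> [1/4, 4]\<close> the five dilates exhaust the sum over all integer powers of \<open>4\<close>, by the
  support of the cut-off; this makes \<open>dual_symbol\<close> a local formula.\<close>

definition square_sum :: "(real \<Rightarrow> complex) \<Rightarrow> real \<Rightarrow> real" where
  "square_sum a t = (norm (ext0 a (16 * t)))\<^sup>2 + (norm (ext0 a (4 * t)))\<^sup>2 + (norm (ext0 a (1 * t)))\<^sup>2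
     + (norm (ext0 a (1/4 * t)))\<^sup>2 + (norm (ext0 a (1/16 * t)))\<^sup>2"

definition dual_symbol :: "(real \<Rightarrow> complex) \<Rightarrow> real \<Rightarrow> complex" where
  "dual_symbol a t = cnj (ext0 a t) * inverse (of_real (square_sum a t))"

text \<open>The dilates of \<open>[1/3, 3]\<close> by powers of 4 overlap because
  \<open>9 > 4\<close>; five of them cover an open interval around \<open>[1/4, 4]\<close>, on which
  the quotient can be differentiated.\<close>

lemma square_sum_pos:
  assumes a: "admissible_cutoff a" and t: "t \<in> {1/16<..<16}"
  shows "square_sum a t > 0"
proof -
  obtain c where c: "c > 0" "\<forall>t\<in>{1/3..3}. norm (a t) > c"
    using a unfolding admissible_cutoff_def by (elim conjE exE) (rule that)
  have nz: "ext0 a s \<noteq> 0" if "s \<in> {1/3..3}" for s using c that unfolding ext0_def by force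
  consider "16 * t \<in> {1/3..3}" | "4 * t \<in> {1/3..3}" | "1 * t \<in> {1/3..3}" | "1/4 * t \<in> {1/3..3}" | "1/16 * t \<in> {1/3..3}"
    using t by force
  then have "(norm (ext0 a (16 * t)))\<^sup>2 > 0 \<or> (norm (ext0 a (4 * t)))\<^sup>2 > 0 \<or> (norm (ext0 a (1 * t)))\<^sup>2 > 0
     \<or> (norm (ext0 a (1/4 * t)))\<^sup>2 > 0 \<or> (norm (ext0 a (1/16 * t)))\<^sup>2 > 0"
    by cases (simp_all only: zero_less_power2 norm_eq_zero nz not_False_eq_True simp_thms)
  moreover have "(norm (ext0 a s))\<^sup>2 \<ge> 0" for s by simp
  note this[of "16 * t"] this[of "4 * t"] this[of "1 * t"] this[of "1/4 * t"] this[of "1/16 * t"]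
  ultimately show ?thesis unfolding square_sum_def by linarith
qed

lemma square_sum_Ck:
  assumes a: "admissible_cutoff a"
  shows "Ck k UNIV (\<lambda>t. of_real (square_sum a t))"
proof -
  have sq: "complex_of_real ((norm z)\<^sup>2) = z * cnj z" for z by (rule complex_norm_square)
  show ?thesis unfolding square_sum_def of_real_add sq
    by (intro Ck_add Ck_mult Ck_cnj Ck_scale[OF ext0_Ck[OF a]])
qed

lemma dual_symbol_support: "admissible_cutoff a \<Longrightarrow> t \<notin> {1/4..4} \<Longrightarrow> dual_symbol a t = 0"
  unfolding dual_symbol_def by (simp add: ext0_support)

text \<open>The factor \<open>exp t\<close> compensates the damping \<open>exp (- \<nu> / n)\<close>
  that comes from integrating over a circle inside the unit disc.\<close>

lemma symbol_chains:
  assumes a: "admissible_cutoff a" and s: "s = ext0 a \<or> s = dual_symbol a"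
  shows "\<exists>D B. D 0 = (\<lambda>t. s t * of_real (exp t)) \<and> (\<forall>m<k. \<forall>t. (D m has_vector_derivative D (Suc m) t) (at t)) \<and>
    (\<forall>t. norm (D 0 t) \<le> B) \<and> (\<forall>t. norm (D k t) \<le> B)"
proof (rule Ck_extend)
  show "open {1/16<..<16::real}" "{1/4..4} \<subseteq> {1/16<..<16::real}" by auto
  show "s t * of_real (exp t) = 0" if "t \<notin> {1/4..4}" for t
    using s ext0_support[OF a that] dual_symbol_support[OF a that] by auto
  have A: "Ck k {1/16<..<16} (ext0 a)" by (rule Ck_subset[OF ext0_Ck[OF a]]) simp
  have "Ck k {1/16<..<16} (\<lambda>t. of_real (square_sum a t))" by (rule Ck_subset[OF square_sum_Ck[OF a]]) simp
  then have "Ck k {1/16<..<16} (\<lambda>t. inverse (complex_of_real (square_sum a t)))"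
  proof (rule Ck_inverse)
    show "complex_of_real (square_sum a t) \<noteq> 0" if "t \<in> {1/16<..<16}" for t
      using square_sum_pos[OF a that] by simp
  qed
  then have "Ck k {1/16<..<16} (dual_symbol a)"
    unfolding dual_symbol_def[abs_def] using A by (intro Ck_mult Ck_cnj)
  then show "Ck k {1/16<..<16} (\<lambda>t. s t * of_real (exp t))" using s A by (auto intro!: Ck_mult Ck_exp)
qed

text \<open>With \<open>u l\<close> the squared modulus of the cut-off at scale \<open>l\<close> and
  \<open>T\<close> their total, each term equals \<open>u j / T\<close>: where \<open>u j\<close> is
  nonzero, the five dilates in \<open>square_sum\<close> already contain all nonzero
  \<open>u l\<close>.\<close>

lemma calderon_sum:
  assumes a: "admissible_cutoff a" and \<nu>: "\<nu> \<ge> (1::nat)"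
  shows "(\<lambda>j. dual_symbol a (real \<nu> / 4 ^ j) * ext0 a (real \<nu> / 4 ^ j)) sums 1"
proof -
  define u where "u l = (norm (ext0 a (real \<nu> / 4 ^ l)))\<^sup>2" for l :: nat
  have big: "ext0 a t = 0" if "t \<ge> 4" for t
    using ext0_at_4[OF a] ext0_support[OF a, of t] that by (cases "t = 4") auto
  obtain J where J: "4 * real \<nu> < 4 ^ J" using real_arch_pow[of 4 "4 * real \<nu>"] by auto
  have uJ: "u l = 0" if "l > J" for l
  proof -
    have "(4::real) ^ J \<le> 4 ^ l" using that by (intro power_increasing) auto
    with J have "4 * real \<nu> < 4 ^ l" by linarith
    then have "real \<nu> / 4 ^ l < 1/4" by (simp add: divide_simps)
    then show ?thesis unfolding u_def using ext0_support[OF a, of "real \<nu> / 4 ^ l"] by auto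
  qed
  define T where "T = (\<Sum>l\<le>J. u l)"
  have up: "u l \<ge> 0" for l unfolding u_def by simp
  have Tpos: "T > 0"
  proof -
    \<comment> \<open>By minimality the argument at scale \<open>j\<close> exceeds
      \<open>3/4\<close> unless \<open>j = 0\<close>, where it equals \<open>\<nu> \<ge> 1\<close>;
      so some scale falls into \<open>[1/3, 3]\<close>.\<close>
    define j where "j = (LEAST j. real \<nu> / 4 ^ j \<le> 3)"
    obtain j0 where "real \<nu> / 3 < 4 ^ j0" using real_arch_pow[of 4 "real \<nu> / 3"] by auto
    then have "real \<nu> / 4 ^ j0 \<le> 3" by (simp add: divide_simps)
    then have j: "real \<nu> / 4 ^ j \<le> 3" unfolding j_def by (rule LeastI)
    have "1/3 \<le> real \<nu> / 4 ^ j"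
    proof (cases j)
      case 0
      then show ?thesis using \<nu> by simp
    next
      case (Suc i)
      then have "\<not> real \<nu> / 4 ^ i \<le> 3" using not_less_Least[of i "\<lambda>j. real \<nu> / 4 ^ j \<le> 3"] unfolding j_def by simp
      then have "real \<nu> > 3 * 4 ^ i" by (simp add: divide_simps)
      moreover have "(4::real) ^ i > 0" by simp
      ultimately show ?thesis unfolding Suc by (simp add: divide_simps)
    qed
    then have j3: "real \<nu> / 4 ^ j \<in> {1/3..3}" using j by simp
    obtain c where c: "c > 0" "\<forall>t\<in>{1/3..3}. norm (a t) > c"
      using a unfolding admissible_cutoff_def by (elim conjE exE) (rule that; assumption)
    have "norm (a (real \<nu> / 4 ^ j)) > c" using c(2) j3 by (rule bspec)
    then have "norm (a (real \<nu> / 4 ^ j)) > 0" using c(1) by linarith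
    then have uj: "u j > 0" unfolding u_def ext0_def by simp
    have "j \<le> J" by (rule ccontr) (use uj uJ[of j] in simp)
    then have "u j \<le> T" unfolding T_def using up by (intro member_le_sum) auto
    then show ?thesis using uj by simp
  qed
  have term_eq: "dual_symbol a (real \<nu> / 4 ^ j) * ext0 a (real \<nu> / 4 ^ j) = of_real (u j / T)" for j
  proof (cases "u j = 0")
    case True
    then show ?thesis unfolding u_def by simp
  next
    case False
    define t where "t = real \<nu> / 4 ^ j"
    have "t \<in> {1/4..4}"
    proof (rule ccontr)
      assume "t \<notin> {1/4..4}"
      from ext0_support[OF a this] show False using False unfolding u_def t_def by simp
    qed
    then have t: "1/4 \<le> t" "t \<le> 4" by simp_all
    have jJ: "j \<le> J" by (rule ccontr) (use False uJ[of j] in simp)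
    have s0: "(norm (ext0 a (1 * t)))\<^sup>2 = u j" unfolding t_def u_def by simp
    have "1/4 * t = real \<nu> / 4 ^ (j + 1)" "1/16 * t = real \<nu> / 4 ^ (j + 2)"
      unfolding t_def by simp_all
    then have s1: "(norm (ext0 a (1/4 * t)))\<^sup>2 = u (j + 1)" "(norm (ext0 a (1/16 * t)))\<^sup>2 = u (j + 2)"
      unfolding u_def by (simp_all only:)
    have far: "u l = 0" if "l \<notin> {j - 2..j + 2}" for l
    proof (cases "l < j")
      case True
      then have "l + 3 \<le> j" using that by auto
      then obtain d where d: "j = l + 3 + d" using le_Suc_ex by blast
      have "real \<nu> / 4 ^ l = t * 4 ^ (3 + d)" unfolding t_def d power_add by simp
      moreover have "t * 4 ^ (3 + d) \<ge> 1/4 * 4 ^ 3" using t by (intro mult_mono power_increasing) auto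
      ultimately have "real \<nu> / 4 ^ l \<ge> 4" by simp
      then show ?thesis unfolding u_def using big by simp
    next
      case False
      then have "j + 3 \<le> l" using that by auto
      then obtain d where d: "l = j + 3 + d" using le_Suc_ex by blast
      have "real \<nu> / 4 ^ l = t / 4 ^ (3 + d)" unfolding t_def d power_add by simp
      also have "\<dots> \<le> 4 / 4 ^ 3" using t by (intro frac_le power_increasing) auto
      also have "\<dots> < 1/4" by simp
      finally show ?thesis unfolding u_def using ext0_support[OF a, of "real \<nu> / 4 ^ l"] by auto
    qed
    have sq: "square_sum a t = (\<Sum>l\<in>{j - 2..j + 2}. u l)"
    proof -
      have "(norm (ext0 a (16 * t)))\<^sup>2 + (norm (ext0 a (4 * t)))\<^sup>2 + u j + u (j + 1) + u (j + 2) = (\<Sum>l\<in>{j - 2..j + 2}. u l)"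
      proof -
        \<comment> \<open>For \<open>j < 2\<close> the dilates \<open>16 * t\<close> or
          \<open>4 * t\<close> belong to negative scales, which do not occur in the sum; they
          contribute 0, since their arguments are at least 4.\<close>
        consider "j = 0" | "j = 1" | i where "j = i + 2"
        proof -
          have "j = 0 \<or> j = 1 \<or> j = (j - 2) + 2" by arith
          then show thesis using that(1) that(2) that(3)[of "j - 2"] by (elim disjE) assumption+
        qed
        then show ?thesis
        proof cases
          case 1
          have "ext0 a (16 * t) = 0" "ext0 a (4 * t) = 0" by (rule big, use \<nu> in \<open>simp add: t_def 1\<close>)+
          moreover have e: "{j - 2..j + 2} = {j, j + 1, j + 2}" unfolding 1 by auto
          ultimately show ?thesis unfolding e by simp
        next
          case 2
          have "ext0 a (16 * t) = 0" by (rule big) (use \<nu> in \<open>simp add: t_def 2\<close>)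
          moreover have "4 * t = real \<nu> / 4 ^ 0" unfolding t_def 2 by simp
          then have "(norm (ext0 a (4 * t)))\<^sup>2 = u 0" unfolding u_def by (simp only:)
          moreover have e: "{j - 2..j + 2} = {0, j, j + 1, j + 2}" unfolding 2 by auto
          moreover have "j \<noteq> 0" using 2 by simp
          ultimately show ?thesis unfolding e by simp
        next
          case (3 i)
          have "16 * t = real \<nu> / 4 ^ i" "4 * t = real \<nu> / 4 ^ (i + 1)" unfolding t_def 3 by simp_all
          then have h: "(norm (ext0 a (16 * t)))\<^sup>2 = u i" "(norm (ext0 a (4 * t)))\<^sup>2 = u (i + 1)"
            unfolding u_def by (simp_all only:)
          have e: "{j - 2..j + 2} = {i, i + 1, j, j + 1, j + 2}" using 3 by auto
          show ?thesis unfolding e h using 3 by simp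
        qed
      qed
      then show ?thesis unfolding square_sum_def s0 s1 .
    qed
    also have "\<dots> = T"
    proof -
      have "(\<Sum>l\<in>{j - 2..j + 2}. u l) = (\<Sum>l\<in>{..J + 2}. u l)"
        by (rule sum.mono_neutral_left) (use jJ far in auto)
      also have "\<dots> = T" unfolding T_def by (rule sum.mono_neutral_right) (use uJ in auto)
      finally show ?thesis .
    qed
    finally have "square_sum a t = T" .
    moreover have "cnj (ext0 a t) * ext0 a t = of_real (u j)"
      unfolding u_def t_def complex_norm_square by (simp only: mult.commute)
    ultimately show ?thesis unfolding dual_symbol_def t_def[symmetric]
      by (simp add: divide_inverse mult_ac)
  qed
  have "(\<lambda>j. if j \<in> {..J} then complex_of_real (u j / T) else 0) sums (\<Sum>j\<le>J. of_real (u j / T))"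
    by (rule sums_If_finite_set) simp
  moreover have "(\<Sum>j\<le>J. complex_of_real (u j / T)) = 1"
  proof -
    have "(\<Sum>j\<le>J. complex_of_real (u j / T)) = of_real ((\<Sum>j\<le>J. u j) / T)" by (simp add: sum_divide_distrib)
    then show ?thesis using Tpos unfolding T_def[symmetric] by simp
  qed
  moreover have "(if j \<in> {..J} then complex_of_real (u j / T) else 0) = of_real (u j / T)" for j
    using uJ[of j] by auto
  ultimately show ?thesis unfolding term_eq by simp
qed

section \<open>Lebesgue spaces\<close>

lemma lpn_finite_imp_AE:
  assumes [measurable]: "u \<in> borel_measurable lborel" and p: "1 \<le> p" and fin: "lpn p u < \<infinity>"
  shows "AE x in lborel. u x < \<infinity>"
proof (cases "p = \<infinity>")
  case True
  have "AE x in lborel. u x \<le> esssup lborel u" by (rule esssup_AE)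
  moreover have "esssup lborel u < \<infinity>" using fin True unfolding lpn_def by simp
  ultimately show ?thesis by (auto elim: eventually_mono)
next
  case False
  have "lpn p u \<noteq> top" using fin by (simp add: less_top)
  then have "(\<integral>\<^sup>+x. ennpowr (u x) (enn2real p) \<partial>lborel) \<noteq> \<infinity>"
    unfolding lpn_powr[OF p False, symmetric] by simp
  then have "AE x in lborel. ennpowr (u x) (enn2real p) \<noteq> \<infinity>" by (intro nn_integral_PInf_AE) auto
  then show ?thesis by (auto elim!: eventually_mono simp: less_top)
qed

lemma lp_norm_cong_AE:
  assumes [measurable]: "F \<in> borel_measurable lborel" "G \<in> borel_measurable lborel"
    and p: "1 \<le> p" and eq: "AE x in lborel. F x = G x"
  shows "lp_norm p F = lp_norm p G"
  unfolding lp_norm_eq_lpn by (rule lpn_cong_AE[OF _ _ p]) (use eq in auto)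

lemma lp_norm_diff_le:
  assumes [measurable]: "F \<in> borel_measurable lborel" "G \<in> borel_measurable lborel" and p: "1 \<le> p"
  shows "lp_norm p (\<lambda>x. F x - G x) \<le> lp_norm p F + lp_norm p G"
proof -
  have "lp_norm p (\<lambda>x. F x - G x) \<le> lpn p (\<lambda>x. ennreal (norm (F x)) + ennreal (norm (G x)))"
    unfolding lp_norm_eq_lpn
    by (rule lpn_mono_AE[OF _ _ p]) (auto simp flip: ennreal_plus intro!: ennreal_leI norm_triangle_ineq4)
  also have "\<dots> \<le> lp_norm p F + lp_norm p G"
    unfolding lp_norm_eq_lpn by (rule lpn_add_le[OF _ _ p]) auto
  finally show ?thesis .
qed

lemma lp_space_diff:
  assumes F: "F \<in> lp_space p" and G: "G \<in> lp_space p" and p: "1 \<le> p"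
  shows "(\<lambda>x. F x - G x) \<in> lp_space p"
proof -
  note m [measurable] = lp_space_measurable[OF F] lp_space_measurable[OF G]
  have "lp_norm p (\<lambda>x. F x - G x) \<le> lp_norm p F + lp_norm p G" by (rule lp_norm_diff_le[OF m p])
  also have "\<dots> < \<infinity>" using lp_space_finite[OF F] lp_space_finite[OF G] by simp
  finally show ?thesis unfolding lp_space_def by simp
qed

lemma hcoeff_diff_lp:
  assumes F: "F \<in> lp_space p" and G: "G \<in> lp_space p" and p: "1 \<le> p"
  shows "hcoeff (\<lambda>x. F x - G x) \<beta> = hcoeff F \<beta> - hcoeff G \<beta>"
  unfolding hcoeff_def left_diff_distrib
  by (rule Bochner_Integration.integral_diff) (intro lp_times_schwartz_integrable[OF _ p Hc_schwartz] F G)+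

text \<open>As \<open>wt \<le> 1\<close>, its \<open>p\<close>-th power is dominated by
  \<open>wt\<close> itself.\<close>

lemma lpn_wt_finite:
  assumes p: "1 \<le> p"
  shows "lpn p (\<lambda>x. ennreal (wt (x :: real ^ 'd::finite))) < \<infinity>"
proof (cases "p = \<infinity>")
  case True
  have "esssup lborel (\<lambda>x. ennreal (wt (x :: real ^ 'd))) \<le> ennreal 1"
    by (rule esssup_I) (auto intro!: ennreal_leI wt_le_1)
  also have "\<dots> < \<infinity>" by simp
  finally show ?thesis using True unfolding lpn_def by simp
next
  case False
  have p1: "enn2real p \<ge> 1" using enn2real_ge_1[OF p False] .
  have pos: "wt x \<ge> 0" for x :: "real ^ 'd" using wt_pos[of x] by simp
  have "(\<integral>\<^sup>+x. ennpowr (ennreal (wt (x :: real ^ 'd))) (enn2real p) \<partial>lborel) \<le> (\<integral>\<^sup>+x. ennreal (wt (x :: real ^ 'd)) \<partial>lborel)"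
  proof (rule nn_integral_mono)
    fix x :: "real ^ 'd"
    have "wt x powr enn2real p \<le> wt x powr 1" using p1 wt_le_1[of x] pos[of x] by (intro powr_mono') auto
    then show "ennpowr (ennreal (wt x)) (enn2real p) \<le> ennreal (wt x)"
      using pos[of x] by (simp add: ennpowr_ennreal ennreal_leI)
  qed
  also have "\<dots> = ennreal (\<integral>x. wt (x :: real ^ 'd) \<partial>lborel)"
    by (rule nn_integral_eq_integral[OF wt_integrable]) (use pos in auto)
  also have "\<dots> < \<infinity>" by simp
  finally have "ennpowr (lpn p (\<lambda>x. ennreal (wt (x :: real ^ 'd)))) (enn2real p) \<noteq> top"
    unfolding lpn_powr[OF p False] by (simp add: less_top)
  then show ?thesis by (simp add: less_top)
qed

lemma schwartz_lp_space:
  fixes \<phi> :: "real ^ 'd::finite \<Rightarrow> complex"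
  assumes \<phi>: "\<phi> \<in> schwartz" and p: "1 \<le> p"
  shows "\<phi> \<in> lp_space p"
proof -
  note [measurable] = schwartz_measurable[OF \<phi>]
  have "lp_norm p \<phi> \<le> lpn p (\<lambda>x. ennreal (schwartz_decay \<phi>) * ennreal (wt (x :: real ^ 'd)))"
    unfolding lp_norm_eq_lpn
  proof (rule lpn_mono_AE[OF _ _ p])
    show "(\<lambda>x. ennreal (norm (\<phi> x))) \<in> borel_measurable lborel"
      "(\<lambda>x. ennreal (schwartz_decay \<phi>) * ennreal (wt (x :: real ^ 'd))) \<in> borel_measurable lborel" by measurable
    show "AE x in lborel. ennreal (norm (\<phi> x)) \<le> ennreal (schwartz_decay \<phi>) * ennreal (wt (x :: real ^ 'd))"
    proof (rule AE_I2)
      fix x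
      have "ennreal (norm (\<phi> x)) \<le> ennreal (schwartz_decay \<phi> * wt x)"
        by (rule ennreal_leI[OF schwartz_decay_bound[OF \<phi>]])
      then show "ennreal (norm (\<phi> x)) \<le> ennreal (schwartz_decay \<phi>) * ennreal (wt (x :: real ^ 'd))"
        using schwartz_decay_nonneg[OF \<phi>] wt_pos[of x] by (simp add: ennreal_mult)
    qed
  qed
  also have "\<dots> \<le> ennreal (schwartz_decay \<phi>) * lpn p (\<lambda>x. ennreal (wt (x :: real ^ 'd)))"
    by (rule lpn_cmult_le[OF _ p]) auto
  also have "\<dots> < \<infinity>" using lpn_wt_finite[OF p, where 'd = 'd] by (simp add: ennreal_mult_less_top)
  finally show ?thesis unfolding lp_space_def by simp
qed

text \<open>Completeness in quantitative form. The coefficients pass to the limit because the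
  pairing with \<open>Hc \<beta>\<close> is bounded by the \<open>L\<^sup>p\<close> norm.\<close>

lemma lp_series:
  fixes u :: "nat \<Rightarrow> real ^ 'd::finite \<Rightarrow> complex"
  assumes u [measurable]: "\<And>j. u j \<in> borel_measurable lborel" and p: "1 \<le> p"
    and fin: "(\<Sum>j. lp_norm p (u j)) < \<infinity>"
  obtains F where "F \<in> lp_space p"
    and "\<And>J. lp_norm p (\<lambda>x. F x - (\<Sum>j<J. u j x)) \<le> (\<Sum>j. lp_norm p (u (j + J)))"
    and "\<And>\<beta>. (\<lambda>j. hcoeff (u j) \<beta>) sums hcoeff F \<beta>"
proof -
  define F where "F x = (\<Sum>j. u j x)" for x
  have [measurable]: "F \<in> borel_measurable lborel" unfolding F_def by measurable
  have "lpn p (\<lambda>x. \<Sum>j. ennreal (norm (u j x))) \<le> (\<Sum>j. lp_norm p (u j))"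
    unfolding lp_norm_eq_lpn by (rule lpn_suminf_le[OF _ p]) auto
  also note fin
  finally have "AE x in lborel. (\<Sum>j. ennreal (norm (u j x))) < \<infinity>"
    by (intro lpn_finite_imp_AE[OF _ p]) auto
  then have sm: "AE x in lborel. summable (\<lambda>j. norm (u j x))"
  proof (rule eventually_mono)
    fix x assume "(\<Sum>j. ennreal (norm (u j x))) < \<infinity>"
    then show "summable (\<lambda>j. norm (u j x))" by (intro summable_suminf_not_top) auto
  qed
  have tail: "lp_norm p (\<lambda>x. F x - (\<Sum>j<J. u j x)) \<le> (\<Sum>j. lp_norm p (u (j + J)))" for J
  proof -
    have "lp_norm p (\<lambda>x. F x - (\<Sum>j<J. u j x)) \<le> lpn p (\<lambda>x. \<Sum>j. ennreal (norm (u (j + J) x)))"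
      unfolding lp_norm_eq_lpn
    proof (rule lpn_mono_AE[OF _ _ p])
      show "AE x in lborel. ennreal (norm (F x - (\<Sum>j<J. u j x))) \<le> (\<Sum>j. ennreal (norm (u (j + J) x)))"
        using sm
      proof (rule eventually_mono)
        fix x assume s: "summable (\<lambda>j. norm (u j x))"
        have sJ: "summable (\<lambda>j. norm (u (j + J) x))" using s by (rule summable_ignore_initial_segment)
        have "F x = (\<Sum>j. u (j + J) x) + (\<Sum>j<J. u j x)"
          unfolding F_def by (rule suminf_split_initial_segment[OF summable_norm_cancel[OF s]])
        then have "norm (F x - (\<Sum>j<J. u j x)) = norm (\<Sum>j. u (j + J) x)" by simp
        also have "\<dots> \<le> (\<Sum>j. norm (u (j + J) x))" by (rule summable_norm[OF sJ])
        finally show "ennreal (norm (F x - (\<Sum>j<J. u j x))) \<le> (\<Sum>j. ennreal (norm (u (j + J) x)))"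
          by (subst suminf_ennreal2) (auto intro!: ennreal_leI sJ)
      qed
    qed auto
    also have "\<dots> \<le> (\<Sum>j. lp_norm p (u (j + J)))"
      unfolding lp_norm_eq_lpn by (rule lpn_suminf_le[OF _ p]) auto
    finally show ?thesis .
  qed
  have lpF: "lp_norm p F < \<infinity>" using order_le_less_trans[OF tail[of 0]] fin by simp
  then have F: "F \<in> lp_space p" unfolding lp_space_def by simp
  have uj: "u j \<in> lp_space p" for j
  proof -
    have "lp_norm p (u j) = (\<Sum>i\<in>{j}. lp_norm p (u i))" by simp
    also have "\<dots> \<le> (\<Sum>j. lp_norm p (u j))" by (rule sum_le_suminf) auto
    also note fin
    finally show ?thesis unfolding lp_space_def by simp
  qed
  have "(\<lambda>j. hcoeff (u j) \<beta>) sums hcoeff F \<beta>" for \<beta>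
  proof -
    obtain K where K0: "K > 0" "\<forall>p F. 1 \<le> p \<longrightarrow> F \<in> borel_measurable lborel \<longrightarrow>
        (\<forall>\<phi> \<in> (schwartz :: (real ^ 'd \<Rightarrow> complex) set).
       (\<integral>\<^sup>+x. ennreal (norm (F x * \<phi> x)) \<partial>lborel) \<le> ennreal (K * schwartz_decay \<phi>) * lp_norm p F)"
      using lp_schwartz_pairing[where 'd = 'd] by (elim exE conjE) (rule that)
    have K: "(\<integral>\<^sup>+x. ennreal (norm (F x * Hc \<beta> x)) \<partial>lborel) \<le> ennreal (K * schwartz_decay (Hc \<beta>)) * lp_norm p F"
      if "F \<in> borel_measurable lborel" for F
      using K0(2)[rule_format, OF p that Hc_schwartz] .
    have i: "integrable lborel (\<lambda>x. u j x * Hc \<beta> x)" for j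
      by (rule lp_times_schwartz_integrable[OF uj p Hc_schwartz])
    have "(\<Sum>j. ennreal (\<integral>x. norm (u j x * Hc \<beta> x) \<partial>lborel)) \<le> (\<Sum>j. ennreal (K * schwartz_decay (Hc \<beta>)) * lp_norm p (u j))"
    proof (rule suminf_le)
      fix j
      have "ennreal (\<integral>x. norm (u j x * Hc \<beta> x) \<partial>lborel) = (\<integral>\<^sup>+x. ennreal (norm (u j x * Hc \<beta> x)) \<partial>lborel)"
        by (rule nn_integral_eq_integral[symmetric]) (use i in auto)
      then show "ennreal (\<integral>x. norm (u j x * Hc \<beta> x) \<partial>lborel) \<le> ennreal (K * schwartz_decay (Hc \<beta>)) * lp_norm p (u j)"
        using K[OF u[of j]] by simp
    qed auto
    also have "\<dots> = ennreal (K * schwartz_decay (Hc \<beta>)) * (\<Sum>j. lp_norm p (u j))" by simp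
    also have "\<dots> < top" using fin by (simp add: ennreal_mult_less_top)
    finally have s2: "summable (\<lambda>j. \<integral>x. norm (u j x * Hc \<beta> x) \<partial>lborel)"
      by (intro summable_suminf_not_top) auto
    have s1: "AE x in lborel. summable (\<lambda>j. norm (u j x * Hc \<beta> x))"
      using sm by (rule eventually_mono) (auto simp: norm_mult intro: summable_mult2)
    have "(\<lambda>j. \<integral>x. u j x * Hc \<beta> x \<partial>lborel) sums (\<integral>x. (\<Sum>j. u j x * Hc \<beta> x) \<partial>lborel)"
      by (rule sums_integral[OF i s1 s2])
    moreover have "(\<integral>x. (\<Sum>j. u j x * Hc \<beta> x) \<partial>lborel) = (\<integral>x. F x * Hc \<beta> x \<partial>lborel)"
    proof (rule integral_cong_AE)
      show "AE x in lborel. (\<Sum>j. u j x * Hc \<beta> x) = F x * Hc \<beta> x"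
        using sm
      proof (rule eventually_mono)
        fix x assume "summable (\<lambda>j. norm (u j x))"
        from suminf_mult2[OF summable_norm_cancel[OF this], of "Hc \<beta> x"]
        show "(\<Sum>j. u j x * Hc \<beta> x) = F x * Hc \<beta> x" unfolding F_def by simp
      qed
    qed measurable
    ultimately show ?thesis unfolding hcoeff_def by simp
  qed
  then show thesis using that[OF F tail] by blast
qed

section \<open>Best approximation\<close>

lemma hsum_in_hermite_space: "hsum n c \<in> hermite_space n"
  unfolding hermite_space_def hsum_def[abs_def] by blast

lemma hermite_spaceE:
  assumes "G \<in> hermite_space n"
  obtains c where "G = hsum n c"
  using assms unfolding hermite_space_def hsum_def[abs_def] by blast

lemma hsum_extend: "n \<le> m \<Longrightarrow> hsum n c = hsum m (\<lambda>\<beta>. if multi_deg \<beta> \<le> n then c \<beta> else 0)"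
proof
  fix x assume nm: "n \<le> m"
  show "hsum n c x = hsum m (\<lambda>\<beta>. if multi_deg \<beta> \<le> n then c \<beta> else 0) x"
    unfolding hsum_def by (rule sum.mono_neutral_cong_left) (use nm in auto)
qed

lemma hermite_space_sum_hsum:
  assumes "\<And>j. j < J \<Longrightarrow> N j \<le> M"
  shows "(\<lambda>x. \<Sum>j<J. hsum (N j) (c j) x) \<in> hermite_space M"
proof -
  have "(\<Sum>j<J. hsum (N j) (c j) x) = hsum M (\<lambda>\<beta>. \<Sum>j<J. if multi_deg \<beta> \<le> N j then c j \<beta> else 0) x" for x
  proof -
    have "(\<Sum>j<J. hsum (N j) (c j) x) = (\<Sum>j<J. hsum M (\<lambda>\<beta>. if multi_deg \<beta> \<le> N j then c j \<beta> else 0) x)"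
    proof (rule sum.cong[OF refl])
      fix j assume "j \<in> {..<J}"
      then have "N j \<le> M" using assms by simp
      from hsum_extend[OF this, of "c j"] show "hsum (N j) (c j) x = hsum M (\<lambda>\<beta>. if multi_deg \<beta> \<le> N j then c j \<beta> else 0) x"
        by (rule fun_cong)
    qed
    also have "\<dots> = hsum M (\<lambda>\<beta>. \<Sum>j<J. if multi_deg \<beta> \<le> N j then c j \<beta> else 0) x"
      unfolding hsum_def by (subst sum.swap) (simp only: sum_distrib_right)
    finally show ?thesis .
  qed
  then show ?thesis using hsum_in_hermite_space by (simp only: ext)
qed

lemma hermite_space_schwartz: "G \<in> hermite_space n \<Longrightarrow> G \<in> schwartz"
  by (elim hermite_spaceE) (simp add: hsum_schwartz)

lemma best_approx_le: "G \<in> hermite_space n \<Longrightarrow> best_approx p n F \<le> lp_norm p (\<lambda>x. F x - G x)"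
  unfolding best_approx_def by (rule INF_lower)

text \<open>The spaces consist of functions rather than classes, so invariance under changes on null
  sets is a separate fact.\<close>

lemma approx_norm_cong_AE:
  fixes F F' :: "real ^ 'd::finite \<Rightarrow> complex"
  assumes m [measurable]: "F \<in> borel_measurable lborel" "F' \<in> borel_measurable lborel"
    and p: "1 \<le> p" and eq: "AE x in lborel. F x = F' x"
  shows "approx_norm \<alpha> p q F = approx_norm \<alpha> p q F'"
proof -
  have "best_approx p n F = best_approx p n F'" for n
    unfolding best_approx_def
  proof (rule INF_cong[OF refl])
    fix G :: "real ^ 'd \<Rightarrow> complex" assume "G \<in> hermite_space n"
    then have [measurable]: "G \<in> borel_measurable borel" by (intro schwartz_measurable hermite_space_schwartz)
    show "lp_norm p (\<lambda>x. F x - G x) = lp_norm p (\<lambda>x. F' x - G x)"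
      by (rule lp_norm_cong_AE[OF _ _ p]) (use eq in auto)
  qed
  then show ?thesis unfolding approx_norm_def using lp_norm_cong_AE[OF m p eq] by simp
qed

section \<open>Littlewood--Paley pieces\<close>

text \<open>The multiplier of the \<open>j\<close>-th piece. Level 0 isolates degree 0, which no
  dilate of a symbol supported in \<open>[1/4, 4]\<close> reaches.\<close>

definition level :: "(real \<Rightarrow> complex) \<Rightarrow> nat \<Rightarrow> nat \<Rightarrow> complex" where
  "level s j \<nu> = (if j = 0 then (if \<nu> = 0 then 1 else 0) else s (real \<nu> / 4 ^ (j - 1)))"

text \<open>For \<open>j \<ge> 1\<close> the cut at degree \<open>4 ^ j = 4 * 4 ^ (j - 1)\<close> is
  the upper end of the dilated support. The argument is a family of coefficients, so functions and
  distributions are treated alike.\<close>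

definition level_op :: "(real \<Rightarrow> complex) \<Rightarrow> nat \<Rightarrow> (('d::finite \<Rightarrow> nat) \<Rightarrow> complex) \<Rightarrow> real ^ 'd \<Rightarrow> complex" where
  "level_op s j c = hsum (4 ^ j) (\<lambda>\<beta>. level s j (multi_deg \<beta>) * c \<beta>)"

text \<open>The two ends of the dilated support: the upper one makes each piece a finite Hermite
  combination, the lower one drives the direct estimate.\<close>

lemma level_eq_0:
  assumes s: "\<And>t. t \<notin> {1/4..4} \<Longrightarrow> s t = 0" and "\<nu> > 4 ^ j \<or> 0 < j \<and> 4 * \<nu> < 4 ^ (j - 1)"
  shows "level s j \<nu> = 0"
proof (cases j)
  case 0
  then show ?thesis using assms(2) unfolding level_def by auto
next
  case (Suc i)
  have "real \<nu> / 4 ^ i \<notin> {1/4..4}"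
  proof (cases "\<nu> > 4 ^ j")
    case True
    then have "real \<nu> > real (4 ^ j)" by (simp only: of_nat_less_iff)
    then have "real \<nu> / 4 ^ i > 4" unfolding Suc by (simp add: divide_simps)
    then show ?thesis by simp
  next
    case False
    then have "4 * \<nu> < 4 ^ i" using assms(2) Suc by simp
    then have "real (4 * \<nu>) < real (4 ^ i)" by (simp only: of_nat_less_iff)
    then have "real \<nu> / 4 ^ i < 1/4" by (simp add: divide_simps)
    then show ?thesis by simp
  qed
  then show ?thesis using s unfolding level_def Suc by simp
qed

lemma multi_deg_0_set: "{\<beta> :: 'd::finite \<Rightarrow> nat. multi_deg \<beta> = 0} = {\<lambda>_. 0}"
  by auto

text \<open>Level 0 is not a dilate of a smooth symbol; its row bound is computed directly from the
  rank-one kernel.\<close>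

lemma hermite_kernel_0_row:
  "\<exists>C>0. \<forall>x :: real ^ 'd::finite. (\<integral>\<^sup>+y. ennreal \<bar>hermite_kernel 0 x y\<bar> \<partial>lborel) \<le> ennreal C"
proof -
  let ?h = "hermite_fun (\<lambda>_ :: 'd. 0)"
  define I where "I = (\<integral>y. norm (Hc (\<lambda>_ :: 'd. 0) y) \<partial>lborel)"
  have I: "I \<ge> 0" unfolding I_def by simp
  have "(\<integral>\<^sup>+y. ennreal \<bar>hermite_kernel 0 x y\<bar> \<partial>lborel) \<le> ennreal (3 ^ CARD('d) * I + 1)" for x :: "real ^ 'd"
  proof -
    have b: "\<bar>?h x\<bar> \<le> 3 ^ CARD('d)" using norm_Hc_bound[of "\<lambda>_ :: 'd. 0" x] by simp
    have "(\<integral>\<^sup>+y. ennreal \<bar>hermite_kernel 0 x y\<bar> \<partial>lborel) = (\<integral>\<^sup>+y. ennreal \<bar>?h x\<bar> * ennreal (norm (Hc (\<lambda>_ :: 'd. 0) y)) \<partial>lborel)"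
      unfolding hermite_kernel_def multi_deg_0_set
      by (intro nn_integral_cong) (simp add: abs_mult ennreal_mult)
    also have "\<dots> = ennreal \<bar>?h x\<bar> * (\<integral>\<^sup>+y. ennreal (norm (Hc (\<lambda>_ :: 'd. 0) y)) \<partial>lborel)"
      by (rule nn_integral_cmult) measurable
    also have "(\<integral>\<^sup>+y. ennreal (norm (Hc (\<lambda>_ :: 'd. 0) y)) \<partial>lborel) = ennreal I"
      unfolding I_def
      by (rule nn_integral_eq_integral) (use integrable_norm[OF schwartz_integrable[OF Hc_schwartz]] in auto)
    also have "ennreal \<bar>?h x\<bar> * ennreal I = ennreal (\<bar>?h x\<bar> * I)" using I by (simp add: ennreal_mult)
    also have "\<dots> \<le> ennreal (3 ^ CARD('d) * I + 1)"
      by (rule ennreal_leI) (use mult_right_mono[OF b I] in linarith)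
    finally show ?thesis .
  qed
  moreover have "3 ^ CARD('d) * I + 1 > 0" using I by (simp add: add_nonneg_pos)
  ultimately show ?thesis by (intro exI[of _ "3 ^ CARD('d) * I + 1"]) simp
qed

text \<open>Level \<open>j \<ge> 1\<close> is the multiplier with dilation
  \<open>n = 4 ^ (j - 1)\<close>. The constant of \<open>mult_kernel_row_bound\<close> does not
  depend on \<open>n\<close>, and that of Schur's test does not depend on \<open>p\<close>.\<close>

lemma level_op_bound:
  assumes a: "admissible_cutoff a" and s: "s = ext0 a \<or> s = dual_symbol a"
  shows "\<exists>C>0. \<forall>j p. \<forall>F \<in> lp_space p. 1 \<le> p \<longrightarrow>
    lp_norm p (level_op s j (hcoeff (F :: real ^ 'd::finite \<Rightarrow> complex))) \<le> ennreal C * lp_norm p F"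
proof -
  have supp: "s t = 0" if "t \<notin> {1/4..4}" for t
    using s ext0_support[OF a that] dual_symbol_support[OF a that] by auto
  obtain D B where D: "D 0 = (\<lambda>t. s t * of_real (exp t))"
    "\<forall>m<CARD('d) + 2. \<forall>t. (D m has_vector_derivative D (Suc m) t) (at t)"
    "\<forall>t. norm (D 0 t) \<le> B" "\<forall>t. norm (D (CARD('d) + 2) t) \<le> B"
    using symbol_chains[OF a s, of "CARD('d) + 2"] by (elim exE conjE) (rule that)
  have "\<exists>C>0. \<forall>n\<ge>1. \<forall>x :: real ^ 'd.
    (\<integral>\<^sup>+y. ennreal (norm (mult_kernel (4 * n) (\<lambda>\<nu>. D 0 (real \<nu> / real n) * of_real (exp (- real \<nu> / real n))) x y)) \<partial>lborel) \<le> ennreal C"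
  proof (rule mult_kernel_row_bound)
    show "D 0 t = 0" if "t \<notin> {0..4}" for t using supp[of t] that unfolding D(1) by simp
  qed (use D in auto)
  then obtain C1 where C1: "C1 > 0" "\<forall>n\<ge>1. \<forall>x :: real ^ 'd.
    (\<integral>\<^sup>+y. ennreal (norm (mult_kernel (4 * n) (\<lambda>\<nu>. D 0 (real \<nu> / real n) * of_real (exp (- real \<nu> / real n))) x y)) \<partial>lborel) \<le> ennreal C1"
    by (elim exE conjE) (rule that)
  obtain C0 where C0: "C0 > 0" "\<forall>x :: real ^ 'd. (\<integral>\<^sup>+y. ennreal \<bar>hermite_kernel 0 x y\<bar> \<partial>lborel) \<le> ennreal C0"
    using hermite_kernel_0_row by (elim exE conjE) (rule that)
  have row: "(\<integral>\<^sup>+y. ennreal (norm (mult_kernel (4 ^ j) (level s j) x y)) \<partial>lborel) \<le> ennreal (max C0 C1)" for j and x :: "real ^ 'd"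
  proof (cases j)
    case 0
    have "mult_kernel (4 ^ 0) (level s 0) x y = of_real (hermite_kernel 0 x y)" for y :: "real ^ 'd"
      unfolding mult_kernel_def level_def by simp
    then have "(\<integral>\<^sup>+y. ennreal (norm (mult_kernel (4 ^ j) (level s j) x y)) \<partial>lborel) \<le> ennreal C0"
      using C0(2) unfolding 0 by simp
    also have "\<dots> \<le> ennreal (max C0 C1)" by (rule ennreal_leI) simp
    finally show ?thesis .
  next
    case (Suc i)
    have e: "level s j \<nu> = D 0 (real \<nu> / real (4 ^ i)) * of_real (exp (- real \<nu> / real (4 ^ i)))" for \<nu>
      unfolding level_def Suc D(1) by (simp add: mult.assoc flip: of_real_mult exp_add)
    have "(1::nat) \<le> 4 ^ i" by simp
    from C1(2)[rule_format, OF this, of x]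
    have "(\<integral>\<^sup>+y. ennreal (norm (mult_kernel (4 ^ j) (level s j) x y)) \<partial>lborel) \<le> ennreal C1"
      unfolding e[symmetric] Suc by simp
    also have "\<dots> \<le> ennreal (max C0 C1)" by (rule ennreal_leI) simp
    finally show ?thesis .
  qed
  have pos: "max C0 C1 > 0" using C0(1) by simp
  have "lp_norm p (level_op s j (hcoeff F)) \<le> ennreal (max C0 C1) * lp_norm p F"
    if F: "F \<in> lp_space p" and p: "1 \<le> p" for j p and F :: "real ^ 'd \<Rightarrow> complex"
    unfolding level_op_def by (rule lp_norm_multiplier_le[OF F p pos row])
  then show ?thesis using pos by (intro exI[of _ "max C0 C1"]) simp
qed

lemma besov_kernel_eq:
  assumes a: "admissible_cutoff a"
  shows "besov_kernel a j x y = mult_kernel (4 ^ j) (level (ext0 a) j) x y"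
proof (cases j)
  case 0
  then show ?thesis unfolding besov_kernel_def mult_kernel_def level_def by simp
next
  case (Suc i)
  have l: "level (ext0 a) j \<nu> = a (real \<nu> / 4 ^ (j - 1))" for \<nu>
    unfolding level_def ext0_def Suc by simp
  have "(\<Sum>\<nu>. level (ext0 a) j \<nu> * complex_of_real (hermite_kernel \<nu> x y))
      = (\<Sum>\<nu>\<le>4 ^ j. level (ext0 a) j \<nu> * complex_of_real (hermite_kernel \<nu> x y))"
  proof (rule suminf_finite)
    fix \<nu> :: nat assume "\<nu> \<notin> {..4 ^ j}"
    then have "level (ext0 a) j \<nu> = 0" using ext0_support[OF a] by (intro level_eq_0) auto
    then show "level (ext0 a) j \<nu> * complex_of_real (hermite_kernel \<nu> x y) = 0" by simp
  qed simp
  then show ?thesis unfolding besov_kernel_def mult_kernel_def l using Suc by simp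
qed

text \<open>The kernel is a finite sum of Hermite functions in \<open>y\<close>, so linearity of
  \<open>f\<close> applies. The conjugations in \<open>kernel_apply\<close> and
  \<open>dist_pair\<close> cancel, whence the coefficients \<open>f (Hc \<beta>)\<close> appear
  unconjugated.\<close>

lemma kernel_apply_besov:
  fixes f :: "(real ^ 'd::finite \<Rightarrow> complex) \<Rightarrow> complex"
  assumes a: "admissible_cutoff a" and f: "f \<in> tempered"
  shows "kernel_apply (besov_kernel a j) f = level_op (ext0 a) j (\<lambda>\<beta>. f (Hc \<beta>))"
proof
  fix x :: "real ^ 'd"
  have k: "besov_kernel a j x y = (\<Sum>\<beta> | multi_deg \<beta> \<le> 4 ^ j. (level (ext0 a) j (multi_deg \<beta>) * Hc \<beta> x) * Hc \<beta> y)" for y :: "real ^ 'd"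
    unfolding besov_kernel_eq[OF a] mult_kernel_def hermite_kernel_def sum_multi_deg_le of_real_sum sum_distrib_left
    by (intro sum.cong refl) (simp add: mult_ac)
  have "kernel_apply (besov_kernel a j) f x = f (besov_kernel a j x)"
    unfolding kernel_apply_def dist_pair_def by simp
  also have "besov_kernel a j x = (\<lambda>y. \<Sum>\<beta> | multi_deg \<beta> \<le> 4 ^ j. (level (ext0 a) j (multi_deg \<beta>) * Hc \<beta> x) * Hc \<beta> y)"
    by (rule ext) (rule k)
  also have "f \<dots> = (\<Sum>\<beta> | multi_deg \<beta> \<le> 4 ^ j. (level (ext0 a) j (multi_deg \<beta>) * Hc \<beta> x) * f (Hc \<beta>))"
    by (rule tempered_sum[OF f finite_multi_deg_le Hc_schwartz])
  also have "\<dots> = level_op (ext0 a) j (\<lambda>\<beta>. f (Hc \<beta>)) x"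
    unfolding level_op_def hsum_def by (intro sum.cong refl) (simp only: mult_ac)
  finally show "kernel_apply (besov_kernel a j) f x = level_op (ext0 a) j (\<lambda>\<beta>. f (Hc \<beta>)) x" .
qed

lemma level_op_schwartz: "level_op s j c \<in> schwartz"
  unfolding level_op_def by (rule hsum_schwartz)

lemma hcoeff_level_op:
  assumes "\<And>t. t \<notin> {1/4..4} \<Longrightarrow> s t = 0"
  shows "hcoeff (level_op s j c) \<beta> = level s j (multi_deg \<beta>) * c \<beta>"
proof -
  have "level s j (multi_deg \<beta>) = 0" if "\<not> multi_deg \<beta> \<le> 4 ^ j"
    by (rule level_eq_0[OF assms]) (use that in \<open>simp_all only: not_le simp_thms\<close>)
  then show ?thesis unfolding level_op_def hcoeff_hsum by simp
qed

section \<open>Direct and inverse estimates\<close>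

text \<open>Subtracting \<open>G\<close> from \<open>F\<close> does not change the piece. The shift
  is 3 because level \<open>i + 3\<close> starts at degree \<open>4 ^ (i + 1)\<close>, whereas the
  support condition still admits degree \<open>4 ^ i\<close> at level \<open>i + 2\<close>.\<close>

lemma level_op_le_best_approx:
  fixes F :: "real ^ 'd::finite \<Rightarrow> complex"
  assumes s: "\<And>t. t \<notin> {1/4..4} \<Longrightarrow> s t = 0" and F: "F \<in> lp_space p" and p: "1 \<le> p" and C: "C > 0"
    and bound: "\<And>F :: real ^ 'd \<Rightarrow> complex. F \<in> lp_space p \<Longrightarrow> lp_norm p (level_op s (i + 3) (hcoeff F)) \<le> ennreal C * lp_norm p F"
  shows "lp_norm p (level_op s (i + 3) (hcoeff F)) \<le> ennreal C * best_approx p (4 ^ i) F"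
proof -
  have c: "ennreal C * ennreal (1 / C) = 1" using C by (simp flip: ennreal_mult)
  define X where "X = lp_norm p (level_op s (i + 3) (hcoeff F))"
  \<comment> \<open>Dividing by \<open>C\<close> first avoids commuting the infimum over
    \<open>G\<close> with a multiplication.\<close>
  have "ennreal (1 / C) * X \<le> best_approx p (4 ^ i) F"
    unfolding best_approx_def
  proof (rule INF_greatest)
    fix G :: "real ^ 'd \<Rightarrow> complex" assume G: "G \<in> hermite_space (4 ^ i)"
    then obtain b where b: "G = hsum (4 ^ i) b" by (rule hermite_spaceE)
    have Gl: "G \<in> lp_space p" by (intro schwartz_lp_space hermite_space_schwartz[OF G] p)
    have "level s (i + 3) (multi_deg \<beta>) * hcoeff (\<lambda>x. F x - G x) \<beta> = level s (i + 3) (multi_deg \<beta>) * hcoeff F \<beta>" for \<beta>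
    proof (cases "multi_deg \<beta> \<le> 4 ^ i")
      case True
      have "(4::nat) * 4 ^ i < 4 ^ (i + 3 - 1)" by (simp add: power_add)
      with mult_le_mono2[OF True, of 4] have "4 * multi_deg \<beta> < 4 ^ (i + 3 - 1)" by (rule le_less_trans)
      then have "level s (i + 3) (multi_deg \<beta>) = 0" by (intro level_eq_0[OF s] disjI2 conjI) simp_all
      then show ?thesis by simp
    next
      case False
      then have "hcoeff G \<beta> = 0" unfolding b hcoeff_hsum by (simp only: if_False)
      then show ?thesis using hcoeff_diff_lp[OF F Gl p, of \<beta>] by simp
    qed
    then have "level_op s (i + 3) (hcoeff F) = level_op s (i + 3) (hcoeff (\<lambda>x. F x - G x))"
      unfolding level_op_def by (simp only:)
    then have "X \<le> ennreal C * lp_norm p (\<lambda>x. F x - G x)"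
      unfolding X_def using bound[OF lp_space_diff[OF F Gl p]] by simp
    from mult_left_mono[OF this, of "ennreal (1 / C)"]
    show "ennreal (1 / C) * X \<le> lp_norm p (\<lambda>x. F x - G x)"
      using c by (simp add: mult.assoc[symmetric] mult.commute)
  qed
  from mult_left_mono[OF this, of "ennreal C"] show ?thesis
    using c unfolding X_def by (simp add: mult.assoc[symmetric])
qed

lemma direct_estimate:
  assumes a: "admissible_cutoff a" and p: "1 \<le> p" and q: "0 < q" and \<alpha>: "\<alpha> > 0"
  shows "\<exists>K>0. \<forall>F \<in> (lp_space p :: (real ^ 'd::finite \<Rightarrow> complex) set).
    besov_norm a \<alpha> p q (dist_of_fun F) \<le> ennreal K * approx_norm (\<alpha> / 2) p q F"
proof -
  obtain C where C: "C > 0" "\<forall>j p. \<forall>F \<in> lp_space p. 1 \<le> p \<longrightarrow>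
    lp_norm p (level_op (ext0 a) j (hcoeff (F :: real ^ 'd \<Rightarrow> complex))) \<le> ennreal C * lp_norm p F"
    using level_op_bound[OF a disjI1[OF refl], where 'd = 'd] by (elim exE conjE) (rule that)
  obtain K where K: "K > 0" "\<forall>s. lq_norm q s \<le> ennreal K * (s 0 + lq_norm q (\<lambda>j. s (Suc j)))"
    using lq_Suc_le[OF q] by (elim exE conjE) (rule that)
  \<comment> \<open>The factor \<open>2 powr (3 * \<alpha>)\<close> covers both the weights of the
    levels below 3 and the shift by 3 between levels and degrees.\<close>
  define M where "M = 2 powr (3 * \<alpha>) * C"
  have M: "M > 0" unfolding M_def using C(1) by simp
  \<comment> \<open>Three applications of \<open>lq_Suc_le\<close> split off the levels 0, 1 and
    2.\<close>
  define K' where "K' = K * (M + K * (M + K * (M + M)))"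
  have K': "K' > 0" unfolding K'_def using K(1) M by (intro mult_pos_pos add_pos_pos)
  have "besov_norm a \<alpha> p q (dist_of_fun F) \<le> ennreal K' * approx_norm (\<alpha> / 2) p q F"
    if F: "F \<in> lp_space p" for F :: "real ^ 'd \<Rightarrow> complex"
  proof -
    have bound: "lp_norm p (level_op (ext0 a) j (hcoeff G)) \<le> ennreal C * lp_norm p G"
      if "G \<in> lp_space p" for j and G :: "real ^ 'd \<Rightarrow> complex"
      using C(2) that p by simp
    define s where "s j = ennreal (2 powr (\<alpha> * real j)) * lp_norm p (level_op (ext0 a) j (hcoeff F))" for j
    define t where "t j = ennreal (2 powr (\<alpha> / 2 * real j)) * best_approx p (2 ^ j) F" for j
    define A where "A = approx_norm (\<alpha> / 2) p q F"
    have A: "A = lp_norm p F + lq_norm q t" unfolding A_def approx_norm_def t_def ..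
    have kf: "kernel_apply (besov_kernel a j) (dist_of_fun F) = level_op (ext0 a) j (hcoeff F)" for j
      unfolding kernel_apply_besov[OF a dist_of_fun_tempered[OF F p]] dist_of_fun_Hc ..
    have bs: "besov_norm a \<alpha> p q (dist_of_fun F) = lq_norm q s"
      unfolding besov_norm_def kf s_def ..
    have small: "s j \<le> ennreal M * A" if "j < 3" for j
    proof -
      have "s j \<le> ennreal (2 powr (\<alpha> * real j)) * (ennreal C * lp_norm p F)"
        unfolding s_def by (intro mult_left_mono bound F) simp
      also have "\<dots> = ennreal (2 powr (\<alpha> * real j) * C) * lp_norm p F"
        using C(1) by (simp add: ennreal_mult mult.assoc)
      also have "\<dots> \<le> ennreal M * A"
      proof (rule mult_mono)
        have "\<alpha> * real j \<le> 3 * \<alpha>" using that \<alpha> by simp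
        then show "ennreal (2 powr (\<alpha> * real j) * C) \<le> ennreal M"
          unfolding M_def using C(1) by (intro ennreal_leI mult_right_mono powr_mono) auto
        show "lp_norm p F \<le> A" unfolding A by simp
      qed auto
      finally show ?thesis .
    qed
    \<comment> \<open>As \<open>4 ^ i = 2 ^ (2 * i)\<close>, level \<open>i + 3\<close> is matched
      with entry \<open>2 * i\<close> of the approximation sequence, whose weight with index
      \<open>\<alpha> / 2\<close> is again \<open>2 powr (\<alpha> * i)\<close>.\<close>
    have big: "s (i + 3) \<le> ennreal M * t (2 * i)" for i
    proof -
      have e: "\<alpha> * real (i + 3) = 3 * \<alpha> + \<alpha> / 2 * real (2 * i)" by (simp add: algebra_simps)
      have "s (i + 3) \<le> ennreal (2 powr (\<alpha> * real (i + 3))) * (ennreal C * best_approx p (4 ^ i) F)"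
        unfolding s_def
        by (intro mult_left_mono level_op_le_best_approx[OF _ F p C(1) bound] ext0_support[OF a]) auto
      also have "\<dots> = ennreal M * t (2 * i)"
        unfolding e powr_add M_def t_def power_mult using C(1) by (simp add: ennreal_mult mult_ac)
      finally show ?thesis .
    qed
    have tail: "lq_norm q (\<lambda>i. s (i + 3)) \<le> ennreal M * A"
    proof -
      have "lq_norm q (\<lambda>i. s (i + 3)) \<le> lq_norm q (\<lambda>i. ennreal M * t (2 * i))" by (intro lq_mono q big)
      also have "\<dots> \<le> ennreal M * lq_norm q (\<lambda>i. t (2 * i))" by (rule lq_cmult_le[OF q])
      also have "\<dots> \<le> ennreal M * lq_norm q t" by (intro mult_left_mono lq_subseq[OF q]) (auto simp: inj_def)
      also have "\<dots> \<le> ennreal M * A" unfolding A by (intro mult_left_mono) auto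
      finally show ?thesis .
    qed
    have "lq_norm q s \<le> ennreal K * (s 0 + lq_norm q (\<lambda>j. s (Suc j)))" using K(2) by simp
    also have "\<dots> \<le> ennreal K * (ennreal M * A + ennreal K * (s 1 + lq_norm q (\<lambda>j. s (Suc (Suc j)))))"
      using K(2)[rule_format, of "\<lambda>j. s (Suc j)"] by (intro mult_left_mono add_mono small) auto
    also have "\<dots> \<le> ennreal K * (ennreal M * A + ennreal K * (ennreal M * A
         + ennreal K * (s 2 + lq_norm q (\<lambda>j. s (Suc (Suc (Suc j)))))))"
      using K(2)[rule_format, of "\<lambda>j. s (Suc (Suc j))"]
      by (intro mult_left_mono add_mono small order_refl) (auto simp: numeral_2_eq_2)
    also have "\<dots> \<le> ennreal K * (ennreal M * A + ennreal K * (ennreal M * A + ennreal K * (ennreal M * A + ennreal M * A)))"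
      using tail by (intro mult_left_mono add_mono small order_refl) (auto simp: numeral_3_eq_3)
    also have "\<dots> = ennreal K' * A"
    proof -
      have h: "ennreal (K * (M + x)) = ennreal K * (ennreal M + ennreal x)" if "x \<ge> 0" for x
        using K(1) M that by (simp add: ennreal_mult ennreal_plus)
      have n: "0 \<le> K * (M + x)" if "x \<ge> 0" for x using K(1) M that by simp
      have "ennreal K' = ennreal K * (ennreal M + ennreal K * (ennreal M + ennreal K * (ennreal M + ennreal M)))"
        unfolding K'_def using M by (subst h[OF n[OF n]], simp, subst h[OF n], simp, subst h, simp_all)
      then show ?thesis by (simp only: distrib_left distrib_right mult.assoc)
    qed
    finally show ?thesis unfolding bs A_def .
  qed
  then show ?thesis using K' by blast
qed

text \<open>Degree 0 is served by level 0 alone; for positive degrees level \<open>Suc j\<close> is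
  the scale \<open>j\<close> of \<open>calderon_sum\<close>.\<close>

lemma partition_of_unity:
  assumes a: "admissible_cutoff a"
  shows "(\<lambda>j. level (dual_symbol a) j \<nu> * level (ext0 a) j \<nu>) sums 1"
proof (cases "\<nu> = 0")
  case True
  have "level (dual_symbol a) j \<nu> * level (ext0 a) j \<nu> = (if j = 0 then 1 else 0)" for j
    using ext0_support[OF a, of 0] unfolding level_def True by simp
  then show ?thesis using sums_single[of 0 "\<lambda>_. 1 :: complex"] by simp
next
  case False
  have "(\<lambda>j. level (dual_symbol a) (Suc j) \<nu> * level (ext0 a) (Suc j) \<nu>) sums 1"
    using calderon_sum[OF a, of \<nu>] False unfolding level_def by simp
  from sums_Suc[OF this] show ?thesis using False by (simp add: level_def)
qed

lemma inverse_estimate: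
  assumes a: "admissible_cutoff a" and p: "1 \<le> p" and q: "0 < q" and \<alpha>: "\<alpha> > 0"
  shows "\<exists>K>0. \<forall>f \<in> (besov_space a \<alpha> p q :: ((real ^ 'd::finite \<Rightarrow> complex) \<Rightarrow> complex) set).
    \<exists>F \<in> lp_space p. dist_of_fun F = f \<and> approx_norm (\<alpha> / 2) p q F \<le> ennreal K * besov_norm a \<alpha> p q f"
proof -
  obtain C where C: "C > 0" "\<forall>j p. \<forall>F \<in> lp_space p. 1 \<le> p \<longrightarrow>
    lp_norm p (level_op (dual_symbol a) j (hcoeff (F :: real ^ 'd \<Rightarrow> complex))) \<le> ennreal C * lp_norm p F"
    using level_op_bound[OF a disjI2[OF refl], where 'd = 'd] by (elim exE conjE) (rule that)
  \<comment> \<open>Chosen so that \<open>r ^ (2 * k) = 2 powr (- \<alpha> * k)\<close>, the decay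
    of the pieces in the shape required by \<open>lq_hardy\<close>.\<close>
  define r where "r = 2 powr (- \<alpha> / 2)"
  have r: "0 < r" "r < 1" unfolding r_def using \<alpha> by (auto simp: powr_less_one)
  obtain H where H: "H > 0" "\<forall>s t. (\<forall>i. s i \<le> (\<Sum>k. ennreal (r ^ (2 * k)) * t (i div 2 + k))) \<longrightarrow>
    lq_norm q s \<le> ennreal H * lq_norm q t"
    using lq_hardy[OF q r] by (elim exE conjE) (rule that)
  have r2: "r ^ (2 * k) = 2 powr (- \<alpha> * real k)" for k
    unfolding r_def powr_realpow[symmetric, of "2 powr (- \<alpha> / 2)"]
    by (simp add: powr_powr powr_realpow[symmetric])
  define S where "S = 1 / (1 - r ^ 2)"
  have r21: "r ^ 2 < 1" using r by (simp add: power_less_one_iff)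
  have S: "S > 0" unfolding S_def using r21 by simp
  have geo: "(\<Sum>k. ennreal (r ^ (2 * k))) = ennreal S"
  proof (rule suminf_ennreal_eq)
    show "(\<lambda>k. r ^ (2 * k)) sums S" unfolding S_def power_mult by (rule geometric_sums) (use r21 in simp)
  qed simp
  define K where "K = C * S + H * C"
  have K: "K > 0" unfolding K_def using C(1) S H(1) by (simp add: add_pos_pos)
  have "\<exists>F \<in> lp_space p. dist_of_fun F = f \<and> approx_norm (\<alpha> / 2) p q F \<le> ennreal K * besov_norm a \<alpha> p q f"
    if f: "f \<in> besov_space a \<alpha> p q" for f :: "(real ^ 'd \<Rightarrow> complex) \<Rightarrow> complex"
  proof -
    have ft: "f \<in> tempered" and fin: "besov_norm a \<alpha> p q f < \<infinity>" using f unfolding besov_space_def by auto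
    define c where "c \<beta> = f (Hc \<beta>)" for \<beta> :: "'d \<Rightarrow> nat"
    define g where "g j = level_op (ext0 a) j c" for j
    define u where "u j = level_op (dual_symbol a) j (hcoeff (g j))" for j
    define s where "s j = ennreal (2 powr (\<alpha> * real j)) * lp_norm p (g j)" for j
    define N where "N = besov_norm a \<alpha> p q f"
    have N: "N = lq_norm q s" unfolding N_def besov_norm_def kernel_apply_besov[OF a ft] s_def g_def c_def ..
    have sN: "s j \<le> N" for j unfolding N by (rule lq_ge[OF q])
    have g: "g j \<in> lp_space p" for j unfolding g_def by (rule schwartz_lp_space[OF level_op_schwartz p])
    have um: "u j \<in> borel_measurable lborel" for j
      using schwartz_measurable[OF level_op_schwartz] unfolding u_def by simp
    have ule: "lp_norm p (u j) \<le> ennreal (C * r ^ (2 * j)) * s j" for j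
    proof -
      have e: "ennreal (r ^ (2 * j)) * ennreal (2 powr (\<alpha> * real j)) = 1"
        unfolding r2 by (simp flip: ennreal_mult powr_add)
      have "lp_norm p (u j) \<le> ennreal C * lp_norm p (g j)" unfolding u_def using C(2) g p by simp
      also have "\<dots> = ennreal C * ((ennreal (r ^ (2 * j)) * ennreal (2 powr (\<alpha> * real j))) * lp_norm p (g j))"
        unfolding e by simp
      also have "\<dots> = ennreal (C * r ^ (2 * j)) * s j"
        unfolding s_def using C(1) r by (simp add: ennreal_mult mult_ac)
      finally show ?thesis .
    qed
    have usum: "(\<Sum>j. lp_norm p (u j)) \<le> ennreal (C * S) * N"
    proof -
      have "(\<Sum>j. lp_norm p (u j)) \<le> (\<Sum>j. ennreal C * (ennreal (r ^ (2 * j)) * N))"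
      proof (rule suminf_le)
        fix j
        have "lp_norm p (u j) \<le> ennreal (C * r ^ (2 * j)) * N"
          by (rule order_trans[OF ule mult_left_mono[OF sN]]) simp
        then show "lp_norm p (u j) \<le> ennreal C * (ennreal (r ^ (2 * j)) * N)"
          using C(1) r by (simp add: ennreal_mult mult.assoc)
      qed auto
      also have "\<dots> = ennreal C * ((\<Sum>j. ennreal (r ^ (2 * j))) * N)" by simp
      also have "\<dots> = ennreal (C * S) * N" unfolding geo using C(1) S by (simp add: ennreal_mult mult.assoc)
      finally show ?thesis .
    qed
    also have "ennreal (C * S) * N < \<infinity>" using fin unfolding N_def by (simp add: ennreal_mult_less_top)
    finally have ufin: "(\<Sum>j. lp_norm p (u j)) < \<infinity>" .
    obtain F where F: "F \<in> lp_space p"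
      and tail: "\<And>J. lp_norm p (\<lambda>x. F x - (\<Sum>j<J. u j x)) \<le> (\<Sum>j. lp_norm p (u (j + J)))"
      and co: "\<And>\<beta>. (\<lambda>j. hcoeff (u j) \<beta>) sums hcoeff F \<beta>"
      by (rule lp_series[OF um p ufin]) (rule that)
    \<comment> \<open>By orthonormality each piece acts on the coefficient as a scalar, and by
      \<open>partition_of_unity\<close> the scalars sum to 1.\<close>
    have cF: "hcoeff F \<beta> = c \<beta>" for \<beta>
    proof -
      have "hcoeff (u j) \<beta> = (level (dual_symbol a) j (multi_deg \<beta>) * level (ext0 a) j (multi_deg \<beta>)) * c \<beta>" for j
      proof -
        have "hcoeff (u j) \<beta> = level (dual_symbol a) j (multi_deg \<beta>) * hcoeff (g j) \<beta>"
          unfolding u_def by (rule hcoeff_level_op) (rule dual_symbol_support[OF a])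
        moreover have "hcoeff (g j) \<beta> = level (ext0 a) j (multi_deg \<beta>) * c \<beta>"
          unfolding g_def by (rule hcoeff_level_op) (rule ext0_support[OF a])
        ultimately show ?thesis by (simp only: mult.assoc)
      qed
      then have "(\<lambda>j. hcoeff (u j) \<beta>) sums (1 * c \<beta>)"
        using sums_mult2[OF partition_of_unity[OF a, of "multi_deg \<beta>"], of "c \<beta>"] by (simp only:)
      then show ?thesis using co[of \<beta>] by (simp add: sums_unique2)
    qed
    have dF: "dist_of_fun F = f"
      by (rule tempered_eqI[OF dist_of_fun_tempered[OF F p] ft]) (simp add: dist_of_fun_Hc cF c_def)
    have lpF: "lp_norm p F \<le> ennreal (C * S) * N"
    proof -
      have "lp_norm p F \<le> (\<Sum>j. lp_norm p (u j))" using tail[of 0] by simp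
      also note usum
      finally show ?thesis .
    qed
    \<comment> \<open>The tail behind the pieces up to \<open>m\<close> starts at piece
      \<open>m + 1\<close>; the shift lets it start at \<open>t m\<close>.\<close>
    define t where "t j = ennreal C * s (Suc j)" for j
    have "ennreal (2 powr (\<alpha> / 2 * real i)) * best_approx p (2 ^ i) F \<le> (\<Sum>k. ennreal (r ^ (2 * k)) * t (i div 2 + k))" for i
    proof -
      \<comment> \<open>The pieces up to \<open>m\<close> have degree at most
        \<open>4 ^ m \<le> 2 ^ i\<close>, so their sum competes in
        \<open>best_approx p (2 ^ i) F\<close>.\<close>
      define m where "m = i div 2"
      have m: "2 * m \<le> i" "i \<le> 2 * m + 1" unfolding m_def by auto
      have "(\<lambda>x. \<Sum>j<m + 1. u j x) \<in> hermite_space (2 ^ i)"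
        unfolding u_def level_op_def
      proof (rule hermite_space_sum_hsum)
        fix j assume "j < m + 1"
        then have "2 * j \<le> i" using m by linarith
        then have "(2::nat) ^ (2 * j) \<le> 2 ^ i" by (rule power_increasing) simp
        then show "(4::nat) ^ j \<le> 2 ^ i" by (simp add: power_mult)
      qed
      then have "best_approx p (2 ^ i) F \<le> lp_norm p (\<lambda>x. F x - (\<Sum>j<m + 1. u j x))"
        by (rule best_approx_le)
      also have "\<dots> \<le> (\<Sum>k. lp_norm p (u (k + (m + 1))))" by (rule tail)
      also have "\<dots> \<le> (\<Sum>k. ennreal (C * r ^ (2 * (k + (m + 1)))) * s (k + (m + 1)))"
        by (intro suminf_le ule) auto
      finally have "ennreal (2 powr (\<alpha> / 2 * real i)) * best_approx p (2 ^ i) F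
          \<le> ennreal (2 powr (\<alpha> / 2 * real i)) * (\<Sum>k. ennreal (C * r ^ (2 * (k + (m + 1)))) * s (k + (m + 1)))"
        by (rule mult_left_mono) simp
      also have "\<dots> = (\<Sum>k. ennreal (2 powr (\<alpha> / 2 * real i)) * (ennreal (C * r ^ (2 * (k + (m + 1)))) * s (k + (m + 1))))"
        by simp
      also have "\<dots> \<le> (\<Sum>k. ennreal (r ^ (2 * k)) * t (m + k))"
      proof (rule suminf_le)
        fix k
        \<comment> \<open>The weight at \<open>i\<close> is paid for by the decay up to the first
          tail index \<open>m + 1\<close>; the factor \<open>r ^ (2 * k)\<close> is left for the
          Hardy inequality.\<close>
        have "real i \<le> 2 * real (m + 1)" using m by simp
        then have "\<alpha> / 2 * real i \<le> \<alpha> / 2 * (2 * real (m + 1))" using \<alpha> by (intro mult_left_mono) simp_all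
        also have "\<dots> = \<alpha> * real (m + 1)" by simp
        finally have "2 powr (\<alpha> / 2 * real i) \<le> 2 powr (\<alpha> * real (m + 1))" by (intro powr_mono) auto
        then have "2 powr (\<alpha> / 2 * real i) * r ^ (2 * (m + 1)) \<le> 2 powr (\<alpha> * real (m + 1)) * r ^ (2 * (m + 1))"
          using r by (intro mult_right_mono) auto
        also have "\<dots> = 1" unfolding r2 by (simp flip: powr_add)
        finally have le: "2 powr (\<alpha> / 2 * real i) * r ^ (2 * (m + 1)) \<le> 1" .
        have pw: "r ^ (2 * (k + (m + 1))) = r ^ (2 * k) * r ^ (2 * (m + 1))" by (simp add: power_add distrib_left)
        have "ennreal (2 powr (\<alpha> / 2 * real i)) * (ennreal (C * r ^ (2 * (k + (m + 1)))) * s (k + (m + 1)))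
            = ennreal (2 powr (\<alpha> / 2 * real i) * r ^ (2 * (m + 1))) * (ennreal (r ^ (2 * k)) * (ennreal C * s (k + (m + 1))))"
        proof -
          have "ennreal X * (ennreal (C * (Y * Z)) * z) = ennreal (X * Z) * (ennreal Y * (ennreal C * z))"
            if "X \<ge> 0" "Y \<ge> 0" "Z \<ge> 0" for X Y Z z using C(1) that by (simp add: ennreal_mult mult_ac)
          then show ?thesis unfolding pw using r by simp
        qed
        also have "\<dots> \<le> ennreal 1 * (ennreal (r ^ (2 * k)) * (ennreal C * s (k + (m + 1))))"
          by (intro mult_right_mono ennreal_leI le) simp
        also have "\<dots> = ennreal (r ^ (2 * k)) * t (m + k)" unfolding t_def by (simp add: add.commute)
        finally show "ennreal (2 powr (\<alpha> / 2 * real i)) * (ennreal (C * r ^ (2 * (k + (m + 1)))) * s (k + (m + 1)))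
            \<le> ennreal (r ^ (2 * k)) * t (m + k)" .
      qed auto
      finally show ?thesis unfolding m_def .
    qed
    then have "lq_norm q (\<lambda>i. ennreal (2 powr (\<alpha> / 2 * real i)) * best_approx p (2 ^ i) F) \<le> ennreal H * lq_norm q t"
      using H(2) by simp
    also have "\<dots> \<le> ennreal H * (ennreal C * N)"
    proof (rule mult_left_mono)
      have "lq_norm q t \<le> ennreal C * lq_norm q (\<lambda>j. s (Suc j))" unfolding t_def by (rule lq_cmult_le[OF q])
      also have "\<dots> \<le> ennreal C * N" unfolding N by (intro mult_left_mono lq_subseq[OF q]) auto
      finally show "lq_norm q t \<le> ennreal C * N" .
    qed simp
    finally have "approx_norm (\<alpha> / 2) p q F \<le> ennreal (C * S) * N + ennreal H * (ennreal C * N)"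
      unfolding approx_norm_def using lpF by (intro add_mono)
    also have "\<dots> = ennreal K * N"
      unfolding K_def using C(1) S H(1) by (simp add: ennreal_mult distrib_right mult.assoc)
    finally show ?thesis using F dF unfolding N_def by blast
  qed
  then show ?thesis using K by blast
qed

theorem proposition5p7:
  fixes \<alpha> :: real and p q :: ennreal and a :: "real \<Rightarrow> complex"
  assumes "\<alpha> > 0" and "1 \<le> p" and "0 < q" and "admissible_cutoff a"
  shows "(besov_space a \<alpha> p q :: ((real ^ 'd::finite \<Rightarrow> complex) \<Rightarrow> complex) set)
           = dist_of_fun ` approx_space (\<alpha> / 2) p q
       \<and> (\<exists>C::real. C > 0 \<and>
            (\<forall>F \<in> (approx_space (\<alpha> / 2) p q :: (real ^ 'd \<Rightarrow> complex) set).
               besov_norm a \<alpha> p q (dist_of_fun F) \<le> ennreal C * approx_norm (\<alpha> / 2) p q F \<and>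
               approx_norm (\<alpha> / 2) p q F \<le> ennreal C * besov_norm a \<alpha> p q (dist_of_fun F)))"
proof -
  note \<alpha> = assms(1) and p = assms(2) and q = assms(3) and a = assms(4)
  obtain K1 where K1: "K1 > 0" "\<forall>F \<in> (lp_space p :: (real ^ 'd \<Rightarrow> complex) set).
      besov_norm a \<alpha> p q (dist_of_fun F) \<le> ennreal K1 * approx_norm (\<alpha> / 2) p q F"
    using direct_estimate[OF a p q \<alpha>, where 'd = 'd] by (elim exE conjE) (rule that)
  obtain K2 where K2: "K2 > 0" "\<forall>f \<in> (besov_space a \<alpha> p q :: ((real ^ 'd \<Rightarrow> complex) \<Rightarrow> complex) set).
      \<exists>F \<in> lp_space p. dist_of_fun F = f \<and> approx_norm (\<alpha> / 2) p q F \<le> ennreal K2 * besov_norm a \<alpha> p q f"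
    using inverse_estimate[OF a p q \<alpha>, where 'd = 'd] by (elim exE conjE) (rule that)
  have fin: "ennreal K * x < \<infinity>" if "x < \<infinity>" for K x using that by (simp add: ennreal_mult_less_top)
  have ap: "F \<in> lp_space p" "approx_norm (\<alpha> / 2) p q F < \<infinity>" if "F \<in> approx_space (\<alpha> / 2) p q"
    for F :: "real ^ 'd \<Rightarrow> complex"
    using that unfolding approx_space_def by auto
  have sub: "dist_of_fun F \<in> besov_space a \<alpha> p q" if "F \<in> approx_space (\<alpha> / 2) p q" for F :: "real ^ 'd \<Rightarrow> complex"
    using dist_of_fun_tempered[OF ap(1)[OF that] p] order_le_less_trans[OF K1(2)[rule_format, OF ap(1)[OF that]] fin[OF ap(2)[OF that]]]
    unfolding besov_space_def by simp
  have sup: "f \<in> dist_of_fun ` approx_space (\<alpha> / 2) p q" if f: "f \<in> besov_space a \<alpha> p q"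
    for f :: "(real ^ 'd \<Rightarrow> complex) \<Rightarrow> complex"
  proof -
    obtain F where F: "F \<in> lp_space p" "dist_of_fun F = f"
      "approx_norm (\<alpha> / 2) p q F \<le> ennreal K2 * besov_norm a \<alpha> p q f" using K2(2) f by blast
    have "besov_norm a \<alpha> p q f < \<infinity>" using f unfolding besov_space_def by simp
    from order_le_less_trans[OF F(3) fin[OF this]] have "F \<in> approx_space (\<alpha> / 2) p q"
      using F(1) unfolding approx_space_def by simp
    then show ?thesis using F(2) by blast
  qed
  \<comment> \<open>The inverse estimate supplies some \<open>G\<close> representing the same
    distribution. Equal Hermite coefficients force \<open>F = G\<close> almost everywhere, so the
    bound carries over to the given \<open>F\<close>.\<close>
  have inv: "approx_norm (\<alpha> / 2) p q F \<le> ennreal K2 * besov_norm a \<alpha> p q (dist_of_fun F)"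
    if F: "F \<in> approx_space (\<alpha> / 2) p q" for F :: "real ^ 'd \<Rightarrow> complex"
  proof -
    obtain G where G: "G \<in> lp_space p" "dist_of_fun G = dist_of_fun F"
      "approx_norm (\<alpha> / 2) p q G \<le> ennreal K2 * besov_norm a \<alpha> p q (dist_of_fun F)" using K2(2) sub[OF F] by blast
    have "hcoeff F \<beta> = hcoeff G \<beta>" for \<beta> using G(2) unfolding dist_of_fun_Hc[symmetric] by simp
    then have "AE x in lborel. F x - G x = 0"
      by (intro lp_eq_0_if_hcoeff_eq_0[OF lp_space_diff[OF ap(1)[OF F] G(1) p] p])
        (simp add: hcoeff_diff_lp[OF ap(1)[OF F] G(1) p])
    then have "approx_norm (\<alpha> / 2) p q F = approx_norm (\<alpha> / 2) p q G"
      by (intro approx_norm_cong_AE lp_space_measurable[OF ap(1)[OF F]] lp_space_measurable[OF G(1)] p) simp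
    then show ?thesis using G(3) by simp
  qed
  have mono: "ennreal K1 \<le> ennreal (max K1 K2)" "ennreal K2 \<le> ennreal (max K1 K2)" by (simp_all add: ennreal_leI)
  have "besov_norm a \<alpha> p q (dist_of_fun F) \<le> ennreal (max K1 K2) * approx_norm (\<alpha> / 2) p q F \<and>
        approx_norm (\<alpha> / 2) p q F \<le> ennreal (max K1 K2) * besov_norm a \<alpha> p q (dist_of_fun F)"
    if F: "F \<in> approx_space (\<alpha> / 2) p q" for F :: "real ^ 'd \<Rightarrow> complex"
    using order_trans[OF K1(2)[rule_format, OF ap(1)[OF F]] mult_right_mono[OF mono(1)]]
      order_trans[OF inv[OF F] mult_right_mono[OF mono(2)]] by simp
  moreover have "max K1 K2 > 0" using K1(1) by simp
  moreover have "besov_space a \<alpha> p q = dist_of_fun ` (approx_space (\<alpha> / 2) p q :: (real ^ 'd \<Rightarrow> complex) set)"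
    using sub sup by blast
  ultimately show ?thesis by blast
qed

end
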